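(* Let $X$ be a bounded geometry discrete metric space with Yu's Property A, and let $G$ be a countable amenable group acting on $X$ coarsely discontinuously by coarse equivalences. Then there is an exact sequence $$0\to\mathcal{K}\to C^\ast(X_G)\to (C^\ast(X)/\mathcal{K})\rtimes_{r,\alpha}G\to 0,$$ where $\rtimes_{r,\alpha}$ denotes the reduced crossed product.
   Context: Large scale structures. For families of subsets of $X$, $\mathrm{st}(\mathcal{B},\mathcal{U})=\{\mathrm{st}(B,\mathcal{U})\mid B\in\mathcal{B}\}$, where $\mathrm{st}(B,\mathcal{U})$ is the union of the elements of $\mathcal{U}$ that intersect $B$. A large scale structure on a set $X$ is a nonempty set of families of subsets of $X$ (the uniformly bounded families) such that (1) if $\mathcal{B}_1$ is uniformly bounded and each element of $\mathcal{B}_2$ with more than one point is contained in some element of $\mathcal{B}_1$, then $\mathcal{B}_2$ is uniformly bounded; (2) $\mathrm{st}(\mathcal{B}_1,\mathcal{B}_2)$ is uniformly bounded whenever $\mathcal{B}_1,\mathcal{B}_2$ are. A metric $d$ induces the large scale structure whose uniformly bounded families are those $\mathcal{U}$ with $\sup_{U\in\mathcal{U}}\mathrm{diam}(U)<\infty$. A metric space has bounded geometry if for every $R>0$ there is an integer $N$ such that every $R$-ball has at most $N$ elements. Actions. A group $G$ acts on a metric space $X$ by coarse equivalences if it acts on the underlying set and for every $g\in G$ and $R>0$ there is $S>0$ with $d(x,y)\le R\Rightarrow d(gx,gy)\le S$. The action is coarsely discontinuous if for each $g\in G\setminus\{e\}$ and $R>0$ there is a bounded set $K$ such that $d(x,g\cdot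 x)\geq R$ for all $x\notin K$. $X_G$ denotes the set $X$ with the smallest large scale structure containing that of $X$ and all families $\{\{x,gx\}\mid x\in X\}$, $g\in G$. For $G$ countable and $X$ discrete of bounded geometry, the large scale structure of $X_G$ is induced by a discrete bounded geometry metric; fix any such metric (the algebra below does not depend on the choice). Roe algebras. Fix a separable infinite-dimensional Hilbert space $H$. For a discrete bounded geometry metric space $Y$, operators $T$ on $\ell^2(Y)\otimes H$ are viewed as matrices $(T_{x,y})_{x,y\in Y}$ of operators on $H$. $C[Y]$ is the $\ast$-algebra of bounded operators $T$ on $\ell^2(Y)\otimes H$ such that every $T_{x,y}$ is compact and there is $R>0$ with $T_{x,y}=0$ whenever $d(x,y)\ge R$. The Roe algebra $C^\ast(Y)$ is the operator norm closure of $C[Y]$ in $B(\ell^2(Y)\otimes H)$. It contains the ideal $\mathcal{K}$ of compact operators on $\ell^2(Y)\otimes H$. For $g\in G$, $M_g$ is the operator on $\ell^2(X)\otimes H$ with $(M_g)_{x,y}=1_H$ if $gy=x$ and $0$ otherwise; $\alpha$ is the action of $G$ on $C^\ast(X)/\mathcal{K}$ given by $g\cdot[T]=[M_gTM_g^\ast]$. Property A. For a set $S$, $\Delta(S)$ is the set of formal linear combinations $\sum_{s\in S}a_s\cdot s$ with $a_s\in[0,1]$, finitely many nonzero, $\sum a_s=1$, with the $\ell^1$ metric; the star of $s\in S$ is the set of elements with $a_s\ne0$. A discrete bounded geometry metric space $X$ has Property A if and only if it is exact: for each uniformly bounded cover $\mathcal{U}$ of $X$ and each $\varepsilon>0$ there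 is a map $\phi:X\to\Delta(S)$, for some set $S$, such that the inverse images of stars of vertices form a uniformly bounded cover of $X$ and $\sup_{U\in\mathcal{U}}\mathrm{diam}\,\phi(U)<\varepsilon$. *)

theory Defs
  imports "HOL-Analysis.Analysis" "HOL-Algebra.Group_Action"
begin

section \<open>Complex Hilbert spaces\<close>

text \<open>
  The class extends the library's real Hilbert spaces, so that norm, topology and bounded operators
  are those of the library; the form is conjugate linear in its first argument.
\<close>

class complex_hilbert = real_inner + complete_space +
  fixes scaleC :: "complex \<Rightarrow> 'a \<Rightarrow> 'a"  (infixr "*\<^sub>C" 75)
    and cinner :: "'a \<Rightarrow> 'a \<Rightarrow> complex"
  assumes scaleC_add_right: "c *\<^sub>C (x + y) = c *\<^sub>C x + c *\<^sub>C y"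
    and scaleC_add_left: "(b + c) *\<^sub>C x = b *\<^sub>C x + c *\<^sub>C x"
    and scaleC_scaleC: "b *\<^sub>C c *\<^sub>C x = (b * c) *\<^sub>C x"
    and scaleC_of_real: "complex_of_real r *\<^sub>C x = r *\<^sub>R x"
    and cinner_commute: "cinner x y = cnj (cinner y x)"
    and cinner_add_left: "cinner (x + y) z = cinner x z + cinner y z"
    and cinner_scaleC_left: "cinner (c *\<^sub>C x) y = cnj c * cinner x y"
    and Re_cinner: "Re (cinner x y) = inner x y"
begin

lemma cinner_scaleC_right: "cinner x (c *\<^sub>C y) = c * cinner x y"
  by (metis cinner_commute cinner_scaleC_left complex_cnj_cnj complex_cnj_mult)

lemma cinner_add_right: "cinner x (y + z) = cinner x y + cinner x z"
  by (metis cinner_commute cinner_add_left complex_cnj_add)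

lemma norm_scaleC: "norm (c *\<^sub>C x) = cmod c * norm x"
proof -
  have "cinner (c *\<^sub>C x) (c *\<^sub>C x) = complex_of_real ((cmod c)\<^sup>2) * cinner x x"
    unfolding complex_norm_square by (simp add: cinner_scaleC_left cinner_scaleC_right ac_simps)
  then have "inner (c *\<^sub>C x) (c *\<^sub>C x) = (cmod c)\<^sup>2 * inner x x"
    by (simp flip: Re_cinner)
  then show ?thesis
    by (simp add: norm_eq_sqrt_inner real_sqrt_mult)
qed

lemma scaleC_zero: "c *\<^sub>C 0 = 0"
  by (metis add_cancel_right_right scaleC_add_right)

lemma Im_cinner: "Im (cinner x y) = inner (\<i> *\<^sub>C x) y"
  by (simp flip: Re_cinner add: cinner_scaleC_left)

end

instantiation complex :: complex_hilbert
begin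
definition "scaleC_complex (c :: complex) (x :: complex) = c * x"
definition "cinner_complex (x :: complex) (y :: complex) = cnj x * y"
instance
  by standard (auto simp: scaleC_complex_def cinner_complex_def algebra_simps inner_complex_def
      scaleR_conv_of_real)
end

lemma bounded_linear_scaleC: "bounded_linear (\<lambda>x :: 'h::complex_hilbert. c *\<^sub>C x)"
proof (rule bounded_linear_intro)
  fix r :: real and x :: 'h
  show "c *\<^sub>C r *\<^sub>R x = r *\<^sub>R c *\<^sub>C x"
    by (simp flip: scaleC_of_real add: scaleC_scaleC mult.commute)
  show "norm (c *\<^sub>C x) \<le> norm x * cmod c"
    by (simp add: norm_scaleC)
qed (rule scaleC_add_right)


section \<open>The Hilbert space of square summable functions\<close>

text \<open>\<open>('i, 'h) l2\<close> is the Hilbert space tensor product of \<open>l2('i)\<close> and \<open>'h\<close>.\<close>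

typedef (overloaded) ('i, 'h) l2 =
    "{f :: 'i \<Rightarrow> 'h::complex_hilbert. (\<lambda>i. (norm (f i))\<^sup>2) summable_on UNIV}"
  morphisms l2_fun Abs_l2
  by (rule exI[of _ "\<lambda>_. 0"]) simp

lemma l2_summable: "(\<lambda>i. (norm (l2_fun f i))\<^sup>2) summable_on UNIV"
  using l2_fun by auto

lemma l2_eqI: "(\<And>i. l2_fun f i = l2_fun g i) \<Longrightarrow> f = g"
  by (metis ext l2_fun_inject)

lemma square_summable_add:
  fixes f g :: "'i \<Rightarrow> 'h::real_normed_vector"
  assumes "(\<lambda>i. (norm (f i))\<^sup>2) summable_on UNIV" "(\<lambda>i. (norm (g i))\<^sup>2) summable_on UNIV"
  shows "(\<lambda>i. (norm (f i + g i))\<^sup>2) summable_on UNIV"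
proof (rule summable_on_comparison_test)
  show "(\<lambda>i. 2 * ((norm (f i))\<^sup>2 + (norm (g i))\<^sup>2)) summable_on UNIV"
    by (intro summable_on_cmult_right summable_on_add assms)
  fix i
  have "(norm (f i + g i))\<^sup>2 \<le> (norm (f i) + norm (g i))\<^sup>2"
    by (simp add: norm_triangle_ineq power_mono)
  also have "\<dots> \<le> 2 * ((norm (f i))\<^sup>2 + (norm (g i))\<^sup>2)"
    using sum_squares_bound[of "norm (f i)" "norm (g i)"] by (simp add: power2_sum)
  finally show "(norm (f i + g i))\<^sup>2 \<le> 2 * ((norm (f i))\<^sup>2 + (norm (g i))\<^sup>2)" .
qed auto

lemma square_summable_scaleC:
  fixes f :: "'i \<Rightarrow> 'h::complex_hilbert"
  assumes "(\<lambda>i. (norm (f i))\<^sup>2) summable_on UNIV"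
  shows "(\<lambda>i. (norm (c *\<^sub>C f i))\<^sup>2) summable_on UNIV"
  using summable_on_cmult_right[OF assms, of "(cmod c)\<^sup>2"]
  by (simp add: norm_scaleC power_mult_distrib)

lemma summable_cinner:
  "(\<lambda>i. cinner (l2_fun f i) (l2_fun g i)) summable_on UNIV" for f g :: "('i, 'h::complex_hilbert) l2"
proof -
  have *: "(\<lambda>i. inner (l2_fun f i) (l2_fun g i)) summable_on UNIV" for f g :: "('i, 'h) l2"
  proof (rule abs_summable_summable, rule summable_on_comparison_test)
    show "(\<lambda>i. (norm (l2_fun f i))\<^sup>2 + (norm (l2_fun g i))\<^sup>2) summable_on UNIV"
      by (intro summable_on_add l2_summable)
    fix i
    have "\<bar>inner (l2_fun f i) (l2_fun g i)\<bar> \<le> norm (l2_fun f i) * norm (l2_fun g i)"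
      by (rule Cauchy_Schwarz_ineq2)
    also have "\<dots> \<le> 2 * norm (l2_fun f i) * norm (l2_fun g i)"
      by simp
    also have "\<dots> \<le> (norm (l2_fun f i))\<^sup>2 + (norm (l2_fun g i))\<^sup>2"
      by (rule sum_squares_bound)
    finally show "norm (inner (l2_fun f i) (l2_fun g i)) \<le> \<dots>"
      by simp
  qed auto
  define h where "h = Abs_l2 (\<lambda>i. \<i> *\<^sub>C l2_fun f i)"
  have h: "l2_fun h = (\<lambda>i. \<i> *\<^sub>C l2_fun f i)"
    unfolding h_def by (rule Abs_l2_inverse) (simp add: square_summable_scaleC l2_summable)
  have "(\<lambda>i. complex_of_real (inner (l2_fun f i) (l2_fun g i))
          + \<i> * complex_of_real (inner (l2_fun h i) (l2_fun g i))) summable_on UNIV"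
    by (intro summable_on_add summable_on_cmult_right summable_on_of_real *)
  also have "(\<lambda>i. complex_of_real (inner (l2_fun f i) (l2_fun g i))
          + \<i> * complex_of_real (inner (l2_fun h i) (l2_fun g i)))
       = (\<lambda>i. cinner (l2_fun f i) (l2_fun g i))"
    by (auto simp: fun_eq_iff complex_eq_iff h Re_cinner Im_cinner)
  finally show ?thesis .
qed

lemma summable_inner: "(\<lambda>i. inner (l2_fun f i) (l2_fun g i)) summable_on UNIV"
  using summable_on_Re[OF summable_cinner[of f g]] by (simp add: Re_cinner)

instantiation l2 :: (type, complex_hilbert) real_inner
begin

definition "0 = (Abs_l2 (\<lambda>_. 0) :: ('a, 'b) l2)"
definition "f + g = Abs_l2 (\<lambda>i. l2_fun f i + l2_fun g i)" for f g :: "('a, 'b) l2"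
definition "- f = Abs_l2 (\<lambda>i. - l2_fun f i)" for f :: "('a, 'b) l2"
definition "f - g = Abs_l2 (\<lambda>i. l2_fun f i - l2_fun g i)" for f g :: "('a, 'b) l2"
definition "scaleR_l2 (r :: real) (f :: ('a, 'b) l2) = Abs_l2 (\<lambda>i. r *\<^sub>R l2_fun f i)"
definition "inner_l2 (f :: ('a, 'b) l2) (g :: ('a, 'b) l2) = (\<Sum>\<^sub>\<infinity>i. inner (l2_fun f i) (l2_fun g i))"
definition "norm_l2 (f :: ('a, 'b) l2) = sqrt (inner f f)"
definition "dist f g = norm (f - g)" for f g :: "('a, 'b) l2"
definition "sgn f = inverse (norm f) *\<^sub>R f" for f :: "('a, 'b) l2"
definition [code del]:
  "(uniformity :: (('a, 'b) l2 \<times> ('a, 'b) l2) filter) = (INF e\<in>{0<..}. principal {(f, g). dist f g < e})"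
definition [code del]:
  "open (U :: ('a, 'b) l2 set) \<longleftrightarrow> (\<forall>x\<in>U. \<forall>\<^sub>F (x', y) in uniformity. x' = x \<longrightarrow> y \<in> U)"

lemma l2_fun_zero: "l2_fun (0 :: ('a, 'b) l2) i = 0"
  unfolding zero_l2_def by (subst Abs_l2_inverse) simp_all

lemma l2_fun_add: "l2_fun (f + g :: ('a, 'b) l2) i = l2_fun f i + l2_fun g i"
  unfolding plus_l2_def
  using square_summable_add[OF l2_summable[of f] l2_summable[of g]]
  by (simp add: Abs_l2_inverse)

lemma l2_fun_minus: "l2_fun (- f :: ('a, 'b) l2) i = - l2_fun f i"
  unfolding uminus_l2_def using l2_summable[of f] by (simp add: Abs_l2_inverse)

lemma l2_fun_diff: "l2_fun (f - g :: ('a, 'b) l2) i = l2_fun f i - l2_fun g i"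
  unfolding minus_l2_def
  using square_summable_add[OF l2_summable[of f] l2_summable[of "- g"]]
  by (simp add: Abs_l2_inverse l2_fun_minus)

lemma l2_fun_scaleR: "l2_fun (r *\<^sub>R f :: ('a, 'b) l2) i = r *\<^sub>R l2_fun f i"
  unfolding scaleR_l2_def
  using square_summable_scaleC[OF l2_summable[of f], of "complex_of_real r"]
  by (simp only: Abs_l2_inverse scaleC_of_real mem_Collect_eq)

lemmas l2_fun_simps =
  l2_fun_zero l2_fun_add l2_fun_minus l2_fun_diff l2_fun_scaleR

lemma norm_l2_nonneg: "0 \<le> norm (f :: ('a, 'b) l2)"
  unfolding norm_l2_def inner_l2_def by (intro real_sqrt_ge_zero infsum_nonneg) simp

lemma norm_l2_square: "(norm (f :: ('a, 'b) l2))\<^sup>2 = (\<Sum>\<^sub>\<infinity>i. (norm (l2_fun f i))\<^sup>2)"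
proof -
  have "0 \<le> (\<Sum>\<^sub>\<infinity>i. inner (l2_fun f i) (l2_fun f i))"
    by (intro infsum_nonneg) simp
  then show ?thesis
    unfolding norm_l2_def inner_l2_def power2_norm_eq_inner by (rule real_sqrt_pow2)
qed

lemma sum_le_norm_l2:
  assumes "finite S"
  shows "(\<Sum>i\<in>S. (norm (l2_fun f i))\<^sup>2) \<le> (norm (f :: ('a, 'b) l2))\<^sup>2"
  unfolding norm_l2_square
  by (rule finite_sum_le_infsum[OF l2_summable assms]) simp_all

lemma norm_l2_fun_le: "norm (l2_fun f i) \<le> norm (f :: ('a, 'b) l2)"
  by (rule power2_le_imp_le) (use sum_le_norm_l2[of "{i}" f] norm_l2_nonneg[of f] in simp_all)

instance
proof
  fix f g h :: "('a, 'b) l2" and a b :: real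
  show "f + g + h = f + (g + h)" "f + g = g + f" "0 + f = f" "- f + f = 0" "f - g = f + - g"
    "a *\<^sub>R (f + g) = a *\<^sub>R f + a *\<^sub>R g" "(a + b) *\<^sub>R f = a *\<^sub>R f + b *\<^sub>R f"
    "a *\<^sub>R b *\<^sub>R f = (a * b) *\<^sub>R f" "1 *\<^sub>R f = f"
    by (rule l2_eqI; simp add: l2_fun_simps algebra_simps)+
  show "dist f g = norm (f - g)"
    by (rule dist_l2_def)
  show "sgn f = inverse (norm f) *\<^sub>R f"
    by (rule sgn_l2_def)
  show "(uniformity :: (('a, 'b) l2 \<times> ('a, 'b) l2) filter)
      = (INF e\<in>{0<..}. principal {(f, g). dist f g < e})"
    by (rule uniformity_l2_def)
  show "open U \<longleftrightarrow> (\<forall>x\<in>U. \<forall>\<^sub>F (x', y) in uniformity. x' = x \<longrightarrow> y \<in> U)" for U :: "('a, 'b) l2 set"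
    by (rule open_l2_def)
  show "inner f g = inner g f"
    by (simp add: inner_l2_def inner_commute)
  show "inner (f + g) h = inner f h + inner g h"
    by (simp add: inner_l2_def l2_fun_simps inner_add_left infsum_add summable_inner)
  show "inner (a *\<^sub>R f) g = a * inner f g"
    by (simp add: inner_l2_def l2_fun_simps infsum_cmult_right')
  show "0 \<le> inner f f"
    by (simp add: inner_l2_def infsum_nonneg)
  show "inner f f = 0 \<longleftrightarrow> f = 0"
  proof
    assume "inner f f = 0"
    then have "norm f = 0"
      by (simp add: norm_l2_def)
    with norm_l2_fun_le[of f] show "f = 0"
      by (intro l2_eqI) (simp add: l2_fun_simps)
  qed (simp add: inner_l2_def l2_fun_simps)
  show "norm f = sqrt (inner f f)"
    by (rule norm_l2_def)
qed

end

instance l2 :: (type, complex_hilbert) complete_space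
proof
  fix X :: "nat \<Rightarrow> ('a, 'b) l2"
  assume X: "Cauchy X"
  have "Cauchy (\<lambda>n. l2_fun (X n) i)" for i
    unfolding Cauchy_def
  proof (intro allI impI)
    fix e :: real assume "e > 0"
    with X obtain M where "\<forall>m\<ge>M. \<forall>n\<ge>M. dist (X m) (X n) < e"
      unfolding Cauchy_def by blast
    then show "\<exists>M. \<forall>m\<ge>M. \<forall>n\<ge>M. dist (l2_fun (X m) i) (l2_fun (X n) i) < e"
      by (metis dist_norm l2_fun_diff norm_l2_fun_le order_le_less_trans)
  qed
  then have "\<exists>l. (\<lambda>n. l2_fun (X n) i) \<longlonglongrightarrow> l" for i
    using Cauchy_convergent convergent_def by blast
  then obtain F where F: "\<And>i. (\<lambda>n. l2_fun (X n) i) \<longlonglongrightarrow> F i"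
    by metis
  have fin: "\<exists>M. \<forall>n\<ge>M. \<forall>S. finite S \<longrightarrow> (\<Sum>i\<in>S. (norm (l2_fun (X n) i - F i))\<^sup>2) \<le> e\<^sup>2"
    if "e > 0" for e :: real
  proof -
    from X \<open>e > 0\<close> obtain M where M: "\<forall>m\<ge>M. \<forall>n\<ge>M. dist (X m) (X n) < e"
      unfolding Cauchy_def by blast
    have "(\<Sum>i\<in>S. (norm (l2_fun (X n) i - F i))\<^sup>2) \<le> e\<^sup>2" if "n \<ge> M" "finite S" for n S
    proof (rule LIMSEQ_le_const2)
      show "(\<lambda>m. \<Sum>i\<in>S. (norm (l2_fun (X n) i - l2_fun (X m) i))\<^sup>2)
          \<longlonglongrightarrow> (\<Sum>i\<in>S. (norm (l2_fun (X n) i - F i))\<^sup>2)"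
        by (intro tendsto_intros F)
      have "(\<Sum>i\<in>S. (norm (l2_fun (X n) i - l2_fun (X m) i))\<^sup>2) \<le> e\<^sup>2" if "m \<ge> M" for m
      proof -
        have "(\<Sum>i\<in>S. (norm (l2_fun (X n) i - l2_fun (X m) i))\<^sup>2) \<le> (norm (X n - X m))\<^sup>2"
          using sum_le_norm_l2[OF \<open>finite S\<close>, of "X n - X m"] by (simp add: l2_fun_simps)
        also have "\<dots> \<le> e\<^sup>2"
          using M \<open>n \<ge> M\<close> \<open>m \<ge> M\<close> by (intro power_mono) (auto simp: dist_norm less_imp_le)
        finally show ?thesis .
      qed
      then show "\<exists>N. \<forall>m\<ge>N. (\<Sum>i\<in>S. (norm (l2_fun (X n) i - l2_fun (X m) i))\<^sup>2) \<le> e\<^sup>2"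
        by blast
    qed
    then show ?thesis by blast
  qed
  have diff: "(\<lambda>i. (norm (l2_fun (X n) i - F i))\<^sup>2) summable_on UNIV"
    if "\<forall>S. finite S \<longrightarrow> (\<Sum>i\<in>S. (norm (l2_fun (X n) i - F i))\<^sup>2) \<le> e\<^sup>2" for n e
    by (rule nonneg_bdd_above_summable_on) (use that in \<open>auto simp: bdd_above_def\<close>)
  obtain M where "\<forall>S. finite S \<longrightarrow> (\<Sum>i\<in>S. (norm (l2_fun (X M) i - F i))\<^sup>2) \<le> 1\<^sup>2"
    using fin[OF zero_less_one] by blast
  then have "(\<lambda>i. (norm (l2_fun (X M) i - F i))\<^sup>2) summable_on UNIV"
    by (rule diff)
  then have "(\<lambda>i. (norm (F i - l2_fun (X M) i))\<^sup>2) summable_on UNIV"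
    by (subst norm_minus_commute)
  from square_summable_add[OF l2_summable[of "X M"] this]
  have "(\<lambda>i. (norm (F i))\<^sup>2) summable_on UNIV"
    by simp
  then have L: "l2_fun (Abs_l2 F) = F"
    by (intro Abs_l2_inverse) simp
  have "\<exists>M. \<forall>n\<ge>M. dist (X n) (Abs_l2 F) < e" if "e > 0" for e :: real
  proof -
    obtain M where M: "\<forall>n\<ge>M. \<forall>S. finite S \<longrightarrow> (\<Sum>i\<in>S. (norm (l2_fun (X n) i - F i))\<^sup>2) \<le> (e / 2)\<^sup>2"
      using fin[of "e / 2"] \<open>e > 0\<close> by auto
    have "dist (X n) (Abs_l2 F) < e" if "n \<ge> M" for n
    proof -
      have "(norm (X n - Abs_l2 F))\<^sup>2 \<le> (e / 2)\<^sup>2"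
        unfolding norm_l2_square l2_fun_simps L
        by (rule infsum_le_finite_sums) (use diff M that in auto)
      then have "norm (X n - Abs_l2 F) \<le> e / 2"
        by (rule power2_le_imp_le) (use \<open>e > 0\<close> in simp)
      with \<open>e > 0\<close> show ?thesis
        by (simp add: dist_norm)
    qed
    then show ?thesis by blast
  qed
  then have "X \<longlonglongrightarrow> Abs_l2 F"
    by (rule metric_LIMSEQ_I)
  then show "convergent X"
    by (rule convergentI)
qed

instantiation l2 :: (type, complex_hilbert) complex_hilbert
begin

definition "scaleC_l2 (c :: complex) (f :: ('a, 'b) l2) = Abs_l2 (\<lambda>i. c *\<^sub>C l2_fun f i)"
definition "cinner_l2 (f :: ('a, 'b) l2) (g :: ('a, 'b) l2) = (\<Sum>\<^sub>\<infinity>i. cinner (l2_fun f i) (l2_fun g i))"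

lemma l2_fun_scaleC: "l2_fun (c *\<^sub>C f :: ('a, 'b) l2) i = c *\<^sub>C l2_fun f i"
  unfolding scaleC_l2_def by (subst Abs_l2_inverse) (auto intro: square_summable_scaleC l2_summable)

instance
proof
  fix f g h :: "('a, 'b) l2" and a :: real and c c' :: complex
  show "c *\<^sub>C (f + g) = c *\<^sub>C f + c *\<^sub>C g" "(c + c') *\<^sub>C f = c *\<^sub>C f + c' *\<^sub>C f"
    "c *\<^sub>C c' *\<^sub>C f = (c * c') *\<^sub>C f" "complex_of_real a *\<^sub>C f = a *\<^sub>R f"
    by (rule l2_eqI; simp add: l2_fun_simps l2_fun_scaleC scaleC_add_right scaleC_add_left
          scaleC_scaleC scaleC_of_real)+
  show "cinner f g = cnj (cinner g f)"
    unfolding cinner_l2_def by (subst cinner_commute) (simp flip: infsum_cnj)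
  show "cinner (f + g) h = cinner f h + cinner g h"
    by (simp add: cinner_l2_def l2_fun_simps cinner_add_left infsum_add summable_cinner)
  show "cinner (c *\<^sub>C f) g = cnj c * cinner f g"
    by (simp add: cinner_l2_def l2_fun_scaleC cinner_scaleC_left infsum_cmult_right')
  show "Re (cinner f g) = inner f g"
    by (simp add: cinner_l2_def inner_l2_def infsum_Re[OF summable_cinner, symmetric] Re_cinner)
qed

end


section \<open>Operators\<close>

definition clinear_op :: "('h::complex_hilbert \<Rightarrow>\<^sub>L 'k::complex_hilbert) \<Rightarrow> bool" where
  "clinear_op T \<longleftrightarrow> (\<forall>c x. T (c *\<^sub>C x) = c *\<^sub>C T x)"

definition compact_op :: "('h::complex_hilbert \<Rightarrow> 'k::complex_hilbert) \<Rightarrow> bool" where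
  "compact_op f \<longleftrightarrow> bounded_linear f \<and> (\<forall>c x. f (c *\<^sub>C x) = c *\<^sub>C f x)
     \<and> compact (closure (f ` cball 0 1))"

definition scale_op :: "complex \<Rightarrow> ('h::complex_hilbert \<Rightarrow>\<^sub>L 'h) \<Rightarrow> ('h \<Rightarrow>\<^sub>L 'h)" where
  "scale_op c T = Blinfun (\<lambda>x. c *\<^sub>C T x)"

lemma scale_op_apply: "scale_op c T x = c *\<^sub>C T x"
  unfolding scale_op_def
  by (subst bounded_linear_Blinfun_apply)
    (auto intro: bounded_linear_compose[OF bounded_linear_scaleC blinfun.bounded_linear_right])

definition adj_op :: "('h::complex_hilbert \<Rightarrow>\<^sub>L 'h) \<Rightarrow> ('h \<Rightarrow>\<^sub>L 'h)" where
  "adj_op T = (SOME S :: 'h \<Rightarrow>\<^sub>L 'h. \<forall>x y. cinner (T x) y = cinner x (S y))"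

lemma riesz_real:
  fixes f :: "'h::{real_inner, complete_space} \<Rightarrow> real"
  assumes f: "bounded_linear f"
  shows "\<exists>z. \<forall>x. f x = inner x z"
proof -
  interpret f: bounded_linear f by (rule f)
  define J where "J x = inner x x - 2 * f x" for x
  obtain K where K: "\<And>x. norm (f x) \<le> norm x * K"
    using f.bounded by blast
  have lower: "- K\<^sup>2 \<le> J x" for x
  proof -
    have "0 \<le> (norm x - K)\<^sup>2" by simp
    also have "\<dots> = inner x x - 2 * (norm x * K) + K\<^sup>2"
      by (simp add: power2_diff power2_norm_eq_inner)
    finally show ?thesis using K[of x] by (simp add: J_def)
  qed
  then have bdd: "bdd_below (range J)" by (auto simp: bdd_below_def)
  define m where "m = Inf (range J)"
  have m: "m \<le> J x" for x
    unfolding m_def by (rule cInf_lower) (use bdd in auto)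
  have "\<exists>x. J x < m + 1 / Suc n" for n
    using cInf_lessD[of "range J" "m + 1 / Suc n"] by (auto simp: m_def)
  then obtain X where X: "\<And>n. J (X n) < m + 1 / Suc n" by metis
  have par: "(norm (x - y))\<^sup>2 = 2 * J x + 2 * J y - 4 * J ((1/2) *\<^sub>R (x + y))" for x y
    by (simp add: J_def power2_norm_eq_inner f.add f.scaleR inner_add_left inner_add_right
        inner_diff_left inner_diff_right inner_commute algebra_simps)
  have d: "(norm (X p - X q))\<^sup>2 < 2 / Suc p + 2 / Suc q" for p q
    using par[of "X p" "X q"] X[of p] X[of q] m[of "(1/2) *\<^sub>R (X p + X q)"] by simp
  have "Cauchy X"
  proof (rule metric_CauchyI)
    fix e :: real assume "e > 0"
    then obtain N where N: "4 / e\<^sup>2 < real N" using reals_Archimedean2 by blast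
    have "dist (X p) (X q) < e" if "p \<ge> N" "q \<ge> N" for p q
    proof -
      have pos: "0 < real N"
        using N \<open>e > 0\<close> by (smt (verit) divide_nonneg_nonneg zero_le_power2)
      have "2 / Suc p \<le> 2 / real N" "2 / Suc q \<le> 2 / real N"
        using that pos by (auto intro!: divide_left_mono)
      then have "(norm (X p - X q))\<^sup>2 < 4 / real N" using d[of p q] by simp
      also have "\<dots> < e\<^sup>2" using N pos \<open>e > 0\<close> by (simp add: field_simps)
      finally show ?thesis
        unfolding dist_norm by (rule power2_less_imp_less) (use \<open>e > 0\<close> in simp)
    qed
    then show "\<exists>M. \<forall>m\<ge>M. \<forall>n\<ge>M. dist (X m) (X n) < e" by blast
  qed
  then obtain z where z: "X \<longlonglongrightarrow> z"
    using Cauchy_convergent convergent_def by blast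
  have "(\<lambda>n. J (X n)) \<longlonglongrightarrow> J z"
    unfolding J_def by (intro tendsto_intros z f.tendsto)
  moreover have "(\<lambda>n. m + 1 / Suc n) \<longlonglongrightarrow> m + 0"
    by (intro tendsto_intros LIMSEQ_Suc[OF lim_1_over_n])
  ultimately have "J z \<le> m + 0"
    by (rule LIMSEQ_le) (use X less_imp_le in blast)
  then have min: "J z \<le> J x" for x using m[of x] by simp
  have "f x = inner x z" for x
  proof (cases "x = 0")
    case False
    define b where "b = inner x z - f x"
    define t where "t = - b / inner x x"
    have x: "inner x x > 0" using False by simp
    have "J (z + t *\<^sub>R x) = J z + t\<^sup>2 * inner x x + 2 * t * b"
      by (simp add: J_def b_def f.add f.scaleR inner_add_left inner_add_right inner_commute
          algebra_simps power2_eq_square)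
    moreover have "t\<^sup>2 * inner x x + 2 * t * b = - (b\<^sup>2 / inner x x)"
      using x by (simp add: t_def power2_eq_square field_simps)
    ultimately have "b\<^sup>2 / inner x x \<le> 0"
      using min[of "z + t *\<^sub>R x"] by linarith
    then have "b = 0" using x by (simp add: divide_le_0_iff)
    then show ?thesis by (simp add: b_def)
  qed (simp add: f.zero)
  then show ?thesis by blast
qed

lemma adj_op: "cinner (T x) y = cinner x (adj_op T y)" if T: "clinear_op T"
proof -
  have "\<exists>z. \<forall>x. inner (T x) y = inner x z" for y
    by (rule riesz_real) (intro bounded_linear_intros)
  then obtain S where S: "\<And>x y. inner (T x) y = inner x (S y)" by metis
  have "bounded_linear S"
  proof (rule bounded_linear_intro)
    fix y y' and r :: real
    show "S (y + y') = S y + S y'"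
      by (metis S inner_add_right vector_eq_ldot)
    show "S (r *\<^sub>R y) = r *\<^sub>R S y"
      by (metis S inner_scaleR_right vector_eq_ldot)
    show "norm (S y) \<le> norm y * norm T"
    proof (cases "S y = 0")
      case False
      have "norm (S y) * norm (S y) = inner (T (S y)) y"
        by (simp add: S power2_norm_eq_inner flip: power2_eq_square)
      also have "\<dots> \<le> norm (T (S y)) * norm y" by (rule norm_cauchy_schwarz)
      also have "\<dots> \<le> norm T * norm (S y) * norm y"
        by (intro mult_right_mono norm_blinfun) auto
      finally show ?thesis using False by (simp add: mult_ac)
    qed simp
  qed
  then have "\<forall>x y. cinner (T x) y = cinner x (Blinfun S y)"
    using T by (simp add: complex_eq_iff Re_cinner Im_cinner S bounded_linear_Blinfun_apply
        clinear_op_def flip: S)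
  then show ?thesis
    unfolding adj_op_def by (rule someI2) blast
qed

lemma adj_op_unique:
  fixes T S :: "'h::complex_hilbert \<Rightarrow>\<^sub>L 'h"
  assumes T: "clinear_op T" and S: "\<And>x y. cinner (T x) y = cinner x (S y)"
  shows "adj_op T = S"
proof (rule blinfun_eqI)
  fix y
  have "inner x (adj_op T y) = inner x (S y)" for x
    by (metis Re_cinner S adj_op[OF T])
  then show "adj_op T y = S y"
    by (metis vector_eq_ldot)
qed


section \<open>Star algebras, quotients and exact sequences\<close>

text \<open>
  The norm of a C*-algebra is determined by its *-algebra structure, and *-homomorphisms are
  automatically contractive, so the norm is not part of the record.  There is no unit: Roe algebras
  are not unital.
\<close>

record 'a star_algebra =
  elts :: "'a set"
  szero :: 'a
  sadd :: "'a \<Rightarrow> 'a \<Rightarrow> 'a"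
  sscale :: "complex \<Rightarrow> 'a \<Rightarrow> 'a"
  smult :: "'a \<Rightarrow> 'a \<Rightarrow> 'a"
  sstar :: "'a \<Rightarrow> 'a"

definition op_algebra :: "('h::complex_hilbert \<Rightarrow>\<^sub>L 'h) set \<Rightarrow> ('h \<Rightarrow>\<^sub>L 'h) star_algebra" where
  "op_algebra S = \<lparr>elts = S, szero = 0, sadd = (+), sscale = scale_op, smult = (o\<^sub>L), sstar = adj_op\<rparr>"

definition star_hom :: "'a star_algebra \<Rightarrow> 'b star_algebra \<Rightarrow> ('a \<Rightarrow> 'b) \<Rightarrow> bool" where
  "star_hom A B f \<longleftrightarrow> f ` elts A \<subseteq> elts B
     \<and> (\<forall>a\<in>elts A. \<forall>b\<in>elts A. f (sadd A a b) = sadd B (f a) (f b))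
     \<and> (\<forall>c. \<forall>a\<in>elts A. f (sscale A c a) = sscale B c (f a))
     \<and> (\<forall>a\<in>elts A. \<forall>b\<in>elts A. f (smult A a b) = smult B (f a) (f b))
     \<and> (\<forall>a\<in>elts A. f (sstar A a) = sstar B (f a))"

definition ideal_coset :: "'a star_algebra \<Rightarrow> 'a set \<Rightarrow> 'a \<Rightarrow> 'a set" where
  "ideal_coset A I a = sadd A a ` I"

definition quotient_algebra :: "'a star_algebra \<Rightarrow> 'a set \<Rightarrow> 'a set star_algebra" where
  "quotient_algebra A I =
     \<lparr>elts = ideal_coset A I ` elts A,
      szero = ideal_coset A I (szero A),
      sadd = \<lambda>C D. \<Union>a\<in>C. \<Union>b\<in>D. ideal_coset A I (sadd A a b),
      sscale = \<lambda>c C. \<Union>a\<in>C. ideal_coset A I (sscale A c a),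
      smult = \<lambda>C D. \<Union>a\<in>C. \<Union>b\<in>D. ideal_coset A I (smult A a b),
      sstar = \<lambda>C. \<Union>a\<in>C. ideal_coset A I (sstar A a)\<rparr>"

definition star_kernel :: "'a star_algebra \<Rightarrow> 'b star_algebra \<Rightarrow> ('a \<Rightarrow> 'b) \<Rightarrow> 'a set" where
  "star_kernel A B f = {a \<in> elts A. f a = szero B}"

definition short_exact ::
    "'a star_algebra \<Rightarrow> 'b star_algebra \<Rightarrow> 'c star_algebra \<Rightarrow> ('a \<Rightarrow> 'b) \<Rightarrow> ('b \<Rightarrow> 'c) \<Rightarrow> bool" where
  "short_exact A B C i q \<longleftrightarrow> star_hom A B i \<and> star_hom B C q
     \<and> inj_on i (elts A) \<and> i ` elts A = star_kernel B C q \<and> q ` elts B = elts C"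


section \<open>Roe algebras\<close>

text \<open>
  For a set \<open>X\<close> of indices, \<open>l2(X) \<otimes> H\<close> is the closed subspace of \<open>('x, 'h) l2\<close> of functions that
  vanish off \<open>X\<close>, and operators on it are extended by \<open>0\<close> on the orthogonal complement.
\<close>

definition l2_single :: "'x \<Rightarrow> 'h::complex_hilbert \<Rightarrow> ('x, 'h) l2" where
  "l2_single y v = Abs_l2 (\<lambda>x. if x = y then v else 0)"

lemma l2_fun_single: "l2_fun (l2_single y v) x = (if x = y then v else 0)"
proof -
  have "(\<lambda>x. (norm (if x = y then v else 0))\<^sup>2) summable_on UNIV"
    by (rule finite_nonzero_values_imp_summable_on) (rule finite_subset[of _ "{y}"], auto)
  then show ?thesis
    unfolding l2_single_def by (subst Abs_l2_inverse) auto
qed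

definition entry :: "(('x, 'h::complex_hilbert) l2 \<Rightarrow>\<^sub>L ('x, 'h) l2) \<Rightarrow> 'x \<Rightarrow> 'x \<Rightarrow> 'h \<Rightarrow> 'h" where
  "entry T x y v = l2_fun (T (l2_single y v)) x"

definition l2_ops :: "'x set \<Rightarrow> (('x, 'h::complex_hilbert) l2 \<Rightarrow>\<^sub>L ('x, 'h) l2) set" where
  "l2_ops X = {T. clinear_op T \<and> (\<forall>x y. x \<notin> X \<or> y \<notin> X \<longrightarrow> entry T x y = (\<lambda>_. 0))}"

definition compact_ops :: "'x set \<Rightarrow> (('x, 'h::complex_hilbert) l2 \<Rightarrow>\<^sub>L ('x, 'h) l2) set" where
  "compact_ops X = {T \<in> l2_ops X. compact_op T}"

definition finite_propagation_ops ::
    "'x set \<Rightarrow> ('x \<Rightarrow> 'x \<Rightarrow> real) \<Rightarrow> (('x, 'h::complex_hilbert) l2 \<Rightarrow>\<^sub>L ('x, 'h) l2) set" where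
  "finite_propagation_ops X d = {T \<in> l2_ops X.
     (\<forall>x\<in>X. \<forall>y\<in>X. compact_op (entry T x y)) \<and>
     (\<exists>R>0. \<forall>x\<in>X. \<forall>y\<in>X. d x y \<ge> R \<longrightarrow> entry T x y = (\<lambda>_. 0))}"

definition roe_ops ::
    "'x set \<Rightarrow> ('x \<Rightarrow> 'x \<Rightarrow> real) \<Rightarrow> (('x, 'h::complex_hilbert) l2 \<Rightarrow>\<^sub>L ('x, 'h) l2) set" where
  "roe_ops X d = closure (finite_propagation_ops X d)"

definition roe_mod_compacts ::
    "'x set \<Rightarrow> ('x \<Rightarrow> 'x \<Rightarrow> real) \<Rightarrow> (('x, 'h::complex_hilbert) l2 \<Rightarrow>\<^sub>L ('x, 'h) l2) set star_algebra" where
  "roe_mod_compacts X d = quotient_algebra (op_algebra (roe_ops X d)) (compact_ops X)"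

text \<open>For a bijection \<open>p\<close> of \<open>X\<close>, the operator that sends the basis vector at \<open>y\<close> to that at \<open>p y\<close>.\<close>

definition perm_op :: "'x set \<Rightarrow> ('x \<Rightarrow> 'x) \<Rightarrow> (('x, 'h::complex_hilbert) l2 \<Rightarrow>\<^sub>L ('x, 'h) l2)" where
  "perm_op X p = Blinfun (\<lambda>\<xi>. Abs_l2 (\<lambda>x. if x \<in> X then l2_fun \<xi> (inv_into X p x) else 0))"

lemma perm_op_apply:
  assumes p: "bij_betw p X X"
  shows "l2_fun (perm_op X p \<xi>) x = (if x \<in> X then l2_fun \<xi> (inv_into X p x) else 0)"
proof -
  define P :: "('a, 'b) l2 \<Rightarrow> ('a, 'b) l2"
    where "P \<xi> = Abs_l2 (\<lambda>x. if x \<in> X then l2_fun \<xi> (inv_into X p x) else 0)" for \<xi>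
  have q: "bij_betw (inv_into X p) X X"
    by (rule bij_betw_inv_into[OF p])
  have eq: "(\<lambda>x. (norm (if x \<in> X then l2_fun \<xi> (inv_into X p x) else 0))\<^sup>2)
      = (\<lambda>x. if x \<in> X then (norm (l2_fun \<xi> (inv_into X p x)))\<^sup>2 else 0)" for \<xi> :: "('a, 'b) l2"
    by auto
  have sX: "(\<lambda>x. (norm (l2_fun \<xi> x))\<^sup>2) summable_on X" for \<xi> :: "('a, 'b) l2"
    by (rule summable_on_subset_banach[OF l2_summable]) simp
  have sum: "(\<lambda>x. (norm (if x \<in> X then l2_fun \<xi> (inv_into X p x) else 0))\<^sup>2) summable_on UNIV"
    for \<xi> :: "('a, 'b) l2"
    unfolding eq
    using sX[of \<xi>, folded summable_on_reindex_bij_betw[OF q, of "\<lambda>x. (norm (l2_fun \<xi> x))\<^sup>2"]]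
    by (subst summable_on_cong_neutral[where T = X]) auto
  have P: "l2_fun (P \<xi>) x = (if x \<in> X then l2_fun \<xi> (inv_into X p x) else 0)" for \<xi> x
    unfolding P_def by (subst Abs_l2_inverse) (use sum in auto)
  have norm: "norm (P \<xi>) \<le> norm \<xi>" for \<xi>
  proof (rule power2_le_imp_le)
    have "(norm (P \<xi>))\<^sup>2 = (\<Sum>\<^sub>\<infinity>x\<in>X. (norm (l2_fun \<xi> (inv_into X p x)))\<^sup>2)"
      unfolding norm_l2_square P eq by (rule infsum_cong_neutral) auto
    also have "\<dots> = (\<Sum>\<^sub>\<infinity>x\<in>X. (norm (l2_fun \<xi> x))\<^sup>2)"
      by (rule infsum_reindex_bij_betw[OF q])
    also have "\<dots> \<le> (norm \<xi>)\<^sup>2"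
      unfolding norm_l2_square by (rule infsum_mono2[OF sX l2_summable]) auto
    finally show "(norm (P \<xi>))\<^sup>2 \<le> (norm \<xi>)\<^sup>2" .
  qed simp
  have "bounded_linear P"
    by (rule bounded_linear_intro[where K = 1]) (auto intro!: l2_eqI simp: P l2_fun_simps norm)
  then have "perm_op X p = Blinfun P" "blinfun_apply (Blinfun P) = P"
    by (simp_all add: perm_op_def P_def[abs_def] bounded_linear_Blinfun_apply)
  then show ?thesis by (simp add: P)
qed

lemma perm_op_in_l2_ops: "perm_op X p \<in> l2_ops X" if "bij_betw p X X"
  using bij_betwE[OF bij_betw_inv_into[OF that]]
  by (auto simp: l2_ops_def clinear_op_def entry_def perm_op_apply[OF that] l2_fun_single
      l2_fun_scaleC scaleC_zero fun_eq_iff intro!: l2_eqI)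

lemma entry_perm_op:
  assumes "bij_betw p X X" "x \<in> X" "y \<in> X"
  shows "entry (perm_op X p) x y = (if p y = x then id else (\<lambda>_. 0))"
proof -
  have "inv_into X p x = y \<longleftrightarrow> p y = x"
    using bij_betw_inv_into_left[OF assms(1,3)] bij_betw_inv_into_right[OF assms(1,2)] by metis
  then show ?thesis
    using assms(2) by (simp add: entry_def perm_op_apply[OF assms(1)] l2_fun_single fun_eq_iff)
qed

text \<open>The action of \<open>G\<close> on \<open>C*(X)/K\<close> induced by conjugation with \<open>M_g = perm_op X (\<phi> g)\<close>.\<close>

definition conj_action ::
    "'x set \<Rightarrow> ('x \<Rightarrow> 'x \<Rightarrow> real) \<Rightarrow> ('g \<Rightarrow> 'x \<Rightarrow> 'x) \<Rightarrow> 'g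
      \<Rightarrow> (('x, 'h::complex_hilbert) l2 \<Rightarrow>\<^sub>L ('x, 'h) l2) set \<Rightarrow> (('x, 'h) l2 \<Rightarrow>\<^sub>L ('x, 'h) l2) set" where
  "conj_action X d \<phi> g C = (\<Union>T\<in>C. ideal_coset (op_algebra (roe_ops X d)) (compact_ops X)
     (perm_op X (\<phi> g) o\<^sub>L T o\<^sub>L adj_op (perm_op X (\<phi> g))))"


section \<open>Reduced crossed products\<close>

definition faithful_rep :: "'a star_algebra \<Rightarrow> ('a \<Rightarrow> 'k::complex_hilbert \<Rightarrow>\<^sub>L 'k) \<Rightarrow> bool" where
  "faithful_rep A \<pi> \<longleftrightarrow> star_hom A (op_algebra {T. clinear_op T}) \<pi> \<and> inj_on \<pi> (elts A)"

text \<open>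
  The covariant representation on \<open>l2(G, 'k)\<close> induced by a representation \<open>\<pi>\<close> of \<open>A\<close> on \<open>'k\<close>:
  \<open>a\<close> acts by \<open>(a \<xi>)(h) = \<pi> (\<alpha> h\<inverse> a) (\<xi> h)\<close> and \<open>G\<close> by left translation.  The reduced crossed product
  is the norm closure of the resulting image of the finitely supported functions \<open>G \<rightarrow> A\<close>; up to
  isomorphism it does not depend on the choice of the faithful representation \<open>\<pi>\<close>.
\<close>

definition induced_rep ::
    "('g, 'm) monoid_scheme \<Rightarrow> ('g \<Rightarrow> 'a \<Rightarrow> 'a) \<Rightarrow> ('a \<Rightarrow> 'k::complex_hilbert \<Rightarrow>\<^sub>L 'k)
      \<Rightarrow> 'a \<Rightarrow> (('g, 'k) l2 \<Rightarrow>\<^sub>L ('g, 'k) l2)" where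
  "induced_rep G \<alpha> \<pi> a = Blinfun (\<lambda>\<xi>. Abs_l2 (\<lambda>h.
     if h \<in> carrier G then \<pi> (\<alpha> (inv\<^bsub>G\<^esub> h) a) (l2_fun \<xi> h) else 0))"

definition left_translation ::
    "('g, 'm) monoid_scheme \<Rightarrow> 'g \<Rightarrow> (('g, 'k::complex_hilbert) l2 \<Rightarrow>\<^sub>L ('g, 'k) l2)" where
  "left_translation G g = perm_op (carrier G) (\<lambda>h. g \<otimes>\<^bsub>G\<^esub> h)"

definition reduced_crossed_product ::
    "'a star_algebra \<Rightarrow> ('g, 'm) monoid_scheme \<Rightarrow> ('g \<Rightarrow> 'a \<Rightarrow> 'a) \<Rightarrow> ('a \<Rightarrow> 'k::complex_hilbert \<Rightarrow>\<^sub>L 'k)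
      \<Rightarrow> (('g, 'k) l2 \<Rightarrow>\<^sub>L ('g, 'k) l2) star_algebra" where
  "reduced_crossed_product A G \<alpha> \<pi> = op_algebra (closure
     {\<Sum>g\<in>F. induced_rep G \<alpha> \<pi> (f g) o\<^sub>L left_translation G g | F f.
        finite F \<and> F \<subseteq> carrier G \<and> (\<forall>g\<in>F. f g \<in> elts A)})"


section \<open>Large scale structures and group actions\<close>

definition star_set :: "'x set \<Rightarrow> 'x set set \<Rightarrow> 'x set" where
  "star_set B \<U> = \<Union>{U \<in> \<U>. U \<inter> B \<noteq> {}}"

definition large_scale_structure :: "'x set \<Rightarrow> 'x set set set \<Rightarrow> bool" where
  "large_scale_structure X L \<longleftrightarrow> L \<noteq> {} \<and> (\<forall>\<B>\<in>L. \<B> \<subseteq> Pow X)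
     \<and> (\<forall>\<B>\<^sub>1\<in>L. \<forall>\<B>\<^sub>2. \<B>\<^sub>2 \<subseteq> Pow X
          \<and> (\<forall>B\<in>\<B>\<^sub>2. (\<exists>x\<in>B. \<exists>y\<in>B. x \<noteq> y) \<longrightarrow> (\<exists>A\<in>\<B>\<^sub>1. B \<subseteq> A)) \<longrightarrow> \<B>\<^sub>2 \<in> L)
     \<and> (\<forall>\<B>\<^sub>1\<in>L. \<forall>\<B>\<^sub>2\<in>L. (\<lambda>B. star_set B \<B>\<^sub>2) ` \<B>\<^sub>1 \<in> L)"

definition metric_lss :: "'x set \<Rightarrow> ('x \<Rightarrow> 'x \<Rightarrow> real) \<Rightarrow> 'x set set set" where
  "metric_lss X d = {\<U>. \<U> \<subseteq> Pow X \<and> (\<exists>R. \<forall>U\<in>\<U>. \<forall>x\<in>U. \<forall>y\<in>U. d x y \<le> R)}"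

definition action_lss ::
    "('g, 'm) monoid_scheme \<Rightarrow> 'x set \<Rightarrow> ('x \<Rightarrow> 'x \<Rightarrow> real) \<Rightarrow> ('g \<Rightarrow> 'x \<Rightarrow> 'x) \<Rightarrow> 'x set set set" where
  "action_lss G X d \<phi> = \<Inter>{L. large_scale_structure X L \<and> metric_lss X d \<subseteq> L
     \<and> (\<forall>g\<in>carrier G. {{x, \<phi> g x} | x. x \<in> X} \<in> L)}"

definition bounded_geometry :: "'x set \<Rightarrow> ('x \<Rightarrow> 'x \<Rightarrow> real) \<Rightarrow> bool" where
  "bounded_geometry X d \<longleftrightarrow> (\<forall>R>0. \<exists>N::nat. \<forall>x\<in>X.
     finite (Metric_space.mball X d x R) \<and> card (Metric_space.mball X d x R) \<le> N)"

definition discrete_bounded_geometry_space :: "'x set \<Rightarrow> ('x \<Rightarrow> 'x \<Rightarrow> real) \<Rightarrow> bool" where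
  "discrete_bounded_geometry_space X d \<longleftrightarrow> Metric_space X d
     \<and> Metric_space.mtopology X d = discrete_topology X \<and> bounded_geometry X d"

definition acts_by_coarse_equivalences ::
    "('g, 'm) monoid_scheme \<Rightarrow> 'x set \<Rightarrow> ('x \<Rightarrow> 'x \<Rightarrow> real) \<Rightarrow> ('g \<Rightarrow> 'x \<Rightarrow> 'x) \<Rightarrow> bool" where
  "acts_by_coarse_equivalences G X d \<phi> \<longleftrightarrow> group_action G X \<phi>
     \<and> (\<forall>g\<in>carrier G. \<forall>R>0. \<exists>S>0. \<forall>x\<in>X. \<forall>y\<in>X. d x y \<le> R \<longrightarrow> d (\<phi> g x) (\<phi> g y) \<le> S)"

definition coarsely_discontinuous ::
    "('g, 'm) monoid_scheme \<Rightarrow> 'x set \<Rightarrow> ('x \<Rightarrow> 'x \<Rightarrow> real) \<Rightarrow> ('g \<Rightarrow> 'x \<Rightarrow> 'x) \<Rightarrow> bool" where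
  "coarsely_discontinuous G X d \<phi> \<longleftrightarrow> (\<forall>g \<in> carrier G - {\<one>\<^bsub>G\<^esub>}. \<forall>R>0.
     \<exists>K. Metric_space.mbounded X d K \<and> (\<forall>x \<in> X - K. d x (\<phi> g x) \<ge> R))"

text \<open>Amenability as existence of a left invariant finitely additive probability measure.\<close>

definition amenable :: "('g, 'm) monoid_scheme \<Rightarrow> bool" where
  "amenable G \<longleftrightarrow> (\<exists>\<mu> :: 'g set \<Rightarrow> real.
     \<mu> (carrier G) = 1
     \<and> (\<forall>A. A \<subseteq> carrier G \<longrightarrow> \<mu> A \<ge> 0)
     \<and> (\<forall>A B. A \<subseteq> carrier G \<and> B \<subseteq> carrier G \<and> A \<inter> B = {} \<longrightarrow> \<mu> (A \<union> B) = \<mu> A + \<mu> B)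
     \<and> (\<forall>g\<in>carrier G. \<forall>A. A \<subseteq> carrier G \<longrightarrow> \<mu> (g <#\<^bsub>G\<^esub> A) = \<mu> A))"

definition prob_simplex :: "'s set \<Rightarrow> ('s \<Rightarrow> real) set" where
  "prob_simplex S = {a. (\<forall>s. a s \<in> {0..1}) \<and> finite {s. a s \<noteq> 0} \<and> {s. a s \<noteq> 0} \<subseteq> S
     \<and> (\<Sum>s | a s \<noteq> 0. a s) = 1}"

definition l1_dist :: "('s \<Rightarrow> real) \<Rightarrow> ('s \<Rightarrow> real) \<Rightarrow> real" where
  "l1_dist a b = (\<Sum>s | a s \<noteq> 0 \<or> b s \<noteq> 0. \<bar>a s - b s\<bar>)"

text \<open>
  The vertex set \<open>S\<close> ranges over the subsets of a type \<open>'s\<close>.  In a theorem that assumes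
  \<open>property_A TYPE('s) X d\<close> this type is arbitrary, hence so is \<open>S\<close>.
\<close>

definition property_A :: "'s itself \<Rightarrow> 'x set \<Rightarrow> ('x \<Rightarrow> 'x \<Rightarrow> real) \<Rightarrow> bool" where
  "property_A _ X d \<longleftrightarrow> (\<forall>\<U> \<epsilon>. \<U> \<in> metric_lss X d \<and> \<Union>\<U> = X \<and> \<epsilon> > 0 \<longrightarrow>
     (\<exists>(S :: 's set) \<phi>. \<phi> ` X \<subseteq> prob_simplex S
        \<and> {{x \<in> X. \<phi> x s \<noteq> 0} | s. s \<in> S} \<in> metric_lss X d
        \<and> \<Union>{{x \<in> X. \<phi> x s \<noteq> 0} | s. s \<in> S} = X
        \<and> (\<exists>\<delta><\<epsilon>. \<forall>U\<in>\<U>. \<forall>x\<in>U. \<forall>y\<in>U. l1_dist (\<phi> x) (\<phi> y) \<le> \<delta>)))"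

end

theory Submission
  imports Defs "HOL-Computational_Algebra.Fundamental_Theorem_Algebra"
begin

text \<open>
  Operators of finite propagation on \<open>X\<^sub>G\<close> are the finite sums \<open>\<Sum>g. t g M g\<close> with \<open>t g\<close> of finite
  propagation on \<open>X\<close>, and \<open>q\<close> sends such a sum to \<open>\<Sum>g. [t g] u g\<close>.  The reduced norm of the image is the
  supremum of the norms of its finite compressions, which are block matrices over \<open>C\<^sup>*(X)/\<K>\<close>.  Modulo compact
  operators, such a matrix may be restricted to vectors supported away from a bounded set.  There Property A
  cuts vectors into pieces of bounded support without affecting norms much, and coarse discontinuity makes
  the translates of these supports far apart, so that the norm of the matrix is at most that of the
  operator: \<open>q\<close> is contractive.  Conversely, averaging the block matrix over an almost invariant finite
  subset of \<open>G\<close> gives back the operator up to a small error, and block matrices lift from the quotient with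
  norm control, so the distance of the operator to \<open>\<K>\<close> is at most the reduced norm.  Both estimates pass to
  the closures.
\<close>

section \<open>Operators on complex Hilbert spaces\<close>

text \<open>The representation \<open>\<pi>\<close> is an arbitrary faithful one, so nothing is
  known about the vectors of its space. Norms in its image are reached only through two general
  facts about *-homomorphisms between operator algebras: they are contractive, and the distance of
  an element to the kernel is at most the norm of its image. Both are derived for algebras without
  unit and then applied to matrices over the Roe algebra. The map \<open>q\<close> cannot be defined
  by a formula on sums: a finite propagation operator on \<open>X_G\<close> decomposes into
  translates in many ways, since one entry may be reached by several group elements. Hence the pairs
  of a finite sum and its image form a relation \<open>graph\<close>, and the norm estimates show
  that its closure is a function with the compact operators as kernel and with closed range.
  Property A enters through square roots of the coordinates of the map into the simplex: their
  squares add up to one, so the squared norms of the pieces of a vector add up to its squared norm,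
  and their slow variation makes commutators with finite propagation operators small.\<close>

lemma cinner_right_eqI:
  fixes a b :: "'h::complex_hilbert"
  assumes "\<And>x. cinner x a = cinner x b"
  shows "a = b"
  by (metis Re_cinner assms vector_eq_ldot)

lemma clinear_op_simps [simp]:
  "clinear_op 0" "clinear_op id_blinfun"
  "clinear_op T \<Longrightarrow> clinear_op S \<Longrightarrow> clinear_op (T + S)"
  "clinear_op T \<Longrightarrow> clinear_op S \<Longrightarrow> clinear_op (T - S)"
  "clinear_op T \<Longrightarrow> clinear_op (- T)"
  "clinear_op T \<Longrightarrow> clinear_op (r *\<^sub>R T)"
  by (auto simp: clinear_op_def scaleC_zero scaleC_add_right blinfun.bilinear_simps
      linear_diff[OF bounded_linear.linear[OF bounded_linear_scaleC]]
      linear_neg[OF bounded_linear.linear[OF bounded_linear_scaleC]]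
      simp flip: scaleC_of_real simp add: scaleC_scaleC mult.commute)

lemma clinear_op_comp [simp]: "clinear_op S \<Longrightarrow> clinear_op T \<Longrightarrow> clinear_op (S o\<^sub>L T)"
  by (simp add: clinear_op_def)

lemma clinear_op_scale [simp]: "clinear_op T \<Longrightarrow> clinear_op (scale_op c T)"
  by (simp add: clinear_op_def scale_op_apply scaleC_scaleC mult.commute)

lemma clinear_op_sum: "(\<And>i. i \<in> I \<Longrightarrow> clinear_op (f i)) \<Longrightarrow> clinear_op (\<Sum>i\<in>I. f i)"
  by (induction I rule: infinite_finite_induct) auto

lemma scale_op_of_real: "scale_op (complex_of_real r) T = r *\<^sub>R T"
  by (rule blinfun_eqI) (simp add: scale_op_apply scaleC_of_real blinfun.bilinear_simps)

lemma inner_adj_op: "clinear_op T \<Longrightarrow> inner (T x) y = inner x (adj_op T y)"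
  by (metis Re_cinner adj_op)

lemma clinear_adj_op [simp]:
  assumes "clinear_op T"
  shows "clinear_op (adj_op T)"
proof -
  have "cinner x (adj_op T (c *\<^sub>C y)) = cinner x (c *\<^sub>C adj_op T y)" for c x y
    by (metis adj_op[OF assms] cinner_scaleC_right)
  then show ?thesis
    unfolding clinear_op_def by (metis cinner_right_eqI)
qed

lemma cinner_adj_op: "clinear_op T \<Longrightarrow> cinner (adj_op T x) y = cinner x (T y)"
  by (metis adj_op cinner_commute)

lemma adj_adj_op [simp]: "clinear_op T \<Longrightarrow> adj_op (adj_op T) = T"
  by (rule adj_op_unique) (auto simp: cinner_adj_op)

lemma adj_op_add: "clinear_op S \<Longrightarrow> clinear_op T \<Longrightarrow> adj_op (S + T) = adj_op S + adj_op T"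
  by (rule adj_op_unique) (auto simp: blinfun.bilinear_simps cinner_add_left cinner_add_right adj_op)

lemma adj_op_zero [simp]: "adj_op 0 = 0"
  by (rule adj_op_unique) (auto intro!: complex_eqI simp: Re_cinner Im_cinner scaleC_zero)

lemma adj_op_comp: "clinear_op S \<Longrightarrow> clinear_op T \<Longrightarrow> adj_op (S o\<^sub>L T) = adj_op T o\<^sub>L adj_op S"
  by (rule adj_op_unique) (auto simp: adj_op)

lemma adj_op_scale: "clinear_op T \<Longrightarrow> adj_op (scale_op c T) = scale_op (cnj c) (adj_op T)"
  by (rule adj_op_unique)
    (auto simp: adj_op scale_op_apply cinner_scaleC_left cinner_scaleC_right)

lemma adj_op_sum:
  "(\<And>i. i \<in> I \<Longrightarrow> clinear_op (f i)) \<Longrightarrow> adj_op (\<Sum>i\<in>I. f i) = (\<Sum>i\<in>I. adj_op (f i))"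
  by (induction I rule: infinite_finite_induct) (auto simp: adj_op_add clinear_op_sum)

lemma norm_adj_op_le: "norm (adj_op T) \<le> norm T" if T: "clinear_op T"
proof (rule norm_blinfun_bound)
  fix y
  have "norm (adj_op T y) * norm (adj_op T y) = inner (T (adj_op T y)) y"
    by (simp add: inner_adj_op[OF T] power2_norm_eq_inner flip: power2_eq_square)
  also have "\<dots> \<le> norm (T (adj_op T y)) * norm y" by (rule norm_cauchy_schwarz)
  also have "\<dots> \<le> norm T * norm (adj_op T y) * norm y"
    by (intro mult_right_mono norm_blinfun) auto
  finally show "norm (adj_op T y) \<le> norm T * norm y"
    by (cases "adj_op T y = 0") (auto simp: mult_ac)
qed simp

lemma norm_adj_op: "norm (adj_op T) = norm T" if "clinear_op T"
  using norm_adj_op_le[OF that] norm_adj_op_le[of "adj_op T"] that by simp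

lemma adj_op_diff: "clinear_op S \<Longrightarrow> clinear_op T \<Longrightarrow> adj_op (S - T) = adj_op S - adj_op T"
  using adj_op_add[of "S - T" T] by (simp add: algebra_simps)

lemma norm_adj_op_diff:
  "clinear_op S \<Longrightarrow> clinear_op T \<Longrightarrow> norm (adj_op S - adj_op T) = norm (S - T)"
  by (simp add: norm_adj_op flip: adj_op_diff)

lemma closed_clinear_ops: "closed {T :: 'h::complex_hilbert \<Rightarrow>\<^sub>L 'k::complex_hilbert. clinear_op T}"
proof -
  have "{T :: 'h \<Rightarrow>\<^sub>L 'k. clinear_op T} = (\<Inter>c. \<Inter>x. {T. blinfun_apply T (c *\<^sub>C x) = c *\<^sub>C blinfun_apply T x})"
    by (auto simp: clinear_op_def)
  also have "closed \<dots>"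
    by (intro closed_INT ballI closed_Collect_eq continuous_intros
       bounded_linear.continuous_on[OF bounded_linear_scaleC])
  finally show ?thesis .
qed

subsection \<open>Polynomials in a positive operator\<close>

text \<open>Horner evaluation. Coefficients are complex so that every nonconstant polynomial has a
  root, on which the lower bound for \<open>op_poly q S\<close> relies.\<close>

definition op_poly :: "complex poly \<Rightarrow> ('h::complex_hilbert \<Rightarrow>\<^sub>L 'h) \<Rightarrow> ('h \<Rightarrow>\<^sub>L 'h)" where
  "op_poly p S = fold_coeffs (\<lambda>a R. scale_op a id_blinfun + (S o\<^sub>L R)) p 0"

lemma scale_op_zero [simp]: "scale_op 0 T = 0" "scale_op c 0 = 0"
  by (rule blinfun_eqI; simp add: scale_op_apply scaleC_zero scaleC_of_real[where r=0, simplified])+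

lemma op_poly_0 [simp]: "op_poly 0 S = 0"
  by (simp add: op_poly_def)

lemma op_poly_pCons [simp]: "op_poly (pCons a p) S = scale_op a id_blinfun + (S o\<^sub>L op_poly p S)"
  by (cases "p = 0 \<and> a = 0") (auto simp: op_poly_def)

lemma scale_op_add_left: "scale_op (a + b) T = scale_op a T + scale_op b T"
  by (rule blinfun_eqI) (simp add: scale_op_apply blinfun.bilinear_simps scaleC_add_left)

lemma scale_op_add_right: "scale_op a (S + T) = scale_op a S + scale_op a T"
  by (rule blinfun_eqI) (simp add: scale_op_apply blinfun.bilinear_simps scaleC_add_right)

lemma scale_op_scale_op: "scale_op a (scale_op b T) = scale_op (a * b) T"
  by (rule blinfun_eqI) (simp add: scale_op_apply scaleC_scaleC)

lemma comp_scale_op: "clinear_op S \<Longrightarrow> S o\<^sub>L scale_op a T = scale_op a (S o\<^sub>L T)"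
  by (rule blinfun_eqI) (simp add: scale_op_apply clinear_op_def)

lemma scale_op_comp: "scale_op a S o\<^sub>L T = scale_op a (S o\<^sub>L T)"
  by (rule blinfun_eqI) (simp add: scale_op_apply)

lemma blinfun_comp_simps:
  "(S + S') o\<^sub>L T = (S o\<^sub>L T) + (S' o\<^sub>L T)" "U o\<^sub>L (S + S') = (U o\<^sub>L S) + (U o\<^sub>L S')"
  "(S - S') o\<^sub>L T = (S o\<^sub>L T) - (S' o\<^sub>L T)" "U o\<^sub>L (S - S') = (U o\<^sub>L S) - (U o\<^sub>L S')"
  "0 o\<^sub>L T = 0" "U o\<^sub>L 0 = 0"
  by (rule blinfun_eqI; simp add: blinfun.bilinear_simps)+

lemma blinfun_comp_assoc: "(R o\<^sub>L S) o\<^sub>L T = R o\<^sub>L (S o\<^sub>L T)"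
  by (rule blinfun_eqI) simp

lemma blinfun_comp_id [simp]: "id_blinfun o\<^sub>L T = T" "T o\<^sub>L id_blinfun = T"
  by (rule blinfun_eqI; simp)+

lemma blinfun_comp_sum:
  "(\<Sum>i\<in>I. f i) o\<^sub>L T = (\<Sum>i\<in>I. f i o\<^sub>L T)" "U o\<^sub>L (\<Sum>i\<in>I. f i) = (\<Sum>i\<in>I. U o\<^sub>L f i)"
  by (induction I rule: infinite_finite_induct) (auto simp: blinfun_comp_simps)

lemma op_poly_add: "op_poly (p + q) S = op_poly p S + op_poly q S"
  by (induction p q rule: poly_induct2) (simp_all add: scale_op_add_left blinfun_comp_simps)

lemma op_poly_smult: "clinear_op S \<Longrightarrow> op_poly (Polynomial.smult a p) S = scale_op a (op_poly p S)"
  by (induction p) (simp_all add: scale_op_add_right scale_op_scale_op comp_scale_op)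

lemma op_poly_diff: "clinear_op S \<Longrightarrow> op_poly (p - q) S = op_poly p S - op_poly q S"
  using op_poly_add[of "p - q" q S] by (simp add: algebra_simps)

lemma op_poly_mult: "clinear_op S \<Longrightarrow> op_poly (p * q) S = op_poly p S o\<^sub>L op_poly q S"
  by (induction p)
    (simp_all add: op_poly_add op_poly_smult blinfun_comp_simps scale_op_comp blinfun_comp_assoc)

lemma op_poly_clinear [simp]: "clinear_op S \<Longrightarrow> clinear_op (op_poly p S)"
  by (induction p) auto

definition self_adjoint :: "('h::complex_hilbert \<Rightarrow>\<^sub>L 'h) \<Rightarrow> bool" where
  "self_adjoint S \<longleftrightarrow> clinear_op S \<and> adj_op S = S"

lemma self_adjointD: "self_adjoint S \<Longrightarrow> clinear_op S" "self_adjoint S \<Longrightarrow> adj_op S = S"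
  "self_adjoint S \<Longrightarrow> inner (S x) y = inner x (S y)"
  using inner_adj_op[of S x y] by (auto simp: self_adjoint_def)

lemma scale_op_one [simp]: "scale_op 1 T = T"
  using scale_op_of_real[of 1 T] by simp

lemma op_poly_commute:
  assumes "clinear_op S"
  shows "op_poly p S o\<^sub>L S = S o\<^sub>L op_poly p S"
proof -
  have "op_poly [:0, 1:] S = S"
    by (simp add: blinfun_comp_simps)
  then show ?thesis
    using op_poly_mult[OF assms, of p "[:0,1:]"] op_poly_mult[OF assms, of "[:0,1:]" p]
    by (metis mult.commute)
qed

lemma op_poly_self_adjoint:
  assumes "self_adjoint S" "\<forall>i. coeff p i \<in> \<real>"
  shows "self_adjoint (op_poly p S)"
  using assms(2)
proof (induction p)
  case (pCons a p)
  have S: "clinear_op S" "adj_op S = S" using self_adjointD[OF assms(1)] by auto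
  have p: "\<forall>i. coeff p i \<in> \<real>" using pCons.prems
    by (metis coeff_pCons_Suc)
  have a: "cnj a = a" using pCons.prems by (metis coeff_pCons_0 Reals_cnj_iff)
  have adj1: "adj_op (id_blinfun :: 'a \<Rightarrow>\<^sub>L 'a) = id_blinfun"
    by (rule adj_op_unique) auto
  show ?case
    using pCons.IH[OF p] S a
    by (auto simp: self_adjoint_def adj_op_add adj_op_comp adj_op_scale adj1 op_poly_commute)
qed (auto simp: self_adjoint_def)

lemma norm_diff_sq: "(norm (x - y))\<^sup>2 = (norm x)\<^sup>2 - 2 * inner x y + (norm y)\<^sup>2"
  for x y :: "'a::real_inner"
  by (simp add: power2_norm_eq_inner inner_diff_left inner_diff_right inner_commute)

text \<open>For nonreal \<open>z\<close>, the vector \<open>\<i> *\<^sub>C x\<close> is orthogonal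
  to both \<open>S x\<close> and \<open>x\<close>, so Pythagoras gives the bound
  \<open>\<bar>Im z\<bar>\<close>. For real \<open>z\<close> outside the interval, the numerical
  range of \<open>S\<close> stays away from \<open>z\<close> and Cauchy-Schwarz gives the distance
  to the interval.\<close>

lemma bounded_below_off_spectrum:
  assumes S: "self_adjoint S" "\<And>x. 0 \<le> inner (S x) x" "\<And>x. inner (S x) x \<le> M * (norm x)\<^sup>2"
    and z: "z \<notin> of_real ` {0..M}"
  shows "\<exists>\<delta>>0. \<forall>x. \<delta> * norm x \<le> norm (S x - z *\<^sub>C x)"
proof -
  define \<alpha> \<beta> where "\<alpha> = Re z" and "\<beta> = Im z"
  have zx: "z *\<^sub>C x = \<alpha> *\<^sub>R x + \<beta> *\<^sub>R (\<i> *\<^sub>C x)" for x :: 'a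
    using complex_eq[of z]
    by (metis \<alpha>_def \<beta>_def mult.commute scaleC_add_left scaleC_of_real scaleC_scaleC)
  \<comment> \<open>Two evaluations of this inner product, one using self-adjointness, give the
    imaginary part of \<open>cinner (S x) x\<close> with opposite signs.\<close>
  have S0: "inner (S x) (\<i> *\<^sub>C x) = 0" for x
  proof -
    have "inner (S x) (\<i> *\<^sub>C x) = inner x (\<i> *\<^sub>C S x)"
      using self_adjointD[OF S(1)] by (simp add: clinear_op_def)
    also have "\<dots> = inner (\<i> *\<^sub>C S x) x" by (rule inner_commute)
    also have "\<dots> = Im (cinner (S x) x)" by (simp add: Im_cinner)
    finally have 1: "inner (S x) (\<i> *\<^sub>C x) = Im (cinner (S x) x)" .
    have "inner (S x) (\<i> *\<^sub>C x) = Re (\<i> * cinner (S x) x)"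
      by (simp flip: Re_cinner add: cinner_scaleC_right)
    then show ?thesis using 1 by simp
  qed
  have x0: "inner x (\<i> *\<^sub>C x) = 0" for x :: 'a
  proof -
    have "inner x (\<i> *\<^sub>C x) = Re (\<i> * cinner x x)"
      by (simp flip: Re_cinner add: cinner_scaleC_right)
    moreover have "inner (\<i> *\<^sub>C x) x = Re (- \<i> * cinner x x)"
      by (simp flip: Re_cinner add: cinner_scaleC_left)
    ultimately show ?thesis using inner_commute[of x "\<i> *\<^sub>C x"] by simp
  qed
  show ?thesis
  proof (cases "\<beta> = 0")
    case False
    have "\<bar>\<beta>\<bar> * norm x \<le> norm (S x - z *\<^sub>C x)" for x
    proof (rule power2_le_imp_le)
      have "(norm (S x - z *\<^sub>C x))\<^sup>2 = (norm ((S x - \<alpha> *\<^sub>R x) - \<beta> *\<^sub>R (\<i> *\<^sub>C x)))\<^sup>2"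
        by (simp add: zx algebra_simps)
      also have "\<dots> = (norm (S x - \<alpha> *\<^sub>R x))\<^sup>2 + (\<bar>\<beta>\<bar> * norm x)\<^sup>2"
        by (subst norm_diff_sq) (simp add: inner_diff_left S0 x0 norm_scaleC)
      finally show "(\<bar>\<beta>\<bar> * norm x)\<^sup>2 \<le> (norm (S x - z *\<^sub>C x))\<^sup>2" by simp
    qed simp
    then show ?thesis using False by (intro exI[of _ "\<bar>\<beta>\<bar>"]) auto
  next
    case True
    then have z': "z = of_real \<alpha>" by (simp add: \<alpha>_def \<beta>_def complex_eq_iff)
    then have sx: "S x - z *\<^sub>C x = S x - \<alpha> *\<^sub>R x" for x by (simp add: scaleC_of_real)
    have \<alpha>: "\<alpha> < 0 \<or> \<alpha> > M" using z z' by force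
    define \<delta> where "\<delta> = (if \<alpha> < 0 then - \<alpha> else \<alpha> - M)"
    have "\<delta> * norm x \<le> norm (S x - z *\<^sub>C x)" for x
    proof (cases "x = 0")
      case False
      have "\<bar>inner (S x - \<alpha> *\<^sub>R x) x\<bar> \<ge> \<delta> * (norm x)\<^sup>2"
        using S(2)[of x] S(3)[of x] \<alpha>
        by (auto simp: \<delta>_def inner_diff_left power2_norm_eq_inner algebra_simps)
      also have "\<bar>inner (S x - \<alpha> *\<^sub>R x) x\<bar> \<le> norm (S x - \<alpha> *\<^sub>R x) * norm x"
        by (rule Cauchy_Schwarz_ineq2)
      finally show ?thesis using False by (simp add: sx power2_eq_square)
    qed simp
    moreover have "\<delta> > 0" using \<alpha> by (auto simp: \<delta>_def)
    ultimately show ?thesis by (intro exI[of _ \<delta>]) simp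
  qed
qed

text \<open>Splitting off one root at a time writes \<open>op_poly q S\<close> as a product of
  factors \<open>S - z\<close> with \<open>z\<close> outside \<open>[0, M]\<close>, each of which is
  bounded below. This takes the place of spectral mapping.\<close>

lemma op_poly_bounded_below:
  assumes S: "self_adjoint S" "\<And>x. 0 \<le> inner (S x) x" "\<And>x. inner (S x) x \<le> M * (norm x)\<^sup>2"
    and "M \<ge> 0" and "\<forall>t\<in>{0..M}. poly q (of_real t) \<noteq> 0"
  shows "\<exists>\<delta>>0. \<forall>x. \<delta> * norm x \<le> norm (op_poly q S x)"
  using assms(5)
proof (induction "degree q" arbitrary: q)
  case 0
  then obtain a where q: "q = [:a:]" by (metis degree_eq_zeroE)
  then have "a \<noteq> 0" using 0(2) \<open>M \<ge> 0\<close> by force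
  then show ?case
    by (intro exI[of _ "cmod a"]) (simp add: q scale_op_apply blinfun_comp_simps norm_scaleC)
next
  case (Suc n)
  then have "\<not> constant (poly q)" by (simp add: constant_degree)
  then obtain z where z: "poly q z = 0" using fundamental_theorem_of_algebra by blast
  then obtain q' where q: "q = [:- z, 1:] * q'" by (metis poly_eq_0_iff_dvd dvdE)
  have "q' \<noteq> 0" using Suc(2) q by auto
  then have "degree q' = n" using Suc(2) q by (simp add: degree_mult_eq del: mult_pCons_left)
  moreover have "\<forall>t\<in>{0..M}. poly q' (of_real t) \<noteq> 0"
    using Suc(3) q by auto
  ultimately obtain \<delta>' where \<delta>': "\<delta>' > 0" "\<And>x. \<delta>' * norm x \<le> norm (op_poly q' S x)"
    using Suc(1) by blast
  have "z \<notin> of_real ` {0..M}" using Suc(3) z by auto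
  from bounded_below_off_spectrum[OF S this] obtain \<delta> where
    \<delta>: "\<delta> > 0" "\<And>x. \<delta> * norm x \<le> norm (S x - z *\<^sub>C x)" by blast
  have "op_poly q S x = S (op_poly q' S x) - z *\<^sub>C (op_poly q' S x)" for x
    unfolding q op_poly_mult[OF self_adjointD(1)[OF S(1)]]
    using scaleC_add_left[of z "- z" "op_poly q' S x"] scaleC_of_real[of 0 "op_poly q' S x"]
    by (simp add: blinfun.bilinear_simps scale_op_apply eq_neg_iff_add_eq_0 algebra_simps)
  then have "\<delta> * norm (op_poly q' S x) \<le> norm (op_poly q S x)" for x
    using \<delta>(2)[of "op_poly q' S x"] by simp
  moreover have "\<delta> * \<delta>' * norm x \<le> \<delta> * norm (op_poly q' S x)" for x
    using mult_left_mono[OF \<delta>'(2)[of x], of \<delta>] \<delta>(1) by (simp add: mult.assoc)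
  ultimately have "\<delta> * \<delta>' * norm x \<le> norm (op_poly q S x)" for x
    by (meson order_trans)
  then show ?case using \<delta>(1) \<delta>'(1) by (intro exI[of _ "\<delta> * \<delta>'"]) auto
qed

text \<open>If \<open>\<rho> = norm (p(S))\<close> exceeded \<open>m\<close>, then \<open>\<rho>\<^sup>2 - p\<^sup>2\<close> would have no root in \<open>[0, M]\<close>, so
  \<open>\<rho>\<^sup>2 - p(S)\<^sup>2\<close> would be bounded below, contradicting the choice of \<open>\<rho>\<close>.\<close>

lemma norm_op_poly_le:
  assumes S: "self_adjoint S" "\<And>x. 0 \<le> inner (S x) x" "\<And>x. inner (S x) x \<le> M * (norm x)\<^sup>2"
    and "M \<ge> 0" and p: "\<forall>i. coeff p i \<in> \<real>"
    and m: "\<And>t. t \<in> {0..M} \<Longrightarrow> cmod (poly p (of_real t)) \<le> m"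
  shows "norm (op_poly p S) \<le> m"
proof (rule ccontr)
  define R \<rho> where "R = op_poly p S" and "\<rho> = norm R"
  assume "\<not> norm (op_poly p S) \<le> m"
  then have \<rho>: "\<rho> > m" by (simp add: R_def \<rho>_def)
  have "m \<ge> 0" using m[of 0] \<open>M \<ge> 0\<close> by (smt (verit) norm_ge_zero atLeastAtMost_iff)
  with \<rho> have \<rho>0: "\<rho> > 0" by simp
  have R: "self_adjoint R" unfolding R_def by (rule op_poly_self_adjoint[OF S(1) p])
  define q where "q = [:complex_of_real (\<rho>\<^sup>2):] - p * p"
  have "\<forall>t\<in>{0..M}. poly q (of_real t) \<noteq> 0"
  proof
    fix t assume t: "t \<in> {0..M}"
    have "cmod (poly p (of_real t)) < \<rho>" using m[OF t] \<rho> by simp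
    then have "cmod (poly p (of_real t) * poly p (of_real t)) < \<rho> * \<rho>"
      unfolding norm_mult by (intro mult_strict_mono') auto
    moreover have "cmod (of_real (\<rho>\<^sup>2)) = \<rho> * \<rho>"
      using \<rho>0 unfolding norm_of_real by (simp add: power2_eq_square)
    ultimately have "poly p (of_real t) * poly p (of_real t) \<noteq> of_real (\<rho>\<^sup>2)"
      by (intro notI) (simp del: of_real_power)
    then show "poly q (of_real t) \<noteq> 0" by (simp add: q_def)
  qed
  from op_poly_bounded_below[OF S \<open>M \<ge> 0\<close> this] obtain \<delta> where
    \<delta>: "\<delta> > 0" "\<And>x. \<delta> * norm x \<le> norm (op_poly q S x)" by blast
  have q: "op_poly q S x = \<rho>\<^sup>2 *\<^sub>R x - R (R x)" for x
    unfolding q_def op_poly_diff[OF self_adjointD(1)[OF S(1)]] op_poly_mult[OF self_adjointD(1)[OF S(1)]]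
    by (simp add: R_def blinfun.bilinear_simps scale_op_apply scaleC_of_real del: of_real_power)
  \<comment> \<open>Square the lower bound for \<open>op_poly q S\<close>, expand, and use
    \<open>norm (R (R x)) \<le> \<rho> * norm (R x)\<close>. The terms collapse into a bound for
    \<open>norm R\<close> strictly smaller than \<open>\<rho>\<close>.\<close>
  have est: "(norm (R x))\<^sup>2 \<le> (\<rho>\<^sup>2 - \<delta>\<^sup>2 / \<rho>\<^sup>2) * (norm x)\<^sup>2" for x
  proof -
    have "(\<delta> * norm x)\<^sup>2 \<le> (norm (op_poly q S x))\<^sup>2"
      using \<delta> by (intro power_mono) auto
    also have "\<dots> = \<rho>^4 * (norm x)\<^sup>2 - 2 * \<rho>\<^sup>2 * (norm (R x))\<^sup>2 + (norm (R (R x)))\<^sup>2"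
      unfolding q norm_diff_sq
      using self_adjointD(3)[OF R, of x "R x"]
      by (simp add: power_mult_distrib power2_norm_eq_inner flip: power_mult)
    also have "\<dots> \<le> \<rho>^4 * (norm x)\<^sup>2 - 2 * \<rho>\<^sup>2 * (norm (R x))\<^sup>2 + (\<rho> * norm (R x))\<^sup>2"
      using norm_blinfun[of R "R x"] by (simp add: \<rho>_def)
    finally have "(\<delta> * norm x)\<^sup>2 \<le> (\<rho>\<^sup>2 * (norm x)\<^sup>2 - (norm (R x))\<^sup>2) * \<rho>\<^sup>2"
      by (simp add: power_mult_distrib algebra_simps flip: power_add)
    then have "(\<delta> * norm x)\<^sup>2 / \<rho>\<^sup>2 \<le> \<rho>\<^sup>2 * (norm x)\<^sup>2 - (norm (R x))\<^sup>2"
      using \<rho>0 by (simp add: pos_divide_le_eq)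
    then show ?thesis by (simp add: power_mult_distrib algebra_simps)
  qed
  \<comment> \<open>The maximum keeps the bound nonnegative even if the bracket is negative.\<close>
  define \<mu> where "\<mu> = max 0 (\<rho>\<^sup>2 - \<delta>\<^sup>2 / \<rho>\<^sup>2)"
  have "norm R \<le> sqrt \<mu>"
  proof (rule norm_blinfun_bound)
    fix x
    have "(norm (R x))\<^sup>2 \<le> \<mu> * (norm x)\<^sup>2"
      using est[of x] by (rule order_trans) (auto simp: \<mu>_def intro!: mult_right_mono)
    then show "norm (R x) \<le> sqrt \<mu> * norm x"
      by - (rule power2_le_imp_le, auto simp: power_mult_distrib \<mu>_def)
  qed (simp add: \<mu>_def)
  moreover have "sqrt \<mu> < \<rho>"
    using \<rho>0 \<delta>(1) by (intro real_less_lsqrt) (auto simp: \<mu>_def)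
  ultimately show False by (simp add: \<rho>_def)
qed

section \<open>Homomorphisms of operator algebras\<close>

text \<open>Makes spaces of bounded operators complete, as required by the fixed point argument and
  by the limits of Cauchy sequences of operators below.\<close>

instance complex_hilbert \<subseteq> banach ..

lemma tendsto_adj_op:
  fixes X :: "nat \<Rightarrow> 'a::complex_hilbert \<Rightarrow>\<^sub>L 'a"
  assumes "X \<longlonglongrightarrow> l" "\<And>n. clinear_op (X n)" "clinear_op l"
  shows "(\<lambda>n. adj_op (X n)) \<longlonglongrightarrow> adj_op l"
  using assms by (simp add: LIMSEQ_iff norm_adj_op_diff)

text \<open>Concrete C*-algebras, possibly without unit. The missing unit is why functional calculus
  below is restricted to functions that vanish at zero.\<close>

locale op_star_algebra =
  fixes D :: "('a::complex_hilbert \<Rightarrow>\<^sub>L 'a) set"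
  assumes clinear: "T \<in> D \<Longrightarrow> clinear_op T"
    and zero: "0 \<in> D"
    and add: "S \<in> D \<Longrightarrow> T \<in> D \<Longrightarrow> S + T \<in> D"
    and scale: "T \<in> D \<Longrightarrow> scale_op c T \<in> D"
    and comp: "S \<in> D \<Longrightarrow> T \<in> D \<Longrightarrow> S o\<^sub>L T \<in> D"
    and adj: "T \<in> D \<Longrightarrow> adj_op T \<in> D"
    and closed: "closed D"
begin

lemma scaleR: "T \<in> D \<Longrightarrow> r *\<^sub>R T \<in> D"
  using scale[of T "of_real r"] by (simp add: scale_op_of_real)

lemma diff: "S \<in> D \<Longrightarrow> T \<in> D \<Longrightarrow> S - T \<in> D"
  using add[of S "(-1) *\<^sub>R T"] scaleR[of T "-1"] by simp

end

locale op_star_hom = op_star_algebra D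
  for D :: "('a::complex_hilbert \<Rightarrow>\<^sub>L 'a) set" +
  fixes \<theta> :: "('a \<Rightarrow>\<^sub>L 'a) \<Rightarrow> ('b::complex_hilbert \<Rightarrow>\<^sub>L 'b)"
  assumes hom: "star_hom (op_algebra D) (op_algebra {T. clinear_op T}) \<theta>"
begin

lemma hom_simps:
  "T \<in> D \<Longrightarrow> clinear_op (\<theta> T)"
  "S \<in> D \<Longrightarrow> T \<in> D \<Longrightarrow> \<theta> (S + T) = \<theta> S + \<theta> T"
  "T \<in> D \<Longrightarrow> \<theta> (scale_op c T) = scale_op c (\<theta> T)"
  "S \<in> D \<Longrightarrow> T \<in> D \<Longrightarrow> \<theta> (S o\<^sub>L T) = \<theta> S o\<^sub>L \<theta> T"
  "T \<in> D \<Longrightarrow> \<theta> (adj_op T) = adj_op (\<theta> T)"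
  using hom by (auto simp: star_hom_def op_algebra_def)

lemma hom_scaleR: "T \<in> D \<Longrightarrow> \<theta> (r *\<^sub>R T) = r *\<^sub>R \<theta> T"
  using hom_simps(3)[of T "of_real r"] by (simp add: scale_op_of_real)

lemma hom_zero: "\<theta> 0 = 0"
  using hom_scaleR[OF zero, of 0] by simp

lemma hom_diff: "S \<in> D \<Longrightarrow> T \<in> D \<Longrightarrow> \<theta> (S - T) = \<theta> S - \<theta> T"
  using hom_simps(2)[of S "(-1) *\<^sub>R T"] hom_scaleR[of T "-1"] scaleR[of T "-1"] by simp

text \<open>For \<open>c = a\<^sup>*a\<close> with \<open>norm c < 1\<close>, a self-adjoint solution \<open>b\<close> of \<open>(1 - b)\<^sup>2 = 1 - c\<close> exists in
  \<open>D\<close> as the fixed point of \<open>b \<mapsto> (c + b\<^sup>2)/2\<close>; its image shows \<open>\<theta> c \<le> 1\<close>.\<close>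

lemma norm_hom_le_1:
  assumes a: "a \<in> D" "norm a < 1"
  shows "norm (\<theta> a) \<le> 1"
proof -
  define c where "c = adj_op a o\<^sub>L a"
  have c: "c \<in> D" "adj_op c = c"
    using a clinear[OF a(1)] by (auto simp: c_def comp adj adj_op_comp)
  define r where "r = (norm a)\<^sup>2"
  have r: "0 \<le> r" "r < 1" using a(2) by (auto simp: r_def power_less_one_iff)
  have nc: "norm c \<le> r"
    using norm_blinfun_compose[of "adj_op a" a] clinear[OF a(1)]
    by (simp add: c_def r_def norm_adj_op power2_eq_square)
  \<comment> \<open>The smaller root of \<open>s = (r + s\<^sup>2) / 2\<close>: the ball of radius
    \<open>s\<close> is then mapped into itself by \<open>f\<close>, and \<open>s < 1\<close> is a
    contraction constant on it.\<close>
  define s where "s = 1 - sqrt (1 - r)"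
  have s: "0 \<le> s" "s < 1" "(r + s\<^sup>2) / 2 = s"
    using r by (auto simp: s_def power2_eq_square field_simps)
  define B where "B = {b \<in> D. adj_op b = b \<and> norm b \<le> s}"
  define f where "f b = (1/2) *\<^sub>R (c + (b o\<^sub>L b))" for b :: "'a \<Rightarrow>\<^sub>L 'a"
  have Bf: "f b \<in> B" if "b \<in> B" for b
  proof -
    have b: "b \<in> D" "adj_op b = b" "norm b \<le> s" using that by (auto simp: B_def)
    have "adj_op (f b) = f b"
      using b c clinear[OF b(1)] clinear[OF c(1)]
      by (simp add: f_def adj_op_scale adj_op_add adj_op_comp flip: scale_op_of_real)
    moreover have "norm (f b) \<le> (r + s\<^sup>2) / 2"
    proof -
      have "norm (c + (b o\<^sub>L b)) \<le> norm c + norm (b o\<^sub>L b)" by (rule norm_triangle_ineq)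
      also have "norm (b o\<^sub>L b) \<le> norm b * norm b" by (rule norm_blinfun_compose)
      also have "\<dots> \<le> s\<^sup>2" using b(3) s(1) by (simp add: power2_eq_square mult_mono)
      finally show ?thesis using nc by (simp add: f_def)
    qed
    ultimately show ?thesis
      using b c s by (auto simp: B_def f_def intro!: scaleR add comp)
  qed
  have "closed B"
    unfolding closed_sequential_limits
  proof (intro allI impI, elim conjE)
    fix X l assume X: "\<forall>n. X n \<in> B" "X \<longlonglongrightarrow> l"
    have l: "l \<in> D" using closed_sequentially[OF closed _ X(2)] X(1) by (auto simp: B_def)
    have "(\<lambda>n. adj_op (X n)) \<longlonglongrightarrow> adj_op l"
      using X l by (intro tendsto_adj_op) (auto simp: clinear B_def)
    moreover have "(\<lambda>n. adj_op (X n)) = X" using X(1) by (auto simp: B_def)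
    ultimately have "adj_op l = l" using X(2) LIMSEQ_unique by metis
    moreover have "norm l \<le> s"
      by (rule LIMSEQ_le_const2[OF tendsto_norm[OF X(2)]]) (use X(1) in \<open>auto simp: B_def\<close>)
    ultimately show "l \<in> B" using l by (auto simp: B_def)
  qed
  then have "complete B" by (simp add: complete_eq_closed)
  moreover have "0 \<in> B" using s zero by (auto simp: B_def)
  moreover have "dist (f b) (f b') \<le> s * dist b b'" if "b \<in> B" "b' \<in> B" for b b'
  proof -
    have "f b - f b' = (1/2) *\<^sub>R ((b o\<^sub>L (b - b')) + ((b - b') o\<^sub>L b'))"
      by (simp add: f_def blinfun_comp_simps algebra_simps)
    then have "norm (f b - f b') = (1/2) * norm ((b o\<^sub>L (b - b')) + ((b - b') o\<^sub>L b'))"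
      by simp
    also have "\<dots> \<le> (1/2) * (norm b * norm (b - b') + norm (b - b') * norm b')"
      by (intro mult_left_mono order_trans[OF norm_triangle_ineq] add_mono norm_blinfun_compose) auto
    also have "\<dots> \<le> (1/2) * (s * norm (b - b') + norm (b - b') * s)"
      using that by (intro mult_left_mono add_mono mult_right_mono) (auto simp: B_def)
    finally show ?thesis by (simp add: dist_norm)
  qed
  ultimately obtain b where b: "b \<in> B" "f b = b"
    using Banach_fix[of B s f] s Bf by blast
  define \<beta> where "\<beta> = \<theta> b"
  have bD: "b \<in> D" "adj_op b = b" using b by (auto simp: B_def)
  have "2 *\<^sub>R b = c + (b o\<^sub>L b)" using arg_cong[OF b(2), of "\<lambda>x. 2 *\<^sub>R x"] by (simp add: f_def)
  then have "2 *\<^sub>R \<beta> = \<theta> c + (\<beta> o\<^sub>L \<beta>)"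
    using bD c by (metis \<beta>_def hom_scaleR hom_simps(2,4) comp)
  moreover have "\<theta> c = adj_op (\<theta> a) o\<^sub>L \<theta> a"
    using a by (simp add: c_def hom_simps adj)
  ultimately have eq: "adj_op (\<theta> a) (\<theta> a x) = 2 *\<^sub>R \<beta> x - \<beta> (\<beta> x)" for x
    by (metis (no_types) add_diff_cancel_right' blinfun.diff_left blinfun.scaleR_left
        blinfun_apply_blinfun_compose)
  have \<beta>: "clinear_op \<beta>" "adj_op \<beta> = \<beta>"
    using hom_simps(1,5)[OF bD(1)] bD by (auto simp: \<beta>_def)
  show ?thesis
  proof (rule norm_blinfun_bound)
    fix x
    have "(norm (\<theta> a x))\<^sup>2 = inner x (adj_op (\<theta> a) (\<theta> a x))"
      by (simp add: power2_norm_eq_inner inner_adj_op[OF hom_simps(1)[OF a(1)]])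
    also have "\<dots> = 2 * inner x (\<beta> x) - (norm (\<beta> x))\<^sup>2"
      using inner_adj_op[OF \<beta>(1), of x "\<beta> x"]
      by (simp add: eq inner_diff_right power2_norm_eq_inner \<beta>(2))
    \<comment> \<open>Completing the square in
      \<open>\<theta> c = 2 \<beta> - \<beta>\<^sup>2\<close> leaves only a nonpositive correction
      to the squared norm of \<open>x\<close>.\<close>
    also have "\<dots> = (norm x)\<^sup>2 - (norm (x - \<beta> x))\<^sup>2" by (simp add: norm_diff_sq)
    also have "\<dots> \<le> (norm x)\<^sup>2" by simp
    finally show "norm (\<theta> a x) \<le> 1 * norm x" by simp
  qed simp
qed

lemma norm_hom_le:
  assumes a: "a \<in> D"
  shows "norm (\<theta> a) \<le> norm a"
proof (rule dense_ge)
  fix t assume t: "norm a < t"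
  then have "t > 0" by (smt (verit) norm_ge_zero)
  then have "norm ((1/t) *\<^sub>R a) < 1" using t by simp
  from norm_hom_le_1[OF scaleR[OF a] this] have "norm (\<theta> a) / t \<le> 1"
    using \<open>t > 0\<close> by (simp add: hom_scaleR[OF a])
  then show "norm (\<theta> a) \<le> t" using \<open>t > 0\<close> by simp
qed

lemma tendsto_hom:
  assumes "X \<longlonglongrightarrow> l" "\<And>n. X n \<in> D" "l \<in> D"
  shows "(\<lambda>n. \<theta> (X n)) \<longlonglongrightarrow> \<theta> l"
proof -
  have "(\<lambda>n. norm (X n - l)) \<longlonglongrightarrow> 0" using assms(1) by (simp add: LIM_zero tendsto_norm_zero)
  then have "(\<lambda>n. \<theta> (X n) - \<theta> l) \<longlonglongrightarrow> 0"
    by (rule Lim_null_comparison[rotated])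
      (use assms norm_hom_le[OF diff] in \<open>auto simp flip: hom_diff\<close>)
  then show ?thesis by (simp add: LIM_zero_iff)
qed

text \<open>The leading factor \<open>c\<close> keeps the expression inside \<open>D\<close>, where
  \<open>op_poly q c\<close> alone may fail to lie for want of a unit; so the induction runs over
  \<open>q\<close> with this factor attached.\<close>

lemma op_poly_mem:
  assumes "c \<in> D"
  shows "(c o\<^sub>L op_poly q c) \<in> D \<and> \<theta> (c o\<^sub>L op_poly q c) = \<theta> c o\<^sub>L op_poly q (\<theta> c)"
proof (induction q)
  case (pCons a q)
  have "c o\<^sub>L op_poly (pCons a q) c = scale_op a c + (c o\<^sub>L (c o\<^sub>L op_poly q c))"
    using clinear[OF assms] by (simp add: blinfun_comp_simps comp_scale_op)
  moreover have "\<theta> c o\<^sub>L op_poly (pCons a q) (\<theta> c)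
      = scale_op a (\<theta> c) + (\<theta> c o\<^sub>L (\<theta> c o\<^sub>L op_poly q (\<theta> c)))"
    using hom_simps(1)[OF assms] by (simp add: blinfun_comp_simps comp_scale_op)
  ultimately show ?case
    using pCons.IH assms by (auto simp: hom_simps scale comp intro!: add)
qed (use zero hom_zero in \<open>auto simp: blinfun_comp_simps\<close>)

lemma op_poly_hom:
  assumes "c \<in> D" "coeff p 0 = 0"
  shows "op_poly p c \<in> D" "\<theta> (op_poly p c) = op_poly p (\<theta> c)"
proof -
  obtain a q where p: "p = pCons a q" by (cases p)
  then have "a = 0" using assms(2) by simp
  then show "op_poly p c \<in> D" "\<theta> (op_poly p c) = op_poly p (\<theta> c)"
    using op_poly_mem[OF assms(1), of q] p by auto
qed

end

text \<open>A Stone-Weierstrass polynomial within \<open>e/2\<close> of \<open>f\<close> has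
  constant term below \<open>e/2\<close>, since \<open>f 0 = 0\<close>; dropping that term costs the
  other \<open>e/2\<close>.\<close>

lemma polynomial_approximation:
  fixes f :: "real \<Rightarrow> real"
  assumes "continuous_on {0..M} f" "M \<ge> 0" "f 0 = 0" "e > 0"
  shows "\<exists>p :: complex poly. coeff p 0 = 0 \<and> (\<forall>i. coeff p i \<in> \<real>)
    \<and> (\<forall>t\<in>{0..M}. cmod (poly p (of_real t) - of_real (f t)) \<le> e)"
proof -
  obtain g where g: "real_polynomial_function g" "\<And>x. x \<in> {0..M} \<Longrightarrow> \<bar>f x - g x\<bar> < e/2"
    using Stone_Weierstrass_real_polynomial_function[OF compact_Icc assms(1), of "e/2"] assms(4) by auto
  obtain a n where ag: "g = (\<lambda>x. \<Sum>i\<le>n. a i * x^i)"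
    using g(1) real_polynomial_function_iff_sum by blast
  define p where "p = (\<Sum>i=1..n. monom (complex_of_real (a i)) i)"
  have g0: "g 0 = a 0" using ag by (simp add: power_0_left if_distrib[of "\<lambda>x. _ * x"] sum.delta cong: if_cong)
  have gp: "poly p (of_real t) = of_real (g t - a 0)" for t
  proof -
    have "g t = a 0 + (\<Sum>i=1..n. a i * t^i)"
      unfolding ag atMost_atLeast0 by (subst sum.atLeast_Suc_atMost) auto
    then show ?thesis by (simp add: p_def poly_sum poly_monom)
  qed
  have "cmod (poly p (of_real t) - of_real (f t)) \<le> e" if "t \<in> {0..M}" for t
  proof -
    have "\<bar>a 0\<bar> < e/2" using g(2)[of 0] assms(2,3) g0 by simp
    moreover have "cmod (poly p (of_real t) - of_real (f t)) = \<bar>g t - a 0 - f t\<bar>"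
      unfolding gp of_real_diff[symmetric] norm_of_real ..
    ultimately show ?thesis using g(2)[OF that] by linarith
  qed
  moreover have "coeff p i \<in> \<real>" for i
    unfolding p_def coeff_sum by (intro sum_in_Reals) (auto simp: )
  moreover have "coeff p 0 = 0" unfolding p_def coeff_sum by (rule sum.neutral) auto
  ultimately show ?thesis by blast
qed

text \<open>The quotient norm modulo the kernel is at most the norm of the image.  With \<open>c = a\<^sup>*a\<close> and
  \<open>f t = max 0 (1 - s\<^sup>2/t)\<close>, the element \<open>e = f(c)\<close> is killed by the homomorphism because \<open>f\<close> vanishes
  on \<open>[0, s\<^sup>2]\<close>, and \<open>norm (a - a e) \<le> s\<close> because \<open>t (1 - f t)\<^sup>2 \<le> s\<^sup>2\<close>.\<close>

lemma (in op_star_hom) kernel_approximation: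
  assumes a: "a \<in> D" and s: "norm (\<theta> a) < s"
  shows "\<exists>n\<in>D. \<theta> n = 0 \<and> norm (a - n) \<le> s"
proof (cases "norm a \<le> s")
  case True
  then show ?thesis using zero hom_zero by (intro bexI[of _ 0]) auto
next
  case False
  have s0: "s > 0" using s norm_ge_zero[of "\<theta> a"] by linarith
  define c where "c = adj_op a o\<^sub>L a"
  have c: "c \<in> D" "self_adjoint c"
    using a clinear[OF a] by (auto simp: c_def comp adj adj_op_comp self_adjoint_def)
  have cx: "inner (c x) y = inner (a x) (a y)" for x y
    using inner_adj_op[OF clinear[OF a], of y "a x"] by (simp add: c_def inner_commute)
  define M where "M = (norm a)\<^sup>2"
  have M: "inner (c x) x \<le> M * (norm x)\<^sup>2" for x
    unfolding cx M_def power_mult_distrib[symmetric] power2_norm_eq_inner[symmetric]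
    by (intro power_mono norm_blinfun) auto
  have M0: "M \<ge> 0" by (simp add: M_def)
  have \<theta>c: "\<theta> c = adj_op (\<theta> a) o\<^sub>L \<theta> a"
    using a by (simp add: c_def hom_simps adj)
  have \<theta>c': "self_adjoint (\<theta> c)"
    using hom_simps(1)[OF a] by (simp add: \<theta>c self_adjoint_def adj_op_comp)
  have \<theta>cx: "inner (\<theta> c x) x = (norm (\<theta> a x))\<^sup>2" for x
    using inner_adj_op[OF hom_simps(1)[OF a], of x "\<theta> a x"]
    by (simp add: \<theta>c inner_commute power2_norm_eq_inner)
  have \<theta>M: "inner (\<theta> c x) x \<le> s\<^sup>2 * (norm x)\<^sup>2" for x
    unfolding \<theta>cx power_mult_distrib[symmetric]
    by (intro power_mono order_trans[OF norm_blinfun] mult_right_mono) (use s in auto)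
  \<comment> \<open>In the remaining case \<open>[0, s\<^sup>2]\<close> lies inside
    \<open>[0, M]\<close>, so approximations on \<open>[0, M]\<close> also control polynomials in
    \<open>\<theta> c\<close>, whose quadratic form is bounded by \<open>s\<^sup>2\<close>.\<close>
  have sM: "s\<^sup>2 \<le> M" unfolding M_def using False s0 by (intro power_mono) auto
  \<comment> \<open>The maximum in the denominator gives \<open>0\<close> up to
    \<open>s\<^sup>2\<close> and \<open>1 - s\<^sup>2/t\<close> beyond, in a form that is visibly
    continuous at zero.\<close>
  define f where "f t = 1 - s\<^sup>2 / max (s\<^sup>2) t" for t :: real
  have max0: "max (s\<^sup>2) t > 0" for t using s0 by (simp add: less_max_iff_disj)
  have f_cont: "continuous_on {0..M} f"
    unfolding f_def using max0 by (intro continuous_intros) (auto simp: less_imp_neq[symmetric])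
  have f0: "f t = 0" if "t \<le> s\<^sup>2" for t using that s0 by (simp add: f_def max_def)
  have f1: "0 \<le> 1 - f t" "1 - f t \<le> 1" "t * (1 - f t)\<^sup>2 \<le> s\<^sup>2" if "t \<ge> 0" for t
  proof -
    show "0 \<le> 1 - f t" "1 - f t \<le> 1" using max0[of t] by (auto simp: f_def)
    then have "(1 - f t)\<^sup>2 \<le> 1 - f t" by (simp add: power2_eq_square mult_left_le)
    then have "t * (1 - f t)\<^sup>2 \<le> t * (1 - f t)" using that by (rule mult_left_mono)
    also have "\<dots> \<le> s\<^sup>2" using max0[of t] s0 by (auto simp: f_def field_simps max_def)
    finally show "t * (1 - f t)\<^sup>2 \<le> s\<^sup>2" .
  qed
  have "\<exists>p :: complex poly. coeff p 0 = 0 \<and> (\<forall>i. coeff p i \<in> \<real>)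
    \<and> (\<forall>t\<in>{0..M}. cmod (poly p (of_real t) - of_real (f t)) \<le> 1 / real (Suc n))" for n
    using polynomial_approximation[OF f_cont M0 f0] s0 by simp
  then obtain p :: "nat \<Rightarrow> complex poly" where p: "\<And>n. coeff (p n) 0 = 0" "\<And>n i. coeff (p n) i \<in> \<real>"
    "\<And>n t. t \<in> {0..M} \<Longrightarrow> cmod (poly (p n) (of_real t) - of_real (f t)) \<le> 1 / real (Suc n)"
    by metis
  \<comment> \<open>Polynomials without constant term, converging to the functional calculus
    \<open>f(c)\<close>. By \<open>norm_op_poly_le\<close> they form a Cauchy sequence, so
    \<open>f(c)\<close> is obtained as a limit inside \<open>D\<close>.\<close>
  define e where "e n = op_poly (p n) c" for n
  have eD: "e n \<in> D" "\<theta> (e n) = op_poly (p n) (\<theta> c)" for n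
    using op_poly_hom[OF c(1) p(1)] by (auto simp: e_def)
  note lin = self_adjointD(1)[OF c(2)]
  have c0: "0 \<le> inner (c x) x" for x by (simp add: cx)
  have e_diff: "norm (e m - e n) \<le> 1 / real (Suc m) + 1 / real (Suc n)" for m n
    unfolding e_def op_poly_diff[OF lin, symmetric]
  proof (rule norm_op_poly_le[OF c(2) c0 M M0])
    fix t assume t: "t \<in> {0..M}"
    have "cmod (poly (p m - p n) (of_real t))
        = cmod ((poly (p m) (of_real t) - of_real (f t)) - (poly (p n) (of_real t) - of_real (f t)))"
      by simp
    also have "\<dots> \<le> 1 / real (Suc m) + 1 / real (Suc n)"
      by (intro order_trans[OF norm_triangle_ineq4] add_mono p(3) t)
    finally show "cmod (poly (p m - p n) (of_real t)) \<le> 1 / real (Suc m) + 1 / real (Suc n)" .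
  qed (use p(2) in auto)
  have lim0: "(\<lambda>n. 1 / real (Suc n)) \<longlonglongrightarrow> 0"
    by (rule LIMSEQ_Suc[OF lim_1_over_n])
  have "Cauchy e"
  proof (rule metric_CauchyI)
    fix \<epsilon> :: real assume "\<epsilon> > 0"
    then have "\<forall>\<^sub>F n in sequentially. 1 / real (Suc n) < \<epsilon> / 2"
      using order_tendstoD(2)[OF lim0, of "\<epsilon>/2"] by simp
    then obtain N where N: "\<And>n. n \<ge> N \<Longrightarrow> 1 / real (Suc n) < \<epsilon> / 2"
      unfolding eventually_sequentially by blast
    have "dist (e m) (e n) < \<epsilon>" if "m \<ge> N" "n \<ge> N" for m n
      using e_diff[of m n] N[OF that(1)] N[OF that(2)] by (simp add: dist_norm)
    then show "\<exists>N. \<forall>m\<ge>N. \<forall>n\<ge>N. dist (e m) (e n) < \<epsilon>" by blast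
  qed
  then obtain l where l: "e \<longlonglongrightarrow> l" using Cauchy_convergent convergent_def by blast
  have lD: "l \<in> D" using closed_sequentially[OF closed _ l] eD by blast
  \<comment> \<open>Only \<open>[0, s\<^sup>2]\<close> matters for \<open>\<theta> c\<close>. There
    \<open>f\<close> vanishes, so the polynomials are uniformly small.\<close>
  have "(\<lambda>n. \<theta> (e n)) \<longlonglongrightarrow> 0"
  proof (rule Lim_null_comparison[OF always_eventually lim0], intro allI)
    fix n
    show "norm (\<theta> (e n)) \<le> 1 / real (Suc n)"
      unfolding eD(2)
      by (rule norm_op_poly_le[OF \<theta>c' _ \<theta>M]) (use p(2) p(3)[of _ n] sM f0 in \<open>force simp: \<theta>cx\<close>)+
  qed
  then have "\<theta> l = 0"
    using tendsto_hom[OF l eD(1) lD] LIMSEQ_unique by blast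
  then have ker: "(a o\<^sub>L l) \<in> D" "\<theta> (a o\<^sub>L l) = 0"
    using a lD by (auto simp: hom_simps comp blinfun_comp_simps)
  \<comment> \<open>Bounds \<open>t (1 - p t)\<^sup>2\<close> on \<open>[0, M]\<close> for a
    polynomial \<open>p\<close> within \<open>1 / Suc n\<close> of \<open>f\<close>: the exact
    \<open>f\<close> contributes \<open>s\<^sup>2\<close>, the error terms the rest.\<close>
  define \<kappa> where "\<kappa> n = s\<^sup>2 + M * (2 * (1 / real (Suc n)) + (1 / real (Suc n))\<^sup>2)" for n
  have "norm (a - (a o\<^sub>L e n)) \<le> sqrt (\<kappa> n)" for n
  proof (rule norm_blinfun_bound)
    fix x
    \<comment> \<open>\<open>q(c) = (1 - e n) c (1 - e n)\<close> is the adjoint of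
      \<open>a - a (e n)\<close> times \<open>a - a (e n)\<close>, so a bound for \<open>q\<close>
      on \<open>[0, M]\<close> bounds the square of the desired norm.\<close>
    define q where "q = [:0, 1:] * (1 - p n) * (1 - p n)"
    define y where "y = x - e n x"
    have e: "self_adjoint (e n)"
      unfolding e_def by (rule op_poly_self_adjoint[OF c(2)]) (simp add: p(2))
    have one: "op_poly 1 c = id_blinfun" by (simp add: one_pCons)
    have X: "op_poly [:0, 1:] c = c" by (simp add: blinfun_comp_simps)
    have "op_poly q c x = c y - c (e n y)"
      unfolding q_def mult.assoc op_poly_mult[OF lin] op_poly_diff[OF lin] one X
      by (simp add: e_def y_def blinfun.bilinear_simps)
    also have "\<dots> = c y - e n (c y)"
      using op_poly_commute[OF lin, of "p n", folded e_def] by (metis blinfun_apply_blinfun_compose)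
    finally have q: "op_poly q c x = c y - e n (c y)" .
    have "norm (op_poly q c) \<le> \<kappa> n"
    proof (rule norm_op_poly_le[OF c(2) c0 M M0])
      fix t assume t: "t \<in> {0..M}"
      define \<eta> where "\<eta> = 1 / real (Suc n)"
      have "cmod (1 - poly (p n) (of_real t)) \<le> cmod (of_real (1 - f t)) + \<eta>"
        using p(3)[OF t, of n] norm_triangle_ineq4[of "of_real (1 - f t)" "poly (p n) (of_real t) - of_real (f t)"]
        by (simp add: \<eta>_def)
      also have "cmod (of_real (1 - f t)) = 1 - f t"
        unfolding norm_of_real using f1(1)[of t] t by simp
      finally have "t * (cmod (1 - poly (p n) (of_real t)))\<^sup>2 \<le> t * (1 - f t + \<eta>)\<^sup>2"
        using t by (intro mult_left_mono power_mono) auto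
      moreover have "cmod (poly q (of_real t)) = t * (cmod (1 - poly (p n) (of_real t)))\<^sup>2"
        using t by (simp add: q_def norm_mult power2_eq_square)
      ultimately have "cmod (poly q (of_real t)) \<le> t * (1 - f t + \<eta>)\<^sup>2" by simp
      also have "\<dots> = t * (1 - f t)\<^sup>2 + t * (2 * (1 - f t) * \<eta> + \<eta>\<^sup>2)"
        by (simp add: power2_eq_square algebra_simps)
      also have "\<dots> \<le> s\<^sup>2 + M * (2 * 1 * \<eta> + \<eta>\<^sup>2)"
        using t f1[of t] by (intro add_mono mult_mono) (auto simp: \<eta>_def)
      finally show "cmod (poly q (of_real t)) \<le> \<kappa> n" by (simp add: \<kappa>_def \<eta>_def)
    next
      show "\<forall>i. coeff q i \<in> \<real>"
        unfolding q_def by (auto simp: coeff_mult coeff_pCons p(2) split: nat.split intro!: sum_in_Reals Reals_mult Reals_diff)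
    qed
    then have "norm (op_poly q c x) \<le> \<kappa> n * norm x"
      by (meson norm_blinfun mult_right_mono norm_ge_zero order_trans)
    then have "\<kappa> n * (norm x)\<^sup>2 \<ge> norm (op_poly q c x) * norm x"
      by (simp add: power2_eq_square mult.assoc[symmetric] mult_right_mono)
    moreover have "(norm ((a - (a o\<^sub>L e n)) x))\<^sup>2 = inner (op_poly q c x) x"
    proof -
      have "(norm ((a - (a o\<^sub>L e n)) x))\<^sup>2 = inner (c y) y"
        unfolding cx power2_norm_eq_inner by (simp add: y_def blinfun.bilinear_simps)
      also have "\<dots> = inner (op_poly q c x) x"
        unfolding q using self_adjointD(3)[OF e, of "c y" x]
        by (simp add: y_def inner_diff_left inner_diff_right)
      finally show ?thesis .
    qed
    ultimately have "(norm ((a - (a o\<^sub>L e n)) x))\<^sup>2 \<le> \<kappa> n * (norm x)\<^sup>2"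
      using norm_cauchy_schwarz[of "op_poly q c x" x] by linarith
    moreover have "\<kappa> n \<ge> 0" using M0 by (simp add: \<kappa>_def)
    ultimately show "norm ((a - (a o\<^sub>L e n)) x) \<le> sqrt (\<kappa> n) * norm x"
      by - (rule power2_le_imp_le, auto simp: power_mult_distrib)
  qed (use M0 in \<open>simp add: \<kappa>_def\<close>)
  moreover have "(\<lambda>n. norm (a - (a o\<^sub>L e n))) \<longlonglongrightarrow> norm (a - (a o\<^sub>L l))"
    by (intro tendsto_intros bounded_bilinear.tendsto[OF bounded_bilinear_blinfun_compose] l)
  moreover have "(\<lambda>n. sqrt (\<kappa> n)) \<longlonglongrightarrow> sqrt (s\<^sup>2 + M * (2 * 0 + 0\<^sup>2))"
    unfolding \<kappa>_def by (intro tendsto_intros lim0)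
  ultimately have "norm (a - (a o\<^sub>L l)) \<le> sqrt (s\<^sup>2 + M * (2 * 0 + 0\<^sup>2))"
    by (intro LIMSEQ_le[of "\<lambda>n. norm (a - (a o\<^sub>L e n))" _ "\<lambda>n. sqrt (\<kappa> n)"]) auto
  then have "norm (a - (a o\<^sub>L l)) \<le> s" using s0 by simp
  then show ?thesis using ker by blast
qed

section \<open>Operators on square summable functions\<close>

lemma l2_single_add: "l2_single i (v + w) = l2_single i v + l2_single i w"
  by (rule l2_eqI) (simp add: l2_fun_single l2_fun_simps)

lemma l2_single_0 [simp]: "l2_single i 0 = 0"
  by (rule l2_eqI) (simp add: l2_fun_single l2_fun_simps)

lemma l2_single_scaleR: "l2_single i (r *\<^sub>R v) = r *\<^sub>R l2_single i v"
  by (rule l2_eqI) (simp add: l2_fun_single l2_fun_simps)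

lemma l2_single_scaleC: "l2_single i (c *\<^sub>C v) = c *\<^sub>C l2_single i v"
  by (rule l2_eqI) (simp add: l2_fun_single l2_fun_scaleC scaleC_zero)

lemma norm_l2_finite:
  fixes \<xi> :: "('i, 'h::complex_hilbert) l2"
  assumes "finite B" "\<And>i. i \<notin> B \<Longrightarrow> l2_fun \<xi> i = 0"
  shows "(norm \<xi>)\<^sup>2 = (\<Sum>i\<in>B. (norm (l2_fun \<xi> i))\<^sup>2)"
proof -
  have "(\<Sum>\<^sub>\<infinity>i. (norm (l2_fun \<xi> i))\<^sup>2) = (\<Sum>\<^sub>\<infinity>i\<in>B. (norm (l2_fun \<xi> i))\<^sup>2)"
    by (rule infsum_cong_neutral) (use assms(2) in auto)
  then show ?thesis using assms(1) by (simp add: norm_l2_square)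
qed

lemma norm_l2_single [simp]: "norm (l2_single i v) = norm v"
proof -
  have "(norm (l2_single i v))\<^sup>2 = (norm v)\<^sup>2"
    by (subst norm_l2_finite[of "{i}"]) (auto simp: l2_fun_single)
  then show ?thesis by (simp add: power2_eq_iff_nonneg)
qed

lemma cinner_l2_single: "cinner (l2_single i v) \<xi> = cinner v (l2_fun \<xi> i)"
proof -
  have "cinner (l2_single i v) \<xi> = (\<Sum>\<^sub>\<infinity>j\<in>{i}. cinner v (l2_fun \<xi> j))"
    unfolding cinner_l2_def by (rule infsum_cong_neutral)
      (auto simp: l2_fun_single cinner_scaleC_left[where c=0, simplified] complex_eq_iff Re_cinner Im_cinner scaleC_zero)
  then show ?thesis by simp
qed

definition ins :: "'i \<Rightarrow> 'h::complex_hilbert \<Rightarrow>\<^sub>L ('i, 'h) l2" where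
  "ins i = Blinfun (l2_single i)"

definition prj :: "'i \<Rightarrow> ('i, 'h::complex_hilbert) l2 \<Rightarrow>\<^sub>L 'h" where
  "prj i = Blinfun (\<lambda>\<xi>. l2_fun \<xi> i)"

lemma ins_apply [simp]: "ins i v = l2_single i v"
  unfolding ins_def
  by (subst bounded_linear_Blinfun_apply)
    (auto intro!: bounded_linear_intro[where K=1] simp: l2_single_add l2_single_scaleR)

lemma prj_apply [simp]: "prj i \<xi> = l2_fun \<xi> i"
  unfolding prj_def
  by (subst bounded_linear_Blinfun_apply)
    (auto intro!: bounded_linear_intro[where K=1] simp: l2_fun_simps norm_l2_fun_le)

lemma clinear_ins [simp]: "clinear_op (ins i)"
  by (simp add: clinear_op_def l2_single_scaleC)

lemma clinear_prj [simp]: "clinear_op (prj i)"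
  by (simp add: clinear_op_def l2_fun_scaleC)

lemma l2_fun_sum: "l2_fun (\<Sum>i\<in>I. f i) x = (\<Sum>i\<in>I. l2_fun (f i) x)"
  by (induction I rule: infinite_finite_induct) (auto simp: l2_fun_simps)

lemma tendsto_l2_fun: "(f \<longlongrightarrow> \<xi>) F \<Longrightarrow> ((\<lambda>n. l2_fun (f n) x) \<longlongrightarrow> l2_fun \<xi> x) F"
  using blinfun.tendsto[OF tendsto_const, of f \<xi> F "prj x"] by simp

definition diag_op :: "('i \<Rightarrow> 'h::complex_hilbert \<Rightarrow>\<^sub>L 'h) \<Rightarrow> (('i, 'h) l2 \<Rightarrow>\<^sub>L ('i, 'h) l2)" where
  "diag_op A = Blinfun (\<lambda>\<xi>. Abs_l2 (\<lambda>i. A i (l2_fun \<xi> i)))"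

lemma
  fixes A :: "'i \<Rightarrow> 'h::complex_hilbert \<Rightarrow>\<^sub>L 'h"
  assumes "\<And>i. norm (A i) \<le> C"
  shows diag_op_apply: "l2_fun (diag_op A \<xi>) i = A i (l2_fun \<xi> i)"
    and norm_diag_op_le: "norm (diag_op A) \<le> C"
proof -
  have C: "C \<ge> 0" using assms norm_ge_zero order_trans by blast
  have A: "(norm (A i v))\<^sup>2 \<le> C\<^sup>2 * (norm v)\<^sup>2" for i v
    unfolding power_mult_distrib[symmetric]
    by (intro power_mono order_trans[OF norm_blinfun] mult_right_mono assms) auto
  have sum: "(\<lambda>i. (norm (A i (l2_fun \<xi> i)))\<^sup>2) summable_on UNIV" for \<xi>
    by (rule summable_on_comparison_test[OF summable_on_cmult_right[OF l2_summable]]) (use A in auto)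
  define P where "P \<xi> = Abs_l2 (\<lambda>i. A i (l2_fun \<xi> i))" for \<xi>
  have P: "l2_fun (P \<xi>) i = A i (l2_fun \<xi> i)" for \<xi> i
    unfolding P_def by (subst Abs_l2_inverse) (use sum in auto)
  have norm: "norm (P \<xi>) \<le> C * norm \<xi>" for \<xi>
  proof (rule power2_le_imp_le)
    have "(norm (P \<xi>))\<^sup>2 \<le> (\<Sum>\<^sub>\<infinity>i. C\<^sup>2 * (norm (l2_fun \<xi> i))\<^sup>2)"
      unfolding norm_l2_square P
      by (rule infsum_mono[OF sum summable_on_cmult_right[OF l2_summable]]) (use A in auto)
    also have "\<dots> = (C * norm \<xi>)\<^sup>2"
      by (simp add: infsum_cmult_right' norm_l2_square power_mult_distrib)
    finally show "(norm (P \<xi>))\<^sup>2 \<le> (C * norm \<xi>)\<^sup>2" .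
  qed (use C in simp)
  have "bounded_linear P"
    by (rule bounded_linear_intro[where K = C])
      (auto intro!: l2_eqI simp: P l2_fun_simps blinfun.bilinear_simps norm mult.commute)
  then have PP: "blinfun_apply (diag_op A) = P"
    by (simp add: diag_op_def P_def[abs_def] bounded_linear_Blinfun_apply)
  show "l2_fun (diag_op A \<xi>) i = A i (l2_fun \<xi> i)" by (simp add: PP P)
  show "norm (diag_op A) \<le> C"
    by (rule norm_blinfun_bound[OF C]) (simp add: PP norm)
qed

lemma clinear_diag_op:
  assumes "\<And>i. norm (A i) \<le> C" "\<And>i. clinear_op (A i)"
  shows "clinear_op (diag_op A)"
  unfolding clinear_op_def using assms(2)
  by (auto intro!: l2_eqI simp: diag_op_apply[OF assms(1)] l2_fun_scaleC clinear_op_def)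

lemma adj_diag_op:
  assumes A: "\<And>i. norm (A i) \<le> C" "\<And>i. clinear_op (A i)"
  shows "adj_op (diag_op A) = diag_op (\<lambda>i. adj_op (A i))"
proof (rule adj_op_unique[OF clinear_diag_op[OF A]])
  have "norm (adj_op (A i)) \<le> C" for i using A by (simp add: norm_adj_op)
  then show "cinner (diag_op A \<xi>) \<eta> = cinner \<xi> (diag_op (\<lambda>i. adj_op (A i)) \<eta>)" for \<xi> \<eta>
    unfolding cinner_l2_def by (simp add: diag_op_apply[OF A(1)] diag_op_apply[where C=C] adj_op[OF A(2)])
qed

definition restr :: "'i set \<Rightarrow> (('i, 'h::complex_hilbert) l2 \<Rightarrow>\<^sub>L ('i, 'h) l2)" where
  "restr B = diag_op (\<lambda>i. if i \<in> B then id_blinfun else 0)"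

lemma l2_fun_restr [simp]: "l2_fun (restr B \<xi>) i = (if i \<in> B then l2_fun \<xi> i else 0)"
  unfolding restr_def by (subst diag_op_apply[where C=1]) (auto simp: norm_blinfun_id_le)

lemma norm_restr_le: "norm (restr B) \<le> 1"
  unfolding restr_def by (rule norm_diag_op_le) (auto simp: norm_blinfun_id_le)

lemma norm_restr_apply_le: "norm (restr B \<xi>) \<le> norm \<xi>"
  by (metis mult_right_mono norm_restr_le norm_blinfun norm_ge_zero mult_1 order_trans)

lemma clinear_restr [simp]: "clinear_op (restr B)"
  unfolding restr_def by (rule clinear_diag_op[where C=1]) (auto simp: norm_blinfun_id_le)

lemma adj_id_blinfun [simp]: "adj_op id_blinfun = id_blinfun"
  by (rule adj_op_unique) auto

lemma adj_restr [simp]: "adj_op (restr B) = restr B"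
  unfolding restr_def by (subst adj_diag_op[where C=1])
    (auto simp: norm_blinfun_id_le if_distrib[of adj_op] cong: if_cong)

lemma restr_restr [simp]: "restr B (restr C \<xi>) = restr (B \<inter> C) \<xi>"
  by (rule l2_eqI) auto

lemma restr_finite_sum:
  assumes "finite B"
  shows "restr B \<xi> = (\<Sum>i\<in>B. l2_single i (l2_fun \<xi> i))"
  by (rule l2_eqI) (use assms in \<open>auto simp: l2_fun_sum l2_fun_single\<close>)

lemma norm_restr_finite:
  assumes "finite B"
  shows "(norm (restr B \<xi>))\<^sup>2 = (\<Sum>i\<in>B. (norm (l2_fun \<xi> i))\<^sup>2)"
  by (subst norm_l2_finite[OF assms]) auto

lemma inner_l2_disjoint:
  assumes "\<And>i. l2_fun \<xi> i = 0 \<or> l2_fun \<eta> i = 0"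
  shows "inner \<xi> \<eta> = 0"
proof -
  have "inner (l2_fun \<xi> i) (l2_fun \<eta> i) = 0" for i using assms[of i] by auto
  then show ?thesis by (simp add: inner_l2_def)
qed

text \<open>A truncation is orthogonal to what it cuts off, so the squared error is a tail of the
  convergent series of squared norms.\<close>

lemma tendsto_restr: "((\<lambda>B. restr B \<xi>) \<longlongrightarrow> \<xi>) (finite_subsets_at_top UNIV)"
proof -
  have eq: "(norm (restr B \<xi> - \<xi>))\<^sup>2 = (norm \<xi>)\<^sup>2 - (\<Sum>i\<in>B. (norm (l2_fun \<xi> i))\<^sup>2)" if "finite B" for B
  proof -
    have "inner (restr B \<xi>) (restr B \<xi> - \<xi>) = 0"
      by (rule inner_l2_disjoint) (auto simp: l2_fun_simps)
    then have "inner (restr B \<xi>) \<xi> = (norm (restr B \<xi>))\<^sup>2"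
      by (simp add: inner_diff_right power2_norm_eq_inner)
    then show ?thesis by (simp add: norm_diff_sq norm_restr_finite[OF that])
  qed
  have "((\<lambda>i. (norm (l2_fun \<xi> i))\<^sup>2) has_sum (norm \<xi>)\<^sup>2) UNIV"
    unfolding norm_l2_square by (rule has_sum_infsum[OF l2_summable])
  then have "((\<lambda>B. (norm \<xi>)\<^sup>2 - (\<Sum>i\<in>B. (norm (l2_fun \<xi> i))\<^sup>2)) \<longlongrightarrow> (norm \<xi>)\<^sup>2 - (norm \<xi>)\<^sup>2)
      (finite_subsets_at_top UNIV)"
    unfolding has_sum_def by (intro tendsto_intros)
  then have "((\<lambda>B. (norm (restr B \<xi> - \<xi>))\<^sup>2) \<longlongrightarrow> 0) (finite_subsets_at_top UNIV)"
    by (rule Lim_transform_eventually[THEN tendsto_eq_rhs])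
      (auto simp: eq intro!: eventually_finite_subsets_at_top_weakI)
  then have "((\<lambda>B. sqrt ((norm (restr B \<xi> - \<xi>))\<^sup>2)) \<longlongrightarrow> sqrt 0) (finite_subsets_at_top UNIV)"
    by (rule tendsto_real_sqrt)
  then show ?thesis by (simp add: tendsto_norm_zero_iff LIM_zero_iff)
qed

subsection \<open>Matrix entries\<close>

lemma entry_eq: "entry T x y v = l2_fun (T (l2_single y v)) x"
  by (simp add: entry_def)

lemma apply_restr_finite:
  fixes T :: "('x, 'h::complex_hilbert) l2 \<Rightarrow>\<^sub>L ('x, 'h) l2"
  assumes "finite B"
  shows "l2_fun (T (restr B \<xi>)) x = (\<Sum>y\<in>B. entry T x y (l2_fun \<xi> y))"
  by (simp add: restr_finite_sum[OF assms] blinfun.sum_right l2_fun_sum entry_eq)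

lemma tendsto_apply_restr:
  fixes T :: "('x, 'h::complex_hilbert) l2 \<Rightarrow>\<^sub>L ('x, 'h) l2"
  shows   "((\<lambda>B. l2_fun (T (restr B \<xi>)) x) \<longlongrightarrow> l2_fun (T \<xi>) x) (finite_subsets_at_top UNIV)"
  by (intro tendsto_l2_fun blinfun.tendsto tendsto_const tendsto_restr)

text \<open>The principle that a bounded operator is determined by its matrix: the value at
  \<open>x\<close> is a limit over finite truncations of \<open>\<xi>\<close>, each of which is a
  finite sum of entries.\<close>

lemma apply_eq_0:
  fixes T :: "('x, 'h::complex_hilbert) l2 \<Rightarrow>\<^sub>L ('x, 'h) l2"
  assumes "\<And>y. l2_fun \<xi> y \<noteq> 0 \<Longrightarrow> entry T x y = (\<lambda>_. 0)"
  shows "l2_fun (T \<xi>) x = 0"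
proof -
  have 0: "entry T x y (l2_fun \<xi> y) = 0" for y
    using assms[of y] by (cases "l2_fun \<xi> y = 0")
      (auto simp: entry_def blinfun.zero_right l2_fun_zero)
  have "\<forall>\<^sub>F B in finite_subsets_at_top UNIV. l2_fun (T (restr B \<xi>)) x = 0"
    by (intro eventually_finite_subsets_at_top_weakI) (simp add: apply_restr_finite 0)
  then have "((\<lambda>B. l2_fun (T (restr B \<xi>)) x) \<longlongrightarrow> 0) (finite_subsets_at_top UNIV)"
    by (rule tendsto_eventually)
  then show ?thesis
    by (rule tendsto_unique[OF finite_subsets_at_top_neq_bot tendsto_apply_restr])
qed

lemma apply_finite_row:
  fixes T :: "('x, 'h::complex_hilbert) l2 \<Rightarrow>\<^sub>L ('x, 'h) l2"
  assumes "finite B" "\<And>y. y \<notin> B \<Longrightarrow> l2_fun \<xi> y \<noteq> 0 \<Longrightarrow> entry T x y = (\<lambda>_. 0)"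
  shows "l2_fun (T \<xi>) x = (\<Sum>y\<in>B. entry T x y (l2_fun \<xi> y))"
proof -
  have "l2_fun (T (\<xi> - restr B \<xi>)) x = 0"
    by (rule apply_eq_0) (use assms(2) in \<open>auto simp: l2_fun_simps split: if_splits\<close>)
  then show ?thesis
    by (simp add: blinfun.diff_right l2_fun_simps apply_restr_finite[OF assms(1)])
qed

lemma blinfun_entry_eqI:
  assumes "\<And>x y. entry S x y = entry T x y"
  shows "S = T"
proof (rule blinfun_eqI, rule l2_eqI)
  fix \<xi> x
  have "l2_fun ((S - T) \<xi>) x = 0"
    by (rule apply_eq_0) (use assms in \<open>auto simp: entry_def fun_eq_iff blinfun.diff_left l2_fun_simps\<close>)
  then show "l2_fun (S \<xi>) x = l2_fun (T \<xi>) x"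
    by (simp add: blinfun.diff_left l2_fun_simps)
qed

lemma entry_blinfun: "entry T x y = blinfun_apply (prj x o\<^sub>L T o\<^sub>L ins y)"
  by (auto simp: entry_def)

lemma norm_entry_le: "norm (entry T x y v) \<le> norm T * norm v"
proof -
  have "norm (entry T x y v) \<le> norm (T (l2_single y v))"
    unfolding entry_def by (rule norm_l2_fun_le)
  also have "\<dots> \<le> norm T * norm v" using norm_blinfun[of T "l2_single y v"] by simp
  finally show ?thesis .
qed

lemma restr_single: "restr B (l2_single y v) = (if y \<in> B then l2_single y v else 0)"
  by (rule l2_eqI) (auto simp: l2_fun_single l2_fun_simps)

lemma entry_restr:
  "entry (restr B o\<^sub>L T) x y = (if x \<in> B then entry T x y else (\<lambda>_. 0))"
  "entry (T o\<^sub>L restr B) x y = (if y \<in> B then entry T x y else (\<lambda>_. 0))"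
  by (auto simp: entry_def fun_eq_iff restr_single l2_fun_simps blinfun.zero_right)

text \<open>Trades the entrywise condition for algebraic identities, which pass to products,
  adjoints and limits without computing entries.\<close>

lemma l2_ops_iff: "T \<in> l2_ops X \<longleftrightarrow> clinear_op T \<and> restr X o\<^sub>L T = T \<and> T o\<^sub>L restr X = T"
  (is "?L \<longleftrightarrow> ?R")
proof
  assume L: ?L
  have "restr X o\<^sub>L T = T" "T o\<^sub>L restr X = T"
    by (rule blinfun_entry_eqI; use L in \<open>auto simp: entry_restr l2_ops_def\<close>)+
  then show ?R using L by (simp add: l2_ops_def)
next
  assume R: ?R
  then have "entry T x y = (\<lambda>_. 0)" if "x \<notin> X \<or> y \<notin> X" for x y
    using entry_restr(1)[of X T x y] entry_restr(2)[of T X x y] that by (auto split: if_splits)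
  then show ?L using R by (auto simp: l2_ops_def)
qed

lemma entry_adj:
  fixes T :: "('x, 'h::complex_hilbert) l2 \<Rightarrow>\<^sub>L ('x, 'h) l2"
  assumes "clinear_op T"
  shows "cinner (entry (adj_op T) x y v) w = cinner v (entry T y x w)"
proof -
  have "cinner (entry (adj_op T) x y v) w = cnj (cinner (l2_single x w) (adj_op T (l2_single y v)))"
    unfolding entry_def by (subst cinner_l2_single) (rule cinner_commute)
  also have "\<dots> = cnj (cinner (T (l2_single x w)) (l2_single y v))"
    by (simp add: adj_op[OF assms])
  also have "\<dots> = cinner (l2_single y v) (T (l2_single x w))" by (rule cinner_commute[symmetric])
  also have "\<dots> = cinner v (entry T y x w)" by (simp add: cinner_l2_single entry_def)
  finally show ?thesis .
qed

section \<open>Compact operators\<close>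

lemma compact_closure_totally_bounded:
  fixes S :: "'a::complete_space set"
  assumes "\<And>e. e > 0 \<Longrightarrow> \<exists>k. finite k \<and> S \<subseteq> (\<Union>x\<in>k. ball x e)"
  shows "compact (closure S)"
  unfolding compact_eq_totally_bounded
proof (intro conjI allI impI)
  show "complete (closure S)" by (simp add: complete_eq_closed)
  fix e :: real assume "e > 0"
  then obtain k where k: "finite k" "S \<subseteq> (\<Union>x\<in>k. ball x (e/2))" using assms[of "e/2"] by auto
  have "S \<subseteq> (\<Union>x\<in>k. cball x (e/2))" using k(2) by (meson SUP_mono' ball_subset_cball order_trans)
  then have "closure S \<subseteq> (\<Union>x\<in>k. cball x (e/2))"
    by (rule closure_minimal) (use k(1) in auto)
  also have "\<dots> \<subseteq> (\<Union>x\<in>k. ball x e)"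
    using \<open>e > 0\<close> by (intro SUP_mono') (auto simp: cball_subset_ball_iff)
  finally show "\<exists>k. finite k \<and> closure S \<subseteq> (\<Union>x\<in>k. ball x e)" using k(1) by blast
qed

lemma compact_op_net:
  assumes "compact_op f" "e > 0"
  shows "\<exists>k. finite k \<and> f ` cball 0 1 \<subseteq> (\<Union>x\<in>k. ball x e)"
proof -
  have "compact (closure (f ` cball 0 1))" using assms(1) by (simp add: compact_op_def)
  then obtain k where "finite k" "closure (f ` cball 0 1) \<subseteq> (\<Union>x\<in>k. ball x e)"
    unfolding compact_eq_totally_bounded using assms(2) by blast
  then show ?thesis by (meson closure_subset order_trans)
qed

lemma compact_op_blinfun:
  "compact_op (blinfun_apply K) \<longleftrightarrow> clinear_op K \<and> compact (closure (K ` cball 0 1))"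
  by (simp add: compact_op_def clinear_op_def blinfun.bounded_linear_right)

lemma compact_opI:
  fixes K :: "'a::complex_hilbert \<Rightarrow>\<^sub>L 'b::complex_hilbert"
  assumes "clinear_op K" "K ` cball 0 1 \<subseteq> C" "compact C"
  shows "compact_op (blinfun_apply K)"
proof -
  have "closure (K ` cball 0 1) \<subseteq> C"
    using assms(2,3) by (intro closure_minimal compact_imp_closed)
  then have "closure (K ` cball 0 1) = C \<inter> closure (K ` cball 0 1)" by blast
  then have "compact (closure (K ` cball 0 1))"
    using compact_Int_closed[OF assms(3), of "closure (K ` cball 0 1)"] by simp
  then show ?thesis using assms(1) by (simp add: compact_op_blinfun)
qed

lemma compact_op_clinear: "compact_op (blinfun_apply K) \<Longrightarrow> clinear_op K"
  by (simp add: compact_op_blinfun)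

lemma compact_op_0 [simp]: "compact_op (blinfun_apply (0 :: 'a::complex_hilbert \<Rightarrow>\<^sub>L 'b::complex_hilbert))"
  by (rule compact_opI[where C="{0}"]) auto

lemma compact_op_zero_fun [simp]: "compact_op (\<lambda>_ :: 'a::complex_hilbert. 0 :: 'b::complex_hilbert)"
  using compact_op_0[where 'a='a and 'b='b] by (simp add: zero_blinfun.rep_eq)

lemma compact_op_add:
  fixes K L :: "'a::complex_hilbert \<Rightarrow>\<^sub>L 'b::complex_hilbert"
  assumes "compact_op (blinfun_apply K)" "compact_op (blinfun_apply L)"
  shows "compact_op (blinfun_apply (K + L))"
proof (rule compact_opI)
  let ?A = "closure (K ` cball 0 1)" and ?B = "closure (L ` cball 0 1)"
  show "compact {x + y | x y. x \<in> ?A \<and> y \<in> ?B}"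
    using assms by (intro compact_sums) (auto simp: compact_op_blinfun)
  have "K x \<in> ?A" "L x \<in> ?B" if "x \<in> cball 0 1" for x
    using that closure_subset[of "K ` cball 0 1"] closure_subset[of "L ` cball 0 1"] by auto
  then show "(K + L) ` cball 0 1 \<subseteq> {x + y | x y. x \<in> ?A \<and> y \<in> ?B}"
    by (auto simp: blinfun.add_left) blast
qed (use assms in \<open>auto simp: compact_op_blinfun\<close>)

lemma compact_op_comp_left:
  fixes K :: "'a::complex_hilbert \<Rightarrow>\<^sub>L 'b::complex_hilbert" and T :: "'b \<Rightarrow>\<^sub>L 'c::complex_hilbert"
  assumes "compact_op (blinfun_apply K)" "clinear_op T"
  shows "compact_op (blinfun_apply (T o\<^sub>L K))"
proof (rule compact_opI)
  show "compact (T ` closure (K ` cball 0 1))"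
    using assms(1) by (intro compact_continuous_image linear_continuous_on blinfun.bounded_linear_right)
      (auto simp: compact_op_blinfun)
  show "(T o\<^sub>L K) ` cball 0 1 \<subseteq> T ` closure (K ` cball 0 1)"
    using closure_subset[of "K ` cball 0 1"] by auto
qed (use assms in \<open>auto simp: compact_op_blinfun\<close>)

lemma compact_op_comp_right:
  fixes K :: "'b::complex_hilbert \<Rightarrow>\<^sub>L 'c::complex_hilbert" and T :: "'a::complex_hilbert \<Rightarrow>\<^sub>L 'b"
  assumes "compact_op (blinfun_apply K)" "clinear_op T"
  shows "compact_op (blinfun_apply (K o\<^sub>L T))"
proof (rule compact_opI)
  \<comment> \<open>The added one keeps \<open>M\<close> positive when \<open>T = 0\<close>, so that
    \<open>T x\<close> can be rescaled into the unit ball.\<close>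
  define M where "M = norm T + 1"
  have M: "M > 0" by (simp add: M_def add_nonneg_pos)
  show "compact ((\<lambda>x. M *\<^sub>R x) ` closure (K ` cball 0 1))"
    using assms(1) by (intro compact_scaling) (auto simp: compact_op_blinfun)
  show "(K o\<^sub>L T) ` cball 0 1 \<subseteq> (\<lambda>x. M *\<^sub>R x) ` closure (K ` cball 0 1)"
  proof
    fix z assume "z \<in> (K o\<^sub>L T) ` cball 0 1"
    then obtain x where x: "norm x \<le> 1" "z = K (T x)" by auto
    have "norm (T x) \<le> norm T * norm x" by (rule norm_blinfun)
    also have "\<dots> \<le> M" using mult_left_le[OF x(1), of "norm T"] by (simp add: M_def)
    finally have "(1/M) *\<^sub>R T x \<in> cball 0 1" using M by simp
    then have "K ((1/M) *\<^sub>R T x) \<in> closure (K ` cball 0 1)"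
      using closure_subset[of "K ` cball 0 1"] by auto
    moreover have "z = M *\<^sub>R K ((1/M) *\<^sub>R T x)" using x M by (simp add: blinfun.scaleR_right)
    ultimately show "z \<in> (\<lambda>x. M *\<^sub>R x) ` closure (K ` cball 0 1)" by blast
  qed
qed (use assms in \<open>auto simp: compact_op_blinfun\<close>)

lemma compact_op_scale:
  assumes "compact_op (blinfun_apply K)"
  shows "compact_op (blinfun_apply (scale_op c K))"
proof -
  have "scale_op c K = scale_op c id_blinfun o\<^sub>L K"
    by (simp add: scale_op_comp)
  then show ?thesis using compact_op_comp_left[OF assms, of "scale_op c id_blinfun"] by simp
qed

lemma compact_op_sum:
  "(\<And>i. i \<in> I \<Longrightarrow> compact_op (blinfun_apply (f i))) \<Longrightarrow> compact_op (blinfun_apply (\<Sum>i\<in>I. f i))"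
  by (induction I rule: infinite_finite_induct) (auto simp: compact_op_add)

lemma closed_compact_ops:
  "closed {K :: 'a::complex_hilbert \<Rightarrow>\<^sub>L 'b::complex_hilbert. compact_op (blinfun_apply K)}"
  unfolding closed_sequential_limits
proof (intro allI impI, elim conjE)
  fix X :: "nat \<Rightarrow> 'a \<Rightarrow>\<^sub>L 'b" and K
  assume X: "\<forall>n. X n \<in> {K. compact_op (blinfun_apply K)}" and lim: "X \<longlonglongrightarrow> K"
  have "clinear_op K"
    using closed_sequentially[OF closed_clinear_ops _ lim] X by (auto dest: compact_op_clinear)
  moreover have "compact (closure (K ` cball 0 1))"
  proof (rule compact_closure_totally_bounded)
    fix e :: real assume e: "e > 0"
    then obtain n where n: "dist (X n) K < e/2"
      using lim unfolding lim_sequentially by (meson half_gt_zero order_refl)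
    obtain k where k: "finite k" "X n ` cball 0 1 \<subseteq> (\<Union>x\<in>k. ball x (e/2))"
      using compact_op_net[of "X n" "e/2"] X e by auto
    have "K ` cball 0 1 \<subseteq> (\<Union>x\<in>k. ball x e)"
    proof
      fix z assume "z \<in> K ` cball 0 1"
      then obtain x where x: "norm x \<le> 1" "z = K x" by auto
      then obtain y where y: "y \<in> k" "dist y (X n x) < e/2" using k(2) by fastforce
      have "dist (X n x) (K x) \<le> norm (X n - K) * norm x"
        unfolding dist_norm blinfun.diff_left[symmetric] by (rule norm_blinfun)
      also have "\<dots> < e/2" using mult_left_le[OF x(1), of "norm (X n - K)"] n by (simp add: dist_norm)
      finally have "dist y z < e"
        unfolding x(2) using y(2) dist_triangle[of y "K x" "X n x"] by linarith
      then show "z \<in> (\<Union>x\<in>k. ball x e)" using y(1) by auto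
    qed
    then show "\<exists>k. finite k \<and> K ` cball 0 1 \<subseteq> (\<Union>x\<in>k. ball x e)" using k(1) by blast
  qed
  ultimately show "K \<in> {K. compact_op (blinfun_apply K)}" by (simp add: compact_op_blinfun)
qed

text \<open>Since \<open>norm (adj_op T w)\<close> squared is at most
  \<open>norm (T (adj_op T w)) * norm w\<close>, a finite net for the image of the ball under the
  compact operator \<open>T o\<^sub>L adj_op T\<close> yields one for
  \<open>adj_op T\<close>.\<close>

lemma compact_op_adj:
  assumes "compact_op (blinfun_apply T)"
  shows "compact_op (blinfun_apply (adj_op T))"
proof -
  have T: "clinear_op T" using assms by (rule compact_op_clinear)
  have TT: "compact_op (blinfun_apply (T o\<^sub>L adj_op T))"
    using assms T by (intro compact_op_comp_right) auto
  have "compact (closure (adj_op T ` cball 0 1))"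
  proof (rule compact_closure_totally_bounded)
    fix e :: real assume e: "e > 0"
    \<comment> \<open>Two points of the ball near the same net point give a squared distance of at
      most \<open>2 * \<delta> * 2\<close>, which is half of \<open>e\<^sup>2\<close>.\<close>
    define \<delta> where "\<delta> = e\<^sup>2 / 8"
    have \<delta>: "\<delta> > 0" using e by (simp add: \<delta>_def)
    obtain k where k: "finite k" "(T o\<^sub>L adj_op T) ` cball 0 1 \<subseteq> (\<Union>z\<in>k. ball z \<delta>)"
      using compact_op_net[OF TT \<delta>] by auto
    \<comment> \<open>Net centres for \<open>adj_op T\<close> are images of points of the ball:
      \<open>g z\<close> is chosen with \<open>T (adj_op T (g z))\<close> within
      \<open>\<delta>\<close> of \<open>z\<close>, whenever such a point exists.\<close>
    define g where "g z = (SOME x. x \<in> cball 0 1 \<and> dist z (T (adj_op T x)) < \<delta>)" for z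
    have "adj_op T ` cball 0 1 \<subseteq> (\<Union>y\<in>(\<lambda>z. adj_op T (g z)) ` k. ball y e)"
    proof
      fix w assume "w \<in> adj_op T ` cball 0 1"
      then obtain x where x: "x \<in> cball 0 1" "w = adj_op T x" by auto
      then obtain z where z: "z \<in> k" "dist z (T (adj_op T x)) < \<delta>" using k(2) by fastforce
      have g: "g z \<in> cball 0 1" "dist z (T (adj_op T (g z))) < \<delta>"
        unfolding g_def using someI[of "\<lambda>x. x \<in> cball 0 1 \<and> dist z (T (adj_op T x)) < \<delta>" x] x z by auto
      have "(norm (adj_op T (g z) - w))\<^sup>2 = inner (T (adj_op T (g z - x))) (g z - x)"
        unfolding x(2) blinfun.diff_right[symmetric] power2_norm_eq_inner
        by (simp add: inner_adj_op[OF T])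
      also have "\<dots> \<le> norm (T (adj_op T (g z - x))) * norm (g z - x)" by (rule norm_cauchy_schwarz)
      also have "\<dots> \<le> (2 * \<delta>) * 2"
      proof (rule mult_mono)
        have "norm (T (adj_op T (g z - x))) = dist (T (adj_op T (g z))) (T (adj_op T x))"
          by (simp add: dist_norm blinfun.diff_right)
        also have "\<dots> \<le> 2 * \<delta>" using g z dist_triangle2[of "T (adj_op T (g z))" "T (adj_op T x)" z]
          by (simp add: dist_commute)
        finally show "norm (T (adj_op T (g z - x))) \<le> 2 * \<delta>" .
        show "norm (g z - x) \<le> 2" using norm_triangle_ineq4[of "g z" x] g x by auto
      qed (use \<delta> in auto)
      also have "\<dots> < e\<^sup>2" using e by (simp add: \<delta>_def)
      finally have "norm (adj_op T (g z) - w) < e"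
        by (rule power2_less_imp_less) (use e in simp)
      then show "w \<in> (\<Union>y\<in>(\<lambda>z. adj_op T (g z)) ` k. ball y e)" using z(1) by (auto simp: dist_norm)
    qed
    then show "\<exists>k. finite k \<and> adj_op T ` cball 0 1 \<subseteq> (\<Union>x\<in>k. ball x e)" using k(1) by blast
  qed
  then show ?thesis using T by (simp add: compact_op_blinfun)
qed

lemma norm_blinfun_le_ball:
  fixes T :: "'a::real_normed_vector \<Rightarrow>\<^sub>L 'b::real_normed_vector"
  assumes "b \<ge> 0" "\<And>x. norm x \<le> 1 \<Longrightarrow> norm (T x) \<le> b"
  shows "norm T \<le> b"
proof (rule norm_blinfun_bound[OF assms(1)])
  fix x
  show "norm (T x) \<le> b * norm x"
  proof (cases "x = 0")
    case False
    then have "norm (T ((1 / norm x) *\<^sub>R x)) \<le> b" by (intro assms(2)) simp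
    then show ?thesis using False by (simp add: blinfun.scaleR_right field_simps)
  qed (simp add: blinfun.zero_right)
qed

text \<open>The truncations converge to the identity only pointwise, but they are contractions, so
  convergence is uniform on the totally bounded image of the ball: check it on a finite
  \<open>e/3\<close>-net.\<close>

lemma compact_op_restr_approximation:
  fixes K :: "'a::complex_hilbert \<Rightarrow>\<^sub>L ('x, 'h::complex_hilbert) l2"
  assumes "compact_op (blinfun_apply K)" "e > 0"
  shows "\<forall>\<^sub>F B in finite_subsets_at_top UNIV. norm (K - (restr B o\<^sub>L K)) \<le> e"
proof -
  obtain k where k: "finite k" "K ` cball 0 1 \<subseteq> (\<Union>x\<in>k. ball x (e/3))"
    using compact_op_net[OF assms(1), of "e/3"] assms(2) by auto
  have "\<forall>\<^sub>F B in finite_subsets_at_top UNIV. \<forall>z\<in>k. dist (restr B z) z < e/3"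
    using k(1) assms(2) by (intro eventually_ball_finite ballI tendstoD tendsto_restr) auto
  then show ?thesis
  proof eventually_elim
    case (elim B)
    show ?case
    proof (rule norm_blinfun_le_ball)
      fix x :: 'a assume "norm x \<le> 1"
      then obtain z where z: "z \<in> k" "norm (z - K x) < e/3" using k(2) by (fastforce simp: dist_norm)
      have "(K - (restr B o\<^sub>L K)) x = (K x - z) + (z - restr B z) + restr B (z - K x)"
        by (simp add: blinfun.bilinear_simps)
      also have "norm \<dots> \<le> norm (K x - z) + norm (z - restr B z) + norm (restr B (z - K x))"
        by (meson add_right_mono norm_triangle_ineq order_trans)
      also have "\<dots> \<le> e/3 + e/3 + e/3"
        using z elim norm_restr_apply_le[of B "z - K x"]
        by (intro add_mono) (auto simp: dist_norm norm_minus_commute less_imp_le)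
      finally show "norm ((K - (restr B o\<^sub>L K)) x) \<le> e" by simp
    qed (use assms in simp)
  qed
qed

text \<open>Truncation on the right is handled as truncation of the compact adjoint on the left; one
  finite set serves both sides because both estimates hold eventually.\<close>

lemma compact_op_approximation:
  fixes K :: "('x, 'h::complex_hilbert) l2 \<Rightarrow>\<^sub>L ('x, 'h) l2"
  assumes K: "compact_op (blinfun_apply K)" and e: "e > 0"
  shows "\<exists>B. finite B \<and> norm (K - (restr B o\<^sub>L K o\<^sub>L restr B)) \<le> e"
proof -
  note K' = compact_op_clinear[OF K]
  have "\<forall>\<^sub>F B in finite_subsets_at_top UNIV. finite B \<and>
     norm (K - (restr B o\<^sub>L K)) \<le> e/2 \<and> norm (adj_op K - (restr B o\<^sub>L adj_op K)) \<le> e/2"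
    using e by (intro eventually_conj compact_op_restr_approximation compact_op_adj K
        eventually_finite_subsets_at_top_weakI[of UNIV finite]) auto
  then obtain B where B: "finite B" "norm (K - (restr B o\<^sub>L K)) \<le> e/2"
     "norm (adj_op K - (restr B o\<^sub>L adj_op K)) \<le> e/2"
    using eventually_happens'[OF finite_subsets_at_top_neq_bot] by blast
  have "adj_op K - (restr B o\<^sub>L adj_op K) = adj_op (K - (K o\<^sub>L restr B))"
    using K' by (simp add: adj_op_diff adj_op_comp)
  with B(3) have B3: "norm (K - (K o\<^sub>L restr B)) \<le> e/2" using K' by (simp add: norm_adj_op)
  have "K - (restr B o\<^sub>L K o\<^sub>L restr B) = (K - (restr B o\<^sub>L K)) + (restr B o\<^sub>L (K - (K o\<^sub>L restr B)))"
    by (simp add: blinfun_comp_simps blinfun_comp_assoc)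
  also have "norm \<dots> \<le> norm (K - (restr B o\<^sub>L K)) + norm (restr B o\<^sub>L (K - (K o\<^sub>L restr B)))"
    by (rule norm_triangle_ineq)
  also have "norm (restr B o\<^sub>L (K - (K o\<^sub>L restr B))) \<le> norm (restr B :: ('x, 'h) l2 \<Rightarrow>\<^sub>L ('x, 'h) l2) * norm (K - (K o\<^sub>L restr B))"
    by (rule norm_blinfun_compose)
  also have "\<dots> \<le> 1 * norm (K - (K o\<^sub>L restr B))" by (intro mult_right_mono norm_restr_le) auto
  finally show ?thesis using B B3 by (intro exI[of _ B]) linarith
qed

section \<open>Finite sets almost invariant under an amenable group\<close>

text \<open>A minimal relation satisfying Hall's condition is a function.\<close>

lemma hall_infinite:
  fixes A :: "'i \<Rightarrow> 'b set"
  assumes fin: "\<And>i. i \<in> I \<Longrightarrow> finite (A i)"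
    and hall: "\<And>J. finite J \<Longrightarrow> J \<subseteq> I \<Longrightarrow> card J \<le> card (\<Union>i\<in>J. A i)"
  shows "\<exists>f. (\<forall>i\<in>I. f i \<in> A i) \<and> inj_on f I"
proof -
  define R0 where "R0 = Sigma I A"
  define H where "H R \<longleftrightarrow> (\<forall>J. finite J \<and> J \<subseteq> I \<longrightarrow> card J \<le> card (R `` J))" for R :: "('i \<times> 'b) set"
  have finR: "finite (R `` J)" if "finite J" "R \<subseteq> R0" for R J
  proof (rule finite_subset)
    show "R `` J \<subseteq> (\<Union>i\<in>J \<inter> I. A i)" using that by (auto simp: R0_def)
  qed (use that fin in auto)
  \<comment> \<open>Zorn's lemma is applied to sets of deleted edges, so that a maximal deletion
    leaves a minimal relation.\<close>
  define \<S> where "\<S> = {S. S \<subseteq> R0 \<and> H (R0 - S)}"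
  have "\<exists>S\<in>\<S>. \<forall>X\<in>\<S>. S \<subseteq> X \<longrightarrow> X = S"
  proof (rule subset_Zorn_nonempty)
    have "R0 `` J = (\<Union>i\<in>J. A i)" if "J \<subseteq> I" for J using that by (auto simp: R0_def)
    then have "{} \<in> \<S>" using hall by (auto simp: \<S>_def H_def)
    then show "\<S> \<noteq> {}" by blast
    fix \<C> assume \<C>: "\<C> \<noteq> {}" "subset.chain \<S> \<C>"
    have sub: "\<C> \<subseteq> \<S>" using \<C>(2) by (simp add: subset.chain_def)
    have "card J \<le> card ((R0 - \<Union>\<C>) `` J)" if J: "finite J" "J \<subseteq> I" for J
    proof -
      \<comment> \<open>Only finitely many edges start in \<open>J\<close>, so a single member of
        the chain already deletes all of them that the union deletes, and Hall's condition for
        \<open>J\<close> is inherited from it.\<close>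
      have "finite (\<Union>\<C> \<inter> Sigma J A)" using J fin by (intro finite_Int disjI2 finite_SigmaI) auto
      then obtain S where S: "S \<in> \<C>" "\<Union>\<C> \<inter> Sigma J A \<subseteq> S"
        using finite_subset_Union_chain[of "\<Union>\<C> \<inter> Sigma J A" \<C> \<S>] \<C> by blast
      then have "card J \<le> card ((R0 - S) `` J)" using sub J by (auto simp: \<S>_def H_def)
      also have "\<dots> \<le> card ((R0 - \<Union>\<C>) `` J)"
        using S by (intro card_mono finR J) (auto simp: R0_def)
      finally show ?thesis .
    qed
    then show "\<Union>\<C> \<in> \<S>" using sub by (auto simp: \<S>_def H_def)
  qed
  then obtain S where S: "S \<in> \<S>" and max: "\<And>X. X \<in> \<S> \<Longrightarrow> S \<subseteq> X \<Longrightarrow> X = S" by blast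
  define R where "R = R0 - S"
  have RR0: "R \<subseteq> R0" and HR: "H R" using S by (auto simp: R_def \<S>_def)
  \<comment> \<open>Deleting one more edge violates Hall's condition on some \<open>J\<close>. Such
    a \<open>J\<close> must contain the source \<open>i\<close>, and without that edge it has at
    most \<open>card J - 1\<close> neighbours.\<close>
  have minimal: "\<exists>J. finite J \<and> J \<subseteq> I \<and> i \<in> J \<and> card ((R - {(i, x)}) `` J) \<le> card (J - {i})"
    if "(i, x) \<in> R" for i x
  proof -
    have "insert (i, x) S \<notin> \<S>" using max[of "insert (i, x) S"] that by (auto simp: R_def)
    moreover have "R0 - insert (i, x) S = R - {(i, x)}" by (auto simp: R_def)
    moreover have "insert (i, x) S \<subseteq> R0" using S that RR0 by (auto simp: \<S>_def)
    ultimately have "\<not> H (R - {(i, x)})" by (simp add: \<S>_def)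
    then obtain J where J: "finite J" "J \<subseteq> I" "card ((R - {(i, x)}) `` J) < card J"
      by (auto simp: H_def not_le)
    have "i \<in> J"
    proof (rule ccontr)
      assume "i \<notin> J"
      then have "(R - {(i, x)}) `` J = R `` J" by auto
      then show False using J HR by (auto simp: H_def)
    qed
    with J show ?thesis by (intro exI[of _ J]) auto
  qed
  have single: "x = y" if x: "(i, x) \<in> R" and y: "(i, y) \<in> R" for i x y
  proof (rule ccontr)
    assume neq: "x \<noteq> y"
    obtain J where J: "finite J" "J \<subseteq> I" "i \<in> J" "card ((R - {(i, x)}) `` J) \<le> card (J - {i})"
      using minimal[OF x] by blast
    obtain L where L: "finite L" "L \<subseteq> I" "i \<in> L" "card ((R - {(i, y)}) `` L) \<le> card (L - {i})"
      using minimal[OF y] by blast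
    \<comment> \<open>Submodularity: \<open>P \<union> Q\<close> contains all neighbours of
      \<open>J \<union> L\<close>, because a neighbour of \<open>i\<close> is different from
      \<open>x\<close> or from \<open>y\<close>, and \<open>P \<inter> Q\<close> contains those of
      the intersection without \<open>i\<close>. Adding the two Hall inequalities exceeds
      \<open>card P + card Q\<close> by one.\<close>
    define P Q where "P = (R - {(i, x)}) `` J" and "Q = (R - {(i, y)}) `` L"
    have fPQ: "finite P" "finite Q" unfolding P_def Q_def
      by (rule finR; use J L RR0 in auto)+
    have eq: "insert i ((J - {i}) \<union> (L - {i})) = J \<union> L" using J(3) by blast
    have "card (insert i ((J - {i}) \<union> (L - {i}))) \<le> card (R `` (J \<union> L))"
      unfolding eq using HR[unfolded H_def, rule_format, of "J \<union> L"] J L by simp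
    also have "card (R `` (J \<union> L)) \<le> card (P \<union> Q)"
    proof (rule card_mono)
    show "finite (P \<union> Q)" using fPQ by simp
    show "R `` (J \<union> L) \<subseteq> P \<union> Q"
    proof
      fix b assume "b \<in> R `` (J \<union> L)"
      then obtain k where k: "(k, b) \<in> R" "k \<in> J \<or> k \<in> L" by blast
      show "b \<in> P \<union> Q"
      proof (cases "k = i")
        case True
        then have "b \<noteq> x \<or> b \<noteq> y" using neq by simp
        then show ?thesis using True k(1) J(3) L(3) by (auto simp: P_def Q_def Image_iff)
      qed (use k in \<open>auto simp: P_def Q_def Image_iff\<close>)
    qed
    qed
    finally have 1: "Suc (card ((J - {i}) \<union> (L - {i}))) \<le> card (P \<union> Q)"
      using J L by (subst (asm) card_insert_disjoint) auto
    have "card ((J - {i}) \<inter> (L - {i})) \<le> card (R `` ((J - {i}) \<inter> (L - {i})))"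
      using HR[unfolded H_def, rule_format, of "(J - {i}) \<inter> (L - {i})"] J(1,2) by blast
    also have "\<dots> \<le> card (P \<inter> Q)"
      using fPQ by (intro card_mono) (auto simp: P_def Q_def)
    finally have 2: "card ((J - {i}) \<inter> (L - {i})) \<le> card (P \<inter> Q)" .
    show False
      using 1 2 J(4) L(4) card_Un_Int[OF fPQ] card_Un_Int[of "J - {i}" "L - {i}"] J(1) L(1)
      unfolding P_def[symmetric] Q_def[symmetric] by simp
  qed
  have "\<exists>x. (i, x) \<in> R" if "i \<in> I" for i
  proof -
    have "card {i} \<le> card (R `` {i})" using HR that unfolding H_def by blast
    then have "R `` {i} \<noteq> {}" by auto
    then show ?thesis by auto
  qed
  then obtain f where f: "\<And>i. i \<in> I \<Longrightarrow> (i, f i) \<in> R" by metis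
  have "inj_on f I"
  proof (rule inj_onI, rule ccontr)
    fix i j assume ij: "i \<in> I" "j \<in> I" "f i = f j" "i \<noteq> j"
    have "card {i, j} \<le> card (R `` {i, j})"
      using HR[unfolded H_def, rule_format, of "{i, j}"] ij by simp
    moreover have "R `` {i, j} \<subseteq> {f i}"
      using single[OF f[OF ij(1)]] single[OF f[OF ij(2)]] ij(3) by fastforce
    then have "card (R `` {i, j}) \<le> 1" using card_mono[of "{f i}"] by fastforce
    ultimately show False using ij by simp
  qed
  moreover have "f i \<in> A i" if "i \<in> I" for i using f[OF that] RR0 by (auto simp: R0_def)
  ultimately show ?thesis by blast
qed

text \<open>If there were no almost invariant finite sets, some finite \<open>W\<close> would satisfy
  \<open>card (W E) \<ge> 2 card E\<close> for all finite \<open>E\<close>, and Hall's theorem would give a paradoxical decomposition.\<close>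

lemma (in group) almost_invariant_finite_set:
  fixes \<epsilon> :: real
  assumes amen: "amenable G" and F: "finite F" "F \<subseteq> carrier G" and \<epsilon>: "\<epsilon> > 0"
  shows "\<exists>E. finite E \<and> E \<noteq> {} \<and> E \<subseteq> carrier G \<and>
    (\<forall>g\<in>F. (1 - \<epsilon>) * card E \<le> card (E \<inter> (\<lambda>h. g \<otimes> h) ` E))"
proof (rule ccontr)
  assume "\<not> ?thesis"
  then have no: "\<exists>g\<in>F. card (E \<inter> (\<lambda>h. g \<otimes> h) ` E) < (1 - \<epsilon>) * card E"
    if "finite E" "E \<noteq> {}" "E \<subseteq> carrier G" for E
    using that by (meson not_le)
  define F1 where "F1 = insert \<one> F"
  have F1: "finite F1" "F1 \<subseteq> carrier G" "\<one> \<in> F1" using F by (auto simp: F1_def)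
  have inj: "inj_on (\<lambda>h. g \<otimes> h) E" if "g \<in> carrier G" "E \<subseteq> carrier G" for g E
    using that by (intro inj_onI) (auto simp: subset_iff)
  have set_mult_image: "A <#> B = (\<Union>a\<in>A. (\<lambda>h. a \<otimes> h) ` B)" for A B
    by (auto simp: set_mult_def)
  have fin_mult: "finite (A <#> B)" if "finite A" "finite B" for A B
    unfolding set_mult_image using that by auto
  \<comment> \<open>A translate that overlaps \<open>E\<close> in fewer than
    \<open>(1 - \<epsilon>) * card E\<close> points adds more than
    \<open>\<epsilon> * card E\<close> new ones; the unit in \<open>F1\<close> keeps
    \<open>E\<close> itself.\<close>
  have grow: "(1 + \<epsilon>) * card E \<le> card (F1 <#> E)" if E: "finite E" "E \<subseteq> carrier G" for E
  proof (cases "E = {}")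
    case False
    then obtain g where g: "g \<in> F" "card (E \<inter> (\<lambda>h. g \<otimes> h) ` E) < (1 - \<epsilon>) * card E"
      using no E by blast
    let ?gE = "(\<lambda>h. g \<otimes> h) ` E"
    have "card ?gE = card E" using g F E by (intro card_image inj) auto
    then have "card (E \<union> ?gE) + card (E \<inter> ?gE) = 2 * card E"
      using card_Un_Int[of E ?gE] E by simp
    moreover have "E \<union> ?gE \<subseteq> F1 <#> E"
      unfolding set_mult_image using g E by (force simp: F1_def)
    then have "card (E \<union> ?gE) \<le> card (F1 <#> E)"
      using fin_mult F1 E by (intro card_mono) auto
    ultimately have "2 * real (card E) - real (card (E \<inter> ?gE)) \<le> real (card (F1 <#> E))"
      by linarith
    then show ?thesis using g(2) by (simp add: algebra_simps)
  qed simp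
  define P where "P n = ((\<lambda>A. F1 <#> A) ^^ n) {\<one>}" for n
  have P: "finite (P n)" "P n \<subseteq> carrier G" for n
    by (induction n) (use F1 in \<open>auto simp: P_def fin_mult set_mult_closed\<close>)
  have grow_n: "(1 + \<epsilon>) ^ n * card E \<le> card (P n <#> E)" if E: "finite E" "E \<subseteq> carrier G" for n E
  proof (induction n)
    case 0
    have "P 0 <#> E = E" using E by (force simp: P_def set_mult_def subset_iff)
    then show ?case by simp
  next
    case (Suc n)
    have "(1 + \<epsilon>) ^ Suc n * card E = (1 + \<epsilon>) * ((1 + \<epsilon>) ^ n * card E)" by simp
    also have "\<dots> \<le> (1 + \<epsilon>) * card (P n <#> E)" using Suc \<epsilon> by (intro mult_left_mono) auto
    also have "\<dots> \<le> card (F1 <#> (P n <#> E))"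
      using P E by (intro grow fin_mult set_mult_closed) auto
    also have "F1 <#> (P n <#> E) = P (Suc n) <#> E"
      using set_mult_assoc[OF F1(2) P(2)[of n] E(2)] by (simp add: P_def)
    finally show ?case .
  qed
  \<comment> \<open>Iterating the growth turns the factor \<open>1 + \<epsilon>\<close> into a
    factor above two, the number of disjoint copies of the group used next.\<close>
  obtain n where n: "2 < (1 + \<epsilon>) ^ n" using real_arch_pow[of "1 + \<epsilon>" 2] \<epsilon> by auto
  define W where "W = P n"
  have W: "finite W" "W \<subseteq> carrier G" using P by (auto simp: W_def)
  have double: "2 * card E \<le> card (W <#> E)" if "finite E" "E \<subseteq> carrier G" for E
  proof -
    have "2 * real (card E) \<le> (1 + \<epsilon>) ^ n * card E" using n by (intro mult_right_mono) auto
    also have "\<dots> \<le> card (W <#> E)" unfolding W_def by (rule grow_n[OF that])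
    finally show ?thesis by linarith
  qed
  \<comment> \<open>An injection of two disjoint copies of the group, labelled by truth values, into
    the group itself, moving each point by a left factor from the finite set
    \<open>W\<close>.\<close>
  have "\<exists>f. (\<forall>i\<in>carrier G \<times> (UNIV :: bool set). f i \<in> (\<lambda>w. w \<otimes> fst i) ` W)
      \<and> inj_on f (carrier G \<times> UNIV)"
  proof (rule hall_infinite)
    fix J :: "('a \<times> bool) set" assume J: "finite J" "J \<subseteq> carrier G \<times> UNIV"
    have "card J \<le> card (fst ` J \<times> (UNIV :: bool set))"
      using J by (intro card_mono) (force intro: image_eqI)+
    also have "\<dots> = 2 * card (fst ` J)" by (simp add: card_cartesian_product)
    also have "\<dots> \<le> card (W <#> (fst ` J))" using J by (intro double) auto
    also have "W <#> (fst ` J) = (\<Union>i\<in>J. (\<lambda>w. w \<otimes> fst i) ` W)" by (auto simp: set_mult_def)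
    finally show "card J \<le> card (\<Union>i\<in>J. (\<lambda>w. w \<otimes> fst i) ` W)" .
  qed (use W in auto)
  then obtain f where f0: "\<forall>i\<in>carrier G \<times> (UNIV :: bool set). f i \<in> (\<lambda>w. w \<otimes> fst i) ` W"
    and f_inj: "inj_on f (carrier G \<times> (UNIV :: bool set))" by blast
  have f: "\<exists>w\<in>W. f (x, b) = w \<otimes> x" if "x \<in> carrier G" for x b
    using bspec[OF f0, of "(x, b)"] that by auto
  obtain \<mu> :: "'a set \<Rightarrow> real" where \<mu>: "\<mu> (carrier G) = 1"
    "\<And>A. A \<subseteq> carrier G \<Longrightarrow> \<mu> A \<ge> 0"
    "\<And>A B. A \<subseteq> carrier G \<Longrightarrow> B \<subseteq> carrier G \<Longrightarrow> A \<inter> B = {} \<Longrightarrow> \<mu> (A \<union> B) = \<mu> A + \<mu> B"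
    "\<And>g A. g \<in> carrier G \<Longrightarrow> A \<subseteq> carrier G \<Longrightarrow> \<mu> (l_coset G g A) = \<mu> A"
    using amen unfolding amenable_def by (elim exE conjE) blast
  have \<mu>0: "\<mu> {} = 0" using \<mu>(3)[of "{}" "{}"] by simp
  have \<mu>_Union: "\<mu> (\<Union>i\<in>I. C i) = (\<Sum>i\<in>I. \<mu> (C i))"
    if "finite I" "\<And>i. i \<in> I \<Longrightarrow> C i \<subseteq> carrier G" "\<And>i j. i \<in> I \<Longrightarrow> j \<in> I \<Longrightarrow> i \<noteq> j \<Longrightarrow> C i \<inter> C j = {}"
    for I and C :: "('a \<times> bool) \<Rightarrow> 'a set"
    using that
  proof (induction I)
    case (insert i I)
    have "\<mu> (C i \<union> (\<Union>i\<in>I. C i)) = \<mu> (C i) + \<mu> (\<Union>i\<in>I. C i)"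
    proof (rule \<mu>(3))
      show "C i \<inter> (\<Union>i\<in>I. C i) = {}" using insert.prems(2)[of i] insert.hyps by fastforce
    qed (use insert.prems(1) in \<open>simp_all add: UN_subset_iff\<close>)
    then show ?case using insert by simp
  qed (simp add: \<mu>0)
  \<comment> \<open>The piece of copy \<open>b\<close> that \<open>f\<close> moves by
    \<open>w\<close>. The pieces of each copy partition the group and have total measure one; by
    injectivity all translated pieces are disjoint, so a measure of two would fit into one.\<close>
  define C where "C = (\<lambda>(w, b). {x \<in> carrier G. f (x, b) = w \<otimes> x})"
  have C: "C i \<subseteq> carrier G" for i by (auto simp: C_def split: prod.split)
  have one: "(\<Sum>w\<in>W. \<mu> (C (w, b))) = 1" for b
  proof -
    have "(\<Union>i\<in>W \<times> {b}. C i) = carrier G" using f by (fastforce simp: C_def)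
    then have "1 = \<mu> (\<Union>i\<in>W \<times> {b}. C i)" using \<mu>(1) by simp
    also have "\<dots> = (\<Sum>i\<in>W \<times> {b}. \<mu> (C i))"
    proof (rule \<mu>_Union)
      fix i j assume ij: "i \<in> W \<times> {b}" "j \<in> W \<times> {b}" "i \<noteq> j"
      show "C i \<inter> C j = {}"
      proof (rule ccontr)
        assume "C i \<inter> C j \<noteq> {}"
        then obtain x where "x \<in> C i" "x \<in> C j" by blast
        then have "x \<in> carrier G" "fst i \<otimes> x = fst j \<otimes> x"
          using ij by (auto simp: C_def)
        then have "fst i = fst j" using ij W by (auto simp: subset_iff)
        then show False using ij by auto
      qed
    qed (use W C in auto)
    also have "\<dots> = (\<Sum>w\<in>W. \<mu> (C (w, b)))"
      by (rule sum.reindex_cong[of "\<lambda>w. (w, b)"]) (auto intro: inj_onI)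
    finally show ?thesis by simp
  qed
  have lC: "l_coset G (fst i) (C i) \<subseteq> carrier G" if "i \<in> W \<times> UNIV" for i
    using that W C by (intro l_coset_subset_G) auto
  have "(\<Sum>i\<in>W \<times> UNIV. \<mu> (C i)) = (\<Sum>i\<in>W \<times> UNIV. \<mu> (l_coset G (fst i) (C i)))"
    using W C by (intro sum.cong) (auto simp: \<mu>(4) subset_iff)
  also have "\<dots> = \<mu> (\<Union>i\<in>W \<times> UNIV. l_coset G (fst i) (C i))"
  proof (rule \<mu>_Union[symmetric])
    fix i j :: "'a \<times> bool" assume ij: "i \<in> W \<times> UNIV" "j \<in> W \<times> UNIV" "i \<noteq> j"
    show "(l_coset G (fst i) (C i)) \<inter> (l_coset G (fst j) (C j)) = {}"
    proof (rule ccontr)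
      assume "(l_coset G (fst i) (C i)) \<inter> (l_coset G (fst j) (C j)) \<noteq> {}"
      then obtain x y where xy: "x \<in> C i" "y \<in> C j" "fst i \<otimes> x = fst j \<otimes> y"
        by (auto simp: l_coset_def)
      then have "f (x, snd i) = f (y, snd j)" "x \<in> carrier G" "y \<in> carrier G"
        by (auto simp: C_def split: prod.splits)
      then have "x = y" "snd i = snd j" using f_inj by (auto dest: inj_onD)
      moreover have "fst i = fst j"
        using xy(3) \<open>x = y\<close> \<open>y \<in> carrier G\<close> ij W by (auto simp: subset_iff)
      ultimately show False using ij by (auto simp: prod_eq_iff)
    qed
  qed (use W lC in simp_all)
  also have "\<dots> \<le> 1"
  proof -
    let ?U = "\<Union>i\<in>W \<times> (UNIV :: bool set). l_coset G (fst i) (C i)"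
    have U: "?U \<subseteq> carrier G"
      by (intro UN_least lC)
    have "\<mu> (?U \<union> (carrier G - ?U)) = \<mu> ?U + \<mu> (carrier G - ?U)"
      using U by (intro \<mu>(3)) auto
    moreover have "?U \<union> (carrier G - ?U) = carrier G" using U by blast
    ultimately show ?thesis using \<mu>(1) \<mu>(2)[of "carrier G - ?U"] by simp
  qed
  finally have "(\<Sum>i\<in>W \<times> (UNIV :: bool set). \<mu> (C i)) \<le> 1" .
  moreover have "(\<Sum>i\<in>W \<times> (UNIV :: bool set). \<mu> (C i)) = (\<Sum>b\<in>UNIV. \<Sum>w\<in>W. \<mu> (C (w, b)))"
    by (subst sum.swap) (simp only: sum.cartesian_product case_prod_eta split_def prod.collapse)
  ultimately show False by (simp add: one)
qed

section \<open>Finite block matrices\<close>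

definition block_op :: "'g set \<Rightarrow> ('g \<Rightarrow> 'g \<Rightarrow> 'h::complex_hilbert \<Rightarrow>\<^sub>L 'h) \<Rightarrow> ('g, 'h) l2 \<Rightarrow>\<^sub>L ('g, 'h) l2" where
  "block_op E a = (\<Sum>h\<in>E. \<Sum>k\<in>E. ins h o\<^sub>L a h k o\<^sub>L prj k)"

lemma blinfun_sum_apply: "blinfun_apply (\<Sum>i\<in>I. f i) x = (\<Sum>i\<in>I. blinfun_apply (f i) x)"
  by (rule blinfun.sum_left)

lemma block_op_apply:
  assumes "finite E"
  shows "l2_fun (block_op E a \<xi>) h = (if h \<in> E then \<Sum>k\<in>E. a h k (l2_fun \<xi> k) else 0)"
proof -
  have "l2_fun (block_op E a \<xi>) h = (\<Sum>h'\<in>E. if h = h' then \<Sum>k\<in>E. a h' k (l2_fun \<xi> k) else 0)"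
    unfolding block_op_def blinfun_sum_apply l2_fun_sum
    by (intro sum.cong) (auto simp: l2_fun_single)
  also have "\<dots> = (if h \<in> E then \<Sum>k\<in>E. a h k (l2_fun \<xi> k) else 0)"
    using assms by simp
  finally show ?thesis .
qed

lemma block_op_cong: "(\<And>h k. h \<in> E \<Longrightarrow> k \<in> E \<Longrightarrow> a h k = b h k) \<Longrightarrow> block_op E a = block_op E b"
  by (simp add: block_op_def)

lemma block_op_entry:
  assumes "finite E" "h \<in> E" "k \<in> E"
  shows "prj h o\<^sub>L block_op E a o\<^sub>L ins k = a h k"
proof (rule blinfun_eqI)
  fix v
  have "(\<Sum>k'\<in>E. a h k' (if k' = k then v else 0)) = (\<Sum>k'\<in>E. if k' = k then a h k v else 0)"
    by (intro sum.cong) (auto simp: blinfun.zero_right)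
  then show "(prj h o\<^sub>L block_op E a o\<^sub>L ins k) v = a h k v"
    using assms by (simp add: block_op_apply l2_fun_single)
qed

lemma block_op_add: "block_op E (\<lambda>h k. a h k + b h k) = block_op E a + block_op E b"
  by (simp add: block_op_def blinfun_comp_simps sum.distrib)

lemma block_op_diff: "block_op E (\<lambda>h k. a h k - b h k) = block_op E a - block_op E b"
  by (simp add: block_op_def blinfun_comp_simps sum_subtractf)

lemma block_op_zero [simp]: "block_op E (\<lambda>h k. 0) = 0"
  by (simp add: block_op_def blinfun_comp_simps)

lemma scaleC_sum: "c *\<^sub>C (\<Sum>i\<in>I. f i) = (\<Sum>i\<in>I. c *\<^sub>C f i)"
  for f :: "'i \<Rightarrow> 'h::complex_hilbert"
  by (rule linear_sum[OF bounded_linear.linear[OF bounded_linear_scaleC]])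

lemma block_op_scale:
  assumes "finite E"
  shows "block_op E (\<lambda>h k. scale_op c (a h k)) = scale_op c (block_op E a)"
  by (intro blinfun_eqI l2_eqI)
    (simp add: block_op_apply[OF assms] scale_op_apply l2_fun_scaleC scaleC_zero scaleC_sum)

lemma block_op_comp:
  assumes "finite E"
  shows "block_op E a o\<^sub>L block_op E b = block_op E (\<lambda>h l. \<Sum>k\<in>E. a h k o\<^sub>L b k l)"
proof (intro blinfun_eqI l2_eqI)
  fix \<xi> h
  have "(\<Sum>k\<in>E. a h k (\<Sum>l\<in>E. b k l (l2_fun \<xi> l))) = (\<Sum>l\<in>E. (\<Sum>k\<in>E. a h k o\<^sub>L b k l) (l2_fun \<xi> l))"
    by (simp add: blinfun.sum_right blinfun_sum_apply) (rule sum.swap)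
  then show "l2_fun ((block_op E a o\<^sub>L block_op E b) \<xi>) h
      = l2_fun (block_op E (\<lambda>h l. \<Sum>k\<in>E. a h k o\<^sub>L b k l) \<xi>) h"
    by (simp add: block_op_apply[OF assms])
qed

lemma clinear_block_op:
  "(\<And>h k. h \<in> E \<Longrightarrow> k \<in> E \<Longrightarrow> clinear_op (a h k)) \<Longrightarrow> clinear_op (block_op E a)"
  unfolding block_op_def by (intro clinear_op_sum) auto

lemma adj_block_op:
  assumes "\<And>h k. h \<in> E \<Longrightarrow> k \<in> E \<Longrightarrow> clinear_op (a h k)"
  shows "adj_op (block_op E a) = block_op E (\<lambda>h k. adj_op (a k h))"
proof -
  have adj: "adj_op (ins h o\<^sub>L T o\<^sub>L prj k) = ins k o\<^sub>L adj_op T o\<^sub>L prj h" if "clinear_op T" for h k T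
  proof (rule adj_op_unique)
    fix x y
    have "cinner ((ins h o\<^sub>L T o\<^sub>L prj k) x) y = cinner (l2_fun x k) (adj_op T (l2_fun y h))"
      by (simp add: cinner_l2_single adj_op[OF that])
    also have "\<dots> = cnj (cinner (l2_single k (adj_op T (l2_fun y h))) x)"
      by (subst cinner_commute) (simp add: cinner_l2_single)
    also have "\<dots> = cinner x ((ins k o\<^sub>L adj_op T o\<^sub>L prj h) y)"
      by (subst (2) cinner_commute) simp
    finally show "cinner ((ins h o\<^sub>L T o\<^sub>L prj k) x) y = cinner x ((ins k o\<^sub>L adj_op T o\<^sub>L prj h) y)" .
  qed (use that in simp)
  have "adj_op (block_op E a) = (\<Sum>h\<in>E. \<Sum>k\<in>E. adj_op (ins h o\<^sub>L a h k o\<^sub>L prj k))"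
    unfolding block_op_def
    by (subst adj_op_sum) (auto intro!: sum.cong adj_op_sum clinear_op_sum simp: assms)
  also have "\<dots> = (\<Sum>h\<in>E. \<Sum>k\<in>E. ins k o\<^sub>L adj_op (a h k) o\<^sub>L prj h)"
    by (intro sum.cong) (auto simp: adj assms)
  also have "\<dots> = block_op E (\<lambda>h k. adj_op (a k h))"
    unfolding block_op_def by (rule sum.swap)
  finally show ?thesis .
qed

section \<open>Amplification of a homomorphism to finite block matrices\<close>

context op_star_hom
begin

lemma hom_sum: "(\<And>i. i \<in> I \<Longrightarrow> f i \<in> D) \<Longrightarrow> (\<Sum>i\<in>I. f i) \<in> D \<and> \<theta> (\<Sum>i\<in>I. f i) = (\<Sum>i\<in>I. \<theta> (f i))"
  by (induction I rule: infinite_finite_induct) (auto simp: zero hom_zero add hom_simps)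

definition block_algebra :: "'g set \<Rightarrow> (('g, 'a) l2 \<Rightarrow>\<^sub>L ('g, 'a) l2) set" where
  "block_algebra E = {block_op E a | a. \<forall>h\<in>E. \<forall>k\<in>E. a h k \<in> D}"

text \<open>The entries are read off the operator itself, so the map involves no choice of a family
  representing the operator.\<close>

definition block_hom :: "'g set \<Rightarrow> (('g, 'a) l2 \<Rightarrow>\<^sub>L ('g, 'a) l2) \<Rightarrow> (('g, 'b) l2 \<Rightarrow>\<^sub>L ('g, 'b) l2)" where
  "block_hom E T = block_op E (\<lambda>h k. \<theta> (prj h o\<^sub>L T o\<^sub>L ins k))"

lemma block_hom_block_op:
  "finite E \<Longrightarrow> block_hom E (block_op E a) = block_op E (\<lambda>h k. \<theta> (a h k))"
  unfolding block_hom_def by (rule block_op_cong) (simp add: block_op_entry)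

text \<open>Since the amplification is again a *-homomorphism of a closed algebra, contractivity and
  kernel approximation become available for matrices with norms that are not entrywise.\<close>

lemma block_hom_star_hom:
  assumes E: "finite E"
  shows "op_star_hom (block_algebra E) (block_hom E)"
proof
  note mem = block_algebra_def
  show "clinear_op T" if "T \<in> block_algebra E" for T
    using that clinear by (auto simp: mem intro!: clinear_block_op)
  show "0 \<in> block_algebra E"
    using zero unfolding mem by (intro CollectI exI[of _ "\<lambda>h k. 0"]) simp
  have add: "S + T \<in> block_algebra E \<and> block_hom E (S + T) = block_hom E S + block_hom E T"
    if ST: "S \<in> block_algebra E" "T \<in> block_algebra E" for S T
  proof -
    obtain a where a: "S = block_op E a" "\<forall>h\<in>E. \<forall>k\<in>E. a h k \<in> D"
      using ST(1) unfolding mem by blast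
    obtain b where b: "T = block_op E b" "\<forall>h\<in>E. \<forall>k\<in>E. b h k \<in> D"
      using ST(2) unfolding mem by blast
    note ab = a b
    have "S + T = block_op E (\<lambda>h k. a h k + b h k)" by (simp add: ab block_op_add)
    moreover have "block_op E (\<lambda>h k. \<theta> (a h k + b h k)) = block_hom E S + block_hom E T"
      unfolding ab block_hom_block_op[OF E] block_op_add[symmetric]
      using ab by (intro block_op_cong) (simp add: hom_simps)
    ultimately show ?thesis using a(2) b(2) add unfolding mem by (auto simp: block_hom_block_op[OF E])
  qed
  have scale: "scale_op c S \<in> block_algebra E \<and> block_hom E (scale_op c S) = scale_op c (block_hom E S)"
    if S: "S \<in> block_algebra E" for c S
  proof -
    obtain a where a: "S = block_op E a" "\<forall>h\<in>E. \<forall>k\<in>E. a h k \<in> D" using S unfolding mem by blast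
    have "scale_op c S = block_op E (\<lambda>h k. scale_op c (a h k))" by (simp add: a block_op_scale[OF E])
    moreover have "block_op E (\<lambda>h k. \<theta> (scale_op c (a h k))) = scale_op c (block_hom E S)"
      unfolding a block_hom_block_op[OF E] block_op_scale[OF E, symmetric]
      using a by (intro block_op_cong) (simp add: hom_simps)
    ultimately show ?thesis using a(2) scale unfolding mem by (auto simp: block_hom_block_op[OF E])
  qed
  have comp: "S o\<^sub>L T \<in> block_algebra E \<and> block_hom E (S o\<^sub>L T) = block_hom E S o\<^sub>L block_hom E T"
    if ST: "S \<in> block_algebra E" "T \<in> block_algebra E" for S T
  proof -
    obtain a where a: "S = block_op E a" "\<forall>h\<in>E. \<forall>k\<in>E. a h k \<in> D"
      using ST(1) unfolding mem by blast
    obtain b where b: "T = block_op E b" "\<forall>h\<in>E. \<forall>k\<in>E. b h k \<in> D"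
      using ST(2) unfolding mem by blast
    note ab = a b
    have *: "(\<Sum>k\<in>E. a h k o\<^sub>L b k l) \<in> D \<and> \<theta> (\<Sum>k\<in>E. a h k o\<^sub>L b k l) = (\<Sum>k\<in>E. \<theta> (a h k) o\<^sub>L \<theta> (b k l))"
      if "h \<in> E" "l \<in> E" for h l
      using hom_sum[of E "\<lambda>k. a h k o\<^sub>L b k l"] a(2) b(2) that by (simp add: comp hom_simps)
    have "S o\<^sub>L T = block_op E (\<lambda>h l. \<Sum>k\<in>E. a h k o\<^sub>L b k l)" by (simp add: ab block_op_comp[OF E])
    moreover have "block_op E (\<lambda>h l. \<theta> (\<Sum>k\<in>E. a h k o\<^sub>L b k l)) = block_hom E S o\<^sub>L block_hom E T"
      unfolding ab block_hom_block_op[OF E] block_op_comp[OF E]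
      using * by (intro block_op_cong) simp
    ultimately show ?thesis using * unfolding mem by (auto simp: block_hom_block_op[OF E])
  qed
  have adj: "adj_op S \<in> block_algebra E \<and> block_hom E (adj_op S) = adj_op (block_hom E S)"
    if S: "S \<in> block_algebra E" for S
  proof -
    obtain a where a: "S = block_op E a" "\<forall>h\<in>E. \<forall>k\<in>E. a h k \<in> D" using S unfolding mem by blast
    have "adj_op S = block_op E (\<lambda>h k. adj_op (a k h))"
      unfolding a by (rule adj_block_op) (use a clinear in auto)
    moreover have "block_op E (\<lambda>h k. \<theta> (adj_op (a k h))) = adj_op (block_hom E S)"
      unfolding a block_hom_block_op[OF E]
      using a by (subst adj_block_op) (auto simp: hom_simps intro!: block_op_cong)
    ultimately show ?thesis using a(2) adj unfolding mem by (auto simp: block_hom_block_op[OF E])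
  qed
  show "S + T \<in> block_algebra E" if "S \<in> block_algebra E" "T \<in> block_algebra E" for S T
    using add that by blast
  show "scale_op c S \<in> block_algebra E" if "S \<in> block_algebra E" for c S using scale that by blast
  show "S o\<^sub>L T \<in> block_algebra E" if "S \<in> block_algebra E" "T \<in> block_algebra E" for S T
    using comp that by blast
  show "adj_op S \<in> block_algebra E" if "S \<in> block_algebra E" for S using adj that by blast
  show "closed (block_algebra E)"
    unfolding closed_sequential_limits
  proof (intro allI impI, elim conjE)
    fix X l assume X: "\<forall>n. X n \<in> block_algebra E" and l: "X \<longlonglongrightarrow> l"
    \<comment> \<open>Entries depend continuously on the operator, so a limit of block matrices is
      the block matrix of the limits of the entries.\<close>
    define c where "c T h k = (prj h o\<^sub>L T o\<^sub>L ins k :: 'a \<Rightarrow>\<^sub>L 'a)" for T :: "('c, 'a) l2 \<Rightarrow>\<^sub>L ('c, 'a) l2" and h k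
    have Xc: "X n = block_op E (c (X n)) \<and> (\<forall>h\<in>E. \<forall>k\<in>E. c (X n) h k \<in> D)" for n
    proof -
      obtain a where "X n = block_op E a" "\<forall>h\<in>E. \<forall>k\<in>E. a h k \<in> D" using X unfolding mem by blast
      then show ?thesis by (auto simp: c_def block_op_entry[OF E] intro!: block_op_cong)
    qed
    have lim: "(\<lambda>n. c (X n) h k) \<longlonglongrightarrow> c l h k" for h k
      unfolding c_def by (intro bounded_bilinear.tendsto[OF bounded_bilinear_blinfun_compose] l tendsto_const)
    then have "c l h k \<in> D" if "h \<in> E" "k \<in> E" for h k
      using closed_sequentially[OF closed, of "\<lambda>n. c (X n) h k"] Xc that by blast
    moreover have "(\<lambda>n. block_op E (c (X n))) \<longlonglongrightarrow> block_op E (c l)"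
      unfolding block_op_def
      by (intro tendsto_sum bounded_bilinear.tendsto[OF bounded_bilinear_blinfun_compose] lim tendsto_const)
    then have "X \<longlonglongrightarrow> block_op E (c l)" using Xc by simp
    then have "l = block_op E (c l)" by (rule LIMSEQ_unique[OF l])
    ultimately show "l \<in> block_algebra E" unfolding mem by blast
  qed
  have "clinear_op (block_hom E T)" if T: "T \<in> block_algebra E" for T
  proof -
    obtain a where a: "T = block_op E a" "\<forall>h\<in>E. \<forall>k\<in>E. a h k \<in> D" using T unfolding mem by blast
    show ?thesis unfolding a block_hom_block_op[OF E] using a(2) by (intro clinear_block_op) (simp add: hom_simps)
  qed
  then show "star_hom (op_algebra (block_algebra E)) (op_algebra {T. clinear_op T}) (block_hom E)"
    using add scale comp adj by (auto simp: star_hom_def op_algebra_def)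
qed

lemma norm_block_hom_le:
  assumes "finite E" "\<And>h k. h \<in> E \<Longrightarrow> k \<in> E \<Longrightarrow> a h k \<in> D"
  shows "norm (block_op E (\<lambda>h k. \<theta> (a h k))) \<le> norm (block_op E a)"
proof -
  have "block_op E a \<in> block_algebra E" using assms(2) unfolding block_algebra_def by blast
  from op_star_hom.norm_hom_le[OF block_hom_star_hom[OF assms(1)] this]
  show ?thesis by (simp add: block_hom_block_op[OF assms(1)])
qed

text \<open>The kernel of the amplification consists of the matrices with entries in the kernel of
  \<open>\<theta>\<close>, so lifting with norm control corrects all entries at once.\<close>

lemma block_kernel_approximation:
  assumes E: "finite E" and a: "\<And>h k. h \<in> E \<Longrightarrow> k \<in> E \<Longrightarrow> a h k \<in> D"
    and s: "norm (block_op E (\<lambda>h k. \<theta> (a h k))) < s"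
  shows "\<exists>n. (\<forall>h\<in>E. \<forall>k\<in>E. n h k \<in> D \<and> \<theta> (n h k) = 0) \<and> norm (block_op E (\<lambda>h k. a h k - n h k)) \<le> s"
proof -
  have "block_op E a \<in> block_algebra E" using a unfolding block_algebra_def by blast
  from op_star_hom.kernel_approximation[OF block_hom_star_hom[OF E] this, of s] s
  obtain N where N: "N \<in> block_algebra E" "block_hom E N = 0" "norm (block_op E a - N) \<le> s"
    by (auto simp: block_hom_block_op[OF E])
  obtain n where n: "N = block_op E n" "\<forall>h\<in>E. \<forall>k\<in>E. n h k \<in> D"
    using N(1) unfolding block_algebra_def by blast
  have "\<theta> (n h k) = 0" if "h \<in> E" "k \<in> E" for h k
    using block_op_entry[OF E that, of "\<lambda>h k. \<theta> (n h k)"] N(2)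
    by (simp add: n(1) block_hom_block_op[OF E] blinfun_comp_simps)
  then show ?thesis using n N(3) by (intro exI[of _ n]) (simp add: block_op_diff)
qed

end

section \<open>Roe algebras\<close>

lemma cinner_zero [simp]: "cinner x 0 = 0" "cinner 0 x = 0"
  by (simp_all add: complex_eq_iff Re_cinner Im_cinner scaleC_zero)

lemma l2_ops_clinear: "T \<in> l2_ops X \<Longrightarrow> clinear_op T"
  by (simp add: l2_ops_def)

lemma l2_ops_closed_ops:
  "0 \<in> l2_ops X"
  "S \<in> l2_ops X \<Longrightarrow> T \<in> l2_ops X \<Longrightarrow> S + T \<in> l2_ops X"
  "T \<in> l2_ops X \<Longrightarrow> scale_op c T \<in> l2_ops X"
  "S \<in> l2_ops X \<Longrightarrow> T \<in> l2_ops X \<Longrightarrow> S o\<^sub>L T \<in> l2_ops X"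
  unfolding l2_ops_iff
  by (auto simp: blinfun_comp_simps scale_op_comp comp_scale_op)
    (auto simp: blinfun_comp_assoc, metis blinfun_comp_assoc)

lemma l2_ops_adj:
  assumes "T \<in> l2_ops X"
  shows "adj_op T \<in> l2_ops X"
proof -
  have T: "clinear_op T" "restr X o\<^sub>L T = T" "T o\<^sub>L restr X = T" using assms by (auto simp: l2_ops_iff)
  have "adj_op (restr X o\<^sub>L T) = adj_op T o\<^sub>L restr X" "adj_op (T o\<^sub>L restr X) = restr X o\<^sub>L adj_op T"
    using T(1) by (simp_all add: adj_op_comp)
  then show ?thesis using T by (simp add: l2_ops_iff)
qed

lemma closed_l2_ops: "closed (l2_ops X :: (('x, 'h::complex_hilbert) l2 \<Rightarrow>\<^sub>L ('x, 'h) l2) set)"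
proof -
  have eq: "l2_ops X = {T :: ('x, 'h) l2 \<Rightarrow>\<^sub>L ('x, 'h) l2. clinear_op T} \<inter>
      ({T. restr X o\<^sub>L T = T} \<inter> {T. T o\<^sub>L restr X = T})"
    by (auto simp: l2_ops_iff)
  show ?thesis
    unfolding eq by (intro closed_Int closed_clinear_ops closed_Collect_eq
      bounded_bilinear.continuous_on[OF bounded_bilinear_blinfun_compose] continuous_intros)
qed

lemma l2_ops_apply_outside: "T \<in> l2_ops X \<Longrightarrow> x \<notin> X \<Longrightarrow> l2_fun (T \<xi>) x = 0"
  by (rule apply_eq_0) (simp add: l2_ops_def)

lemma compact_entry_add:
  "compact_op (entry S x y) \<Longrightarrow> compact_op (entry T x y) \<Longrightarrow> compact_op (entry (S + T) x y)"
  unfolding entry_blinfun blinfun_comp_simps by (rule compact_op_add)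

lemma compact_entry_scale:
  assumes "compact_op (entry T x y)"
  shows "compact_op (entry (scale_op c T) x y)"
proof -
  have "prj x o\<^sub>L scale_op c T o\<^sub>L ins y = scale_op c (prj x o\<^sub>L T o\<^sub>L ins y)"
    by (rule blinfun_eqI) (simp add: scale_op_apply l2_fun_scaleC)
  then show ?thesis
    using compact_op_scale[OF assms[unfolded entry_blinfun], of c] unfolding entry_blinfun by simp
qed

lemma compact_entry_adj:
  assumes "clinear_op T" "compact_op (entry T y x)"
  shows "compact_op (entry (adj_op T) x y)"
proof -
  have "adj_op (prj y o\<^sub>L T o\<^sub>L ins x) = prj x o\<^sub>L adj_op T o\<^sub>L ins y"
  proof (rule adj_op_unique)
    fix v w
    have "cinner ((prj x o\<^sub>L adj_op T o\<^sub>L ins y) w) v = cinner w ((prj y o\<^sub>L T o\<^sub>L ins x) v)"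
      using entry_adj[OF assms(1), of x y w v] by (simp add: entry_def)
    then show "cinner ((prj y o\<^sub>L T o\<^sub>L ins x) v) w = cinner v ((prj x o\<^sub>L adj_op T o\<^sub>L ins y) w)"
      by (metis cinner_commute)
  qed (use assms(1) in simp)
  then show ?thesis
    using compact_op_adj[OF assms(2)[unfolded entry_blinfun]] unfolding entry_blinfun by simp
qed

lemma compact_entry:
  assumes "compact_op (blinfun_apply K)"
  shows "compact_op (entry K x y)"
  unfolding entry_blinfun by (intro compact_op_comp_left compact_op_comp_right assms) auto

lemma op_star_algebra_closure:
  assumes clinear: "\<And>T. T \<in> D0 \<Longrightarrow> clinear_op T" and zero: "0 \<in> D0"
    and add: "\<And>S T. S \<in> D0 \<Longrightarrow> T \<in> D0 \<Longrightarrow> S + T \<in> D0"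
    and scale: "\<And>c T. T \<in> D0 \<Longrightarrow> scale_op c T \<in> D0"
    and comp: "\<And>S T. S \<in> D0 \<Longrightarrow> T \<in> D0 \<Longrightarrow> S o\<^sub>L T \<in> D0"
    and adj: "\<And>T. T \<in> D0 \<Longrightarrow> adj_op T \<in> D0"
  shows "op_star_algebra (closure D0)"
proof
  have lim: "\<exists>X. (\<forall>n. X n \<in> D0) \<and> X \<longlonglongrightarrow> T" if "T \<in> closure D0" for T
    using that closure_sequential by blast
  show "clinear_op T" if "T \<in> closure D0" for T
    using closure_minimal[OF _ closed_clinear_ops, of D0] that clinear by blast
  then have clin: "clinear_op T" if "T \<in> closure D0" for T using that by blast
  show "0 \<in> closure D0" using zero closure_subset[of D0] by blast
  show "S + T \<in> closure D0" if "S \<in> closure D0" "T \<in> closure D0" for S T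
  proof -
    obtain X Y where "\<forall>n. X n \<in> D0" "X \<longlonglongrightarrow> S" "\<forall>n. Y n \<in> D0" "Y \<longlonglongrightarrow> T"
      using lim \<open>S \<in> closure D0\<close> \<open>T \<in> closure D0\<close> by metis
    then have "\<forall>n. X n + Y n \<in> D0" "(\<lambda>n. X n + Y n) \<longlonglongrightarrow> S + T"
      using add by (auto intro: tendsto_add)
    then show ?thesis unfolding closure_sequential by (intro exI conjI)
  qed
  show "S o\<^sub>L T \<in> closure D0" if "S \<in> closure D0" "T \<in> closure D0" for S T
  proof -
    obtain X Y where "\<forall>n. X n \<in> D0" "X \<longlonglongrightarrow> S" "\<forall>n. Y n \<in> D0" "Y \<longlonglongrightarrow> T"
      using lim \<open>S \<in> closure D0\<close> \<open>T \<in> closure D0\<close> by metis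
    then have "\<forall>n. X n o\<^sub>L Y n \<in> D0" "(\<lambda>n. X n o\<^sub>L Y n) \<longlonglongrightarrow> (S o\<^sub>L T)"
      using comp by (auto intro: bounded_bilinear.tendsto[OF bounded_bilinear_blinfun_compose])
    then show ?thesis unfolding closure_sequential by (intro exI conjI)
  qed
  show "scale_op c T \<in> closure D0" if T: "T \<in> closure D0" for c T
  proof -
    obtain X where X: "\<forall>n. X n \<in> D0" "X \<longlonglongrightarrow> T" using lim T by blast
    have "(\<lambda>n. scale_op c (X n)) \<longlonglongrightarrow> scale_op c T"
      using bounded_bilinear.tendsto[OF bounded_bilinear_blinfun_compose tendsto_const X(2), of "scale_op c id_blinfun"]
      by (simp add: scale_op_comp)
    moreover have "\<forall>n. scale_op c (X n) \<in> D0" using X scale by blast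
    ultimately show ?thesis unfolding closure_sequential by (intro exI conjI)
  qed
  show "adj_op T \<in> closure D0" if T: "T \<in> closure D0" for T
  proof -
    obtain X where X: "\<forall>n. X n \<in> D0" "X \<longlonglongrightarrow> T" using lim T by blast
    then have "\<forall>n. adj_op (X n) \<in> D0" "(\<lambda>n. adj_op (X n)) \<longlonglongrightarrow> adj_op T"
      using adj clinear clin[OF T] by (auto intro!: tendsto_adj_op)
    then show ?thesis unfolding closure_sequential by (intro exI conjI)
  qed
qed simp

section \<open>Operators of finite propagation on a space of bounded geometry\<close>

locale bg_space = Metric_space X d for X :: "'x set" and d +
  assumes bounded_geometry: "bounded_geometry X d"
begin

text \<open>Closed balls, matching propagation bounds stated as \<open>d x y > R\<close>; the
  bounded geometry condition for the open ball of a slightly larger radius controls them.\<close>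

definition nbhd :: "'x \<Rightarrow> real \<Rightarrow> 'x set" where
  "nbhd x R = {y \<in> X. d x y \<le> R}"

lemma nbhd_bound: "\<exists>N::nat. \<forall>x\<in>X. finite (nbhd x R) \<and> card (nbhd x R) \<le> N"
proof -
  have "\<bar>R\<bar> + 1 > 0" by simp
  with bounded_geometry obtain N :: nat where
    N: "\<forall>x\<in>X. finite (mball x (\<bar>R\<bar> + 1)) \<and> card (mball x (\<bar>R\<bar> + 1)) \<le> N"
    unfolding bounded_geometry_def by blast
  have "nbhd x R \<subseteq> mball x (\<bar>R\<bar> + 1)" if "x \<in> X" for x
    using that by (auto simp: nbhd_def mball_def)
  then show ?thesis using N by (meson card_mono finite_subset order_trans)
qed

lemma finite_nbhd: "x \<in> X \<Longrightarrow> finite (nbhd x R)"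
  using nbhd_bound by blast

lemma finite_mbounded:
  assumes "mbounded K"
  shows "finite K"
proof (cases "K = {}")
  case False
  then obtain x where x: "x \<in> K" by blast
  with assms obtain B where "K \<subseteq> nbhd x B" "x \<in> X"
    by (auto simp: mbounded_alt nbhd_def)
  then show ?thesis using finite_nbhd finite_subset by metis
qed simp

text \<open>A normal form for computations: entries vanish off \<open>X\<close>, so the quantifiers
  can range over the whole type, and the strict inequality makes propagations add under
  composition.\<close>

lemma finite_propagation_iff:
  "T \<in> finite_propagation_ops X d \<longleftrightarrow> T \<in> l2_ops X \<and> (\<forall>x y. compact_op (entry T x y)) \<and>
    (\<exists>R\<ge>0. \<forall>x y. d x y > R \<longrightarrow> entry T x y = (\<lambda>_. 0))"
proof
  assume T: "T \<in> finite_propagation_ops X d"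
  then have l2: "T \<in> l2_ops X" by (simp add: finite_propagation_ops_def)
  then have out: "entry T x y = (\<lambda>_. 0)" if "x \<notin> X \<or> y \<notin> X" for x y using that by (simp add: l2_ops_def)
  obtain R where R: "R > 0" "\<And>x y. x \<in> X \<Longrightarrow> y \<in> X \<Longrightarrow> d x y \<ge> R \<Longrightarrow> entry T x y = (\<lambda>_. 0)"
    using T unfolding finite_propagation_ops_def by blast
  have "compact_op (entry T x y)" for x y
    using T out[of x y] by (cases "x \<in> X \<and> y \<in> X") (auto simp: finite_propagation_ops_def)
  moreover have "entry T x y = (\<lambda>_. 0)" if "d x y > R" for x y
    using out[of x y] R(2)[of x y] that by (cases "x \<in> X \<and> y \<in> X") auto
  ultimately show "T \<in> l2_ops X \<and> (\<forall>x y. compact_op (entry T x y)) \<and>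
    (\<exists>R\<ge>0. \<forall>x y. d x y > R \<longrightarrow> entry T x y = (\<lambda>_. 0))" using l2 R(1) by (meson less_imp_le)
next
  assume T: "T \<in> l2_ops X \<and> (\<forall>x y. compact_op (entry T x y)) \<and>
    (\<exists>R\<ge>0. \<forall>x y. d x y > R \<longrightarrow> entry T x y = (\<lambda>_. 0))"
  then obtain R where R: "R \<ge> 0" "\<forall>x y. d x y > R \<longrightarrow> entry T x y = (\<lambda>_. 0)" by blast
  \<comment> \<open>The shift by one turns the strict condition into the weak one and makes the
    radius positive when \<open>R = 0\<close>.\<close>
  have "\<forall>x\<in>X. \<forall>y\<in>X. d x y \<ge> R + 1 \<longrightarrow> entry T x y = (\<lambda>_. 0)" using R(2) by simp
  then show "T \<in> finite_propagation_ops X d"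
    unfolding finite_propagation_ops_def using T R(1)
    by (intro CollectI conjI exI[of _ "R + 1"]) auto
qed

lemma finite_propagation_clinear: "T \<in> finite_propagation_ops X d \<Longrightarrow> clinear_op T"
  by (simp add: finite_propagation_iff l2_ops_def)

lemma apply_propagation:
  assumes T: "T \<in> l2_ops X" "\<And>x y. d x y > R \<Longrightarrow> entry T x y = (\<lambda>_. 0)" and x: "x \<in> X"
  shows "l2_fun (T \<xi>) x = (\<Sum>y\<in>nbhd x R. entry T x y (l2_fun \<xi> y))"
proof (rule apply_finite_row[OF finite_nbhd[OF x]])
  fix y assume y: "y \<notin> nbhd x R"
  show "entry T x y = (\<lambda>_. 0)"
    using T(1) T(2)[of x y] y x by (cases "y \<in> X") (auto simp: l2_ops_def nbhd_def)
qed

lemma finite_propagation_0: "0 \<in> finite_propagation_ops X d"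
proof -
  have "entry 0 x y = (\<lambda>_. 0)" for x y :: 'x by (auto simp: entry_def l2_fun_simps)
  then show ?thesis by (auto simp: finite_propagation_iff l2_ops_closed_ops)
qed

lemma finite_propagation_add:
  assumes "S \<in> finite_propagation_ops X d" "T \<in> finite_propagation_ops X d"
  shows "S + T \<in> finite_propagation_ops X d"
proof -
  obtain R where R: "R \<ge> 0" "\<And>x y. d x y > R \<Longrightarrow> entry S x y = (\<lambda>_. 0)"
    using assms(1) by (auto simp: finite_propagation_iff)
  obtain R' where R': "R' \<ge> 0" "\<And>x y. d x y > R' \<Longrightarrow> entry T x y = (\<lambda>_. 0)"
    using assms(2) by (auto simp: finite_propagation_iff)
  have "entry (S + T) x y = (\<lambda>_. 0)" if "d x y > max R R'" for x y
    using R(2)[of x y] R'(2)[of x y] that by (auto simp: entry_def fun_eq_iff blinfun.add_left l2_fun_simps)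
  then have "\<exists>R\<ge>0. \<forall>x y. d x y > R \<longrightarrow> entry (S + T) x y = (\<lambda>_. 0)"
    using R(1) by (intro exI[of _ "max R R'"]) auto
  then show ?thesis
    using assms by (simp add: finite_propagation_iff l2_ops_closed_ops compact_entry_add)
qed

lemma finite_propagation_scale:
  assumes "T \<in> finite_propagation_ops X d"
  shows "scale_op c T \<in> finite_propagation_ops X d"
proof -
  obtain R where R: "R \<ge> 0" "\<And>x y. d x y > R \<Longrightarrow> entry T x y = (\<lambda>_. 0)"
    using assms by (auto simp: finite_propagation_iff)
  have "entry (scale_op c T) x y = (\<lambda>_. 0)" if "d x y > R" for x y
    using R(2)[of x y] that by (auto simp: entry_def fun_eq_iff scale_op_apply l2_fun_scaleC scaleC_zero)
  then have "\<exists>R\<ge>0. \<forall>x y. d x y > R \<longrightarrow> entry (scale_op c T) x y = (\<lambda>_. 0)" using R(1) by blast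
  then show ?thesis
    using assms by (simp add: finite_propagation_iff l2_ops_closed_ops compact_entry_scale)
qed

lemma finite_propagation_adj:
  assumes "T \<in> finite_propagation_ops X d"
  shows "adj_op T \<in> finite_propagation_ops X d"
proof -
  note T = finite_propagation_clinear[OF assms]
  obtain R where R: "R \<ge> 0" "\<And>x y. d x y > R \<Longrightarrow> entry T x y = (\<lambda>_. 0)"
    using assms by (auto simp: finite_propagation_iff)
  have "entry (adj_op T) x y = (\<lambda>_. 0)" if "d x y > R" for x y
  proof
    fix v
    have "cinner w (entry (adj_op T) x y v) = cinner w 0" for w
    proof -
      have "cinner (entry (adj_op T) x y v) w = cinner v 0"
        using R(2)[of y x] that by (simp add: entry_adj[OF T] commute)
      then show ?thesis by (metis cinner_commute cinner_zero complex_cnj_zero)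
    qed
    then show "entry (adj_op T) x y v = 0" by (rule cinner_right_eqI)
  qed
  then have "\<exists>R\<ge>0. \<forall>x y. d x y > R \<longrightarrow> entry (adj_op T) x y = (\<lambda>_. 0)" using R(1) by blast
  then show ?thesis
    using assms by (simp add: finite_propagation_iff l2_ops_adj compact_entry_adj T)
qed

text \<open>By bounded geometry a row of \<open>S\<close> has finitely many nonzero entries, so each
  entry of the product is a finite sum of compact operators; the triangle inequality adds the
  propagations.\<close>

lemma finite_propagation_comp:
  assumes "S \<in> finite_propagation_ops X d" "T \<in> finite_propagation_ops X d"
  shows "S o\<^sub>L T \<in> finite_propagation_ops X d"
proof -
  have S: "S \<in> l2_ops X" and T: "T \<in> l2_ops X" using assms by (auto simp: finite_propagation_iff)
  obtain R where R: "R \<ge> 0" "\<And>x y. d x y > R \<Longrightarrow> entry S x y = (\<lambda>_. 0)"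
    using assms(1) by (auto simp: finite_propagation_iff)
  obtain R' where R': "R' \<ge> 0" "\<And>x y. d x y > R' \<Longrightarrow> entry T x y = (\<lambda>_. 0)"
    using assms(2) by (auto simp: finite_propagation_iff)
  have ent: "prj x o\<^sub>L (S o\<^sub>L T) o\<^sub>L ins y
      = (\<Sum>z\<in>nbhd x R. (prj x o\<^sub>L S o\<^sub>L ins z) o\<^sub>L (prj z o\<^sub>L T o\<^sub>L ins y))" if "x \<in> X" for x y
  proof (rule blinfun_eqI)
    fix v
    show "(prj x o\<^sub>L (S o\<^sub>L T) o\<^sub>L ins y) v
        = (\<Sum>z\<in>nbhd x R. (prj x o\<^sub>L S o\<^sub>L ins z) o\<^sub>L (prj z o\<^sub>L T o\<^sub>L ins y)) v"
      using apply_propagation[OF S R(2) that, where \<xi> = "T (l2_single y v)"]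
      by (simp add: blinfun_sum_apply entry_def)
  qed
  have "compact_op (entry (S o\<^sub>L T) x y)" for x y
  proof (cases "x \<in> X")
    case True
    have "compact_op (blinfun_apply (prj x o\<^sub>L S o\<^sub>L ins z))" for z
      using assms(1) unfolding finite_propagation_iff entry_blinfun by blast
    moreover have "clinear_op (prj z o\<^sub>L T o\<^sub>L ins y)" for z using l2_ops_clinear[OF T] by simp
    ultimately show ?thesis
      unfolding entry_blinfun ent[OF True] by (intro compact_op_sum) (rule compact_op_comp_right)
  next
    case False
    then have "entry (S o\<^sub>L T) x y = (\<lambda>_. 0)"
      using l2_ops_closed_ops(4)[OF S T] by (simp add: l2_ops_def)
    then show ?thesis by simp
  qed
  moreover have "entry (S o\<^sub>L T) x y = (\<lambda>_. 0)" if xy: "d x y > R + R'" for x y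
  proof (cases "x \<in> X \<and> y \<in> X")
    case True
    have "entry T z y = (\<lambda>_. 0)" if "z \<in> nbhd x R" for z
      using that xy True triangle[of x z y] by (intro R'(2)) (auto simp: nbhd_def)
    then have "l2_fun (T (l2_single y v)) z = 0" if "z \<in> nbhd x R" for z v
      using that by (metis entry_def)
    then show ?thesis
      using True by (auto simp: entry_def fun_eq_iff apply_propagation[OF S R(2)] blinfun.zero_right l2_fun_simps)
  next
    case False
    then show ?thesis using l2_ops_closed_ops(4)[OF S T] by (auto simp: l2_ops_def)
  qed
  then have "\<exists>R\<ge>0. \<forall>x y. d x y > R \<longrightarrow> entry (S o\<^sub>L T) x y = (\<lambda>_. 0)"
    using R(1) R'(1) by (intro exI[of _ "R + R'"]) auto
  ultimately show ?thesis
    using S T by (simp add: finite_propagation_iff l2_ops_closed_ops)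
qed

lemma roe_ops_star_algebra: "op_star_algebra (roe_ops X d)"
  unfolding roe_ops_def
  by (rule op_star_algebra_closure)
    (auto intro: finite_propagation_clinear finite_propagation_0 finite_propagation_add
      finite_propagation_scale finite_propagation_comp finite_propagation_adj)

lemma roe_ops_subset_l2_ops: "roe_ops X d \<subseteq> l2_ops X"
  unfolding roe_ops_def by (rule closure_minimal[OF _ closed_l2_ops]) (auto simp: finite_propagation_iff)

text \<open>A compact operator is a norm limit of truncations to finite sets, and these have finite
  propagation because a finite set has finite diameter.\<close>

lemma compact_ops_subset_roe_ops: "compact_ops X \<subseteq> roe_ops X d"
proof
  fix K assume "K \<in> compact_ops X"
  then have K: "K \<in> l2_ops X" "compact_op (blinfun_apply K)" by (auto simp: compact_ops_def)
  show "K \<in> roe_ops X d"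
    unfolding roe_ops_def closure_approachable
  proof (intro allI impI)
    fix e :: real assume "e > 0"
    then obtain B where B: "finite B" "norm (K - (restr B o\<^sub>L K o\<^sub>L restr B)) \<le> e/2"
      using compact_op_approximation[OF K(2), of "e/2"] by auto
    let ?T = "restr B o\<^sub>L K o\<^sub>L restr B"
    have ent: "entry ?T x y = (if x \<in> B \<and> y \<in> B then entry K x y else (\<lambda>_. 0))" for x y
      by (auto simp: entry_restr blinfun_comp_assoc)
    have "?T \<in> l2_ops X" using K(1) by (auto simp: l2_ops_def ent)
    moreover have "compact_op (entry ?T x y)" for x y
      unfolding ent using compact_entry[OF K(2)] by simp
    moreover have "\<exists>R\<ge>0. \<forall>x y. d x y > R \<longrightarrow> entry ?T x y = (\<lambda>_. 0)"
    proof -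
      \<comment> \<open>A crude bound for the diameter of \<open>B\<close> that needs no case
        distinction for empty \<open>B\<close>.\<close>
      define R where "R = (\<Sum>x\<in>B. \<Sum>y\<in>B. d x y)"
      have "d x y \<le> R" if "x \<in> B" "y \<in> B" for x y
      proof -
        have "d x y \<le> (\<Sum>y\<in>B. d x y)" using B that by (intro member_le_sum) auto
        also have "\<dots> \<le> R" unfolding R_def using B that by (intro member_le_sum sum_nonneg) auto
        finally show ?thesis .
      qed
      moreover have "R \<ge> 0" unfolding R_def by (intro sum_nonneg) auto
      ultimately show ?thesis unfolding ent by (intro exI[of _ R]) (auto simp: not_le[symmetric])
    qed
    ultimately have "?T \<in> finite_propagation_ops X d" by (simp add: finite_propagation_iff)
    moreover have "dist ?T K < e" using B(2) \<open>e > 0\<close> by (simp add: dist_norm norm_minus_commute)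
    ultimately show "\<exists>T\<in>finite_propagation_ops X d. dist T K < e" by blast
  qed
qed

end

lemma compact_ops_ideal:
  "0 \<in> compact_ops X"
  "S \<in> compact_ops X \<Longrightarrow> T \<in> compact_ops X \<Longrightarrow> S + T \<in> compact_ops X"
  "T \<in> compact_ops X \<Longrightarrow> scale_op c T \<in> compact_ops X"
  "K \<in> compact_ops X \<Longrightarrow> T \<in> l2_ops X \<Longrightarrow> K o\<^sub>L T \<in> compact_ops X"
  "K \<in> compact_ops X \<Longrightarrow> T \<in> l2_ops X \<Longrightarrow> T o\<^sub>L K \<in> compact_ops X"
  "K \<in> compact_ops X \<Longrightarrow> adj_op K \<in> compact_ops X"
  by (auto simp: compact_ops_def l2_ops_closed_ops compact_op_add compact_op_scale l2_ops_clinear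
      intro: l2_ops_adj compact_op_adj compact_op_comp_left compact_op_comp_right)

lemma closed_compact_ops_space:
  "closed (compact_ops X :: (('x, 'h::complex_hilbert) l2 \<Rightarrow>\<^sub>L ('x, 'h) l2) set)"
proof -
  have eq: "compact_ops X = l2_ops X \<inter> {K :: ('x, 'h) l2 \<Rightarrow>\<^sub>L ('x, 'h) l2. compact_op (blinfun_apply K)}"
    by (auto simp: compact_ops_def)
  show ?thesis unfolding eq by (intro closed_Int closed_l2_ops closed_compact_ops)
qed

text \<open>Replaces the representation of the quotient by a homomorphism \<open>\<theta>\<close> of
  \<open>D\<close> with kernel \<open>K\<close>, so that the general results on operator algebras
  apply and cosets can be left behind.\<close>

lemma quotient_representation:
  fixes D K :: "('a::complex_hilbert \<Rightarrow>\<^sub>L 'a) set"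
    and \<pi> :: "('a \<Rightarrow>\<^sub>L 'a) set \<Rightarrow> ('b::complex_hilbert \<Rightarrow>\<^sub>L 'b)"
  assumes D: "op_star_algebra D" and KD: "K \<subseteq> D" and K0: "0 \<in> K"
    and K_add: "\<And>S T. S \<in> K \<Longrightarrow> T \<in> K \<Longrightarrow> S + T \<in> K"
    and K_scale: "\<And>c T. T \<in> K \<Longrightarrow> scale_op c T \<in> K"
    and K_comp: "\<And>S T. S \<in> K \<Longrightarrow> T \<in> D \<Longrightarrow> S o\<^sub>L T \<in> K" "\<And>S T. S \<in> K \<Longrightarrow> T \<in> D \<Longrightarrow> T o\<^sub>L S \<in> K"
    and K_adj: "\<And>T. T \<in> K \<Longrightarrow> adj_op T \<in> K"
    and \<pi>: "faithful_rep (quotient_algebra (op_algebra D) K) \<pi>"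
  defines "\<theta> \<equiv> \<lambda>T. \<pi> (ideal_coset (op_algebra D) K T)"
  shows "op_star_hom D \<theta>" and "\<And>T. T \<in> D \<Longrightarrow> \<theta> T = 0 \<longleftrightarrow> T \<in> K"
    and "\<And>S T. S - T \<in> K \<Longrightarrow> ideal_coset (op_algebra D) K S = ideal_coset (op_algebra D) K T"
proof -
  interpret op_star_algebra D by (rule D)
  define cs where "cs = ideal_coset (op_algebra D) K"
  have cs: "cs T = (+) T ` K" for T by (simp add: cs_def ideal_coset_def op_algebra_def)
  have K_neg: "- T \<in> K" if "T \<in> K" for T
    using K_scale[OF that, of "complex_of_real (-1)"] unfolding scale_op_of_real by simp
  have cs_sub: "cs S \<subseteq> cs T" if "S - T \<in> K" for S T
  proof
    fix x assume "x \<in> cs S"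
    then obtain k where "k \<in> K" "x = S + k" by (auto simp: cs)
    then have "x = T + ((S - T) + k)" "(S - T) + k \<in> K" using K_add[OF that] by auto
    then show "x \<in> cs T" unfolding cs by blast
  qed
  show cs_eq: "ideal_coset (op_algebra D) K S = ideal_coset (op_algebra D) K T" if "S - T \<in> K" for S T
    using cs_sub[OF that] cs_sub[of T S] K_neg[OF that] by (simp add: cs_def)
  have self: "T \<in> cs T" for T using K0 unfolding cs by (metis add.right_neutral imageI)
  have UN_const: "(\<Union>a\<in>cs S. C a) = C0" if "\<And>a. a \<in> cs S \<Longrightarrow> C a = C0" for S and C :: "_ \<Rightarrow> ('a \<Rightarrow>\<^sub>L 'a) set" and C0
  proof -
    have "(\<Union>a\<in>cs S. C a) = (\<Union>a\<in>cs S. C0)" by (intro SUP_cong refl that)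
    also have "cs S \<noteq> {}" using self by blast
    then have "(\<Union>a\<in>cs S. C0) = C0" by simp
    finally show ?thesis .
  qed
  \<comment> \<open>The quotient operations are unions over all representatives. When the class of
    the result does not depend on the representative, all sets in the union coincide.\<close>
  have UN_eq: "(\<Union>a\<in>cs S. cs (f a)) = cs (f S)" if *: "\<And>k. k \<in> K \<Longrightarrow> f (S + k) - f S \<in> K" for S f
    by (rule UN_const) (auto simp: cs[of S] intro!: cs_eq[folded cs_def] *)
  have UN_eq2: "(\<Union>a\<in>cs S. \<Union>b\<in>cs T. cs (f a b)) = cs (f S T)"
    if *: "\<And>k l. k \<in> K \<Longrightarrow> l \<in> K \<Longrightarrow> f (S + k) (T + l) - f S T \<in> K" for S T f
    by (rule UN_const, rule UN_const) (auto simp: cs[of S] cs[of T] intro!: cs_eq[folded cs_def] *)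
  let ?A = "quotient_algebra (op_algebra D) K"
  have A: "elts ?A = cs ` D"
    "sadd ?A C C' = (\<Union>a\<in>C. \<Union>b\<in>C'. cs (a + b))"
    "sscale ?A c C = (\<Union>a\<in>C. cs (scale_op c a))"
    "smult ?A C C' = (\<Union>a\<in>C. \<Union>b\<in>C'. cs (a o\<^sub>L b))"
    "sstar ?A C = (\<Union>a\<in>C. cs (adj_op a))" for C C' c
    by (simp_all add: quotient_algebra_def op_algebra_def cs_def)
  have A_cs: "sadd ?A (cs S) (cs T) = cs (S + T)" "sscale ?A c (cs S) = cs (scale_op c S)"
    "smult ?A (cs S) (cs T) = cs (S o\<^sub>L T)" "sstar ?A (cs S) = cs (adj_op S)"
    if ST: "S \<in> D" "T \<in> D" for S T c
  proof -
    show "sadd ?A (cs S) (cs T) = cs (S + T)"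
      unfolding A by (rule UN_eq2) (simp add: K_add)
    show "sscale ?A c (cs S) = cs (scale_op c S)"
      unfolding A by (rule UN_eq) (simp add: scale_op_add_right K_scale)
    show "smult ?A (cs S) (cs T) = cs (S o\<^sub>L T)"
      unfolding A
    proof (rule UN_eq2)
      fix k l assume kl: "k \<in> K" "l \<in> K"
      have "((S + k) o\<^sub>L (T + l)) - (S o\<^sub>L T) = (S o\<^sub>L l) + ((k o\<^sub>L T) + (k o\<^sub>L l))"
        by (simp add: blinfun_comp_simps)
      moreover have "l \<in> D" using kl KD by blast
      ultimately show "((S + k) o\<^sub>L (T + l)) - (S o\<^sub>L T) \<in> K"
        using K_add[OF K_comp(2)[OF kl(2) ST(1)] K_add[OF K_comp(1)[OF kl(1) ST(2)] K_comp(1)[OF kl(1)]]]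
        by simp
    qed
    show "sstar ?A (cs S) = cs (adj_op S)"
      unfolding A
    proof (rule UN_eq)
      fix k assume "k \<in> K"
      then have "clinear_op k" "clinear_op S" using KD ST clinear by auto
      then show "adj_op (S + k) - adj_op S \<in> K" using \<open>k \<in> K\<close> by (simp add: adj_op_add K_adj)
    qed
  qed
  have hom: "star_hom ?A (op_algebra {T. clinear_op T}) \<pi>" and inj: "inj_on \<pi> (elts ?A)"
    using \<pi> by (auto simp: faithful_rep_def)
  have \<theta>: "\<theta> T = \<pi> (cs T)" for T by (simp add: \<theta>_def cs_def)
  have hom': "clinear_op (\<theta> S)" "\<theta> (S + T) = \<theta> S + \<theta> T" "\<theta> (scale_op c S) = scale_op c (\<theta> S)"
    "\<theta> (S o\<^sub>L T) = \<theta> S o\<^sub>L \<theta> T" "\<theta> (adj_op S) = adj_op (\<theta> S)" if "S \<in> D" "T \<in> D" for S T c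
  proof -
    have mem: "cs S \<in> elts ?A" "cs T \<in> elts ?A" using that by (auto simp: A)
    show "clinear_op (\<theta> S)" using hom mem(1) unfolding star_hom_def \<theta> by (auto simp: op_algebra_def)
    show "\<theta> (S + T) = \<theta> S + \<theta> T" "\<theta> (scale_op c S) = scale_op c (\<theta> S)"
      "\<theta> (S o\<^sub>L T) = \<theta> S o\<^sub>L \<theta> T" "\<theta> (adj_op S) = adj_op (\<theta> S)"
      using hom mem unfolding star_hom_def \<theta> A_cs(1,3,4)[OF that, symmetric] A_cs(2)[OF that, of c, symmetric]
      by (simp_all add: op_algebra_def)
  qed
  show th: "op_star_hom D \<theta>"
    by unfold_locales (use hom' zero in \<open>auto simp: star_hom_def op_algebra_def\<close>)
  show "\<theta> T = 0 \<longleftrightarrow> T \<in> K" if "T \<in> D" for T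
  proof
    assume "\<theta> T = 0"
    then have "\<pi> (cs T) = \<pi> (cs 0)" using op_star_hom.hom_zero[OF th] by (simp add: \<theta>)
    then have "cs T = cs 0" using inj that zero by (auto simp: A inj_on_def)
    then have "T \<in> cs 0" using self by metis
    then show "T \<in> K" by (auto simp: cs)
  next
    assume "T \<in> K"
    then have "cs T = cs 0" unfolding cs_def by (intro cs_eq) simp
    then show "\<theta> T = 0" using op_star_hom.hom_zero[OF th] by (simp add: \<theta>)
  qed
qed

section \<open>Group actions by permutation operators\<close>

context group_action
begin

definition perm :: "'a \<Rightarrow> ('c, 'h::complex_hilbert) l2 \<Rightarrow>\<^sub>L ('c, 'h) l2" where
  "perm g = perm_op E (\<phi> g)"

lemma group_G: "group G"
  using group_hom by (simp add: group_hom_def)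

lemma inv_closed [simp]: "g \<in> carrier G \<Longrightarrow> inv g \<in> carrier G"
  by (rule group.inv_closed[OF group_G])

lemma m_closed [simp]: "g \<in> carrier G \<Longrightarrow> h \<in> carrier G \<Longrightarrow> g \<otimes> h \<in> carrier G"
  using group_G by (simp add: group.is_monoid monoid.m_closed)

lemma one_closed [simp]: "\<one> \<in> carrier G"
  using group_G by (simp add: group.is_monoid monoid.one_closed)

lemma action_closed [simp]: "g \<in> carrier G \<Longrightarrow> x \<in> E \<Longrightarrow> \<phi> g x \<in> E"
  by (rule element_image) auto

lemma action_one [simp]: "x \<in> E \<Longrightarrow> \<phi> \<one> x = x"
  using id_eq_one by (metis restrict_apply')

lemma action_inv [simp]:
  "g \<in> carrier G \<Longrightarrow> x \<in> E \<Longrightarrow> \<phi> (inv g) (\<phi> g x) = x"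
  "g \<in> carrier G \<Longrightarrow> x \<in> E \<Longrightarrow> \<phi> g (\<phi> (inv g) x) = x"
proof -
  show 1: "\<phi> (inv g) (\<phi> g x) = x" if "g \<in> carrier G" "x \<in> E" for g x
    using composition_rule[of x "inv g" g] that group.l_inv[OF group_G] by simp
  show "g \<in> carrier G \<Longrightarrow> x \<in> E \<Longrightarrow> \<phi> g (\<phi> (inv g) x) = x"
    using composition_rule[of x g "inv g"] group.r_inv[OF group_G] by simp
qed

lemma action_bij: "g \<in> carrier G \<Longrightarrow> bij_betw (\<phi> g) E E"
  by (rule bij_betw_byWitness[where f' = "\<phi> (inv g)"]) auto

lemma perm_apply:
  assumes g: "g \<in> carrier G"
  shows "l2_fun (perm g \<xi>) x = (if x \<in> E then l2_fun \<xi> (\<phi> (inv g) x) else 0)"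
proof -
  have b: "bij_betw (\<phi> g) E E" by (rule action_bij[OF g])
  have "inv_into E (\<phi> g) x = \<phi> (inv g) x" if "x \<in> E"
    using bij_betw_imp_inj_on[OF b] that g by (metis action_closed action_inv(2) inv_into_f_f inv_closed)
  then show ?thesis unfolding perm_def perm_op_apply[OF b] by simp
qed

lemma perm_in_l2_ops: "g \<in> carrier G \<Longrightarrow> perm g \<in> l2_ops E"
  unfolding perm_def by (rule perm_op_in_l2_ops[OF action_bij])

lemma perm_clinear [simp]: "g \<in> carrier G \<Longrightarrow> clinear_op (perm g)"
  using perm_in_l2_ops l2_ops_clinear by blast

lemma perm_comp: "g \<in> carrier G \<Longrightarrow> h \<in> carrier G \<Longrightarrow> perm g o\<^sub>L perm h = perm (g \<otimes> h)"
  by (intro blinfun_eqI l2_eqI) (simp add: perm_apply composition_rule group.inv_mult_group[OF group_G])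

lemma perm_perm: "g \<in> carrier G \<Longrightarrow> h \<in> carrier G \<Longrightarrow> perm g (perm h \<xi>) = perm (g \<otimes> h) \<xi>"
  by (simp flip: perm_comp)

text \<open>Vectors are functions on the whole type, so the unit acts as the projection onto
  functions supported in \<open>E\<close>, and products that would cancel for unitaries leave this
  projection behind.\<close>

lemma perm_one: "perm \<one> = restr E"
  by (intro blinfun_eqI l2_eqI) (simp add: perm_apply monoid.inv_one[OF group.is_monoid[OF group_G]])

lemma perm_inv_perm [simp]:
  "g \<in> carrier G \<Longrightarrow> perm (inv g) (perm g \<xi>) = restr E \<xi>"
  "g \<in> carrier G \<Longrightarrow> perm g (perm (inv g) \<xi>) = restr E \<xi>"
  by (simp_all add: perm_perm perm_one group.l_inv[OF group_G] group.r_inv[OF group_G])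

lemma perm_restr [simp]:
  "g \<in> carrier G \<Longrightarrow> perm g (restr E \<xi>) = perm g \<xi>"
  "g \<in> carrier G \<Longrightarrow> restr E (perm g \<xi>) = perm g \<xi>"
  by (rule l2_eqI; simp add: perm_apply)+

lemma adj_perm:
  assumes g: "g \<in> carrier G"
  shows "adj_op (perm g) = perm (inv g)"
proof (rule adj_op_unique)
  fix \<xi> \<eta> :: "('c, 'h::complex_hilbert) l2"
  have "cinner (perm g \<xi>) \<eta> = (\<Sum>\<^sub>\<infinity>x\<in>E. cinner (l2_fun \<xi> (\<phi> (inv g) x)) (l2_fun \<eta> x))"
    unfolding cinner_l2_def by (rule infsum_cong_neutral) (auto simp: perm_apply[OF g])
  also have "\<dots> = (\<Sum>\<^sub>\<infinity>x\<in>E. cinner (l2_fun \<xi> x) (l2_fun \<eta> (\<phi> g x)))"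
    by (subst infsum_reindex_bij_betw[OF action_bij[OF g], symmetric]) (auto intro: infsum_cong simp: g)
  also have "\<dots> = cinner \<xi> (perm (inv g) \<eta>)"
    unfolding cinner_l2_def using g
    by (intro infsum_cong_neutral) (auto simp: perm_apply group.inv_inv[OF group_G])
  finally show "cinner (perm g \<xi>) \<eta> = cinner \<xi> (perm (inv g) \<eta>)" .
qed (use g in simp)

lemma norm_perm_apply:
  assumes g: "g \<in> carrier G"
  shows "norm (perm g \<xi>) = norm (restr E \<xi>)"
proof -
  have "(norm (perm g \<xi>))\<^sup>2 = inner \<xi> (restr E \<xi>)"
    using inner_adj_op[of "perm g" \<xi> "perm g \<xi>"] g by (simp add: adj_perm power2_norm_eq_inner)
  also have "\<dots> = (norm (restr E \<xi>))\<^sup>2"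
    using inner_adj_op[of "restr E" \<xi> "restr E \<xi>"] by (simp add: power2_norm_eq_inner)
  finally show ?thesis by (simp add: power2_eq_iff_nonneg)
qed

lemma norm_perm_le: "g \<in> carrier G \<Longrightarrow> norm (perm g) \<le> 1"
  by (rule norm_blinfun_bound) (simp_all add: norm_perm_apply norm_restr_apply_le)

lemma perm_single:
  assumes "g \<in> carrier G" "x \<in> E"
  shows "perm g (l2_single x v) = l2_single (\<phi> g x) v"
proof (rule l2_eqI)
  fix y
  have "\<phi> (inv g) y = x \<longleftrightarrow> y = \<phi> g x" if "y \<in> E" using assms that by (metis action_inv)
  then show "l2_fun (perm g (l2_single x v)) y = l2_fun (l2_single (\<phi> g x) v) y"
    using assms by (auto simp: perm_apply l2_fun_single)
qed

lemma entry_perm: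
  assumes "g \<in> carrier G" "h \<in> carrier G" "x \<in> E" "y \<in> E"
  shows "entry (perm g o\<^sub>L T o\<^sub>L perm h) x y = entry T (\<phi> (inv g) x) (\<phi> h y)"
  using assms by (auto simp: entry_def fun_eq_iff perm_apply perm_single)

end

section \<open>The large scale structure of an action\<close>

text \<open>After exchanging the sums each term is counted as often as its point lies in some
  \<open>Q x\<close>. This supplies the column half of the norm bounds for band matrices.\<close>

lemma double_count_le:
  fixes u :: "'y \<Rightarrow> real"
  assumes "finite B" "\<And>x. x \<in> B \<Longrightarrow> finite (Q x)" "\<And>y. y \<in> (\<Union>x\<in>B. Q x) \<Longrightarrow> card {x \<in> B. y \<in> Q x} \<le> N"
    "\<And>y. u y \<ge> 0"
  shows "(\<Sum>x\<in>B. \<Sum>y\<in>Q x. u y) \<le> real N * (\<Sum>y\<in>(\<Union>x\<in>B. Q x). u y)"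
proof -
  define U where "U = (\<Union>x\<in>B. Q x)"
  have U: "finite U" using assms(1,2) by (simp add: U_def)
  have "(\<Sum>x\<in>B. \<Sum>y\<in>Q x. u y) = (\<Sum>x\<in>B. \<Sum>y\<in>U. if y \<in> Q x then u y else 0)"
  proof (rule sum.cong[OF refl])
    fix x assume "x \<in> B"
    then have "U \<inter> Q x = Q x" by (auto simp: U_def)
    then show "(\<Sum>y\<in>Q x. u y) = (\<Sum>y\<in>U. if y \<in> Q x then u y else 0)"
      using sum.inter_restrict[OF U, of u "Q x"] by simp
  qed
  also have "\<dots> = (\<Sum>y\<in>U. \<Sum>x\<in>B. if y \<in> Q x then u y else 0)" by (rule sum.swap)
  also have "\<dots> = (\<Sum>y\<in>U. real (card {x \<in> B. y \<in> Q x}) * u y)"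
  proof (rule sum.cong[OF refl])
    fix y
    show "(\<Sum>x\<in>B. if y \<in> Q x then u y else 0) = real (card {x \<in> B. y \<in> Q x}) * u y"
      using sum.inter_filter[OF assms(1), of "\<lambda>_. u y" "\<lambda>x. y \<in> Q x"] by simp
  qed
  also have "\<dots> \<le> (\<Sum>y\<in>U. real N * u y)"
    using assms(3,4) by (intro sum_mono mult_right_mono) (auto simp: U_def)
  finally show ?thesis by (simp add: sum_distrib_left U_def)
qed

lemma norm_sum_square_le:
  fixes f :: "'i \<Rightarrow> 'b::real_normed_vector"
  assumes "card A \<le> N"
  shows "(norm (\<Sum>i\<in>A. f i))\<^sup>2 \<le> real N * (\<Sum>i\<in>A. (norm (f i))\<^sup>2)"
proof -
  have "(norm (\<Sum>i\<in>A. f i))\<^sup>2 \<le> (\<Sum>i\<in>A. norm (f i))\<^sup>2"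
    by (intro power_mono norm_sum) auto
  also have "\<dots> \<le> (\<Sum>i\<in>A. (norm (f i))\<^sup>2) * real (card A)"
    by (rule sum_squared_le_sum_of_squares)
  also have "\<dots> \<le> (\<Sum>i\<in>A. (norm (f i))\<^sup>2) * real N"
    using assms by (intro mult_left_mono sum_nonneg) auto
  finally show ?thesis by (simp add: mult.commute)
qed

text \<open>The truncated matrix is bounded, having bounded entries and at most \<open>N\<close> nonzero ones in each row and
  column.\<close>

lemma band_truncation:
  fixes T :: "('x, 'h::complex_hilbert) l2 \<Rightarrow>\<^sub>L ('x, 'h) l2"
  assumes T: "clinear_op T"
    and row: "\<And>x. finite (Q x) \<and> card (Q x) \<le> N"
    and col: "\<And>y. finite {x. y \<in> Q x} \<and> card {x. y \<in> Q x} \<le> N"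
  shows "\<exists>T'. clinear_op T' \<and> (\<forall>x y. entry T' x y = (if y \<in> Q x then entry T x y else (\<lambda>_. 0)))"
proof -
  define a where "a x y = prj x o\<^sub>L T o\<^sub>L ins y" for x y
  have a: "a x y v = entry T x y v" for x y v by (simp add: a_def entry_def)
  define f where "f \<xi> x = (\<Sum>y\<in>Q x. a x y (l2_fun \<xi> y))" for \<xi> :: "('x, 'h) l2" and x
  define C where "C = norm T"
  have fx: "(norm (f \<xi> x))\<^sup>2 \<le> real N * (\<Sum>y\<in>Q x. C\<^sup>2 * (norm (l2_fun \<xi> y))\<^sup>2)" for \<xi> x
  proof -
    have "(norm (f \<xi> x))\<^sup>2 \<le> real N * (\<Sum>y\<in>Q x. (norm (a x y (l2_fun \<xi> y)))\<^sup>2)"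
      unfolding f_def using row by (intro norm_sum_square_le) auto
    also have "\<dots> \<le> real N * (\<Sum>y\<in>Q x. C\<^sup>2 * (norm (l2_fun \<xi> y))\<^sup>2)"
      unfolding a C_def power_mult_distrib[symmetric]
      by (intro mult_left_mono sum_mono power_mono norm_entry_le) auto
    finally show ?thesis .
  qed
  have fB: "(\<Sum>x\<in>B. (norm (f \<xi> x))\<^sup>2) \<le> (real N * C * norm \<xi>)\<^sup>2" if B: "finite B" for \<xi> B
  proof -
    have "(\<Sum>x\<in>B. (norm (f \<xi> x))\<^sup>2) \<le> (\<Sum>x\<in>B. real N * (\<Sum>y\<in>Q x. C\<^sup>2 * (norm (l2_fun \<xi> y))\<^sup>2))"
      by (intro sum_mono fx)
    also have "\<dots> = real N * C\<^sup>2 * (\<Sum>x\<in>B. \<Sum>y\<in>Q x. (norm (l2_fun \<xi> y))\<^sup>2)"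
      by (simp add: sum_distrib_left mult.assoc)
    also have "\<dots> \<le> real N * C\<^sup>2 * (real N * (\<Sum>y\<in>(\<Union>x\<in>B. Q x). (norm (l2_fun \<xi> y))\<^sup>2))"
    proof (intro mult_left_mono double_count_le B)
      fix y
      have "card {x \<in> B. y \<in> Q x} \<le> card {x. y \<in> Q x}" using col by (intro card_mono) auto
      then show "card {x \<in> B. y \<in> Q x} \<le> N" using col order_trans by blast
    qed (use row in auto)
    also have "\<dots> \<le> real N * C\<^sup>2 * (real N * (norm \<xi>)\<^sup>2)"
      by (intro mult_left_mono sum_le_norm_l2) (use B row in auto)
    finally show ?thesis by (simp add: power_mult_distrib power2_eq_square mult_ac)
  qed
  have sum: "(\<lambda>x. (norm (f \<xi> x))\<^sup>2) summable_on UNIV" for \<xi>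
    by (rule nonneg_bdd_above_summable_on) (use fB[of _ \<xi>] in \<open>auto simp: bdd_above_def\<close>)
  define P where "P \<xi> = Abs_l2 (f \<xi>)" for \<xi>
  have P: "l2_fun (P \<xi>) x = f \<xi> x" for \<xi> x
    unfolding P_def by (subst Abs_l2_inverse) (use sum in auto)
  have norm: "norm (P \<xi>) \<le> norm \<xi> * (real N * C)" for \<xi>
  proof (rule power2_le_imp_le)
    have "(norm (P \<xi>))\<^sup>2 \<le> (real N * C * norm \<xi>)\<^sup>2"
      unfolding norm_l2_square P by (rule infsum_le_finite_sums[OF sum]) (use fB in auto)
    then show "(norm (P \<xi>))\<^sup>2 \<le> (norm \<xi> * (real N * C))\<^sup>2" by (simp add: mult.commute)
  qed (simp add: C_def)
  have "bounded_linear P"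
    by (rule bounded_linear_intro[where K="real N * C"])
      (auto intro!: l2_eqI norm simp: P f_def l2_fun_simps blinfun.bilinear_simps sum.distrib scaleR_sum_right)
  then have T': "blinfun_apply (Blinfun P) = P" by (rule bounded_linear_Blinfun_apply)
  have alin: "clinear_op (a x y)" for x y using T by (simp add: a_def)
  have "clinear_op (Blinfun P)"
    using alin unfolding clinear_op_def T'
    by (auto intro!: l2_eqI simp: P f_def l2_fun_scaleC scaleC_sum)
  moreover have "entry (Blinfun P) x y = (if y \<in> Q x then entry T x y else (\<lambda>_. 0))" for x y
  proof
    fix v
    have "entry (Blinfun P) x y v = (\<Sum>z\<in>Q x. if z = y then a x y v else 0)"
      unfolding entry_def T' P f_def by (intro sum.cong) (auto simp: l2_fun_single blinfun.zero_right)
    then show "entry (Blinfun P) x y v = (if y \<in> Q x then entry T x y else (\<lambda>_. 0)) v"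
      using row by (simp add: a)
  qed
  ultimately show ?thesis by blast
qed

lemma entry_sum: "entry (\<Sum>i\<in>I. f i) x y v = (\<Sum>i\<in>I. entry (f i) x y v)"
  by (simp add: entry_def blinfun_sum_apply l2_fun_sum)

text \<open>The metric \<open>dG\<close> is tied to the action only through its large scale
  structure, so every comparison between \<open>d\<close> and \<open>dG\<close> is made by testing a
  family of pairs for uniform boundedness.\<close>

locale coarse_action = bg_space X d + group_action G X \<phi> + dG: bg_space X dG
  for X :: "'x set" and d and G :: "('g, 'm) monoid_scheme" (structure) and \<phi> and dG +
  assumes coarse: "\<And>g R. g \<in> carrier G \<Longrightarrow> R > 0 \<Longrightarrow>
      \<exists>S>0. \<forall>x\<in>X. \<forall>y\<in>X. d x y \<le> R \<longrightarrow> d (\<phi> g x) (\<phi> g y) \<le> S"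
    and discontinuous: "coarsely_discontinuous G X d \<phi>"
    and lss: "metric_lss X dG = action_lss G X d \<phi>"
begin

definition expansion :: "'g \<Rightarrow> real \<Rightarrow> real" where
  "expansion g R = (SOME S. S > 0 \<and> (\<forall>x\<in>X. \<forall>y\<in>X. d x y \<le> R \<longrightarrow> d (\<phi> g x) (\<phi> g y) \<le> S))"

lemma
  assumes "g \<in> carrier G"
  shows expansion_pos: "expansion g R > 0"
    and expansion: "\<And>x y. x \<in> X \<Longrightarrow> y \<in> X \<Longrightarrow> d x y \<le> R \<Longrightarrow> d (\<phi> g x) (\<phi> g y) \<le> expansion g R"
proof -
  \<comment> \<open>The hypothesis speaks of positive radii only, whence the maximum with
    one.\<close>
  have "\<exists>S>0. \<forall>x\<in>X. \<forall>y\<in>X. d x y \<le> max R 1 \<longrightarrow> d (\<phi> g x) (\<phi> g y) \<le> S"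
    by (rule coarse[OF assms]) simp
  then have "\<exists>S. S > 0 \<and> (\<forall>x\<in>X. \<forall>y\<in>X. d x y \<le> R \<longrightarrow> d (\<phi> g x) (\<phi> g y) \<le> S)"
    by (meson max.coboundedI1)
  from someI_ex[OF this, folded expansion_def]
  show "expansion g R > 0" "\<And>x y. x \<in> X \<Longrightarrow> y \<in> X \<Longrightarrow> d x y \<le> R \<Longrightarrow> d (\<phi> g x) (\<phi> g y) \<le> expansion g R"
    by blast+
qed

lemma uniform_expansion:
  assumes "finite F" "F \<subseteq> carrier G"
  shows "\<exists>S\<ge>0. \<forall>g\<in>F. \<forall>x\<in>X. \<forall>y\<in>X. d x y \<le> R \<longrightarrow> d (\<phi> g x) (\<phi> g y) \<le> S"
proof (intro exI[of _ "\<Sum>g\<in>F. expansion g R"] conjI ballI impI)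
  have pos: "expansion g R \<ge> 0" if "g \<in> F" for g using expansion_pos[of g R] that assms(2) by force
  show "(\<Sum>g\<in>F. expansion g R) \<ge> 0" by (intro sum_nonneg pos)
  fix g x y assume g: "g \<in> F" and xy: "x \<in> X" "y \<in> X" "d x y \<le> R"
  have "d (\<phi> g x) (\<phi> g y) \<le> expansion g R" using expansion xy g assms(2) by blast
  also have "\<dots> \<le> (\<Sum>g\<in>F. expansion g R)" using assms(1) g pos by (intro member_le_sum) auto
  finally show "d (\<phi> g x) (\<phi> g y) \<le> (\<Sum>g\<in>F. expansion g R)" .
qed

text \<open>An explicit structure that contains the generators of \<open>action_lss\<close> and so
  bounds it from above. It is the source of the finite sets of group elements in the decomposition
  of operators.\<close>

definition orbit_lss :: "'x set set set" where
  "orbit_lss = {\<U>. \<U> \<subseteq> Pow X \<and> (\<exists>F R. finite F \<and> F \<subseteq> carrier G \<and> R \<ge> 0 \<and>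
     (\<forall>U\<in>\<U>. \<forall>x\<in>U. \<forall>y\<in>U. \<exists>g\<in>F. d x (\<phi> g y) \<le> R))}"

text \<open>For stars, two points are joined through three sets, giving a product of three group
  elements; coarseness of finitely many elements controls how they spread the intermediate
  errors.\<close>

lemma orbit_lss_large_scale_structure: "large_scale_structure X orbit_lss"
  unfolding large_scale_structure_def
proof (intro conjI ballI allI impI)
  have "{} \<in> orbit_lss" unfolding orbit_lss_def by (auto intro!: exI[of _ "{}"] exI[of _ 0])
  then show "orbit_lss \<noteq> {}" by blast
  show "\<B> \<subseteq> Pow X" if "\<B> \<in> orbit_lss" for \<B> using that by (simp add: orbit_lss_def)
next
  fix \<B>1 \<B>2
  assume 1: "\<B>1 \<in> orbit_lss"
    and 2: "\<B>2 \<subseteq> Pow X \<and> (\<forall>B\<in>\<B>2. (\<exists>x\<in>B. \<exists>y\<in>B. x \<noteq> y) \<longrightarrow> (\<exists>A\<in>\<B>1. B \<subseteq> A))"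
  obtain F R where F: "finite F" "F \<subseteq> carrier G" "R \<ge> 0"
    "\<forall>U\<in>\<B>1. \<forall>x\<in>U. \<forall>y\<in>U. \<exists>g\<in>F. d x (\<phi> g y) \<le> R"
    using 1 by (auto simp: orbit_lss_def)
  \<comment> \<open>The unit takes care of sets with a single point, which need not lie in any
    member of the first family.\<close>
  have "\<exists>g\<in>insert \<one> F. d x (\<phi> g y) \<le> R" if B: "B \<in> \<B>2" "x \<in> B" "y \<in> B" for B x y
  proof (cases "x = y")
    case True
    have "x \<in> X" using 2 B by blast
    then show ?thesis using True F(3) by auto
  next
    case False
    then obtain A where "A \<in> \<B>1" "B \<subseteq> A" using 2 B by blast
    then show ?thesis using F(4) B by blast
  qed
  then show "\<B>2 \<in> orbit_lss"
    unfolding orbit_lss_def using 2 F(1-3)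
    by (intro CollectI conjI exI[of _ "insert \<one> F"] exI[of _ R]) auto
next
  fix \<B>1 \<B>2 assume "\<B>1 \<in> orbit_lss" "\<B>2 \<in> orbit_lss"
  then obtain F1 R1 F2 R2 where sub: "\<B>1 \<subseteq> Pow X" "\<B>2 \<subseteq> Pow X"
    and F1: "finite F1" "F1 \<subseteq> carrier G" "R1 \<ge> 0" "\<forall>U\<in>\<B>1. \<forall>x\<in>U. \<forall>y\<in>U. \<exists>g\<in>F1. d x (\<phi> g y) \<le> R1"
    and F2: "finite F2" "F2 \<subseteq> carrier G" "R2 \<ge> 0" "\<forall>U\<in>\<B>2. \<forall>x\<in>U. \<forall>y\<in>U. \<exists>g\<in>F2. d x (\<phi> g y) \<le> R2"
    by (auto simp: orbit_lss_def)
  \<comment> \<open>The chain runs from a star set through the middle set to another star set, so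
    its group element lies in the product of \<open>F2\<close>, \<open>F1\<close> and
    \<open>F2\<close>.\<close>
  define F12 where "F12 = (\<lambda>(g, h). g \<otimes> h) ` (F2 \<times> F1)"
  define F where "F = (\<lambda>(g, h). g \<otimes> h) ` (F12 \<times> F2)"
  have fin: "finite F12" "F12 \<subseteq> carrier G" "finite F" "F \<subseteq> carrier G"
    using F1(1,2) F2(1,2) by (auto simp: F12_def F_def intro!: m_closed)
  obtain S1 where S1: "S1 \<ge> 0" "\<And>g x y. g \<in> F2 \<Longrightarrow> x \<in> X \<Longrightarrow> y \<in> X \<Longrightarrow> d x y \<le> R1 \<Longrightarrow> d (\<phi> g x) (\<phi> g y) \<le> S1"
    using uniform_expansion[OF F2(1,2)] by meson
  obtain S2 where S2: "S2 \<ge> 0" "\<And>g x y. g \<in> F12 \<Longrightarrow> x \<in> X \<Longrightarrow> y \<in> X \<Longrightarrow> d x y \<le> R2 \<Longrightarrow> d (\<phi> g x) (\<phi> g y) \<le> S2"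
    using uniform_expansion[OF fin(1,2)] by meson
  have key: "\<exists>g\<in>F. d x (\<phi> g y) \<le> R2 + S1 + S2"
    if B: "B \<in> \<B>1" and x: "x \<in> star_set B \<B>2" and y: "y \<in> star_set B \<B>2" for B x y
  proof -
    obtain U b where U: "U \<in> \<B>2" "x \<in> U" "b \<in> U" "b \<in> B" using x by (auto simp: star_set_def)
    obtain V c where V: "V \<in> \<B>2" "y \<in> V" "c \<in> V" "c \<in> B" using y by (auto simp: star_set_def)
    have X: "x \<in> X" "y \<in> X" "b \<in> X" "c \<in> X" using sub U V by auto
    obtain g1 where g1: "g1 \<in> F2" "d x (\<phi> g1 b) \<le> R2" using F2(4) U by blast
    obtain g2 where g2: "g2 \<in> F1" "d b (\<phi> g2 c) \<le> R1" using F1(4) B U V by blast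
    obtain g3 where g3: "g3 \<in> F2" "d c (\<phi> g3 y) \<le> R2" using F2(4) V by blast
    have gc: "g1 \<in> carrier G" "g2 \<in> carrier G" "g3 \<in> carrier G" using g1 g2 g3 F1 F2 by auto
    have g12: "g1 \<otimes> g2 \<in> F12" using g1 g2 by (auto simp: F12_def)
    have gF: "g1 \<otimes> g2 \<otimes> g3 \<in> F" using g12 g3 by (force simp: F_def)
    have "d (\<phi> g1 b) (\<phi> g1 (\<phi> g2 c)) \<le> S1" using S1(2)[OF g1(1)] g2(2) X gc by simp
    moreover have "d (\<phi> (g1 \<otimes> g2) c) (\<phi> (g1 \<otimes> g2) (\<phi> g3 y)) \<le> S2"
      using S2(2)[OF g12] g3(2) X gc by simp
    ultimately have "d x (\<phi> (g1 \<otimes> g2 \<otimes> g3) y) \<le> R2 + S1 + S2"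
      using g1(2) X gc triangle[of x "\<phi> g1 b" "\<phi> g1 (\<phi> g2 c)"]
        triangle[of x "\<phi> g1 (\<phi> g2 c)" "\<phi> (g1 \<otimes> g2 \<otimes> g3) y"]
      by (simp add: composition_rule)
    then show ?thesis using gF by blast
  qed
  have "(\<lambda>B. star_set B \<B>2) ` \<B>1 \<subseteq> Pow X" using sub by (auto simp: star_set_def)
  then show "(\<lambda>B. star_set B \<B>2) ` \<B>1 \<in> orbit_lss"
    unfolding orbit_lss_def using fin F2(3) S1(1) S2(1) key
    by (intro CollectI conjI exI[of _ F] exI[of _ "R2 + S1 + S2"]) auto
qed

text \<open>The smallest structure containing the generators lies in \<open>orbit_lss\<close>; this
  inclusion is read off for the family of all pairs at \<open>dG\<close>-distance at most
  \<open>R\<close>.\<close>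

lemma dG_controlled:
  "\<exists>F R'. finite F \<and> F \<subseteq> carrier G \<and> R' \<ge> 0 \<and> (\<forall>x\<in>X. \<forall>y\<in>X. dG x y \<le> R \<longrightarrow> (\<exists>g\<in>F. d x (\<phi> g y) \<le> R'))"
proof -
  have "metric_lss X d \<subseteq> orbit_lss"
  proof
    fix \<U> assume "\<U> \<in> metric_lss X d"
    then obtain R where R: "\<U> \<subseteq> Pow X" "\<forall>U\<in>\<U>. \<forall>x\<in>U. \<forall>y\<in>U. d x y \<le> R"
      by (auto simp: metric_lss_def)
    have "\<forall>U\<in>\<U>. \<forall>x\<in>U. \<forall>y\<in>U. \<exists>g\<in>{\<one>}. d x (\<phi> g y) \<le> max R 0"
    proof (intro ballI)
      fix U x y assume U: "U \<in> \<U>" "x \<in> U" "y \<in> U"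
      then have "y \<in> X" "d x y \<le> R" using R by auto
      then show "\<exists>g\<in>{\<one>}. d x (\<phi> g y) \<le> max R 0" by simp
    qed
    then show "\<U> \<in> orbit_lss"
      unfolding orbit_lss_def using R(1) by (intro CollectI conjI exI[of _ "{\<one>}"] exI[of _ "max R 0"]) auto
  qed
  moreover have "{{x, \<phi> g x} | x. x \<in> X} \<in> orbit_lss" if g: "g \<in> carrier G" for g
  proof -
    have "\<exists>h\<in>{\<one>, g, inv g}. d y (\<phi> h z) \<le> 0" if "x \<in> X" "y \<in> {x, \<phi> g x}" "z \<in> {x, \<phi> g x}" for x y z
      using that g by auto
    then show ?thesis
      unfolding orbit_lss_def using g
      by (intro CollectI conjI exI[of _ "{\<one>, g, inv g}"] exI[of _ 0]) auto
  qed
  ultimately have sub: "metric_lss X dG \<subseteq> orbit_lss"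
    unfolding lss action_lss_def using orbit_lss_large_scale_structure by blast
  define W where "W = {{x, y} | x y. x \<in> X \<and> y \<in> X \<and> dG x y \<le> R}"
  have "W \<in> metric_lss X dG"
    unfolding metric_lss_def W_def by (auto intro!: exI[of _ "max R 0"] simp: dG.commute)
  then have "W \<in> orbit_lss" using sub by blast
  then obtain F R' where F: "finite F" "F \<subseteq> carrier G" "R' \<ge> 0"
    and *: "\<forall>U\<in>W. \<forall>x\<in>U. \<forall>y\<in>U. \<exists>g\<in>F. d x (\<phi> g y) \<le> R'"
    by (auto simp: orbit_lss_def)
  have "\<exists>g\<in>F. d x (\<phi> g y) \<le> R'" if "x \<in> X" "y \<in> X" "dG x y \<le> R" for x y
  proof -
    have "{x, y} \<in> W" using that by (auto simp: W_def)
    from bspec[OF bspec[OF bspec[OF * this], of x], of y] show ?thesis by simp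
  qed
  then show ?thesis using F by blast
qed

lemma d_controlled: "\<exists>R'. \<forall>x\<in>X. \<forall>y\<in>X. d x y \<le> R \<longrightarrow> dG x y \<le> R'"
proof -
  define W where "W = {{x, y} | x y. x \<in> X \<and> y \<in> X \<and> d x y \<le> R}"
  have "W \<in> metric_lss X d"
    unfolding metric_lss_def W_def by (auto intro!: exI[of _ "max R 0"] simp: commute)
  then have "W \<in> metric_lss X dG"
    unfolding lss action_lss_def by blast
  then obtain R' where R': "\<forall>U\<in>W. \<forall>x\<in>U. \<forall>y\<in>U. dG x y \<le> R'"
    by (auto simp: metric_lss_def)
  have "dG x y \<le> R'" if "x \<in> X" "y \<in> X" "d x y \<le> R" for x y
  proof -
    have "{x, y} \<in> W" using that by (auto simp: W_def)
    from bspec[OF bspec[OF bspec[OF R' this], of x], of y] show ?thesis by simp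
  qed
  then show ?thesis by blast
qed

lemma orbit_controlled:
  assumes "g \<in> carrier G"
  shows "\<exists>R'. \<forall>x\<in>X. dG x (\<phi> g x) \<le> R'"
proof -
  define W where "W = {{x, \<phi> g x} | x. x \<in> X}"
  have "W \<in> metric_lss X dG"
    unfolding lss action_lss_def W_def using assms by blast
  then obtain R' where R': "\<forall>U\<in>W. \<forall>x\<in>U. \<forall>y\<in>U. dG x y \<le> R'"
    by (auto simp: metric_lss_def)
  have "dG x (\<phi> g x) \<le> R'" if "x \<in> X" for x
  proof -
    have "{x, \<phi> g x} \<in> W" using that by (auto simp: W_def)
    from bspec[OF bspec[OF bspec[OF R' this], of x], of "\<phi> g x"] show ?thesis by simp
  qed
  then show ?thesis by blast
qed

end

section \<open>Finite propagation operators on \<open>X_G\<close> as sums of translates\<close>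

context coarse_action
begin

lemma conj_finite_propagation:
  assumes T: "T \<in> finite_propagation_ops X d" and g: "g \<in> carrier G"
  shows "perm g o\<^sub>L T o\<^sub>L perm (inv g) \<in> finite_propagation_ops X d"
proof -
  let ?T = "perm g o\<^sub>L T o\<^sub>L perm (inv g)"
  have T': "T \<in> l2_ops X" "\<And>x y. compact_op (entry T x y)" using T by (auto simp: finite_propagation_iff)
  obtain R where R: "R \<ge> 0" "\<And>x y. d x y > R \<Longrightarrow> entry T x y = (\<lambda>_. 0)"
    using T by (auto simp: finite_propagation_iff)
  have l2: "?T \<in> l2_ops X" using T' g by (intro l2_ops_closed_ops perm_in_l2_ops) auto
  have ent: "entry ?T x y = (if x \<in> X \<and> y \<in> X then entry T (\<phi> (inv g) x) (\<phi> (inv g) y) else (\<lambda>_. 0))" for x y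
    using l2 g by (cases "x \<in> X \<and> y \<in> X") (auto simp: entry_perm l2_ops_def)
  have "entry ?T x y = (\<lambda>_. 0)" if "d x y > expansion g R" for x y
  proof (cases "x \<in> X \<and> y \<in> X")
    case True
    \<comment> \<open>By contraposition: if the preimages were within \<open>R\<close>, applying
      \<open>g\<close> would bring \<open>x\<close> and \<open>y\<close> within
      \<open>expansion g R\<close>.\<close>
    have "d (\<phi> (inv g) x) (\<phi> (inv g) y) > R"
      using expansion[OF g, of "\<phi> (inv g) x" "\<phi> (inv g) y" R] that True g by force
    then show ?thesis using R(2) ent True by simp
  qed (auto simp: ent)
  then have "\<exists>R\<ge>0. \<forall>x y. d x y > R \<longrightarrow> entry ?T x y = (\<lambda>_. 0)"
    using expansion_pos[OF g, of R] by (intro exI[of _ "expansion g R"]) auto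
  then show ?thesis using l2 T'(2) by (simp add: finite_propagation_iff ent)
qed

lemma conj_roe:
  assumes T: "T \<in> roe_ops X d" and g: "g \<in> carrier G"
  shows "perm g o\<^sub>L T o\<^sub>L perm (inv g) \<in> roe_ops X d"
proof -
  obtain Y where Y: "\<forall>n. Y n \<in> finite_propagation_ops X d" "Y \<longlonglongrightarrow> T"
    using T unfolding roe_ops_def closure_sequential by blast
  have "(\<lambda>n. perm g o\<^sub>L Y n o\<^sub>L perm (inv g)) \<longlonglongrightarrow> (perm g o\<^sub>L T o\<^sub>L perm (inv g))"
    by (intro bounded_bilinear.tendsto[OF bounded_bilinear_blinfun_compose] Y(2) tendsto_const)
  moreover have "\<forall>n. perm g o\<^sub>L Y n o\<^sub>L perm (inv g) \<in> finite_propagation_ops X d"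
    by (intro allI conj_finite_propagation[OF _ g] Y(1)[rule_format])
  ultimately show ?thesis
    unfolding roe_ops_def closure_sequential by (intro exI conjI)
qed

text \<open>A nonzero entry at \<open>(x, y)\<close> forces \<open>x\<close> to be
  \<open>d\<close>-close, hence \<open>dG\<close>-close, to \<open>\<phi> g y\<close>, and moving a
  point by a fixed \<open>g\<close> is a bounded displacement for \<open>dG\<close>.\<close>

lemma translate_finite_propagation:
  assumes T: "T \<in> finite_propagation_ops X d" and g: "g \<in> carrier G"
  shows "T o\<^sub>L perm g \<in> finite_propagation_ops X dG"
proof -
  have T': "T \<in> l2_ops X" "\<And>x y. compact_op (entry T x y)" using T by (auto simp: finite_propagation_iff)
  obtain R where R: "R \<ge> 0" "\<And>x y. d x y > R \<Longrightarrow> entry T x y = (\<lambda>_. 0)"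
    using T by (auto simp: finite_propagation_iff)
  obtain R1 where R1: "\<And>x y. x \<in> X \<Longrightarrow> y \<in> X \<Longrightarrow> d x y \<le> R \<Longrightarrow> dG x y \<le> R1"
    using d_controlled by meson
  obtain R2 where R2: "\<And>x. x \<in> X \<Longrightarrow> dG x (\<phi> g x) \<le> R2"
    using orbit_controlled[OF g] by blast
  have l2: "T o\<^sub>L perm g \<in> l2_ops X" using T' g by (intro l2_ops_closed_ops perm_in_l2_ops) auto
  have ent: "entry (T o\<^sub>L perm g) x y = (if x \<in> X \<and> y \<in> X then entry T x (\<phi> g y) else (\<lambda>_. 0))" for x y
    using l2 g by (cases "x \<in> X \<and> y \<in> X") (auto simp: entry_def fun_eq_iff perm_single l2_ops_def)
  have "entry (T o\<^sub>L perm g) x y = (\<lambda>_. 0)" if "dG x y > max 0 (R1 + R2)" for x y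
  proof (cases "x \<in> X \<and> y \<in> X")
    case True
    have "d x (\<phi> g y) > R"
    proof (rule ccontr)
      assume "\<not> d x (\<phi> g y) > R"
      then have "dG x (\<phi> g y) \<le> R1" using True g by (intro R1) auto
      then show False
        using that True g R2[of y] dG.triangle[of x "\<phi> g y" y] dG.commute[of y "\<phi> g y"] by simp
    qed
    then show ?thesis using R(2) ent True by simp
  qed (auto simp: ent)
  then have "\<exists>R\<ge>0. \<forall>x y. dG x y > R \<longrightarrow> entry (T o\<^sub>L perm g) x y = (\<lambda>_. 0)"
    by (intro exI[of _ "max 0 (R1 + R2)"]) auto
  then show ?thesis using l2 T'(2) by (simp add: dG.finite_propagation_iff ent)
qed

text \<open>Each pair at bounded \<open>dG\<close>-distance is assigned a single \<open>g\<close>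
  that moves \<open>y\<close> close to \<open>x\<close>, and \<open>t g\<close> collects the entries
  assigned to \<open>g\<close>. Such an arbitrary selection of entries of a bounded operator is
  bounded only because the selected entries lie in a band, which is what
  \<open>band_truncation\<close> is for.\<close>

lemma translate_decomposition:
  assumes T: "T \<in> finite_propagation_ops X dG"
  shows "\<exists>F t. finite F \<and> F \<subseteq> carrier G \<and> (\<forall>g\<in>F. t g \<in> finite_propagation_ops X d) \<and>
    T = (\<Sum>g\<in>F. t g o\<^sub>L perm g)"
proof -
  have l2: "T \<in> l2_ops X" and comp: "\<And>x y. compact_op (entry T x y)"
    using T by (auto simp: dG.finite_propagation_iff)
  obtain R0 where R0: "\<And>x y. dG x y > R0 \<Longrightarrow> entry T x y = (\<lambda>_. 0)"
    using T by (auto simp: dG.finite_propagation_iff)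
  obtain F R where F: "finite F" "F \<subseteq> carrier G" and R: "R \<ge> 0"
    and FR: "\<And>x y. x \<in> X \<Longrightarrow> y \<in> X \<Longrightarrow> dG x y \<le> R0 \<Longrightarrow> \<exists>g\<in>F. d x (\<phi> g y) \<le> R"
    using dG_controlled[of R0] by blast
  define c where "c x y = (SOME g. g \<in> F \<and> d x (\<phi> g y) \<le> R)" for x y
  have c: "c x y \<in> F" "d x (\<phi> (c x y) y) \<le> R" if "x \<in> X" "y \<in> X" "dG x y \<le> R0" for x y
    unfolding c_def using someI_ex[of "\<lambda>g. g \<in> F \<and> d x (\<phi> g y) \<le> R"] FR[OF that] by blast+
  \<comment> \<open>A column \<open>z\<close> of \<open>t g\<close> stands for the column
    \<open>\<phi> (inv g) z\<close> of \<open>T\<close>; the condition on \<open>c\<close> ensures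
    that no entry of \<open>T\<close> is used by two group elements.\<close>
  define Q where "Q g x = {z. x \<in> X \<and> z \<in> X \<and> d x z \<le> R \<and> c x (\<phi> (inv g) z) = g \<and> dG x (\<phi> (inv g) z) \<le> R0}" for g x
  obtain N where N: "\<forall>x\<in>X. finite (nbhd x R) \<and> card (nbhd x R) \<le> N"
    using nbhd_bound by blast
  have row: "finite (Q g x) \<and> card (Q g x) \<le> N" for g x
  proof (cases "x \<in> X")
    case True
    have "Q g x \<subseteq> nbhd x R" by (auto simp: Q_def nbhd_def)
    then show ?thesis using N True by (meson card_mono finite_subset order_trans)
  qed (simp add: Q_def)
  have col: "finite {x. y \<in> Q g x} \<and> card {x. y \<in> Q g x} \<le> N" for g y
  proof (cases "y \<in> X")
    case True
    have "{x. y \<in> Q g x} \<subseteq> nbhd y R" by (auto simp: Q_def nbhd_def commute)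
    then show ?thesis using N True by (meson card_mono finite_subset order_trans)
  qed (simp add: Q_def)
  have "\<forall>g\<in>F. \<exists>T'. clinear_op T' \<and>
      (\<forall>x y. entry T' x y = (if y \<in> Q g x then entry (T o\<^sub>L perm (inv g)) x y else (\<lambda>_. 0)))"
    using F l2_ops_clinear[OF l2] row col by (intro ballI band_truncation) auto
  then obtain t where t: "\<And>g. g \<in> F \<Longrightarrow> clinear_op (t g)"
    "\<And>g x y. g \<in> F \<Longrightarrow> entry (t g) x y = (if y \<in> Q g x then entry (T o\<^sub>L perm (inv g)) x y else (\<lambda>_. 0))"
    by metis
  have t_ent: "entry (t g) x y = (if y \<in> Q g x then entry T x (\<phi> (inv g) y) else (\<lambda>_. 0))" if "g \<in> F" for g x y
    using that F by (auto simp: t(2) fun_eq_iff entry_def perm_single Q_def)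
  have t_mem: "t g \<in> finite_propagation_ops X d" if g: "g \<in> F" for g
  proof -
    have "t g \<in> l2_ops X" using t(1)[OF g] by (auto simp: l2_ops_def t_ent[OF g] Q_def)
    moreover have "compact_op (entry (t g) x y)" for x y unfolding t_ent[OF g] using comp by simp
    moreover have "\<exists>R\<ge>0. \<forall>x y. d x y > R \<longrightarrow> entry (t g) x y = (\<lambda>_. 0)"
      using R by (intro exI[of _ R]) (auto simp: t_ent[OF g] Q_def)
    ultimately show ?thesis by (simp add: finite_propagation_iff)
  qed
  have "T = (\<Sum>g\<in>F. t g o\<^sub>L perm g)"
  proof (rule blinfun_entry_eqI)
    fix x y
    have sum_l2: "(\<Sum>g\<in>F. t g o\<^sub>L perm g) \<in> l2_ops X"
    proof -
      have "t g o\<^sub>L perm g \<in> l2_ops X" if "g \<in> F" for g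
        using t_mem[OF that] F that by (intro l2_ops_closed_ops perm_in_l2_ops) (auto simp: finite_propagation_iff)
      then show ?thesis
        by (induction F rule: infinite_finite_induct) (auto simp: l2_ops_closed_ops)
    qed
    show "entry T x y = entry (\<Sum>g\<in>F. t g o\<^sub>L perm g) x y"
    proof (cases "x \<in> X \<and> y \<in> X")
      case False
      then have "entry T x y = (\<lambda>_. 0)" "entry (\<Sum>g\<in>F. t g o\<^sub>L perm g) x y = (\<lambda>_. 0)"
        using l2 sum_l2 unfolding l2_ops_def by blast+
      then show ?thesis by simp
    next
      case True
      show ?thesis
      proof
        fix v
        have e: "entry (t g o\<^sub>L perm g) x y v
            = (if g = c x y \<and> dG x y \<le> R0 then entry T x y v else 0)" if g: "g \<in> F" for g
        proof -
          have gc: "g \<in> carrier G" using g F by blast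
          have "entry (t g o\<^sub>L perm g) x y v = entry (t g) x (\<phi> g y) v"
            using True gc by (simp add: entry_def perm_single)
          also have "\<dots> = (if d x (\<phi> g y) \<le> R \<and> c x y = g \<and> dG x y \<le> R0 then entry T x y v else 0)"
            using True gc by (auto simp: t_ent[OF g] Q_def)
          also have "\<dots> = (if g = c x y \<and> dG x y \<le> R0 then entry T x y v else 0)"
            using c(2)[of x y] True by auto
          finally show ?thesis .
        qed
        have "entry (\<Sum>g\<in>F. t g o\<^sub>L perm g) x y v
            = (\<Sum>g\<in>F. if g = c x y then (if dG x y \<le> R0 then entry T x y v else 0) else 0)"
          unfolding entry_sum by (intro sum.cong) (auto simp: e)
        also have "\<dots> = (if c x y \<in> F \<and> dG x y \<le> R0 then entry T x y v else 0)"
          using F(1) by simp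
        also have "\<dots> = entry T x y v"
          using c(1)[of x y] R0[of x y] True by (cases "dG x y \<le> R0") auto
        finally show "entry T x y v = entry (\<Sum>g\<in>F. t g o\<^sub>L perm g) x y v" by simp
      qed
    qed
  qed
  then show ?thesis using F t_mem by blast
qed

end

section \<open>Localization of norms\<close>

lemma norm_sum_disjoint:
  fixes f :: "'i \<Rightarrow> ('x, 'h::complex_hilbert) l2"
  assumes "finite I" "\<And>i x. i \<in> I \<Longrightarrow> l2_fun (f i) x \<noteq> 0 \<Longrightarrow> x \<in> S i"
    "\<And>i j. i \<in> I \<Longrightarrow> j \<in> I \<Longrightarrow> i \<noteq> j \<Longrightarrow> S i \<inter> S j = {}"
  shows "(norm (\<Sum>i\<in>I. f i))\<^sup>2 = (\<Sum>i\<in>I. (norm (f i))\<^sup>2)"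
proof -
  have "inner (f i) (f j) = (if j = i then (norm (f i))\<^sup>2 else 0)" if "i \<in> I" "j \<in> I" for i j
    using assms(2)[of i] assms(2)[of j] assms(3)[of i j] that
    by (auto simp: power2_norm_eq_inner intro!: inner_l2_disjoint)
  then have "(\<Sum>i\<in>I. \<Sum>j\<in>I. inner (f i) (f j)) = (\<Sum>i\<in>I. \<Sum>j\<in>I. if j = i then (norm (f i))\<^sup>2 else 0)"
    by (intro sum.cong) auto
  then show ?thesis
    using assms(1) sum.swap[of "\<lambda>i j. inner (f i) (f j)" I I]
    by (simp add: power2_norm_eq_inner inner_sum_left inner_sum_right)
qed

lemma sum_norm_restr_disjoint_le:
  fixes \<xi> :: "('x, 'h::complex_hilbert) l2"
  assumes I: "finite I" and S: "\<And>i j. i \<in> I \<Longrightarrow> j \<in> I \<Longrightarrow> i \<noteq> j \<Longrightarrow> S i \<inter> S j = {}"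
  shows "(\<Sum>i\<in>I. (norm (restr (S i) \<xi>))\<^sup>2) \<le> (norm \<xi>)\<^sup>2"
proof -
  have "(\<Sum>i\<in>I. restr (S i) \<xi>) = restr (\<Union>i\<in>I. S i) \<xi>"
  proof (rule l2_eqI)
    fix x
    show "l2_fun (\<Sum>i\<in>I. restr (S i) \<xi>) x = l2_fun (restr (\<Union>i\<in>I. S i) \<xi>) x"
    proof (cases "\<exists>i\<in>I. x \<in> S i")
      case True
      then obtain i where i: "i \<in> I" "x \<in> S i" by blast
      then have "(x \<in> S j) = (j = i)" if "j \<in> I" for j using S[of i j] that by auto
      then have "(\<Sum>j\<in>I. if x \<in> S j then l2_fun \<xi> x else 0) = (\<Sum>j\<in>I. if j = i then l2_fun \<xi> x else 0)"
        by (intro sum.cong) auto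
      then show ?thesis using i I by (auto simp: l2_fun_sum)
    qed (auto simp: l2_fun_sum intro!: sum.neutral)
  qed
  moreover have "(norm (\<Sum>i\<in>I. restr (S i) \<xi>))\<^sup>2 = (\<Sum>i\<in>I. (norm (restr (S i) \<xi>))\<^sup>2)"
    by (rule norm_sum_disjoint[OF I _ S]) (auto split: if_splits)
  ultimately show ?thesis by (metis norm_restr_apply_le norm_ge_zero power_mono)
qed

definition mul_op :: "('x \<Rightarrow> real) \<Rightarrow> ('x, 'h::complex_hilbert) l2 \<Rightarrow>\<^sub>L ('x, 'h) l2" where
  "mul_op f = diag_op (\<lambda>x. f x *\<^sub>R id_blinfun)"

lemma mul_op_apply:
  assumes "\<And>x. \<bar>f x\<bar> \<le> 1"
  shows "l2_fun (mul_op f \<xi>) x = f x *\<^sub>R l2_fun \<xi> x"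
proof -
  have "norm (f x *\<^sub>R (id_blinfun :: 'b \<Rightarrow>\<^sub>L 'b)) \<le> 1 * 1" for x
    unfolding norm_scaleR using assms norm_blinfun_id_le by (intro mult_mono) auto
  then show ?thesis unfolding mul_op_def by (subst diag_op_apply[where C=1]) (auto simp: blinfun.scaleR_left)
qed

text \<open>Pointwise the inequality is the hypothesis on the squares; it is summed over finite sets
  of points first and passes to the limit.\<close>

lemma sum_norm_mul_op_le:
  fixes \<xi> :: "('x, 'h::complex_hilbert) l2"
  assumes "finite S" "\<And>s x. \<bar>f s x\<bar> \<le> 1" "\<And>x. (\<Sum>s\<in>S. (f s x)\<^sup>2) \<le> 1"
  shows "(\<Sum>s\<in>S. (norm (mul_op (f s) \<xi>))\<^sup>2) \<le> (norm \<xi>)\<^sup>2"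
proof -
  have "((\<lambda>B. \<Sum>s\<in>S. (norm (restr B (mul_op (f s) \<xi>)))\<^sup>2) \<longlongrightarrow> (\<Sum>s\<in>S. (norm (mul_op (f s) \<xi>))\<^sup>2))
      (finite_subsets_at_top UNIV)"
    by (intro tendsto_intros tendsto_restr)
  moreover have "(\<Sum>s\<in>S. (norm (restr B (mul_op (f s) \<xi>)))\<^sup>2) \<le> (norm \<xi>)\<^sup>2" if B: "finite B" for B
  proof -
    have "(\<Sum>s\<in>S. (norm (restr B (mul_op (f s) \<xi>)))\<^sup>2) = (\<Sum>s\<in>S. \<Sum>x\<in>B. (f s x)\<^sup>2 * (norm (l2_fun \<xi> x))\<^sup>2)"
      by (simp add: norm_restr_finite[OF B] mul_op_apply[OF assms(2)] power_mult_distrib)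
    also have "\<dots> = (\<Sum>x\<in>B. (\<Sum>s\<in>S. (f s x)\<^sup>2) * (norm (l2_fun \<xi> x))\<^sup>2)"
      by (subst sum.swap) (simp add: sum_distrib_right)
    also have "\<dots> \<le> (\<Sum>x\<in>B. 1 * (norm (l2_fun \<xi> x))\<^sup>2)"
      by (intro sum_mono mult_right_mono assms(3)) auto
    also have "\<dots> \<le> (norm \<xi>)\<^sup>2" using sum_le_norm_l2[OF B] by simp
    finally show ?thesis .
  qed
  ultimately show ?thesis
    by (intro tendsto_upperbound[OF _ _ finite_subsets_at_top_neq_bot])
      (auto intro: eventually_finite_subsets_at_top_weakI)
qed

context bg_space
begin

text \<open>The commutator with a multiplication operator has entries
  \<open>(f s y - f s x) *\<^sub>R entry A x y\<close>. Cauchy-Schwarz in each row costs one factor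
  \<open>N\<close>, double counting of columns another, and summing over \<open>s\<close> before
  anything else turns the differences into \<open>\<delta>\<close>.\<close>

lemma commutator_estimate:
  fixes A :: "('x, 'h::complex_hilbert) l2 \<Rightarrow>\<^sub>L ('x, 'h) l2"
  assumes A: "A \<in> l2_ops X" "\<And>x y. d x y > R \<Longrightarrow> entry A x y = (\<lambda>_. 0)"
    and N: "\<And>x. x \<in> X \<Longrightarrow> card (nbhd x R) \<le> N"
    and S: "finite S" and f: "\<And>s x. \<bar>f s x\<bar> \<le> 1"
    and var: "\<And>x y. x \<in> X \<Longrightarrow> y \<in> X \<Longrightarrow> d x y \<le> R \<Longrightarrow> (\<Sum>s\<in>S. (f s y - f s x)\<^sup>2) \<le> \<delta>"
    and \<delta>: "\<delta> \<ge> 0"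
  shows "(\<Sum>s\<in>S. (norm (A (mul_op (f s) \<xi>) - mul_op (f s) (A \<xi>)))\<^sup>2) \<le> (real N)\<^sup>2 * (norm A)\<^sup>2 * \<delta> * (norm \<xi>)\<^sup>2"
proof -
  define w where "w s = A (mul_op (f s) \<xi>) - mul_op (f s) (A \<xi>)" for s
  define c where "c = real N * (norm A)\<^sup>2 * \<delta>"
  have out: "l2_fun (w s) x = 0" if "x \<notin> X" for s x
    using l2_ops_apply_outside[OF A(1) that] by (simp add: w_def l2_fun_simps mul_op_apply[OF f])
  have w: "l2_fun (w s) x = (\<Sum>y\<in>nbhd x R. (f s y - f s x) *\<^sub>R entry A x y (l2_fun \<xi> y))" if "x \<in> X" for s x
    by (simp add: w_def l2_fun_simps mul_op_apply[OF f] apply_propagation[OF A that] scaleR_sum_right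
        scaleR_diff_left sum_subtractf entry_blinfun blinfun.scaleR_right del: blinfun_apply_blinfun_compose)
  have wx: "(\<Sum>s\<in>S. (norm (l2_fun (w s) x))\<^sup>2) \<le> (\<Sum>y\<in>nbhd x R. c * (norm (l2_fun \<xi> y))\<^sup>2)" if x: "x \<in> X" for x
  proof -
    have "(\<Sum>s\<in>S. (norm (l2_fun (w s) x))\<^sup>2)
        \<le> (\<Sum>s\<in>S. real N * (\<Sum>y\<in>nbhd x R. (norm ((f s y - f s x) *\<^sub>R entry A x y (l2_fun \<xi> y)))\<^sup>2))"
      unfolding w[OF x] by (intro sum_mono norm_sum_square_le N x)
    also have "\<dots> = real N * (\<Sum>y\<in>nbhd x R. (\<Sum>s\<in>S. (f s y - f s x)\<^sup>2) * (norm (entry A x y (l2_fun \<xi> y)))\<^sup>2)"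
      unfolding sum_distrib_left[symmetric] sum_distrib_right
      by (subst sum.swap) (simp add: power_mult_distrib)
    also have "\<dots> \<le> real N * (\<Sum>y\<in>nbhd x R. \<delta> * (norm A * norm (l2_fun \<xi> y))\<^sup>2)"
      using x by (intro mult_left_mono sum_mono mult_mono var power_mono norm_entry_le)
        (auto simp: nbhd_def \<delta> sum_nonneg)
    also have "\<dots> = (\<Sum>y\<in>nbhd x R. c * (norm (l2_fun \<xi> y))\<^sup>2)"
      by (simp add: sum_distrib_left c_def power_mult_distrib mult_ac)
    finally show ?thesis .
  qed
  have bound: "(\<Sum>s\<in>S. (norm (restr B (w s)))\<^sup>2) \<le> real N * (c * (norm \<xi>)\<^sup>2)" if B: "finite B" for B
  proof -
    have "(\<Sum>s\<in>S. (norm (restr B (w s)))\<^sup>2) = (\<Sum>x\<in>B. \<Sum>s\<in>S. (norm (l2_fun (w s) x))\<^sup>2)"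
      unfolding norm_restr_finite[OF B] by (rule sum.swap)
    also have "\<dots> = (\<Sum>x\<in>B \<inter> X. \<Sum>s\<in>S. (norm (l2_fun (w s) x))\<^sup>2)"
      using B by (intro sum.mono_neutral_right) (auto simp: out)
    also have "\<dots> \<le> (\<Sum>x\<in>B \<inter> X. \<Sum>y\<in>nbhd x R. c * (norm (l2_fun \<xi> y))\<^sup>2)"
      by (intro sum_mono wx) auto
    also have "\<dots> \<le> real N * (\<Sum>y\<in>(\<Union>x\<in>B \<inter> X. nbhd x R). c * (norm (l2_fun \<xi> y))\<^sup>2)"
    proof (rule double_count_le)
      fix y assume "y \<in> (\<Union>x\<in>B \<inter> X. nbhd x R)"
      then have "y \<in> X" by (auto simp: nbhd_def)
      then have "card {x \<in> B \<inter> X. y \<in> nbhd x R} \<le> card (nbhd y R)"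
        by (intro card_mono finite_nbhd) (auto simp: nbhd_def commute)
      then show "card {x \<in> B \<inter> X. y \<in> nbhd x R} \<le> N" using N[OF \<open>y \<in> X\<close>] by simp
    qed (use B finite_nbhd \<delta> in \<open>auto simp: c_def\<close>)
    also have "\<dots> \<le> real N * (c * (norm \<xi>)\<^sup>2)"
      unfolding sum_distrib_left[symmetric]
      by (intro mult_left_mono sum_le_norm_l2) (use B finite_nbhd \<delta> in \<open>auto simp: c_def\<close>)
    finally show ?thesis .
  qed
  have "((\<lambda>B. \<Sum>s\<in>S. (norm (restr B (w s)))\<^sup>2) \<longlongrightarrow> (\<Sum>s\<in>S. (norm (w s))\<^sup>2)) (finite_subsets_at_top UNIV)"
    by (intro tendsto_intros tendsto_restr)
  then have "(\<Sum>s\<in>S. (norm (w s))\<^sup>2) \<le> real N * (c * (norm \<xi>)\<^sup>2)"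
    by (rule tendsto_upperbound[OF _ _ finite_subsets_at_top_neq_bot])
      (auto intro: eventually_finite_subsets_at_top_weakI bound)
  then show ?thesis by (simp add: w_def c_def power2_eq_square mult_ac)
qed

text \<open>Exactness is applied to the cover by pairs of points at distance at most
  \<open>R\<close>. The resulting map is unpacked into a partition of unity whose variation is
  stated for finite sets of vertices only.\<close>

lemma property_A_partition:
  assumes A: "property_A TYPE('s) X d" and \<delta>: "\<delta> > 0"
  obtains p :: "'x \<Rightarrow> 's \<Rightarrow> real" and r where
    "\<forall>x\<in>X. (\<forall>s. p x s \<in> {0..1}) \<and> finite {s. p x s \<noteq> 0} \<and> (\<Sum>s | p x s \<noteq> 0. p x s) = 1"
    "\<forall>s. \<forall>x\<in>X. \<forall>y\<in>X. p x s \<noteq> 0 \<longrightarrow> p y s \<noteq> 0 \<longrightarrow> d x y \<le> r"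
    "\<forall>S x y. finite S \<longrightarrow> x \<in> X \<longrightarrow> y \<in> X \<longrightarrow> d x y \<le> R \<longrightarrow> (\<Sum>s\<in>S. \<bar>p x s - p y s\<bar>) \<le> \<delta>"
proof -
  \<comment> \<open>The maximum ensures that the sets \<open>{x, x}\<close> belong to the family and
    cover \<open>X\<close> even for negative \<open>R\<close>.\<close>
  define W where "W = {{x, y} | x y. x \<in> X \<and> y \<in> X \<and> d x y \<le> max R 0}"
  have W1: "W \<in> metric_lss X d"
    unfolding metric_lss_def W_def by (auto intro!: exI[of _ "max R 0"] simp: commute)
  have W2: "\<Union>W = X"
  proof
    show "X \<subseteq> \<Union>W"
    proof
      fix x assume "x \<in> X"
      then have "{x, x} \<in> W" unfolding W_def by (intro CollectI exI[of _ x]) auto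
      then show "x \<in> \<Union>W" by blast
    qed
  qed (auto simp: W_def)
  obtain S :: "'s set" and p where Sp: "p ` X \<subseteq> prob_simplex S
     \<and> {{x \<in> X. p x s \<noteq> 0} | s. s \<in> S} \<in> metric_lss X d
     \<and> \<Union>{{x \<in> X. p x s \<noteq> 0} | s. s \<in> S} = X
     \<and> (\<exists>\<delta>'<\<delta>. \<forall>U\<in>W. \<forall>x\<in>U. \<forall>y\<in>U. l1_dist (p x) (p y) \<le> \<delta>')"
    using A[unfolded property_A_def, THEN spec, THEN spec, THEN mp, OF conjI[OF W1 conjI[OF W2 \<delta>]]]
    by (elim exE) (rule that)
  then obtain \<delta>' where p: "p ` X \<subseteq> prob_simplex S"
    and ub: "{{x \<in> X. p x s \<noteq> 0} | s. s \<in> S} \<in> metric_lss X d"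
    and \<delta>': "\<delta>' < \<delta>" "\<forall>U\<in>W. \<forall>x\<in>U. \<forall>y\<in>U. l1_dist (p x) (p y) \<le> \<delta>'"
    by (elim exE conjE) (rule that)
  obtain r where r: "\<forall>U\<in>{{x \<in> X. p x s \<noteq> 0} | s. s \<in> S}. \<forall>x\<in>U. \<forall>y\<in>U. d x y \<le> r"
    using ub unfolding metric_lss_def by auto
  have px: "(\<forall>s. p x s \<in> {0..1}) \<and> finite {s. p x s \<noteq> 0} \<and> {s. p x s \<noteq> 0} \<subseteq> S \<and> (\<Sum>s | p x s \<noteq> 0. p x s) = 1"
    if "x \<in> X" for x
    using p that by (auto simp: prob_simplex_def image_subset_iff)
  have r': "d x y \<le> r" if "x \<in> X" "y \<in> X" "p x s \<noteq> 0" "p y s \<noteq> 0" for x y s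
  proof -
    have "s \<in> S" using px[OF that(1)] that(3) by blast
    then have "{x \<in> X. p x s \<noteq> 0} \<in> {{x \<in> X. p x s \<noteq> 0} | s. s \<in> S}" by blast
    from bspec[OF r this] show ?thesis using that by simp
  qed
  have var: "(\<Sum>s\<in>T. \<bar>p x s - p y s\<bar>) \<le> \<delta>"
    if T: "finite T" and xy: "x \<in> X" "y \<in> X" "d x y \<le> R" for T x y
  proof -
    have fin: "finite {s. p x s \<noteq> 0 \<or> p y s \<noteq> 0}"
      unfolding Collect_disj_eq using px[OF xy(1)] px[OF xy(2)] by blast
    have "(\<Sum>s\<in>T. \<bar>p x s - p y s\<bar>) \<le> (\<Sum>s\<in>T \<union> {s. p x s \<noteq> 0 \<or> p y s \<noteq> 0}. \<bar>p x s - p y s\<bar>)"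
      using T fin by (intro sum_mono2) auto
    also have "\<dots> = l1_dist (p x) (p y)"
      unfolding l1_dist_def using T fin by (intro sum.mono_neutral_right) auto
    also have "\<dots> \<le> \<delta>'"
    proof -
      have "{x, y} \<in> W"
        unfolding W_def using xy by (intro CollectI exI[of _ x] exI[of _ y]) auto
      from bspec[OF bspec[OF bspec[OF \<delta>'(2) this], of x], of y] show ?thesis by simp
    qed
    finally show ?thesis using \<delta>'(1) by simp
  qed
  show ?thesis
  proof (rule that[of p r])
    show "\<forall>x\<in>X. (\<forall>s. p x s \<in> {0..1}) \<and> finite {s. p x s \<noteq> 0} \<and> (\<Sum>s | p x s \<noteq> 0. p x s) = 1"
      using px by simp
  qed (use r' var in simp_all)
qed

end

context coarse_action
begin

definition thick :: "real \<Rightarrow> 'x set \<Rightarrow> 'x set" where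
  "thick R C = {x \<in> X. \<exists>y\<in>C. d x y \<le> R}"

lemma subset_thick: "R \<ge> 0 \<Longrightarrow> C \<subseteq> X \<Longrightarrow> C \<subseteq> thick R C"
  by (auto simp: thick_def intro!: bexI)

lemma propagation_support:
  assumes A: "A \<in> l2_ops X" "\<And>x y. d x y > R \<Longrightarrow> entry A x y = (\<lambda>_. 0)"
    and \<xi>: "\<And>y. l2_fun \<xi> y \<noteq> 0 \<Longrightarrow> y \<in> C" and x: "l2_fun (A \<xi>) x \<noteq> 0"
  shows "x \<in> thick R C"
proof (rule ccontr)
  assume no: "x \<notin> thick R C"
  have "l2_fun (A \<xi>) x = 0"
  proof (rule apply_eq_0)
    fix y assume "l2_fun \<xi> y \<noteq> 0"
    then have "x \<notin> X \<or> d x y > R" using no \<xi>[of y] by (auto simp: thick_def)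
    then show "entry A x y = (\<lambda>_. 0)" using A by (auto simp: l2_ops_def)
  qed
  then show False using x by simp
qed

text \<open>The matrix of \<open>\<Sum>g. t g u_g\<close> in the regular covariant representation, cut down to \<open>E\<close>.\<close>

definition covariant_block :: "'g set \<Rightarrow> ('g \<Rightarrow> ('x, 'h::complex_hilbert) l2 \<Rightarrow>\<^sub>L ('x, 'h) l2)
    \<Rightarrow> 'g \<Rightarrow> 'g \<Rightarrow> ('x, 'h) l2 \<Rightarrow>\<^sub>L ('x, 'h) l2" where
  "covariant_block F t h k =
     (if h \<otimes> inv k \<in> F then perm (inv h) o\<^sub>L t (h \<otimes> inv k) o\<^sub>L perm h else 0)"

lemma mult_eq_iff: "g \<in> carrier G \<Longrightarrow> h \<in> carrier G \<Longrightarrow> k \<in> carrier G \<Longrightarrow> g \<otimes> k = h \<longleftrightarrow> g = h \<otimes> inv k"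
  by (metis group.inv_solve_right[OF group_G])

text \<open>For a family supported in a set \<open>C\<close> whose translates are far apart, the vectors \<open>perm k (v k)\<close> are
  orthogonal, and so are the components of the image of their sum near the translates of \<open>C\<close>.\<close>

lemma local_estimate:
  fixes t :: "'g \<Rightarrow> ('x, 'h::complex_hilbert) l2 \<Rightarrow>\<^sub>L ('x, 'h) l2"
  assumes F: "finite F" "F \<subseteq> carrier G" and E: "finite E" "E \<subseteq> carrier G" and R: "R \<ge> 0"
    and t: "\<And>g. g \<in> F \<Longrightarrow> t g \<in> l2_ops X"
      "\<And>g x y. g \<in> F \<Longrightarrow> d x y > R \<Longrightarrow> entry (t g) x y = (\<lambda>_. 0)"
    and C: "C \<subseteq> X"
    and disj: "\<And>h h'. h \<in> E \<Longrightarrow> h' \<in> E \<union> (\<lambda>(g, k). g \<otimes> k) ` (F \<times> E) \<Longrightarrow> h \<noteq> h' \<Longrightarrow>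
      thick R (\<phi> h ` C) \<inter> thick R (\<phi> h' ` C) = {}"
    and v: "\<And>k x. k \<in> E \<Longrightarrow> l2_fun (v k) x \<noteq> 0 \<Longrightarrow> x \<in> C"
  shows "(\<Sum>h\<in>E. (norm (\<Sum>k\<in>E. covariant_block F t h k (v k)))\<^sup>2)
    \<le> (norm (\<Sum>g\<in>F. t g o\<^sub>L perm g))\<^sup>2 * (\<Sum>k\<in>E. (norm (v k))\<^sup>2)"
proof -
  define T where "T = (\<Sum>g\<in>F. t g o\<^sub>L perm g)"
  \<comment> \<open>The test vector: spreading the components over disjoint translates of
    \<open>C\<close> lets the single operator \<open>T\<close> act on them as the whole block matrix
    does.\<close>
  define \<zeta> where "\<zeta> = (\<Sum>k\<in>E. perm k (v k))"
  define NC where "NC h = thick R (\<phi> h ` C)" for h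
  have imC: "\<phi> h ` C \<subseteq> X" if "h \<in> carrier G" for h using C that by auto
  have supp: "x \<in> \<phi> h ` C" if "h \<in> carrier G" "k \<in> E" "l2_fun (perm h (v k)) x \<noteq> 0" for h k x
  proof -
    have "x \<in> X" "\<phi> (inv h) x \<in> C" using that v[of k] by (auto simp: perm_apply split: if_splits)
    then show ?thesis using that(1) by (metis action_inv(2) imageI)
  qed
  have rX: "restr X (v k) = v k" if "k \<in> E" for k
    by (rule l2_eqI) (use v[OF that] C in auto)
  have norm_perm_v: "norm (perm h (v k)) = norm (v k)" if "h \<in> carrier G" "k \<in> E" for h k
    using that by (simp add: norm_perm_apply rX)
  have EG: "h \<in> carrier G" if "h \<in> E" for h using that E by blast
  have "(norm \<zeta>)\<^sup>2 = (\<Sum>k\<in>E. (norm (perm k (v k)))\<^sup>2)"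
    unfolding \<zeta>_def
  proof (rule norm_sum_disjoint[OF E(1)])
    show "x \<in> NC k" if "k \<in> E" "l2_fun (perm k (v k)) x \<noteq> 0" for k x
      using supp[OF EG[OF that(1)] that] subset_thick[OF R imC[OF EG[OF that(1)]]] by (auto simp: NC_def)
    show "NC i \<inter> NC j = {}" if "i \<in> E" "j \<in> E" "i \<noteq> j" for i j
      unfolding NC_def using that by (intro disj) auto
  qed
  then have \<zeta>: "(norm \<zeta>)\<^sup>2 = (\<Sum>k\<in>E. (norm (v k))\<^sup>2)" using EG by (simp add: norm_perm_v)
  define w where "w h = (\<Sum>k\<in>E. covariant_block F t h k (v k))" for h
  have T\<zeta>: "T \<zeta> = (\<Sum>g\<in>F. \<Sum>k\<in>E. t g (perm (g \<otimes> k) (v k)))"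
    unfolding T_def \<zeta>_def blinfun_sum_apply using F E
    by (auto simp: blinfun.sum_right perm_perm subset_iff intro!: sum.cong)
  \<comment> \<open>By finite propagation the term of \<open>g\<close> and \<open>k\<close> is
    supported near the translate of \<open>C\<close> by \<open>g \<otimes> k\<close>; near the
    translate by \<open>h\<close> only the terms with \<open>g \<otimes> k = h\<close> survive. This
    is why disjointness is also required for the products of \<open>F\<close> with
    \<open>E\<close>.\<close>
  have comp: "restr (NC h) (T \<zeta>) = perm h (w h)" if h: "h \<in> E" for h
  proof -
    have hG: "h \<in> carrier G" using EG[OF h] .
    have piece: "restr (NC h) (t g (perm (g \<otimes> k) (v k))) = (if g = h \<otimes> inv k then t g (perm h (v k)) else 0)"
      if g: "g \<in> F" and k: "k \<in> E" for g k
    proof (rule l2_eqI)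
      fix x
      have gG: "g \<in> carrier G" "k \<in> carrier G" "g \<otimes> k \<in> carrier G" using F g EG[OF k] by auto
      have sup: "l2_fun (t g (perm (g \<otimes> k) (v k))) x \<noteq> 0 \<Longrightarrow> x \<in> NC (g \<otimes> k)"
        unfolding NC_def by (rule propagation_support[OF t(1)[OF g] t(2)[OF g]]) (use supp[OF gG(3) k] in auto)
      show "l2_fun (restr (NC h) (t g (perm (g \<otimes> k) (v k)))) x
          = l2_fun (if g = h \<otimes> inv k then t g (perm h (v k)) else 0) x"
      proof (cases "g \<otimes> k = h")
        case True
        then have "g = h \<otimes> inv k" using mult_eq_iff gG hG by blast
        then show ?thesis using sup True by auto
      next
        case False
        then have "g \<noteq> h \<otimes> inv k" using mult_eq_iff gG hG by blast
        moreover have "NC h \<inter> NC (g \<otimes> k) = {}"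
          unfolding NC_def using h g k False by (intro disj) auto
        ultimately show ?thesis using sup by (auto simp: l2_fun_simps)
      qed
    qed
    have "restr (NC h) (T \<zeta>) = (\<Sum>g\<in>F. \<Sum>k\<in>E. if g = h \<otimes> inv k then t g (perm h (v k)) else 0)"
      unfolding T\<zeta> blinfun.sum_right by (intro sum.cong refl piece)
    also have "\<dots> = (\<Sum>k\<in>E. if h \<otimes> inv k \<in> F then t (h \<otimes> inv k) (perm h (v k)) else 0)"
      using F(1) by (subst sum.swap) (auto intro!: sum.cong)
    also have "\<dots> = perm h (w h)"
    proof -
      have "restr X (t g \<xi>) = t g \<xi>" if "g \<in> F" for g \<xi>
        using t(1)[OF that] unfolding l2_ops_iff by (metis blinfun_apply_blinfun_compose)
      then show ?thesis
        unfolding w_def blinfun.sum_right covariant_block_def using hG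
        by (intro sum.cong) (auto simp: blinfun.zero_right)
    qed
    finally show ?thesis .
  qed
  have norm_w: "norm (perm h (w h)) = norm (w h)" if h: "h \<in> E" for h
  proof -
    have "restr X (w h) = w h"
      unfolding w_def blinfun.sum_right covariant_block_def using EG[OF h]
      by (intro sum.cong) (auto simp: blinfun.zero_right)
    then show ?thesis using EG[OF h] by (simp add: norm_perm_apply)
  qed
  have "(\<Sum>h\<in>E. (norm (w h))\<^sup>2) = (\<Sum>h\<in>E. (norm (restr (NC h) (T \<zeta>)))\<^sup>2)"
    by (intro sum.cong) (simp_all add: comp norm_w)
  also have "\<dots> \<le> (norm (T \<zeta>))\<^sup>2"
  proof (rule sum_norm_restr_disjoint_le[OF E(1)])
    show "NC i \<inter> NC j = {}" if "i \<in> E" "j \<in> E" "i \<noteq> j" for i j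
      unfolding NC_def using that by (intro disj) auto
  qed
  also have "\<dots> \<le> (norm T * norm \<zeta>)\<^sup>2" by (intro power_mono norm_blinfun) auto
  finally show ?thesis by (simp add: w_def T_def \<zeta> power_mult_distrib)
qed

text \<open>If the neighbourhoods meet, then for some \<open>x\<close> in \<open>C\<close> the
  element \<open>h' \<otimes> inv h\<close> moves \<open>\<phi> h x\<close> by at most
  \<open>2 * R + S\<close>. Coarse discontinuity confines \<open>\<phi> h x\<close> to a bounded,
  hence finite set, whose preimages make up \<open>B\<close>.\<close>

lemma translates_disjoint_at_infinity:
  assumes E: "finite E" "E \<subseteq> carrier G"
  obtains B where "finite B" "\<forall>C h h'. C \<subseteq> X - B \<longrightarrow> (\<forall>x\<in>C. \<forall>y\<in>C. d x y \<le> r) \<longrightarrow>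
    h \<in> E \<longrightarrow> h' \<in> E \<longrightarrow> h \<noteq> h' \<longrightarrow> thick R (\<phi> h ` C) \<inter> thick R (\<phi> h' ` C) = {}"
proof -
  obtain S where S: "S \<ge> 0" "\<And>g x y. g \<in> E \<Longrightarrow> x \<in> X \<Longrightarrow> y \<in> X \<Longrightarrow> d x y \<le> r \<Longrightarrow> d (\<phi> g x) (\<phi> g y) \<le> S"
    using uniform_expansion[OF E] by meson
  \<comment> \<open>Positive, and strictly larger than the displacement \<open>2 * R + S\<close>
    that has to be excluded.\<close>
  define Q where "Q = \<bar>2 * R + S\<bar> + 1"
  have "\<exists>K. mbounded K \<and> (\<forall>x\<in>X - K. d x (\<phi> (h' \<otimes> inv h) x) \<ge> Q)"
    if "h \<in> E" "h' \<in> E" "h \<noteq> h'" for h h'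
  proof -
    have hh: "h \<in> carrier G" "h' \<in> carrier G" using that E by auto
    have "h' \<otimes> inv h \<noteq> \<one>"
      using hh that(3) by (metis one_closed mult_eq_iff monoid.l_one[OF group.is_monoid[OF group_G]])
    then have "h' \<otimes> inv h \<in> carrier G - {\<one>}" using hh by simp
    moreover have "Q > 0" by (simp add: Q_def)
    ultimately show ?thesis using discontinuous unfolding coarsely_discontinuous_def by blast
  qed
  then obtain K where K: "\<And>h h'. h \<in> E \<Longrightarrow> h' \<in> E \<Longrightarrow> h \<noteq> h' \<Longrightarrow>
      mbounded (K h h') \<and> (\<forall>x\<in>X - K h h'. d x (\<phi> (h' \<otimes> inv h) x) \<ge> Q)" by metis
  define B where "B = (\<Union>h\<in>E. \<Union>h'\<in>E - {h}. \<phi> (inv h) ` K h h')"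
  have "finite B" unfolding B_def using E K finite_mbounded by (intro finite_UN_I finite_imageI) auto
  moreover have "thick R (\<phi> h ` C) \<inter> thick R (\<phi> h' ` C) = {}"
    if C: "C \<subseteq> X - B" "\<forall>x\<in>C. \<forall>y\<in>C. d x y \<le> r" and h: "h \<in> E" "h' \<in> E" "h \<noteq> h'" for C h h'
  proof (rule ccontr)
    assume "thick R (\<phi> h ` C) \<inter> thick R (\<phi> h' ` C) \<noteq> {}"
    then obtain z x x' where z: "z \<in> X" "x \<in> C" "x' \<in> C" "d z (\<phi> h x) \<le> R" "d z (\<phi> h' x') \<le> R"
      by (auto simp: thick_def)
    have hh: "h \<in> carrier G" "h' \<in> carrier G" using h E by auto
    have X: "x \<in> X" "x' \<in> X" using z C by auto
    have PX: "\<phi> h x \<in> X" "\<phi> h' x' \<in> X" "\<phi> h' x \<in> X" using X hh by auto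
    have "d (\<phi> h' x') (\<phi> h' x) \<le> S" using S(2)[OF h(2) X(2,1)] C(2) z by blast
    then have "d (\<phi> h x) (\<phi> h' x) \<le> 2 * R + S"
      using z triangle[OF PX(1) z(1) PX(2)] triangle[OF PX(1,2,3)] commute[of z "\<phi> h x"] by linarith
    moreover have "\<phi> (h' \<otimes> inv h) (\<phi> h x) = \<phi> h' x"
      using hh X by (simp add: composition_rule)
    moreover have "\<phi> h x \<notin> K h h'"
    proof
      assume "\<phi> h x \<in> K h h'"
      then have "x \<in> \<phi> (inv h) ` K h h'" using hh X by (metis action_inv(1) imageI)
      then have "x \<in> B" using h by (auto simp: B_def)
      then show False using z C by auto
    qed
    ultimately have "Q \<le> 2 * R + S" using K[OF h] PX by (metis DiffI order_trans)
    then show False by (simp add: Q_def)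
  qed
  ultimately show ?thesis by (intro that[of B] allI impI)
qed

end

text \<open>Converts the \<open>l1\<close>-variation controlled by Property A into the square
  variation of the square roots that enters the commutator estimate.\<close>

lemma square_diff_sqrt_le:
  assumes "a \<ge> 0" "b \<ge> 0"
  shows "(sqrt a - sqrt b)\<^sup>2 \<le> \<bar>a - b\<bar>"
proof -
  have "(sqrt a - sqrt b)\<^sup>2 = \<bar>sqrt a - sqrt b\<bar> * \<bar>sqrt a - sqrt b\<bar>" by (simp add: power2_eq_square)
  also have "\<dots> \<le> \<bar>sqrt a - sqrt b\<bar> * (sqrt a + sqrt b)"
    using assms by (intro mult_left_mono) (auto simp: abs_le_iff)
  also have "\<dots> = \<bar>(sqrt a - sqrt b) * (sqrt a + sqrt b)\<bar>"
    using assms by (simp add: abs_mult)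
  also have "(sqrt a - sqrt b) * (sqrt a + sqrt b) = a - b"
    using assms by (simp add: algebra_simps)
  finally show ?thesis .
qed

section \<open>The norm of a covariant block matrix away from a finite set\<close>

context coarse_action
begin

lemma covariant_block_finite_propagation:
  assumes "\<And>g. g \<in> F \<Longrightarrow> t g \<in> finite_propagation_ops X d" "h \<in> carrier G"
  shows "covariant_block F t h k \<in> finite_propagation_ops X d"
  using conj_finite_propagation[of "t (h \<otimes> inv k)" "inv h"] assms
  by (auto simp: covariant_block_def finite_propagation_0 group.inv_inv[OF group_G])

text \<open>A partition of unity provided by Property A cuts a vector into pieces supported on sets of bounded
  diameter, to which the local estimate applies, and almost commutes with the operators.\<close>

lemma covariant_block_estimate:
  fixes t :: "'g \<Rightarrow> ('x, 'h::complex_hilbert) l2 \<Rightarrow>\<^sub>L ('x, 'h) l2"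
  assumes A: "property_A TYPE('s) X d"
    and F: "finite F" "F \<subseteq> carrier G" and E: "finite E" "E \<subseteq> carrier G"
    and t: "\<And>g. g \<in> F \<Longrightarrow> t g \<in> finite_propagation_ops X d" and \<epsilon>: "\<epsilon> > 0"
  shows "\<exists>B. finite B \<and> norm (block_op E (\<lambda>h k. covariant_block F t h k o\<^sub>L restr (- B)))
    \<le> norm (\<Sum>g\<in>F. t g o\<^sub>L perm g) + \<epsilon>"
proof -
  define c where "c = norm (\<Sum>g\<in>F. t g o\<^sub>L perm g)"
  define a where "a = covariant_block F t"
  have EG: "h \<in> carrier G" if "h \<in> E" for h using that E by blast
  have a: "a h k \<in> finite_propagation_ops X d" if "h \<in> E" for h k
    unfolding a_def using t EG[OF that] by (rule covariant_block_finite_propagation)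
  have al2: "a h k \<in> l2_ops X" if "h \<in> E" for h k using a[OF that] by (simp add: finite_propagation_iff)
  have "\<forall>g\<in>F. \<exists>R\<ge>0. \<forall>x y. d x y > R \<longrightarrow> entry (t g) x y = (\<lambda>_. 0)"
    using t by (simp add: finite_propagation_iff)
  then obtain Rt where Rt: "\<And>g. g \<in> F \<Longrightarrow> Rt g \<ge> 0"
    "\<And>g x y. g \<in> F \<Longrightarrow> d x y > Rt g \<Longrightarrow> entry (t g) x y = (\<lambda>_. 0)" by metis
  \<comment> \<open>The sum serves as a common bound for finitely many propagations;
    \<open>R'\<close> and \<open>M\<close> below are formed in the same way.\<close>
  define R where "R = (\<Sum>g\<in>F. Rt g)"
  have R: "R \<ge> 0" unfolding R_def using Rt by (intro sum_nonneg)
  have tR: "entry (t g) x y = (\<lambda>_. 0)" if "g \<in> F" "d x y > R" for g x y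
    using Rt(2)[OF that(1)] member_le_sum[OF that(1), of Rt] Rt(1) F(1) that(2)
    by (auto simp: R_def)
  have "\<forall>h\<in>E. \<forall>k. \<exists>R\<ge>0. \<forall>x y. d x y > R \<longrightarrow> entry (a h k) x y = (\<lambda>_. 0)"
    using a by (simp add: finite_propagation_iff)
  then obtain Ra where Ra: "\<And>h k. h \<in> E \<Longrightarrow> Ra h k \<ge> 0"
    "\<And>h k x y. h \<in> E \<Longrightarrow> d x y > Ra h k \<Longrightarrow> entry (a h k) x y = (\<lambda>_. 0)" by metis
  define R' where "R' = (\<Sum>h\<in>E. \<Sum>k\<in>E. Ra h k)"
  have aR': "entry (a h k) x y = (\<lambda>_. 0)" if "h \<in> E" "k \<in> E" "d x y > R'" for h k x y
  proof -
    have "Ra h k \<le> (\<Sum>k\<in>E. Ra h k)" using E that Ra by (intro member_le_sum) auto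
    also have "\<dots> \<le> R'" unfolding R'_def using E that Ra by (intro member_le_sum sum_nonneg) auto
    finally show ?thesis using Ra(2)[OF that(1)] that(3) by simp
  qed
  obtain N where N: "\<And>x. x \<in> X \<Longrightarrow> card (nbhd x R') \<le> N" using nbhd_bound by meson
  define M where "M = (\<Sum>h\<in>E. \<Sum>k\<in>E. norm (a h k))"
  have M: "norm (a h k) \<le> M" if "h \<in> E" "k \<in> E" for h k
  proof -
    have "norm (a h k) \<le> (\<Sum>k\<in>E. norm (a h k))" using E that by (intro member_le_sum) auto
    also have "\<dots> \<le> M" unfolding M_def using E that by (intro member_le_sum sum_nonneg) auto
    finally show ?thesis .
  qed
  \<comment> \<open>The factor in front of \<open>\<delta>\<close> in the total squared norm of the
    commutators: one \<open>card E\<close> from Cauchy-Schwarz, one from summing over rows, and the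
    constant of \<open>commutator_estimate\<close>. The choice of \<open>\<delta>\<close> brings the
    total below \<open>\<epsilon>\<^sup>2\<close>.\<close>
  define L where "L = (real (card E) * real N * M)\<^sup>2"
  define \<delta> where "\<delta> = \<epsilon>\<^sup>2 / (L + 1)"
  have L: "L \<ge> 0" by (simp add: L_def)
  have \<delta>: "\<delta> > 0" "L * \<delta> \<le> \<epsilon>\<^sup>2" using \<epsilon> L by (auto simp: \<delta>_def field_simps)
  obtain p :: "'x \<Rightarrow> 's \<Rightarrow> real" and r where
    p0: "\<forall>x\<in>X. (\<forall>s. p x s \<in> {0..1}) \<and> finite {s. p x s \<noteq> 0} \<and> (\<Sum>s | p x s \<noteq> 0. p x s) = 1"
    and r0: "\<forall>s. \<forall>x\<in>X. \<forall>y\<in>X. p x s \<noteq> 0 \<longrightarrow> p y s \<noteq> 0 \<longrightarrow> d x y \<le> r"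
    and pvar: "\<forall>S x y. finite S \<longrightarrow> x \<in> X \<longrightarrow> y \<in> X \<longrightarrow> d x y \<le> R' \<longrightarrow> (\<Sum>s\<in>S. \<bar>p x s - p y s\<bar>) \<le> \<delta>"
    by (rule property_A_partition[OF A \<delta>(1), of R'])
  note p = bspec[OF p0]
  have r: "d x y \<le> r" if "x \<in> X" "y \<in> X" "p x s \<noteq> 0" "p y s \<noteq> 0" for s x y
    using r0 that by blast
  \<comment> \<open>Contains every group element whose translates \<open>local_estimate\<close>
    needs to be far apart.\<close>
  define E' where "E' = E \<union> (\<lambda>(g, k). g \<otimes> k) ` (F \<times> E)"
  have E': "finite E'" "E' \<subseteq> carrier G" using E F by (auto simp: E'_def intro!: m_closed)
  obtain B where B: "finite B" and disj: "\<forall>C h h'. C \<subseteq> X - B \<longrightarrow> (\<forall>x\<in>C. \<forall>y\<in>C. d x y \<le> r) \<longrightarrow>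
      h \<in> E' \<longrightarrow> h' \<in> E' \<longrightarrow> h \<noteq> h' \<longrightarrow> thick R (\<phi> h ` C) \<inter> thick R (\<phi> h' ` C) = {}"
    by (rule translates_disjoint_at_infinity[OF E', of r R])
  \<comment> \<open>Square roots, so that the squares of the cut-off functions sum to one on
    \<open>X\<close>.\<close>
  define \<psi> where "\<psi> s x = (if x \<in> X then sqrt (p x s) else 0)" for s x
  have \<psi>1: "\<bar>\<psi> s x\<bar> \<le> 1" for s x using p[of x] by (auto simp: \<psi>_def)
  have \<psi>sq: "(\<psi> s x)\<^sup>2 = p x s" if "x \<in> X" for s x using p[OF that] that by (simp add: \<psi>_def)
  have main: "norm (block_op E (\<lambda>h k. a h k o\<^sub>L restr (- B)) \<eta>) \<le> (c + \<epsilon>) * norm \<eta>" for \<eta>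
  proof -
    define v where "v k = restr (X - B) (l2_fun \<eta> k)" for k
    define u where "u h = (\<Sum>k\<in>E. a h k (v k))" for h
    define V where "V = sqrt (\<Sum>k\<in>E. (norm (v k))\<^sup>2)"
    have V0: "V \<ge> 0" by (simp add: V_def sum_nonneg)
    have V2: "V\<^sup>2 = (\<Sum>k\<in>E. (norm (v k))\<^sup>2)" by (simp add: V_def sum_nonneg)
    have V: "V \<le> norm \<eta>"
    proof (rule power2_le_imp_le)
      have "V\<^sup>2 \<le> (\<Sum>k\<in>E. (norm (l2_fun \<eta> k))\<^sup>2)"
        unfolding V2 v_def by (intro sum_mono power_mono norm_restr_apply_le) auto
      also have "\<dots> \<le> (norm \<eta>)\<^sup>2" by (rule sum_le_norm_l2[OF E(1)])
      finally show "V\<^sup>2 \<le> (norm \<eta>)\<^sup>2" .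
    qed simp
    have uB: "l2_fun (block_op E (\<lambda>h k. a h k o\<^sub>L restr (- B)) \<eta>) h = u h" if h: "h \<in> E" for h
    proof -
      have "a h k (restr (- B) w) = a h k (restr (X - B) w)" for k w
      proof -
        have "a h k (restr (- B) w) = a h k (restr X (restr (- B) w))"
          using al2[OF h] unfolding l2_ops_iff by (metis blinfun_apply_blinfun_compose)
        then show ?thesis by (simp add: Diff_eq)
      qed
      then show ?thesis using h by (simp add: block_op_apply[OF E(1)] u_def v_def)
    qed
    \<comment> \<open>Testing on a finite set \<open>B1\<close> leaves finitely many relevant
      vertices: the squares of the \<open>\<psi> s\<close> with \<open>s\<close> in \<open>S\<close>
      then sum to one on \<open>B1\<close> and to at most one elsewhere.\<close>
    have bound: "(\<Sum>h\<in>E. (norm (restr B1 (u h)))\<^sup>2) \<le> ((c + \<epsilon>) * V)\<^sup>2" if B1: "finite B1" for B1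
    proof -
      define S where "S = (\<Union>x\<in>B1 \<inter> X. {s. p x s \<noteq> 0})"
      have S: "finite S" unfolding S_def using B1 p by auto
      have sum1: "(\<Sum>s\<in>S. (\<psi> s x)\<^sup>2) \<le> 1" for x
      proof (cases "x \<in> X")
        case True
        have "(\<Sum>s\<in>S. p x s) \<le> (\<Sum>s\<in>S \<union> {s. p x s \<noteq> 0}. p x s)"
          using S p[OF True] by (intro sum_mono2) auto
        also have "\<dots> = (\<Sum>s | p x s \<noteq> 0. p x s)"
          using S p[OF True] by (intro sum.mono_neutral_right) auto
        finally show ?thesis using p[OF True] by (simp add: \<psi>sq[OF True])
      qed (simp add: \<psi>_def)
      have sum_eq1: "(\<Sum>s\<in>S. (\<psi> s x)\<^sup>2) = 1" if "x \<in> B1 \<inter> X" for x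
      proof -
        have "(\<Sum>s\<in>S. p x s) = (\<Sum>s | p x s \<noteq> 0. p x s)"
          using S that by (intro sum.mono_neutral_right) (auto simp: S_def)
        then show ?thesis using p[of x] \<psi>sq[of x] that by simp
      qed
      have var: "(\<Sum>s\<in>S. (\<psi> s y - \<psi> s x)\<^sup>2) \<le> \<delta>" if xy: "x \<in> X" "y \<in> X" "d x y \<le> R'" for x y
      proof -
        have "(\<Sum>s\<in>S. (\<psi> s y - \<psi> s x)\<^sup>2) \<le> (\<Sum>s\<in>S. \<bar>p x s - p y s\<bar>)"
        proof (rule sum_mono)
          fix s
          have "(\<psi> s y - \<psi> s x)\<^sup>2 \<le> \<bar>p y s - p x s\<bar>"
            using p xy by (simp add: \<psi>_def square_diff_sqrt_le)
          then show "(\<psi> s y - \<psi> s x)\<^sup>2 \<le> \<bar>p x s - p y s\<bar>" by (simp add: abs_minus_commute)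
        qed
        also have "\<dots> \<le> \<delta>" by (rule pvar[rule_format, OF S xy])
        finally show ?thesis .
      qed
      \<comment> \<open>A piece of the image equals the image of the pieces, measured by
        \<open>\<alpha>\<close>, minus a commutator, measured by \<open>\<beta>\<close>.\<close>
      define \<alpha> where "\<alpha> s h = norm (\<Sum>k\<in>E. a h k (mul_op (\<psi> s) (v k)))" for s h
      define \<beta> where "\<beta> s h = norm (\<Sum>k\<in>E. a h k (mul_op (\<psi> s) (v k)) - mul_op (\<psi> s) (a h k (v k)))" for s h
      have \<alpha>: "(\<Sum>s\<in>S. \<Sum>h\<in>E. (\<alpha> s h)\<^sup>2) \<le> (c * V)\<^sup>2"
      proof -
        \<comment> \<open>The vectors cut off by \<open>\<psi> s\<close> live on the support of
          \<open>p\<close> at \<open>s\<close> without \<open>B\<close>, a set of diameter at most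
          \<open>r\<close> whose relevant translates are far apart by the choice of
          \<open>B\<close>.\<close>
        have "(\<Sum>h\<in>E. (\<alpha> s h)\<^sup>2) \<le> c\<^sup>2 * (\<Sum>k\<in>E. (norm (mul_op (\<psi> s) (v k)))\<^sup>2)" for s
          unfolding \<alpha>_def a_def c_def
        proof (rule local_estimate[OF F E R _ tR, where C = "{x \<in> X. p x s \<noteq> 0} - B"])
          show "t g \<in> l2_ops X" if "g \<in> F" for g using t[OF that] by (simp add: finite_propagation_iff)
          show "x \<in> {x \<in> X. p x s \<noteq> 0} - B" if "l2_fun (mul_op (\<psi> s) (v k)) x \<noteq> 0" for k x
            using that by (auto simp: mul_op_apply[OF \<psi>1] v_def \<psi>_def split: if_splits)
          show "thick R (\<phi> h ` ({x \<in> X. p x s \<noteq> 0} - B)) \<inter> thick R (\<phi> h' ` ({x \<in> X. p x s \<noteq> 0} - B)) = {}"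
            if "h \<in> E" "h' \<in> E \<union> (\<lambda>(g, k). g \<otimes> k) ` (F \<times> E)" "h \<noteq> h'" for h h'
            using that r by (intro disj[rule_format]) (auto simp: E'_def)
        qed auto
        then have "(\<Sum>s\<in>S. \<Sum>h\<in>E. (\<alpha> s h)\<^sup>2) \<le> (\<Sum>s\<in>S. c\<^sup>2 * (\<Sum>k\<in>E. (norm (mul_op (\<psi> s) (v k)))\<^sup>2))"
          by (intro sum_mono)
        also have "\<dots> = c\<^sup>2 * (\<Sum>k\<in>E. \<Sum>s\<in>S. (norm (mul_op (\<psi> s) (v k)))\<^sup>2)"
          unfolding sum_distrib_left[symmetric] by (subst sum.swap) simp
        also have "\<dots> \<le> c\<^sup>2 * (\<Sum>k\<in>E. (norm (v k))\<^sup>2)"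
          by (intro mult_left_mono sum_mono sum_norm_mul_op_le S \<psi>1 sum1) auto
        finally show ?thesis by (simp add: power_mult_distrib V2)
      qed
      have \<beta>: "(\<Sum>s\<in>S. \<Sum>h\<in>E. (\<beta> s h)\<^sup>2) \<le> (\<epsilon> * V)\<^sup>2"
      proof -
        define w where "w s h k = (norm (a h k (mul_op (\<psi> s) (v k)) - mul_op (\<psi> s) (a h k (v k))))\<^sup>2" for s h k
        have w: "(\<Sum>s\<in>S. w s h k) \<le> (real N)\<^sup>2 * M\<^sup>2 * \<delta> * (norm (v k))\<^sup>2" if "h \<in> E" "k \<in> E" for h k
        proof -
          have "(\<Sum>s\<in>S. w s h k) \<le> (real N)\<^sup>2 * (norm (a h k))\<^sup>2 * \<delta> * (norm (v k))\<^sup>2"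
            unfolding w_def using \<delta>
            by (intro commutator_estimate[OF al2[OF that(1)] aR'[OF that] N S \<psi>1 var]) auto
          also have "\<dots> \<le> (real N)\<^sup>2 * M\<^sup>2 * \<delta> * (norm (v k))\<^sup>2"
            using \<delta> M[OF that] by (intro mult_right_mono mult_left_mono power_mono) auto
          finally show ?thesis .
        qed
        have "(\<Sum>s\<in>S. \<Sum>h\<in>E. (\<beta> s h)\<^sup>2) \<le> (\<Sum>s\<in>S. \<Sum>h\<in>E. real (card E) * (\<Sum>k\<in>E. w s h k))"
          unfolding \<beta>_def w_def by (intro sum_mono norm_sum_square_le) simp
        also have "\<dots> = real (card E) * (\<Sum>h\<in>E. \<Sum>k\<in>E. \<Sum>s\<in>S. w s h k)"
          unfolding sum_distrib_left[symmetric]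
          by (subst sum.swap) (intro arg_cong[of _ _ "\<lambda>x. _ * x"] sum.cong refl sum.swap)
        also have "\<dots> \<le> real (card E) * (\<Sum>h\<in>E. \<Sum>k\<in>E. (real N)\<^sup>2 * M\<^sup>2 * \<delta> * (norm (v k))\<^sup>2)"
          by (intro mult_left_mono sum_mono w) auto
        also have "\<dots> = real (card E) * (real (card E) * ((real N)\<^sup>2 * M\<^sup>2 * \<delta> * V\<^sup>2))"
          unfolding V2 sum_distrib_left[symmetric] by simp
        also have "\<dots> = L * \<delta> * V\<^sup>2"
          by (simp add: L_def power2_eq_square mult_ac)
        also have "\<dots> \<le> \<epsilon>\<^sup>2 * V\<^sup>2" using \<delta>(2) by (intro mult_right_mono) auto
        finally show ?thesis by (simp add: power_mult_distrib)
      qed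
      have pw: "norm (mul_op (\<psi> s) (u h)) \<le> \<alpha> s h + \<beta> s h" for s h
      proof -
        have eq: "mul_op (\<psi> s) (u h) = (\<Sum>k\<in>E. a h k (mul_op (\<psi> s) (v k)))
            - (\<Sum>k\<in>E. a h k (mul_op (\<psi> s) (v k)) - mul_op (\<psi> s) (a h k (v k)))"
          by (simp add: u_def blinfun.sum_right sum_subtractf)
        show ?thesis unfolding \<alpha>_def \<beta>_def eq by (rule norm_triangle_ineq4)
      qed
      have "(\<Sum>h\<in>E. (norm (restr B1 (u h)))\<^sup>2) \<le> (\<Sum>h\<in>E. \<Sum>s\<in>S. (norm (mul_op (\<psi> s) (u h)))\<^sup>2)"
      proof (rule sum_mono)
        fix h assume h: "h \<in> E"
        have u0: "l2_fun (u h) x = 0" if "x \<notin> X" for x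
          using l2_ops_apply_outside[OF al2[OF h] that] by (simp add: u_def l2_fun_sum)
        have "(norm (restr B1 (u h)))\<^sup>2 = (\<Sum>x\<in>B1 \<inter> X. (norm (l2_fun (u h) x))\<^sup>2)"
          unfolding norm_restr_finite[OF B1] using B1 u0 by (intro sum.mono_neutral_right) auto
        also have "\<dots> = (\<Sum>x\<in>B1 \<inter> X. (\<Sum>s\<in>S. (\<psi> s x)\<^sup>2) * (norm (l2_fun (u h) x))\<^sup>2)"
          by (intro sum.cong) (auto simp: sum_eq1)
        also have "\<dots> = (\<Sum>s\<in>S. \<Sum>x\<in>B1 \<inter> X. (norm (l2_fun (mul_op (\<psi> s) (u h)) x))\<^sup>2)"
          unfolding sum_distrib_right by (subst sum.swap) (simp add: mul_op_apply[OF \<psi>1] power_mult_distrib)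
        also have "\<dots> \<le> (\<Sum>s\<in>S. (norm (mul_op (\<psi> s) (u h)))\<^sup>2)"
          using B1 by (intro sum_mono sum_le_norm_l2) auto
        finally show "(norm (restr B1 (u h)))\<^sup>2 \<le> (\<Sum>s\<in>S. (norm (mul_op (\<psi> s) (u h)))\<^sup>2)" .
      qed
      also have "\<dots> = (\<Sum>(s, h)\<in>S \<times> E. (norm (mul_op (\<psi> s) (u h)))\<^sup>2)"
        by (subst sum.swap) (simp add: sum.cartesian_product)
      also have "\<dots> \<le> (\<Sum>(s, h)\<in>S \<times> E. (\<alpha> s h + \<beta> s h)\<^sup>2)"
        by (intro sum_mono) (auto intro!: power_mono pw)
      \<comment> \<open>Minkowski's inequality over vertices and rows together adds the two errors
        as norms, giving \<open>c + \<epsilon>\<close> without an extra factor.\<close>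
      also have "\<dots> = (L2_set (\<lambda>i. case i of (s, h) \<Rightarrow> \<alpha> s h + \<beta> s h) (S \<times> E))\<^sup>2"
        by (simp add: L2_set_def sum_nonneg split_def)
      also have "\<dots> \<le> (L2_set (\<lambda>(s, h). \<alpha> s h) (S \<times> E) + L2_set (\<lambda>(s, h). \<beta> s h) (S \<times> E))\<^sup>2"
        using L2_set_triangle_ineq[of "\<lambda>(s, h). \<alpha> s h" "\<lambda>(s, h). \<beta> s h" "S \<times> E"]
        by (intro power_mono) (auto simp: split_def L2_set_nonneg)
      also have "\<dots> \<le> (c * V + \<epsilon> * V)\<^sup>2"
      proof (intro power_mono add_mono)
        show "L2_set (\<lambda>(s, h). \<alpha> s h) (S \<times> E) \<le> c * V"
          unfolding L2_set_def using \<alpha> V0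
          by (intro real_le_lsqrt) (auto simp: c_def sum.cartesian_product split_def)
        show "L2_set (\<lambda>(s, h). \<beta> s h) (S \<times> E) \<le> \<epsilon> * V"
          unfolding L2_set_def using \<beta> V0 \<epsilon>
          by (intro real_le_lsqrt) (auto simp: sum.cartesian_product split_def)
      qed (simp add: L2_set_nonneg)
      finally show ?thesis by (simp add: distrib_right)
    qed
    have "((\<lambda>B1. \<Sum>h\<in>E. (norm (restr B1 (u h)))\<^sup>2) \<longlongrightarrow> (\<Sum>h\<in>E. (norm (u h))\<^sup>2)) (finite_subsets_at_top UNIV)"
      by (intro tendsto_intros tendsto_restr)
    then have "(\<Sum>h\<in>E. (norm (u h))\<^sup>2) \<le> ((c + \<epsilon>) * V)\<^sup>2"
      by (rule tendsto_upperbound[OF _ _ finite_subsets_at_top_neq_bot])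
        (auto intro: eventually_finite_subsets_at_top_weakI bound)
    moreover have "(norm (block_op E (\<lambda>h k. a h k o\<^sub>L restr (- B)) \<eta>))\<^sup>2 = (\<Sum>h\<in>E. (norm (u h))\<^sup>2)"
    proof -
      have "(norm (block_op E (\<lambda>h k. a h k o\<^sub>L restr (- B)) \<eta>))\<^sup>2
          = (\<Sum>h\<in>E. (norm (l2_fun (block_op E (\<lambda>h k. a h k o\<^sub>L restr (- B)) \<eta>) h))\<^sup>2)"
        by (rule norm_l2_finite[OF E(1)]) (simp add: block_op_apply[OF E(1)])
      also have "\<dots> = (\<Sum>h\<in>E. (norm (u h))\<^sup>2)" by (intro sum.cong) (simp_all add: uB)
      finally show ?thesis .
    qed
    ultimately have "(norm (block_op E (\<lambda>h k. a h k o\<^sub>L restr (- B)) \<eta>))\<^sup>2 \<le> ((c + \<epsilon>) * V)\<^sup>2"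
      by simp
    then have "norm (block_op E (\<lambda>h k. a h k o\<^sub>L restr (- B)) \<eta>) \<le> (c + \<epsilon>) * V"
      by (rule power2_le_imp_le) (use V0 \<epsilon> in \<open>simp add: c_def\<close>)
    also have "\<dots> \<le> (c + \<epsilon>) * norm \<eta>" using V \<epsilon> by (intro mult_left_mono) (auto simp: c_def)
    finally show ?thesis .
  qed
  have "norm (block_op E (\<lambda>h k. a h k o\<^sub>L restr (- B))) \<le> c + \<epsilon>"
    using main \<epsilon> by (intro norm_blinfun_bound) (auto simp: c_def)
  then show ?thesis using B unfolding a_def c_def by blast
qed

end

section \<open>Extension of a contractive homomorphism to an exact sequence\<close>

text \<open>The closure of \<open>P\<close> is the graph of \<open>q\<close>: contractivity makes it
  single valued and total on the closed domain. The lifting bound \<open>approx\<close> identifies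
  the kernel with \<open>K\<close>, and it closes the range, since preimages of a convergent
  sequence can be corrected by elements of \<open>K\<close> until they converge.\<close>

lemma closed_range_extension:
  fixes P :: "(('a::complex_hilbert \<Rightarrow>\<^sub>L 'a) \<times> ('b::complex_hilbert \<Rightarrow>\<^sub>L 'b)) set"
  assumes clin: "\<And>a b. (a, b) \<in> P \<Longrightarrow> clinear_op a \<and> clinear_op b"
    and add: "\<And>p q. p \<in> P \<Longrightarrow> q \<in> P \<Longrightarrow> p + q \<in> P"
    and scale: "\<And>c a b. (a, b) \<in> P \<Longrightarrow> (scale_op c a, scale_op c b) \<in> P"
    and mult: "\<And>a b a' b'. (a, b) \<in> P \<Longrightarrow> (a', b') \<in> P \<Longrightarrow> (a o\<^sub>L a', b o\<^sub>L b') \<in> P"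
    and adj: "\<And>a b. (a, b) \<in> P \<Longrightarrow> (adj_op a, adj_op b) \<in> P"
    and contr: "\<And>a b. (a, b) \<in> P \<Longrightarrow> norm b \<le> norm a"
    and approx: "\<And>a b e. (a, b) \<in> P \<Longrightarrow> e > 0 \<Longrightarrow> \<exists>k\<in>K. norm (a - k) \<le> norm b + e"
    and K: "closed K" "\<And>k. k \<in> K \<Longrightarrow> (k, 0) \<in> closure P"
  shows "\<exists>q. short_exact (op_algebra K) (op_algebra (closure (fst ` P))) (op_algebra (closure (snd ` P))) id q"
proof -
  define C where "C = closure P"
  have lim: "\<exists>X Y. (\<forall>n. (X n, Y n) \<in> P) \<and> X \<longlonglongrightarrow> a \<and> Y \<longlonglongrightarrow> b" if ab: "(a, b) \<in> C" for a b
  proof -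
    obtain Z where Z: "\<forall>n. Z n \<in> P" "Z \<longlonglongrightarrow> (a, b)" using ab unfolding C_def closure_sequential by blast
    have "(\<lambda>n. fst (Z n)) \<longlonglongrightarrow> a" "(\<lambda>n. snd (Z n)) \<longlonglongrightarrow> b"
      using tendsto_fst[OF Z(2)] tendsto_snd[OF Z(2)] by auto
    with Z(1) show ?thesis by (intro exI[of _ "\<lambda>n. fst (Z n)"] exI[of _ "\<lambda>n. snd (Z n)"]) auto
  qed
  have limI: "(a, b) \<in> C" if "\<And>n. (X n, Y n) \<in> P" "X \<longlonglongrightarrow> a" "Y \<longlonglongrightarrow> b" for X Y a b
    unfolding C_def closure_sequential using that tendsto_Pair[OF that(2,3)]
    by (intro exI[of _ "\<lambda>n. (X n, Y n)"]) auto
  have clinC: "clinear_op a \<and> clinear_op b" if ab: "(a, b) \<in> C" for a b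
  proof -
    obtain X Y where XY: "\<forall>n. (X n, Y n) \<in> P" "X \<longlonglongrightarrow> a" "Y \<longlonglongrightarrow> b" using lim[OF ab] by blast
    have "X n \<in> {T. clinear_op T}" "Y n \<in> {T. clinear_op T}" for n using clin XY(1) by auto
    then show ?thesis
      using closed_sequentially[OF closed_clinear_ops _ XY(2)] closed_sequentially[OF closed_clinear_ops _ XY(3)]
      by auto
  qed
  have addC: "(a + a', b + b') \<in> C" if ab: "(a, b) \<in> C" "(a', b') \<in> C" for a b a' b'
  proof -
    obtain X Y where XY: "\<forall>n. (X n, Y n) \<in> P" "X \<longlonglongrightarrow> a" "Y \<longlonglongrightarrow> b" using lim[OF ab(1)] by blast
    obtain X' Y' where XY': "\<forall>n. (X' n, Y' n) \<in> P" "X' \<longlonglongrightarrow> a'" "Y' \<longlonglongrightarrow> b'" using lim[OF ab(2)] by blast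
    show ?thesis
      using add XY(1) XY'(1)
      by (intro limI[OF _ tendsto_add[OF XY(2) XY'(2)] tendsto_add[OF XY(3) XY'(3)]]) force
  qed
  have scaleC: "(scale_op c a, scale_op c b) \<in> C" if ab: "(a, b) \<in> C" for a b c
  proof -
    obtain X Y where XY: "\<forall>n. (X n, Y n) \<in> P" "X \<longlonglongrightarrow> a" "Y \<longlonglongrightarrow> b" using lim[OF ab] by blast
    have s: "(\<lambda>n. scale_op c (Z n)) \<longlonglongrightarrow> scale_op c z" if "Z \<longlonglongrightarrow> z"
      for Z :: "nat \<Rightarrow> 'c::complex_hilbert \<Rightarrow>\<^sub>L 'c" and z
      using bounded_bilinear.tendsto[OF bounded_bilinear_blinfun_compose tendsto_const that, of "scale_op c id_blinfun"]
      by (simp add: scale_op_comp)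
    show ?thesis using scale XY(1) by (intro limI[OF _ s[OF XY(2)] s[OF XY(3)]]) auto
  qed
  have multC: "(a o\<^sub>L a', b o\<^sub>L b') \<in> C" if ab: "(a, b) \<in> C" "(a', b') \<in> C" for a b a' b'
  proof -
    obtain X Y where XY: "\<forall>n. (X n, Y n) \<in> P" "X \<longlonglongrightarrow> a" "Y \<longlonglongrightarrow> b" using lim[OF ab(1)] by blast
    obtain X' Y' where XY': "\<forall>n. (X' n, Y' n) \<in> P" "X' \<longlonglongrightarrow> a'" "Y' \<longlonglongrightarrow> b'" using lim[OF ab(2)] by blast
    note tm = bounded_bilinear.tendsto[OF bounded_bilinear_blinfun_compose]
    show ?thesis
      using mult XY(1) XY'(1) by (intro limI[OF _ tm[OF XY(2) XY'(2)] tm[OF XY(3) XY'(3)]]) auto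
  qed
  have adjC: "(adj_op a, adj_op b) \<in> C" if ab: "(a, b) \<in> C" for a b
  proof -
    obtain X Y where XY: "\<forall>n. (X n, Y n) \<in> P" "X \<longlonglongrightarrow> a" "Y \<longlonglongrightarrow> b" using lim[OF ab] by blast
    have "clinear_op (X n)" "clinear_op (Y n)" for n using clin XY(1) by auto
    then show ?thesis
      using adj XY(1) clinC[OF ab]
      by (intro limI[OF _ tendsto_adj_op[OF XY(2)] tendsto_adj_op[OF XY(3)]]) auto
  qed
  have contrC: "norm b \<le> norm a" if ab: "(a, b) \<in> C" for a b
  proof -
    obtain X Y where XY: "\<forall>n. (X n, Y n) \<in> P" "X \<longlonglongrightarrow> a" "Y \<longlonglongrightarrow> b" using lim[OF ab] by blast
    show ?thesis
      by (rule LIMSEQ_le[OF tendsto_norm[OF XY(3)] tendsto_norm[OF XY(2)]]) (use contr XY(1) in auto)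
  qed
  have diffC: "(a - a', b - b') \<in> C" if ab: "(a, b) \<in> C" "(a', b') \<in> C" for a b a' b'
    using addC[OF ab(1) scaleC[OF ab(2), of "complex_of_real (-1)"]] unfolding scale_op_of_real by simp
  \<comment> \<open>Contractivity survives in the closure, so a pair with first component zero has
    second component zero.\<close>
  have uniq: "b = b'" if "(a, b) \<in> C" "(a, b') \<in> C" for a b b'
    using contrC[OF diffC[OF that]] by simp
  have PC: "P \<subseteq> C" unfolding C_def by (rule closure_subset)
  have diffP: "norm (snd p - snd p') \<le> norm (fst p - fst p')" if "p \<in> P" "p' \<in> P" for p p'
    using contrC[OF diffC[of "fst p" "snd p" "fst p'" "snd p'"]] that PC by auto
  have ex: "\<exists>b. (a, b) \<in> C" if a: "a \<in> closure (fst ` P)" for a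
  proof -
    obtain X where X: "\<forall>n. X n \<in> fst ` P" "X \<longlonglongrightarrow> a" using a unfolding closure_sequential by blast
    then have "\<forall>n. \<exists>b. (X n, b) \<in> P" by force
    then obtain Y where Y: "\<And>n. (X n, Y n) \<in> P" by metis
    have "Cauchy Y"
    proof (rule metric_CauchyI)
      fix e :: real assume "e > 0"
      then obtain M where "\<forall>m\<ge>M. \<forall>n\<ge>M. dist (X m) (X n) < e"
        using LIMSEQ_imp_Cauchy[OF X(2)] unfolding Cauchy_def by blast
      then have "dist (Y m) (Y n) < e" if "m \<ge> M" "n \<ge> M" for m n
        using diffP[OF Y[of m] Y[of n]] that by (force simp: dist_norm)
      then show "\<exists>M. \<forall>m\<ge>M. \<forall>n\<ge>M. dist (Y m) (Y n) < e" by blast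
    qed
    then obtain b where "Y \<longlonglongrightarrow> b" using Cauchy_convergent convergent_def by blast
    then show ?thesis using limI[OF Y X(2)] by blast
  qed
  have fstC: "a \<in> closure (fst ` P)" and sndC: "b \<in> closure (snd ` P)" if ab: "(a, b) \<in> C" for a b
  proof -
    obtain X Y where XY: "\<forall>n. (X n, Y n) \<in> P" "X \<longlonglongrightarrow> a" "Y \<longlonglongrightarrow> b" using lim[OF ab] by blast
    show "a \<in> closure (fst ` P)" unfolding closure_sequential using XY by force
    show "b \<in> closure (snd ` P)" unfolding closure_sequential using XY by force
  qed
  define q where "q a = (THE b. (a, b) \<in> C)" for a
  have q: "q a = b" if "(a, b) \<in> C" for a b
    unfolding q_def using that uniq by (intro the_equality) auto
  have qC: "(a, q a) \<in> C" if "a \<in> closure (fst ` P)" for a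
    using ex[OF that] q by metis
  have hom: "star_hom (op_algebra (closure (fst ` P))) (op_algebra (closure (snd ` P))) q"
    unfolding star_hom_def op_algebra_def
    using sndC qC q addC scaleC multC adjC by auto
  have KC: "(k, 0) \<in> C" if "k \<in> K" for k using K(2)[OF that] by (simp add: C_def)
  have "star_hom (op_algebra K) (op_algebra (closure (fst ` P))) id"
    using fstC[OF KC] by (auto simp: star_hom_def op_algebra_def)
  moreover have "K = star_kernel (op_algebra (closure (fst ` P))) (op_algebra (closure (snd ` P))) q"
  proof
    show "K \<subseteq> star_kernel (op_algebra (closure (fst ` P))) (op_algebra (closure (snd ` P))) q"
      using fstC[OF KC] q[OF KC] by (auto simp: star_kernel_def op_algebra_def)
    show "star_kernel (op_algebra (closure (fst ` P))) (op_algebra (closure (snd ` P))) q \<subseteq> K"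
    proof
      fix a assume "a \<in> star_kernel (op_algebra (closure (fst ` P))) (op_algebra (closure (snd ` P))) q"
      then have a: "(a, 0) \<in> C" using qC[of a] by (auto simp: star_kernel_def op_algebra_def)
      obtain X Y where XY: "\<forall>n. (X n, Y n) \<in> P" "X \<longlonglongrightarrow> a" "Y \<longlonglongrightarrow> 0" using lim[OF a] by blast
      \<comment> \<open>Approximate \<open>(a, 0)\<close> by elements of \<open>P\<close>: their
        second components are small, so by \<open>approx\<close> their first components are close to
        \<open>K\<close>.\<close>
      have "a \<in> closure K"
        unfolding closure_approachable
      proof (intro allI impI)
        fix e :: real assume e: "e > 0"
        have "\<forall>\<^sub>F n in sequentially. dist (X n) a < e/4 \<and> dist (Y n) 0 < e/4"
          using e XY by (intro eventually_conj tendstoD) auto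
        then obtain n where n: "dist (X n) a < e/4" "dist (Y n) 0 < e/4"
          using eventually_happens'[OF sequentially_bot] by blast
        obtain k where k: "k \<in> K" "norm (X n - k) \<le> norm (Y n) + e/4"
          using approx[of "X n" "Y n" "e/4"] XY(1) e by auto
        have "dist k a \<le> norm (X n - k) + dist (X n) a"
          using dist_triangle[of k a "X n"] by (simp add: dist_norm norm_minus_commute)
        moreover have "norm (Y n) < e/4" using n(2) by simp
        ultimately have "dist k a < e" using n(1) k(2) e by linarith
        then show "\<exists>k\<in>K. dist k a < e" using k(1) by blast
      qed
      then show "a \<in> K" using K(1) by simp
    qed
  qed
  moreover have "q ` closure (fst ` P) = closure (snd ` P)"
  proof
    show "q ` closure (fst ` P) \<subseteq> closure (snd ` P)" using sndC qC by auto
    show "closure (snd ` P) \<subseteq> q ` closure (fst ` P)"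
    proof
      fix b assume b: "b \<in> closure (snd ` P)"
      \<comment> \<open>A geometric rate, so that the corrected preimages built below have summable
        increments.\<close>
      have "\<exists>p\<in>P. dist (snd p) b < (1/2)^n" for n :: nat
        using b unfolding closure_approachable by force
      then obtain p where p: "\<And>n. p n \<in> P" "\<And>n. dist (snd (p n)) b < (1/2)^n" by metis
      \<comment> \<open>The distances of two consecutive images to \<open>b\<close> contribute at
        most \<open>(1/2)^n\<close> each, and the slack in \<open>approx\<close> contributes the
        third summand.\<close>
      have "\<exists>k\<in>K. norm (fst (p (Suc n)) - fst (p n) - k) \<le> 3 * (1/2)^n" for n
      proof -
        have "p (Suc n) + (scale_op (of_real (-1)) (fst (p n)), scale_op (of_real (-1)) (snd (p n))) \<in> P"
          using add[OF p(1)] scale[of "fst (p n)" "snd (p n)" "of_real (-1)"] p(1)[of n] by simp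
        then have "(fst (p (Suc n)) - fst (p n), snd (p (Suc n)) - snd (p n)) \<in> P"
          unfolding scale_op_of_real by (simp add: plus_prod_def)
        then obtain k where k: "k \<in> K" "norm (fst (p (Suc n)) - fst (p n) - k)
            \<le> norm (snd (p (Suc n)) - snd (p n)) + (1/2)^n"
          using approx[of _ _ "(1/2)^n"] by force
        have "norm (snd (p (Suc n)) - snd (p n)) \<le> dist (snd (p (Suc n))) b + dist (snd (p n)) b"
          using dist_triangle2[of "snd (p (Suc n))" "snd (p n)" b] by (simp add: dist_norm)
        also have "\<dots> \<le> (1/2)^n + (1/2)^n"
          using p(2)[of n] p(2)[of "Suc n"] zero_le_power[of "1/2 :: real" n] unfolding power_Suc
          by linarith
        finally show ?thesis using k by (intro bexI[OF _ k(1)]) simp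
      qed
      then obtain k where k: "\<And>n. k n \<in> K" "\<And>n. norm (fst (p (Suc n)) - fst (p n) - k n) \<le> 3 * (1/2)^n"
        by metis
      \<comment> \<open>Subtracting elements of the kernel leaves the image \<open>snd (p n)\<close>
        unchanged but makes consecutive preimages differ by at most
        \<open>3 * (1/2)^n\<close>.\<close>
      define a where "a n = fst (p n) - (\<Sum>i<n. k i)" for n
      have "(\<Sum>i<n. k i, 0) \<in> C" for n
      proof (induction n)
        case 0
        show ?case using diffC[OF KC[OF k(1)[of 0]] KC[OF k(1)[of 0]]] by simp
      next
        case (Suc n)
        show ?case using addC[OF Suc KC[OF k(1)[of n]]] by simp
      qed
      then have aC: "(a n, snd (p n)) \<in> C" for n
        using diffC[of "fst (p n)" "snd (p n)" "\<Sum>i<n. k i" 0] p(1)[of n] PC by (auto simp: a_def)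
      have "summable (\<lambda>n. a (Suc n) - a n)"
      proof (rule summable_comparison_test)
        have "norm (a (Suc n) - a n) \<le> 3 * (1/2)^n" for n
          using k(2)[of n] by (simp add: a_def algebra_simps)
        then show "\<exists>N. \<forall>n\<ge>N. norm (a (Suc n) - a n) \<le> 3 * (1/2)^n" by blast
        show "summable (\<lambda>n. 3 * (1/2)^n :: real)" by (intro summable_mult summable_geometric) simp
      qed
      then have "convergent (\<lambda>n. \<Sum>i<n. a (Suc i) - a i)" by (simp add: summable_iff_convergent)
      then have "convergent (\<lambda>n. a n - a 0)" by (simp add: sum_lessThan_telescope)
      then obtain l where "(\<lambda>n. a n - a 0) \<longlonglongrightarrow> l" by (auto simp: convergent_def)
      then have "(\<lambda>n. (a n - a 0) + a 0) \<longlonglongrightarrow> l + a 0" by (intro tendsto_add tendsto_const)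
      then have lima: "a \<longlonglongrightarrow> l + a 0" by simp
      have "(\<lambda>n. dist (snd (p n)) b) \<longlonglongrightarrow> 0"
      proof (rule tendsto_sandwich[of "\<lambda>_. 0" _ _ "\<lambda>n. (1/2)^n"])
        show "(\<lambda>n. (1/2)^n :: real) \<longlonglongrightarrow> 0" by (rule LIMSEQ_power_zero) simp
        show "\<forall>\<^sub>F n in sequentially. dist (snd (p n)) b \<le> (1/2)^n"
          by (intro always_eventually allI less_imp_le[OF p(2)])
      qed simp_all
      then have "(\<lambda>n. snd (p n)) \<longlonglongrightarrow> b" by (rule tendsto_dist_iff[THEN iffD2])
      then have "(\<lambda>n. (a n, snd (p n))) \<longlonglongrightarrow> (l + a 0, b)" by (rule tendsto_Pair[OF lima])
      then have "(l + a 0, b) \<in> C"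
        using closed_sequentially[of C "\<lambda>n. (a n, snd (p n))"] aC by (auto simp: C_def)
      then show "b \<in> q ` closure (fst ` P)" using q fstC by blast
    qed
  qed
  ultimately show ?thesis
    using hom unfolding short_exact_def by (intro exI[of _ q]) (simp add: op_algebra_def)
qed

section \<open>The reduced crossed product\<close>

text \<open>Finitely many columns of a band matrix have finitely many nonzero entries, so the
  truncation is a finite block matrix with compact entries. This is what makes finite sets invisible
  modulo compact operators.\<close>

lemma (in bg_space) compact_truncation:
  assumes A: "A \<in> finite_propagation_ops X d" and B: "finite B"
  shows "A o\<^sub>L restr B \<in> compact_ops X"
proof -
  have l2: "A \<in> l2_ops X" and comp: "\<And>x y. compact_op (entry A x y)"
    using A by (auto simp: finite_propagation_iff)
  obtain R where R: "\<And>x y. d x y > R \<Longrightarrow> entry A x y = (\<lambda>_. 0)"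
    using A by (auto simp: finite_propagation_iff)
  define U where "U = B \<union> (\<Union>y\<in>B \<inter> X. nbhd y R)"
  have U: "finite U" using B finite_nbhd by (auto simp: U_def)
  define b where "b x y = prj x o\<^sub>L (A o\<^sub>L restr B) o\<^sub>L ins y" for x y
  have ent: "entry (A o\<^sub>L restr B) x y = (if y \<in> B then entry A x y else (\<lambda>_. 0))" for x y
    by (simp add: entry_restr)
  have "A o\<^sub>L restr B = block_op U b"
  proof (rule blinfun_entry_eqI)
    fix x y
    have out: "entry (A o\<^sub>L restr B) x y = (\<lambda>_. 0)" if xy: "x \<notin> U \<or> y \<notin> U"
    proof (cases "y \<in> B \<and> y \<in> X \<and> x \<in> X")
      case True
      then have "x \<notin> nbhd y R" using xy by (auto simp: U_def)
      then have "d x y > R" using True by (simp add: nbhd_def commute)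
      then show ?thesis by (simp add: ent R)
    next
      case False
      then show ?thesis using l2 by (auto simp: ent l2_ops_def)
    qed
    show "entry (A o\<^sub>L restr B) x y = entry (block_op U b) x y"
    proof (cases "x \<in> U \<and> y \<in> U")
      case True
      then show ?thesis
        unfolding entry_blinfun using block_op_entry[OF U, of x y b] by (simp add: b_def)
    next
      case False
      have "l2_fun (block_op U b (l2_single y v)) x = 0" for v
        using False by (auto simp: block_op_apply[OF U] l2_fun_single blinfun.zero_right intro!: sum.neutral)
      then show ?thesis using out False by (auto simp: entry_def fun_eq_iff)
    qed
  qed
  moreover have "compact_op (blinfun_apply (block_op U b))"
    unfolding block_op_def
  proof (intro compact_op_sum compact_op_comp_right[where K = "ins h o\<^sub>L b h k" for h k] compact_op_comp_left)
    fix h k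
    show "compact_op (blinfun_apply (b h k))"
      using comp[of h k] unfolding b_def entry_blinfun[symmetric] ent by simp
  qed auto
  moreover have "A o\<^sub>L restr B \<in> l2_ops X"
    using l2 by (auto simp: l2_ops_def ent)
  ultimately show ?thesis by (simp add: compact_ops_def)
qed

text \<open>Restricted to the carrier because the bijections forming \<open>BijGroup\<close> are
  extensional. As a group action it inherits all facts about \<open>perm\<close>.\<close>

definition left_mult :: "('g, 'm) monoid_scheme \<Rightarrow> 'g \<Rightarrow> 'g \<Rightarrow> 'g" where
  "left_mult G g = (\<lambda>h\<in>carrier G. g \<otimes>\<^bsub>G\<^esub> h)"

lemma (in group) left_mult_action: "group_action G (carrier G) (left_mult G)"
proof -
  have bij: "(\<lambda>h\<in>carrier G. g \<otimes> h) \<in> Bij (carrier G)" if "g \<in> carrier G" for g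
  proof -
    have "bij_betw (\<lambda>h\<in>carrier G. g \<otimes> h) (carrier G) (carrier G)"
      by (rule bij_betw_byWitness[where f' = "\<lambda>h. inv g \<otimes> h"])
        (use that in \<open>auto simp: m_assoc[symmetric]\<close>)
    then show ?thesis by (simp add: Bij_def)
  qed
  have "(\<lambda>g. \<lambda>h\<in>carrier G. g \<otimes> h) \<in> hom G (BijGroup (carrier G))"
  proof (rule homI)
    show "(\<lambda>h\<in>carrier G. g \<otimes> h) \<in> carrier (BijGroup (carrier G))" if "g \<in> carrier G" for g
      using bij[OF that] by (simp add: BijGroup_def)
    show "(\<lambda>h\<in>carrier G. (g \<otimes> g') \<otimes> h) = (\<lambda>h\<in>carrier G. g \<otimes> h) \<otimes>\<^bsub>BijGroup (carrier G)\<^esub> (\<lambda>h\<in>carrier G. g' \<otimes> h)"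
      if "g \<in> carrier G" "g' \<in> carrier G" for g g'
      using that bij by (auto simp: BijGroup_def compose_def m_assoc fun_eq_iff)
  qed
  then have "left_mult G \<in> hom G (BijGroup (carrier G))"
    by (simp add: left_mult_def[abs_def])
  then show ?thesis
    unfolding group_action_def group_hom_def group_hom_axioms_def
    using group_BijGroup is_group by blast
qed

lemma perm_op_cong:
  assumes "\<And>x. x \<in> X \<Longrightarrow> p x = q x"
  shows "perm_op X p = perm_op X q"
proof -
  have eq: "inv_into X p = inv_into X q"
    using assms by (auto simp: inv_into_def fun_eq_iff intro!: arg_cong[of _ _ Eps])
  show ?thesis unfolding perm_op_def eq ..
qed

section \<open>The covariant representation of the quotient by the compact operators\<close>

locale coarse_crossed_product = coarse_action X d G \<phi> dG
  for X :: "'x set" and d and G :: "('g, 'm) monoid_scheme" (structure) and \<phi> and dG +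
  fixes \<pi> :: "(('x, 'h::complex_hilbert) l2 \<Rightarrow>\<^sub>L ('x, 'h) l2) set \<Rightarrow> ('k::complex_hilbert \<Rightarrow>\<^sub>L 'k)"
  assumes faithful: "faithful_rep (roe_mod_compacts X d) \<pi>"
begin

abbreviation "\<D> \<equiv> roe_ops X d :: (('x, 'h) l2 \<Rightarrow>\<^sub>L ('x, 'h) l2) set"
abbreviation "\<D>0 \<equiv> finite_propagation_ops X d :: (('x, 'h) l2 \<Rightarrow>\<^sub>L ('x, 'h) l2) set"
abbreviation "\<K> \<equiv> compact_ops X :: (('x, 'h) l2 \<Rightarrow>\<^sub>L ('x, 'h) l2) set"

definition coset :: "(('x, 'h) l2 \<Rightarrow>\<^sub>L ('x, 'h) l2) \<Rightarrow> (('x, 'h) l2 \<Rightarrow>\<^sub>L ('x, 'h) l2) set" where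
  "coset T = ideal_coset (op_algebra \<D>) \<K> T"

text \<open>The representation pulled back to the Roe algebra, where it is a homomorphism with
  kernel \<open>\<K>\<close>.\<close>

definition \<theta> :: "(('x, 'h) l2 \<Rightarrow>\<^sub>L ('x, 'h) l2) \<Rightarrow> ('k \<Rightarrow>\<^sub>L 'k)" where
  "\<theta> T = \<pi> (coset T)"

lemma \<D>_l2: "T \<in> \<D> \<Longrightarrow> T \<in> l2_ops X"
  using roe_ops_subset_l2_ops by blast

lemma \<D>0_\<D>: "T \<in> \<D>0 \<Longrightarrow> T \<in> \<D>"
  unfolding roe_ops_def using closure_subset[of \<D>0] by blast

lemma quotient_facts:
  shows "op_star_hom \<D> \<theta>" and "T \<in> \<D> \<Longrightarrow> \<theta> T = 0 \<longleftrightarrow> T \<in> \<K>"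
    and "S - T \<in> \<K> \<Longrightarrow> coset S = coset T"
proof -
  have \<theta>: "\<theta> = (\<lambda>T. \<pi> (ideal_coset (op_algebra \<D>) \<K> T))" by (simp add: \<theta>_def coset_def fun_eq_iff)
  have rep: "faithful_rep (quotient_algebra (op_algebra \<D>) \<K>) \<pi>"
    using faithful by (simp add: roe_mod_compacts_def)
  note * = quotient_representation[OF roe_ops_star_algebra compact_ops_subset_roe_ops compact_ops_ideal(1,2,3)
     compact_ops_ideal(4)[OF _ \<D>_l2] compact_ops_ideal(5)[OF _ \<D>_l2] compact_ops_ideal(6) rep]
  show "op_star_hom \<D> \<theta>" unfolding \<theta> by (rule *(1))
  show "T \<in> \<D> \<Longrightarrow> \<theta> T = 0 \<longleftrightarrow> T \<in> \<K>" unfolding \<theta>_def coset_def by (rule *(2))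
  show "S - T \<in> \<K> \<Longrightarrow> coset S = coset T" unfolding coset_def by (rule *(3))
qed

end

sublocale coarse_crossed_product \<subseteq> roe: op_star_hom \<D> \<theta>
  by (rule quotient_facts)

sublocale coarse_crossed_product \<subseteq> tr: group_action G "carrier G" "left_mult G"
  by (rule group.left_mult_action[OF group_G])

context coarse_crossed_product
begin

lemma left_translation_eq: "left_translation G g = tr.perm g"
  unfolding left_translation_def tr.perm_def by (rule perm_op_cong) (simp add: left_mult_def)

lemma tr_apply:
  assumes "g \<in> carrier G"
  shows "l2_fun (tr.perm g \<xi>) h = (if h \<in> carrier G then l2_fun \<xi> (inv g \<otimes> h) else 0)"
  using assms by (simp add: tr.perm_apply left_mult_def)

definition conjugate :: "'g \<Rightarrow> (('x, 'h) l2 \<Rightarrow>\<^sub>L ('x, 'h) l2) \<Rightarrow> (('x, 'h) l2 \<Rightarrow>\<^sub>L ('x, 'h) l2)" where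
  "conjugate g T = perm g o\<^sub>L T o\<^sub>L perm (inv g)"

lemma conj_mem:
  assumes "g \<in> carrier G"
  shows "T \<in> \<D> \<Longrightarrow> conjugate g T \<in> \<D>" "T \<in> \<D>0 \<Longrightarrow> conjugate g T \<in> \<D>0" "T \<in> \<K> \<Longrightarrow> conjugate g T \<in> \<K>"
  unfolding conjugate_def
  by (intro conj_roe conj_finite_propagation assms compact_ops_ideal(4)[OF compact_ops_ideal(5)]
      perm_in_l2_ops inv_closed; assumption)+

lemma norm_conj_le:
  assumes "g \<in> carrier G"
  shows "norm (conjugate g T) \<le> norm T"
proof -
  have "norm (conjugate g T) \<le> norm (perm g o\<^sub>L T) * norm (perm (inv g) :: ('x, 'h) l2 \<Rightarrow>\<^sub>L _)"
    unfolding conjugate_def by (rule norm_blinfun_compose)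
  also have "\<dots> \<le> (norm (perm g :: ('x, 'h) l2 \<Rightarrow>\<^sub>L _) * norm T) * 1"
    by (intro mult_mono norm_blinfun_compose norm_perm_le) (use assms in auto)
  also have "\<dots> \<le> (1 * norm T) * 1"
    by (intro mult_right_mono norm_perm_le) (use assms in auto)
  finally show ?thesis by simp
qed

lemma conj_simps:
  assumes g: "g \<in> carrier G"
  shows "conjugate g (S + T) = conjugate g S + conjugate g T" "conjugate g (S - T) = conjugate g S - conjugate g T"
    "conjugate g (scale_op c S) = scale_op c (conjugate g S)"
    "S \<in> l2_ops X \<Longrightarrow> conjugate g (S o\<^sub>L T) = conjugate g S o\<^sub>L conjugate g T"
    "clinear_op S \<Longrightarrow> conjugate g (adj_op S) = adj_op (conjugate g S)"
    "h \<in> carrier G \<Longrightarrow> conjugate g (conjugate h S) = conjugate (g \<otimes> h) S"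
proof -
  show "conjugate g (S + T) = conjugate g S + conjugate g T" "conjugate g (S - T) = conjugate g S - conjugate g T"
    by (simp_all add: conjugate_def blinfun_comp_simps)
  show "conjugate g (scale_op c S) = scale_op c (conjugate g S)"
    using g by (simp add: conjugate_def comp_scale_op scale_op_comp)
  show "conjugate g (S o\<^sub>L T) = conjugate g S o\<^sub>L conjugate g T" if "S \<in> l2_ops X"
  proof -
    have "S (restr X \<xi>) = S \<xi>" for \<xi>
      using that unfolding l2_ops_iff by (metis blinfun_apply_blinfun_compose)
    then show ?thesis using g by (intro blinfun_eqI) (simp add: conjugate_def)
  qed
  show "conjugate g (adj_op S) = adj_op (conjugate g S)" if "clinear_op S"
    using that g by (simp add: conjugate_def adj_op_comp adj_perm group.inv_inv[OF group_G] blinfun_comp_assoc)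
  show "conjugate g (conjugate h S) = conjugate (g \<otimes> h) S" if "h \<in> carrier G"
    using that g
    by (intro blinfun_eqI) (simp add: conjugate_def perm_perm group.inv_mult_group[OF group_G])
qed

text \<open>Conjugation maps compact operators to compact operators, so the union over
  representatives that defines the action is a single coset.\<close>

lemma conj_action_coset:
  assumes T: "T \<in> \<D>" and g: "g \<in> carrier G"
  shows "conj_action X d \<phi> g (coset T) = coset (conjugate g T)"
proof -
  have "coset (perm_op X (\<phi> g) o\<^sub>L S o\<^sub>L adj_op (perm_op X (\<phi> g))) = coset (conjugate g T)"
    if S: "S \<in> coset T" for S
  proof -
    obtain k where k: "k \<in> \<K>" "S = T + k"
      using S by (auto simp: coset_def ideal_coset_def op_algebra_def)
    have "perm_op X (\<phi> g) o\<^sub>L S o\<^sub>L adj_op (perm_op X (\<phi> g)) = conjugate g T + conjugate g k"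
      unfolding perm_def[symmetric] using g by (simp add: adj_perm k conjugate_def blinfun_comp_simps)
    then show ?thesis using conj_mem(3)[OF g k(1)] by (intro quotient_facts(3)) simp
  qed
  moreover have "T \<in> coset T"
    using compact_ops_ideal(1) by (force simp: coset_def ideal_coset_def op_algebra_def)
  ultimately show ?thesis
    unfolding conj_action_def coset_def[symmetric] by (auto; blast)
qed

text \<open>The induced representation of the class of \<open>T\<close>, computed on
  \<open>T\<close> itself: conjugation by \<open>inv h\<close> stands for the action of the inverse
  of \<open>h\<close> on the quotient.\<close>

definition rho :: "(('x, 'h) l2 \<Rightarrow>\<^sub>L ('x, 'h) l2) \<Rightarrow> (('g, 'k) l2 \<Rightarrow>\<^sub>L ('g, 'k) l2)" where
  "rho T = diag_op (\<lambda>h. if h \<in> carrier G then \<theta> (conjugate (inv h) T) else 0)"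

lemma induced_rep_coset:
  assumes "T \<in> \<D>"
  shows "induced_rep G (conj_action X d \<phi>) \<pi> (coset T) = rho T"
proof -
  have "(if h \<in> carrier G then \<pi> (conj_action X d \<phi> (inv h) (coset T)) v else 0)
      = (if h \<in> carrier G then \<theta> (conjugate (inv h) T) else 0) v" for h v
    using assms by (simp add: conj_action_coset \<theta>_def)
  then show ?thesis unfolding induced_rep_def rho_def diag_op_def by simp
qed

lemma rho_bound:
  assumes "T \<in> \<D>"
  shows "norm (if h \<in> carrier G then \<theta> (conjugate (inv h) T) else 0) \<le> norm T"
  using roe.norm_hom_le[OF conj_mem(1)[OF _ assms], of "inv h"] norm_conj_le[of "inv h" T]
  by (auto intro: order_trans)

lemma rho_apply:
  assumes "T \<in> \<D>"
  shows "l2_fun (rho T \<xi>) h = (if h \<in> carrier G then \<theta> (conjugate (inv h) T) (l2_fun \<xi> h) else 0)"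
  unfolding rho_def by (subst diag_op_apply[OF rho_bound[OF assms]]) simp

lemma norm_rho_le: "T \<in> \<D> \<Longrightarrow> norm (rho T) \<le> norm T"
  unfolding rho_def by (rule norm_diag_op_le[OF rho_bound])

lemma rho_clinear: "T \<in> \<D> \<Longrightarrow> clinear_op (rho T)"
  unfolding rho_def by (rule clinear_diag_op[OF rho_bound]) (auto simp: roe.hom_simps conj_mem)

lemma rho_simps:
  "S \<in> \<D> \<Longrightarrow> T \<in> \<D> \<Longrightarrow> rho (S + T) = rho S + rho T"
  "S \<in> \<D> \<Longrightarrow> T \<in> \<D> \<Longrightarrow> rho (S - T) = rho S - rho T"
  "S \<in> \<D> \<Longrightarrow> rho (scale_op c S) = scale_op c (rho S)"
  "S \<in> \<D> \<Longrightarrow> T \<in> \<D> \<Longrightarrow> rho (S o\<^sub>L T) = rho S o\<^sub>L rho T"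
  by (intro blinfun_eqI l2_eqI, simp add: rho_apply roe.add roe.diff roe.scale roe.comp conj_simps conj_mem
      roe.hom_simps roe.hom_diff l2_fun_simps l2_fun_scaleC scale_op_apply blinfun.bilinear_simps
      scaleC_zero \<D>_l2)+

lemma rho_adj:
  assumes "T \<in> \<D>"
  shows "adj_op (rho T) = rho (adj_op T)"
proof -
  have "adj_op (if h \<in> carrier G then \<theta> (conjugate (inv h) T) else 0)
      = (if h \<in> carrier G then \<theta> (conjugate (inv h) (adj_op T)) else 0)" for h
    using assms roe.clinear[OF assms] by (simp add: conj_simps roe.hom_simps conj_mem)
  then show ?thesis
    unfolding rho_def using assms
    by (subst adj_diag_op[OF rho_bound]) (auto simp: roe.hom_simps conj_mem)
qed

lemma rho_compact:
  assumes "k \<in> \<K>"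
  shows "rho k = 0"
proof -
  have k: "k \<in> \<D>" using assms compact_ops_subset_roe_ops by blast
  have "\<theta> (conjugate (inv h) k) = 0" if "h \<in> carrier G" for h
    using quotient_facts(2)[of "conjugate (inv h) k"] conj_mem(1,3)[of "inv h" k] assms k that by simp
  then show ?thesis
    by (intro blinfun_eqI l2_eqI) (simp add: rho_apply[OF k] l2_fun_simps)
qed

lemma tr_rho:
  assumes T: "T \<in> \<D>" and g: "g \<in> carrier G"
  shows "tr.perm g o\<^sub>L rho T = rho (conjugate g T) o\<^sub>L tr.perm g"
proof (intro blinfun_eqI l2_eqI)
  fix \<xi> :: "('g, 'k) l2" and h
  \<comment> \<open>Translation by \<open>g\<close> reads a vector at
    \<open>inv g \<otimes> h\<close>, whose inverse is \<open>inv h \<otimes> g\<close>; this is the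
    covariance relation.\<close>
  have "conjugate (inv h) (conjugate g T) = conjugate (inv (inv g \<otimes> h)) T" if "h \<in> carrier G"
    using that g by (simp add: conj_simps group.inv_mult_group[OF group_G] group.inv_inv[OF group_G])
  then show "l2_fun ((tr.perm g o\<^sub>L rho T) \<xi>) h = l2_fun ((rho (conjugate g T) o\<^sub>L tr.perm g) \<xi>) h"
    using g T conj_mem(1)[OF g T] by (simp add: tr_apply rho_apply)
qed

end

section \<open>The algebra of finite sums paired with their images\<close>

context coarse_crossed_product
begin

definition gen :: "'g \<Rightarrow> (('x, 'h) l2 \<Rightarrow>\<^sub>L ('x, 'h) l2) \<Rightarrow>
    (('x, 'h) l2 \<Rightarrow>\<^sub>L ('x, 'h) l2) \<times> (('g, 'k) l2 \<Rightarrow>\<^sub>L ('g, 'k) l2)" where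
  "gen g T = (T o\<^sub>L perm g, rho T o\<^sub>L tr.perm g)"

text \<open>A relation rather than a function, because different families \<open>t\<close> may give
  the same operator; that the images then agree is a consequence of the norm estimate, not of the
  construction.\<close>

definition graph :: "((('x, 'h) l2 \<Rightarrow>\<^sub>L ('x, 'h) l2) \<times> (('g, 'k) l2 \<Rightarrow>\<^sub>L ('g, 'k) l2)) set" where
  "graph = {\<Sum>g\<in>F. gen g (t g) | F t. finite F \<and> F \<subseteq> carrier G \<and> (\<forall>g\<in>F. t g \<in> \<D>0)}"

lemma gen_add: "S \<in> \<D> \<Longrightarrow> T \<in> \<D> \<Longrightarrow> gen g (S + T) = gen g S + gen g T"
  by (simp add: gen_def rho_simps blinfun_comp_simps)

lemma gen_zero: "gen g 0 = 0"
  using rho_simps(1)[OF roe.zero roe.zero] by (simp add: gen_def blinfun_comp_simps zero_prod_def)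

lemma gen_in_graph: "g \<in> carrier G \<Longrightarrow> T \<in> \<D>0 \<Longrightarrow> gen g T \<in> graph"
  unfolding graph_def by (intro CollectI exI[of _ "{g}"] exI[of _ "\<lambda>_. T"]) simp

lemma graph_add:
  assumes "p \<in> graph" "q \<in> graph"
  shows "p + q \<in> graph"
proof -
  obtain F t where F: "finite F" "F \<subseteq> carrier G" "\<forall>g\<in>F. t g \<in> \<D>0" "p = (\<Sum>g\<in>F. gen g (t g))"
    using assms(1) by (auto simp: graph_def)
  obtain F' t' where F': "finite F'" "F' \<subseteq> carrier G" "\<forall>g\<in>F'. t' g \<in> \<D>0" "q = (\<Sum>g\<in>F'. gen g (t' g))"
    using assms(2) by (auto simp: graph_def)
  define u where "u g = (if g \<in> F then t g else 0)" for g
  define u' where "u' g = (if g \<in> F' then t' g else 0)" for g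
  have u: "u g \<in> \<D>0" "u' g \<in> \<D>0" for g
    using F F' finite_propagation_0 by (auto simp: u_def u'_def)
  have "p = (\<Sum>g\<in>F. gen g (u g))" using F by (simp add: u_def)
  also have "\<dots> = (\<Sum>g\<in>F \<union> F'. gen g (u g))"
    using F F' by (intro sum.mono_neutral_left) (auto simp: u_def gen_zero)
  finally have p: "p = (\<Sum>g\<in>F \<union> F'. gen g (u g))" .
  have "q = (\<Sum>g\<in>F'. gen g (u' g))" using F' by (simp add: u'_def)
  also have "\<dots> = (\<Sum>g\<in>F \<union> F'. gen g (u' g))"
    using F F' by (intro sum.mono_neutral_left) (auto simp: u'_def gen_zero)
  finally have q: "q = (\<Sum>g\<in>F \<union> F'. gen g (u' g))" .
  have "p + q = (\<Sum>g\<in>F \<union> F'. gen g (u g + u' g))"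
    unfolding p q sum.distrib[symmetric] using u \<D>0_\<D> by (intro sum.cong) (auto simp: gen_add)
  then show ?thesis
    unfolding graph_def using F F' finite_propagation_add[OF u]
    by (intro CollectI exI[of _ "F \<union> F'"] exI[of _ "\<lambda>g. u g + u' g"]) auto
qed

lemma graph_zero: "0 \<in> graph"
  unfolding graph_def by (intro CollectI exI[of _ "{}"]) auto

lemma graph_sum: "(\<And>i. i \<in> I \<Longrightarrow> f i \<in> graph) \<Longrightarrow> (\<Sum>i\<in>I. f i) \<in> graph"
  by (induction I rule: infinite_finite_induct) (auto simp: graph_zero graph_add)

lemma fst_sum_gen: "fst (\<Sum>g\<in>F. gen g (t g)) = (\<Sum>g\<in>F. t g o\<^sub>L perm g)"
  by (induction F rule: infinite_finite_induct) (auto simp: gen_def)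

lemma snd_sum_gen: "snd (\<Sum>g\<in>F. gen g (t g)) = (\<Sum>g\<in>F. rho (t g) o\<^sub>L tr.perm g)"
  by (induction F rule: infinite_finite_induct) (auto simp: gen_def)

lemma graphE:
  assumes "(a, b) \<in> graph"
  obtains F t where "finite F" "F \<subseteq> carrier G" "\<forall>g\<in>F. t g \<in> \<D>0"
    "a = (\<Sum>g\<in>F. t g o\<^sub>L perm g)" "b = (\<Sum>g\<in>F. rho (t g) o\<^sub>L tr.perm g)"
proof -
  obtain F t where F: "finite F" "F \<subseteq> carrier G" "\<forall>g\<in>F. t g \<in> \<D>0" "(a, b) = (\<Sum>g\<in>F. gen g (t g))"
    using assms by (auto simp: graph_def)
  show ?thesis
    using that[OF F(1-3)] fst_sum_gen[of t F] snd_sum_gen[of t F] by (simp flip: F(4))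
qed

text \<open>Twisted convolution: moving the translation by \<open>g\<close> past \<open>T\<close>
  conjugates \<open>T\<close>. On the second component the same exchange is the covariance relation
  \<open>tr_rho\<close>, so both components multiply by the same rule.\<close>

lemma gen_mult:
  assumes S: "S \<in> \<D>" and T: "T \<in> \<D>" and g: "g \<in> carrier G" and h: "h \<in> carrier G"
  shows "(fst (gen g S) o\<^sub>L fst (gen h T), snd (gen g S) o\<^sub>L snd (gen h T)) = gen (g \<otimes> h) (S o\<^sub>L conjugate g T)"
proof -
  have Tr: "T (restr X \<xi>) = T \<xi>" for \<xi>
    using \<D>_l2[OF T] unfolding l2_ops_iff by (metis blinfun_apply_blinfun_compose)
  have 1: "(S o\<^sub>L perm g) o\<^sub>L (T o\<^sub>L perm h) = (S o\<^sub>L conjugate g T) o\<^sub>L perm (g \<otimes> h)"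
  proof (rule blinfun_eqI)
    fix \<xi> :: "('x, 'h) l2"
    have "perm (inv g) (perm (g \<otimes> h) \<xi>) = perm (inv g) (perm g (perm h \<xi>))"
      by (simp add: perm_perm g h)
    also have "\<dots> = perm h \<xi>" using g h by simp
    finally have "perm (inv g) (perm (g \<otimes> h) \<xi>) = perm h \<xi>" .
    then show "((S o\<^sub>L perm g) o\<^sub>L (T o\<^sub>L perm h)) \<xi> = ((S o\<^sub>L conjugate g T) o\<^sub>L perm (g \<otimes> h)) \<xi>"
      by (simp add: conjugate_def)
  qed
  have "(rho S o\<^sub>L tr.perm g) o\<^sub>L (rho T o\<^sub>L tr.perm h) = rho S o\<^sub>L ((tr.perm g o\<^sub>L rho T) o\<^sub>L tr.perm h)"
    by (simp add: blinfun_comp_assoc)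
  also have "\<dots> = (rho S o\<^sub>L rho (conjugate g T)) o\<^sub>L (tr.perm g o\<^sub>L tr.perm h)"
    by (simp add: tr_rho[OF T g] blinfun_comp_assoc)
  also have "\<dots> = rho (S o\<^sub>L conjugate g T) o\<^sub>L tr.perm (g \<otimes> h)"
    using S conj_mem(1)[OF g T] g h by (simp add: rho_simps tr.perm_comp)
  finally show ?thesis using 1 by (simp add: gen_def)
qed

lemma gen_adj:
  assumes T: "T \<in> \<D>" and g: "g \<in> carrier G"
  shows "(adj_op (fst (gen g T)), adj_op (snd (gen g T))) = gen (inv g) (conjugate (inv g) (adj_op T))"
proof -
  have T': "clinear_op T" "adj_op T \<in> \<D>" using T roe.clinear roe.adj by auto
  have Tr: "adj_op T (restr X \<xi>) = adj_op T \<xi>" for \<xi>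
    using \<D>_l2[OF T'(2)] unfolding l2_ops_iff by (metis blinfun_apply_blinfun_compose)
  have "adj_op (T o\<^sub>L perm g) = perm (inv g) o\<^sub>L adj_op T" using g T' by (simp add: adj_op_comp adj_perm)
  also have "\<dots> = conjugate (inv g) (adj_op T) o\<^sub>L perm (inv g)"
    using g by (intro blinfun_eqI) (simp add: conjugate_def group.inv_inv[OF group_G] Tr)
  finally have 1: "adj_op (T o\<^sub>L perm g) = conjugate (inv g) (adj_op T) o\<^sub>L perm (inv g)" .
  have "adj_op (rho T o\<^sub>L tr.perm g) = tr.perm (inv g) o\<^sub>L rho (adj_op T)"
    using g rho_clinear[OF T] by (simp add: adj_op_comp tr.adj_perm rho_adj[OF T])
  also have "\<dots> = rho (conjugate (inv g) (adj_op T)) o\<^sub>L tr.perm (inv g)"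
    using g T' by (intro tr_rho) auto
  finally show ?thesis using 1 by (simp add: gen_def)
qed

lemma graph_mult:
  assumes "(a, b) \<in> graph" "(a', b') \<in> graph"
  shows "(a o\<^sub>L a', b o\<^sub>L b') \<in> graph"
proof -
  obtain F t where F: "finite F" "F \<subseteq> carrier G" "\<forall>g\<in>F. t g \<in> \<D>0"
    "a = (\<Sum>g\<in>F. t g o\<^sub>L perm g)" "b = (\<Sum>g\<in>F. rho (t g) o\<^sub>L tr.perm g)"
    by (rule graphE[OF assms(1)])
  obtain F' t' where F': "finite F'" "F' \<subseteq> carrier G" "\<forall>g\<in>F'. t' g \<in> \<D>0"
    "a' = (\<Sum>g\<in>F'. t' g o\<^sub>L perm g)" "b' = (\<Sum>g\<in>F'. rho (t' g) o\<^sub>L tr.perm g)"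
    by (rule graphE[OF assms(2)])
  let ?p = "\<lambda>g h. (fst (gen g (t g)) o\<^sub>L fst (gen h (t' h)), snd (gen g (t g)) o\<^sub>L snd (gen h (t' h)))"
  have "(\<Sum>g\<in>F. \<Sum>h\<in>F'. ?p g h) \<in> graph"
  proof (intro graph_sum)
    fix g h assume "g \<in> F" "h \<in> F'"
    then have gc: "g \<in> carrier G" "h \<in> carrier G" and tt: "t g \<in> \<D>0" "t' h \<in> \<D>0" using F F' by auto
    show "?p g h \<in> graph"
      unfolding gen_mult[OF \<D>0_\<D>[OF tt(1)] \<D>0_\<D>[OF tt(2)] gc]
      by (intro gen_in_graph m_closed gc finite_propagation_comp conj_mem tt)
  qed
  moreover have "(\<Sum>g\<in>F. \<Sum>h\<in>F'. ?p g h) = (a o\<^sub>L a', b o\<^sub>L b')"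
  proof (rule prod_eqI)
    show "fst (\<Sum>g\<in>F. \<Sum>h\<in>F'. ?p g h) = fst (a o\<^sub>L a', b o\<^sub>L b')"
      unfolding F F' fst_sum by (simp add: blinfun_comp_sum gen_def) (rule sum.swap)
    show "snd (\<Sum>g\<in>F. \<Sum>h\<in>F'. ?p g h) = snd (a o\<^sub>L a', b o\<^sub>L b')"
      unfolding F F' snd_sum by (simp add: blinfun_comp_sum gen_def) (rule sum.swap)
  qed
  ultimately show ?thesis by simp
qed

lemma graph_clinear:
  assumes "(a, b) \<in> graph"
  shows "clinear_op a \<and> clinear_op b"
proof -
  obtain F t where F: "finite F" "F \<subseteq> carrier G" "\<forall>g\<in>F. t g \<in> \<D>0"
    "a = (\<Sum>g\<in>F. t g o\<^sub>L perm g)" "b = (\<Sum>g\<in>F. rho (t g) o\<^sub>L tr.perm g)"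
    by (rule graphE[OF assms])
  have "clinear_op (t g o\<^sub>L perm g)" "clinear_op (rho (t g) o\<^sub>L tr.perm g)" if "g \<in> F" for g
    using F that rho_clinear \<D>0_\<D> roe.clinear by (auto simp: subset_iff)
  then show ?thesis unfolding F by (auto intro!: clinear_op_sum)
qed

lemma graph_adj:
  assumes ab: "(a, b) \<in> graph"
  shows "(adj_op a, adj_op b) \<in> graph"
proof -
  obtain F t where F: "finite F" "F \<subseteq> carrier G" "\<forall>g\<in>F. t g \<in> \<D>0"
    "a = (\<Sum>g\<in>F. t g o\<^sub>L perm g)" "b = (\<Sum>g\<in>F. rho (t g) o\<^sub>L tr.perm g)"
    by (rule graphE[OF ab])
  have lin: "clinear_op (t g o\<^sub>L perm g)" "clinear_op (rho (t g) o\<^sub>L tr.perm g)" if "g \<in> F" for g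
    using F that rho_clinear \<D>0_\<D> roe.clinear by (auto simp: subset_iff)
  let ?p = "\<lambda>g. (adj_op (fst (gen g (t g))), adj_op (snd (gen g (t g))))"
  have "(\<Sum>g\<in>F. ?p g) \<in> graph"
  proof (intro graph_sum)
    fix g assume g: "g \<in> F"
    then have gc: "g \<in> carrier G" and tt: "t g \<in> \<D>0" using F by auto
    show "?p g \<in> graph"
      unfolding gen_adj[OF \<D>0_\<D>[OF tt] gc]
      by (intro gen_in_graph inv_closed gc conj_mem finite_propagation_adj tt)
  qed
  moreover have "(\<Sum>g\<in>F. ?p g) = (adj_op a, adj_op b)"
  proof (rule prod_eqI)
    show "fst (\<Sum>g\<in>F. ?p g) = fst (adj_op a, adj_op b)"
      unfolding F fst_sum using lin by (simp add: adj_op_sum gen_def)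
    show "snd (\<Sum>g\<in>F. ?p g) = snd (adj_op a, adj_op b)"
      unfolding F snd_sum using lin by (simp add: adj_op_sum gen_def)
  qed
  ultimately show ?thesis by simp
qed

lemma graph_scale:
  assumes "(a, b) \<in> graph"
  shows "(scale_op c a, scale_op c b) \<in> graph"
proof -
  obtain F t where F: "finite F" "F \<subseteq> carrier G" "\<forall>g\<in>F. t g \<in> \<D>0"
    "a = (\<Sum>g\<in>F. t g o\<^sub>L perm g)" "b = (\<Sum>g\<in>F. rho (t g) o\<^sub>L tr.perm g)"
    by (rule graphE[OF assms])
  have scale_sum: "scale_op c (\<Sum>i\<in>I. f i) = (\<Sum>i\<in>I. scale_op c (f i))"
    for I :: "'g set" and f :: "'g \<Rightarrow> 'v::complex_hilbert \<Rightarrow>\<^sub>L 'v"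
    by (rule blinfun_eqI) (simp add: scale_op_apply blinfun_sum_apply scaleC_sum)
  have "(\<Sum>g\<in>F. gen g (scale_op c (t g))) \<in> graph"
    using F by (intro graph_sum gen_in_graph finite_propagation_scale) auto
  moreover have "(\<Sum>g\<in>F. gen g (scale_op c (t g))) = (scale_op c a, scale_op c b)"
  proof (rule prod_eqI)
    show "fst (\<Sum>g\<in>F. gen g (scale_op c (t g))) = fst (scale_op c a, scale_op c b)"
      unfolding fst_sum_gen F by (simp add: scale_sum scale_op_comp)
    show "snd (\<Sum>g\<in>F. gen g (scale_op c (t g))) = snd (scale_op c a, scale_op c b)"
      unfolding snd_sum_gen F using F(3) \<D>0_\<D>
      by (auto simp: scale_sum scale_op_comp rho_simps intro!: sum.cong)
  qed
  ultimately show ?thesis by simp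
qed

lemma fst_graph: "fst ` graph = finite_propagation_ops X dG"
proof
  show "fst ` graph \<subseteq> finite_propagation_ops X dG"
  proof
    fix a assume "a \<in> fst ` graph"
    then obtain b where ab: "(a, b) \<in> graph" by force
    obtain F t where F: "finite F" "F \<subseteq> carrier G" "\<forall>g\<in>F. t g \<in> \<D>0"
      "a = (\<Sum>g\<in>F. t g o\<^sub>L perm g)" "b = (\<Sum>g\<in>F. rho (t g) o\<^sub>L tr.perm g)"
      by (rule graphE[OF ab])
    have "(\<Sum>g\<in>I. t g o\<^sub>L perm g) \<in> finite_propagation_ops X dG" if "I \<subseteq> F" for I
      using finite_subset[OF that F(1)] that F(2,3)
      by (induction I rule: finite_induct)
        (auto intro!: dG.finite_propagation_0 dG.finite_propagation_add translate_finite_propagation)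
    then show "a \<in> finite_propagation_ops X dG" using F(4) by blast
  qed
  show "finite_propagation_ops X dG \<subseteq> fst ` graph"
  proof
    fix a :: "('x, 'h) l2 \<Rightarrow>\<^sub>L ('x, 'h) l2" assume "a \<in> finite_propagation_ops X dG"
    from translate_decomposition[OF this] obtain F t where F: "finite F" "F \<subseteq> carrier G"
      "\<forall>g\<in>F. t g \<in> \<D>0" "a = (\<Sum>g\<in>F. t g o\<^sub>L perm g)" by blast
    have "(\<Sum>g\<in>F. gen g (t g)) \<in> graph" using F by (intro graph_sum gen_in_graph) auto
    moreover have "fst (\<Sum>g\<in>F. gen g (t g)) = a" by (simp add: fst_sum_gen F(4))
    ultimately show "a \<in> fst ` graph" by force
  qed
qed

text \<open>A compact operator need not have finite propagation, so only the closure is reached: for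
  approximants \<open>Y n\<close> the images equal \<open>rho (Y n - k)\<close> and tend to
  zero.\<close>

lemma graph_compact:
  assumes "k \<in> \<K>"
  shows "(k, 0) \<in> closure graph"
proof -
  have kD: "k \<in> \<D>" using assms compact_ops_subset_roe_ops by blast
  then obtain Y where Y: "\<forall>n. Y n \<in> \<D>0" "Y \<longlonglongrightarrow> k" unfolding roe_ops_def closure_sequential by blast
  note tm = bounded_bilinear.tendsto[OF bounded_bilinear_blinfun_compose]
  have "(\<lambda>n. Y n o\<^sub>L perm \<one>) \<longlonglongrightarrow> (k o\<^sub>L perm \<one>)" by (rule tm[OF Y(2) tendsto_const])
  moreover have "k o\<^sub>L perm \<one> = k" using \<D>_l2[OF kD] by (simp add: perm_one l2_ops_iff)
  ultimately have 1: "(\<lambda>n. Y n o\<^sub>L perm \<one>) \<longlonglongrightarrow> k" by simp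
  have "(\<lambda>n. rho (Y n)) \<longlonglongrightarrow> 0"
  proof (rule Lim_null_comparison)
    have "norm (rho (Y n)) \<le> norm (Y n - k)" for n
      using norm_rho_le[OF roe.diff[OF \<D>0_\<D> kD], of "Y n"] Y(1)
      by (simp add: rho_simps(2)[OF \<D>0_\<D> kD] rho_compact[OF assms])
    then show "\<forall>\<^sub>F n in sequentially. norm (rho (Y n)) \<le> norm (Y n - k)" by simp
    show "(\<lambda>n. norm (Y n - k)) \<longlonglongrightarrow> 0" using Y(2) by (intro tendsto_norm_zero LIM_zero)
  qed
  then have "(\<lambda>n. rho (Y n) o\<^sub>L tr.perm \<one>) \<longlonglongrightarrow> (0 o\<^sub>L tr.perm \<one>)" by (rule tm[OF _ tendsto_const])
  then have 2: "(\<lambda>n. rho (Y n) o\<^sub>L tr.perm \<one>) \<longlonglongrightarrow> 0" by (simp add: blinfun_comp_simps)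
  have "(\<lambda>n. gen \<one> (Y n)) \<longlonglongrightarrow> (k, 0)" unfolding gen_def by (rule tendsto_Pair[OF 1 2])
  moreover have "\<forall>n. gen \<one> (Y n) \<in> graph" using Y(1) by (auto intro: gen_in_graph)
  ultimately show ?thesis
    unfolding closure_sequential by (intro exI[of _ "\<lambda>n. gen \<one> (Y n)"] conjI)
qed

text \<open>The crossed product admits coefficients from the whole quotient, the graph only classes
  of finite propagation operators; since \<open>rho\<close> is contractive and these operators are
  dense, the closures agree.\<close>

lemma reduced_crossed_product_eq:
  "reduced_crossed_product (roe_mod_compacts X d) G (conj_action X d \<phi>) \<pi> = op_algebra (closure (snd ` graph))"
proof -
  have elts: "elts (roe_mod_compacts X d) = coset ` \<D>"
    by (simp add: roe_mod_compacts_def quotient_algebra_def op_algebra_def coset_def)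
  define W where "W = {\<Sum>g\<in>F. induced_rep G (conj_action X d \<phi>) \<pi> (f g) o\<^sub>L left_translation G g | F f.
        finite F \<and> F \<subseteq> carrier G \<and> (\<forall>g\<in>F. f g \<in> elts (roe_mod_compacts X d))}"
  have "W \<subseteq> closure (snd ` graph)"
  proof
    fix w assume "w \<in> W"
    then obtain F f where F: "finite F" "F \<subseteq> carrier G" "\<forall>g\<in>F. f g \<in> coset ` \<D>"
      "w = (\<Sum>g\<in>F. induced_rep G (conj_action X d \<phi>) \<pi> (f g) o\<^sub>L left_translation G g)"
      unfolding W_def elts by blast
    have "\<forall>g\<in>F. \<exists>T. f g = coset T \<and> T \<in> \<D>" using F(3) by auto
    from bchoice[OF this] obtain t where t: "\<forall>g\<in>F. f g = coset (t g) \<and> t g \<in> \<D>" by (elim exE)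
    have w: "w = (\<Sum>g\<in>F. rho (t g) o\<^sub>L tr.perm g)"
      unfolding F(4) left_translation_eq using t by (intro sum.cong) (auto simp: induced_rep_coset)
    have "\<forall>g\<in>F. \<exists>Y. (\<forall>n. Y n \<in> \<D>0) \<and> Y \<longlonglongrightarrow> t g"
      using t unfolding roe_ops_def closure_sequential by blast
    from bchoice[OF this] obtain Y where Y: "\<forall>g\<in>F. (\<forall>n. Y g n \<in> \<D>0) \<and> Y g \<longlonglongrightarrow> t g" by (elim exE)
    have "(\<lambda>n. rho (Y g n)) \<longlonglongrightarrow> rho (t g)" if g: "g \<in> F" for g
    proof (rule LIM_zero_cancel, rule Lim_null_comparison)
      have YD: "Y g n \<in> \<D>" for n using Y g \<D>0_\<D> by blast
      have tD: "t g \<in> \<D>" using t g by blast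
      have "norm (rho (Y g n) - rho (t g)) \<le> norm (Y g n - t g)" for n
        using norm_rho_le[OF roe.diff[OF YD tD]] by (simp add: rho_simps(2)[OF YD tD])
      then show "\<forall>\<^sub>F n in sequentially. norm (rho (Y g n) - rho (t g)) \<le> norm (Y g n - t g)" by simp
      show "(\<lambda>n. norm (Y g n - t g)) \<longlonglongrightarrow> 0" using Y g by (intro tendsto_norm_zero LIM_zero) blast
    qed
    then have "(\<lambda>n. \<Sum>g\<in>F. rho (Y g n) o\<^sub>L tr.perm g) \<longlonglongrightarrow> w"
      unfolding w by (intro tendsto_sum bounded_bilinear.tendsto[OF bounded_bilinear_blinfun_compose] tendsto_const)
    moreover have "(\<Sum>g\<in>F. rho (Y g n) o\<^sub>L tr.perm g) \<in> snd ` graph" for n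
    proof -
      have "(\<Sum>g\<in>F. gen g (Y g n)) \<in> graph" using F Y by (intro graph_sum gen_in_graph) auto
      then show ?thesis by (rule image_eqI[rotated]) (rule snd_sum_gen[symmetric])
    qed
    ultimately show "w \<in> closure (snd ` graph)"
      unfolding closure_sequential
      by (intro exI[of _ "\<lambda>n. \<Sum>g\<in>F. rho (Y g n) o\<^sub>L tr.perm g"] conjI allI)
  qed
  moreover have "snd ` graph \<subseteq> W"
  proof
    fix b assume "b \<in> snd ` graph"
    then obtain a where ab: "(a, b) \<in> graph" by force
    obtain F t where F: "finite F" "F \<subseteq> carrier G" "\<forall>g\<in>F. t g \<in> \<D>0"
      "a = (\<Sum>g\<in>F. t g o\<^sub>L perm g)" "b = (\<Sum>g\<in>F. rho (t g) o\<^sub>L tr.perm g)"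
      by (rule graphE[OF ab])
    have "b = (\<Sum>g\<in>F. induced_rep G (conj_action X d \<phi>) \<pi> (coset (t g)) o\<^sub>L left_translation G g)"
      unfolding F(5) left_translation_eq using F(3) \<D>0_\<D> by (intro sum.cong) (auto simp: induced_rep_coset)
    then show "b \<in> W"
      unfolding W_def elts using F(1-3) \<D>0_\<D>
      by (intro CollectI exI[of _ F] exI[of _ "\<lambda>g. coset (t g)"]) auto
  qed
  ultimately have "closure W = closure (snd ` graph)"
    by (metis closure_closure closure_mono subset_antisym)
  then show ?thesis by (simp add: reduced_crossed_product_def W_def)
qed

end

section \<open>Norm estimates in both directions and the exact sequence\<close>

context coarse_crossed_product
begin

text \<open>Only the summand with \<open>g = h \<otimes> inv k\<close> contributes to the entry at
  \<open>(h, k)\<close>, since translation by \<open>g\<close> carries the coordinate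
  \<open>k\<close> to \<open>g \<otimes> k\<close>.\<close>

lemma compression_covariant:
  assumes F: "finite F" "F \<subseteq> carrier G" "\<forall>g\<in>F. t g \<in> \<D>0" and E: "finite E" "E \<subseteq> carrier G"
  shows "restr E o\<^sub>L (\<Sum>g\<in>F. rho (t g) o\<^sub>L tr.perm g) o\<^sub>L restr E
    = block_op E (\<lambda>h k. \<theta> (covariant_block F t h k))"
proof (intro blinfun_eqI l2_eqI)
  fix \<eta> :: "('g, 'k) l2" and h
  show "l2_fun ((restr E o\<^sub>L (\<Sum>g\<in>F. rho (t g) o\<^sub>L tr.perm g) o\<^sub>L restr E) \<eta>) h
      = l2_fun (block_op E (\<lambda>h k. \<theta> (covariant_block F t h k)) \<eta>) h"
  proof (cases "h \<in> E")
    case True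
    then have h: "h \<in> carrier G" using E by blast
    have FG: "g \<in> carrier G" if "g \<in> F" for g using F that by blast
    define A where "A g = \<theta> (conjugate (inv h) (t g))" for g
    have cov: "\<theta> (covariant_block F t h k) = (if h \<otimes> inv k \<in> F then A (h \<otimes> inv k) else 0)" for k
      using h by (simp add: covariant_block_def A_def conjugate_def group.inv_inv[OF group_G] roe.hom_zero)
    have "l2_fun ((restr E o\<^sub>L (\<Sum>g\<in>F. rho (t g) o\<^sub>L tr.perm g) o\<^sub>L restr E) \<eta>) h
        = (\<Sum>g\<in>F. A g (l2_fun (restr E \<eta>) (inv g \<otimes> h)))"
      using True h F(3) \<D>0_\<D> FG
      by (auto simp: blinfun_sum_apply l2_fun_sum rho_apply tr_apply A_def intro!: sum.cong)
    also have "\<dots> = (\<Sum>g\<in>F. \<Sum>k\<in>E. if g = h \<otimes> inv k then A g (l2_fun \<eta> k) else 0)"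
    proof (rule sum.cong[OF refl])
      fix g assume g: "g \<in> F"
      have iff: "g = h \<otimes> inv k \<longleftrightarrow> inv g \<otimes> h = k" if "k \<in> E" for k
        using mult_eq_iff[OF FG[OF g] h] FG[OF g] h that E
        by (metis group.inv_solve_left[OF group_G] subsetD)
      have "A g (l2_fun (restr E \<eta>) (inv g \<otimes> h))
          = (\<Sum>k\<in>E. if k = inv g \<otimes> h then A g (l2_fun \<eta> k) else 0)"
        using E(1) by (simp add: blinfun.zero_right)
      also have "\<dots> = (\<Sum>k\<in>E. if g = h \<otimes> inv k then A g (l2_fun \<eta> k) else 0)"
        using iff by (intro sum.cong) auto
      finally show "A g (l2_fun (restr E \<eta>) (inv g \<otimes> h))
          = (\<Sum>k\<in>E. if g = h \<otimes> inv k then A g (l2_fun \<eta> k) else 0)" .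
    qed
    also have "\<dots> = (\<Sum>k\<in>E. (if h \<otimes> inv k \<in> F then A (h \<otimes> inv k) else 0) (l2_fun \<eta> k))"
      using F(1) by (subst sum.swap) (auto intro!: sum.cong)
    also have "\<dots> = l2_fun (block_op E (\<lambda>h k. \<theta> (covariant_block F t h k)) \<eta>) h"
      using True by (simp add: block_op_apply[OF E(1)] cov)
    finally show ?thesis .
  qed (simp add: block_op_apply[OF E(1)])
qed

text \<open>Cutting the entries off a finite set changes them by compact operators, which
  \<open>\<theta>\<close> does not see. The amplification is contractive, so the estimate for the
  cut matrix bounds the image.\<close>

lemma norm_compression_le:
  assumes A: "property_A TYPE('s) X d"
    and F: "finite F" "F \<subseteq> carrier G" "\<forall>g\<in>F. t g \<in> \<D>0" and E: "finite E" "E \<subseteq> carrier G"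
  shows "norm (block_op E (\<lambda>h k. \<theta> (covariant_block F t h k))) \<le> norm (\<Sum>g\<in>F. t g o\<^sub>L perm g)"
proof (rule field_le_epsilon)
  fix \<epsilon> :: real assume \<epsilon>: "\<epsilon> > 0"
  let ?a = "covariant_block F t"
  obtain B where B: "finite B" "norm (block_op E (\<lambda>h k. ?a h k o\<^sub>L restr (- B)))
      \<le> norm (\<Sum>g\<in>F. t g o\<^sub>L perm g) + \<epsilon>"
    using covariant_block_estimate[OF A F(1,2) E _ \<epsilon>, of t] F(3) by blast
  have mem: "?a h k o\<^sub>L restr (- B) \<in> \<D> \<and> \<theta> (?a h k o\<^sub>L restr (- B)) = \<theta> (?a h k)" if "h \<in> E" for h k
  proof -
    have a0: "?a h k \<in> \<D>0" using F(3) E that by (intro covariant_block_finite_propagation) auto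
    have c: "?a h k o\<^sub>L restr B \<in> \<K>" by (rule compact_truncation[OF a0 B(1)])
    have cD: "?a h k o\<^sub>L restr B \<in> \<D>" using c compact_ops_subset_roe_ops by blast
    have split: "restr (- B) = id_blinfun - (restr B :: ('x, 'h) l2 \<Rightarrow>\<^sub>L _)"
      by (intro blinfun_eqI l2_eqI) (simp add: blinfun.diff_left l2_fun_simps)
    have eq: "?a h k o\<^sub>L restr (- B) = ?a h k - (?a h k o\<^sub>L restr B)"
      unfolding split by (simp add: blinfun_comp_simps)
    show ?thesis
      unfolding eq using roe.diff[OF \<D>0_\<D>[OF a0] cD] roe.hom_diff[OF \<D>0_\<D>[OF a0] cD]
        quotient_facts(2)[OF cD] c by simp
  qed
  have "norm (block_op E (\<lambda>h k. \<theta> (?a h k))) = norm (block_op E (\<lambda>h k. \<theta> (?a h k o\<^sub>L restr (- B))))"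
    using mem by (intro arg_cong[of _ _ norm] block_op_cong) simp
  also have "\<dots> \<le> norm (block_op E (\<lambda>h k. ?a h k o\<^sub>L restr (- B)))"
    using mem by (intro roe.norm_block_hom_le E) auto
  finally show "norm (block_op E (\<lambda>h k. \<theta> (?a h k))) \<le> norm (\<Sum>g\<in>F. t g o\<^sub>L perm g) + \<epsilon>"
    using B(2) by simp
qed

text \<open>The bound for finite compressions is uniform, so it passes to the limit, in the argument
  of \<open>b\<close> and then in its value.\<close>

lemma graph_contractive:
  assumes A: "property_A TYPE('s) X d" and ab: "(a, b) \<in> graph"
  shows "norm b \<le> norm a"
proof (rule norm_blinfun_bound)
  obtain F t where F: "finite F" "F \<subseteq> carrier G" "\<forall>g\<in>F. t g \<in> \<D>0"
    "a = (\<Sum>g\<in>F. t g o\<^sub>L perm g)" "b = (\<Sum>g\<in>F. rho (t g) o\<^sub>L tr.perm g)"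
    by (rule graphE[OF ab])
  fix \<eta>
  have restr_b: "norm (restr E (b (restr E \<eta>))) \<le> norm a * norm \<eta>" if E: "finite E" for E
  proof -
    \<comment> \<open>The compression bound is stated for subsets of the group; coordinates outside
      the carrier are neither read nor produced by \<open>b\<close>.\<close>
    let ?E = "E \<inter> carrier G"
    have "rho (t g) (tr.perm g (restr (E \<inter> carrier G) \<eta>)) = rho (t g) (tr.perm g (restr E \<eta>))" if "g \<in> F" for g
    proof -
      have g: "g \<in> carrier G" using F that by blast
      have "tr.perm g (restr (E \<inter> carrier G) \<eta>) = tr.perm g (restr E \<eta>)"
        using g by (intro l2_eqI) (auto simp: tr_apply)
      then show ?thesis by simp
    qed
    then have b1: "b (restr ?E \<eta>) = b (restr E \<eta>)"
      unfolding F(5) blinfun_sum_apply by (intro sum.cong) auto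
    have b2: "restr ?E (b \<xi>) = restr E (b \<xi>)" for \<xi>
    proof -
      have "l2_fun (b \<xi>) h = 0" if "h \<notin> carrier G" for h
        unfolding F(5) blinfun_sum_apply l2_fun_sum using F(3) \<D>0_\<D> that
        by (intro sum.neutral) (simp add: rho_apply)
      then show ?thesis by (intro l2_eqI) auto
    qed
    have "restr ?E o\<^sub>L b o\<^sub>L restr ?E = block_op ?E (\<lambda>h k. \<theta> (covariant_block F t h k))"
      unfolding F(5) by (rule compression_covariant) (use F E in auto)
    moreover have "norm (block_op ?E (\<lambda>h k. \<theta> (covariant_block F t h k))) \<le> norm a"
      unfolding F(4) by (rule norm_compression_le[OF A]) (use F E in auto)
    ultimately have "norm ((restr ?E o\<^sub>L b o\<^sub>L restr ?E) \<eta>) \<le> norm a * norm \<eta>"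
      by (metis norm_blinfun mult_right_mono norm_ge_zero order_trans)
    then show ?thesis by (simp add: b1 b2)
  qed
  \<comment> \<open>The argument is truncated to finite sets \<open>S\<close> containing
    \<open>E\<close>, so that the symmetric compression to \<open>S\<close> dominates the truncated
    value.\<close>
  have restr_b': "norm (restr E (b \<eta>)) \<le> norm a * norm \<eta>" if E: "finite E" for E
  proof (rule tendsto_upperbound[OF _ _ finite_subsets_at_top_neq_bot])
    show "((\<lambda>S. norm (restr E (b (restr S \<eta>)))) \<longlongrightarrow> norm (restr E (b \<eta>))) (finite_subsets_at_top UNIV)"
      by (intro tendsto_norm blinfun.tendsto tendsto_const tendsto_restr)
    have "norm (restr E (b (restr S \<eta>))) \<le> norm a * norm \<eta>" if "finite S" "E \<subseteq> S" for S
    proof -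
      have "restr E (b (restr S \<eta>)) = restr E (restr S (b (restr S \<eta>)))"
        using that(2) by (simp add: Int_absorb2)
      also have "norm \<dots> \<le> norm (restr S (b (restr S \<eta>)))" by (rule norm_restr_apply_le)
      finally show ?thesis using restr_b[OF that(1)] by simp
    qed
    then show "\<forall>\<^sub>F S in finite_subsets_at_top UNIV. norm (restr E (b (restr S \<eta>))) \<le> norm a * norm \<eta>"
      unfolding eventually_finite_subsets_at_top using E by (intro exI[of _ E]) auto
  qed
  show "norm (b \<eta>) \<le> norm a * norm \<eta>"
    by (rule tendsto_upperbound[OF tendsto_norm[OF tendsto_restr] _ finite_subsets_at_top_neq_bot])
      (auto intro: eventually_finite_subsets_at_top_weakI restr_b')
qed simp

text \<open>Compression of a block matrix by the isometry \<open>\<xi> \<mapsto> card E powr (-1/2) (perm h\<^sup>-\<^sup>1 \<xi>)\<^sub>h\<close>.\<close>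

definition average :: "'g set \<Rightarrow> ('g \<Rightarrow> 'g \<Rightarrow> ('x, 'h) l2 \<Rightarrow>\<^sub>L ('x, 'h) l2) \<Rightarrow> ('x, 'h) l2 \<Rightarrow>\<^sub>L ('x, 'h) l2" where
  "average E b = (1 / card E) *\<^sub>R (\<Sum>h\<in>E. \<Sum>k\<in>E. perm h o\<^sub>L b h k o\<^sub>L perm (inv k))"

lemma average_diff: "average E (\<lambda>h k. a h k - b h k) = average E a - average E b"
  by (simp add: average_def blinfun_comp_simps sum_subtractf scaleR_diff_right)

text \<open>Distributing a vector over \<open>E\<close> and collecting the results each cost at most
  the square root of \<open>card E\<close>, and the factor \<open>1 / card E\<close> cancels
  both.\<close>

lemma norm_average_le:
  assumes E: "finite E" "E \<subseteq> carrier G" "E \<noteq> {}"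
  shows "norm (average E b) \<le> norm (block_op E b)"
proof (rule norm_blinfun_bound)
  fix \<xi>
  define n where "n = real (card E)"
  have n: "n > 0" using E by (simp add: n_def card_gt_0_iff)
  define \<eta> :: "('g, ('x, 'h) l2) l2" where "\<eta> = (\<Sum>k\<in>E. l2_single k (perm (inv k) \<xi>))"
  have \<eta>: "l2_fun \<eta> k = (if k \<in> E then perm (inv k) \<xi> else 0)" for k
    using E(1) by (simp add: \<eta>_def l2_fun_sum l2_fun_single)
  have "(norm \<eta>)\<^sup>2 = (\<Sum>k\<in>E. (norm (perm (inv k) \<xi>))\<^sup>2)"
    by (subst norm_l2_finite[OF E(1)]) (auto simp: \<eta>)
  also have "\<dots> \<le> (\<Sum>k\<in>E. (norm \<xi>)\<^sup>2)"
    using E by (intro sum_mono power_mono) (auto simp: norm_perm_apply norm_restr_apply_le subset_iff)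
  finally have n\<eta>: "(norm \<eta>)\<^sup>2 \<le> n * (norm \<xi>)\<^sup>2" by (simp add: n_def)
  define \<omega> where "\<omega> = block_op E b \<eta>"
  have \<omega>: "l2_fun \<omega> h = (\<Sum>k\<in>E. b h k (perm (inv k) \<xi>))" if "h \<in> E" for h
    using that by (simp add: \<omega>_def block_op_apply[OF E(1)] \<eta>)
  have av: "n *\<^sub>R average E b \<xi> = (\<Sum>h\<in>E. perm h (l2_fun \<omega> h))"
    using n by (simp add: average_def n_def[symmetric] blinfun.scaleR_left blinfun_sum_apply \<omega> blinfun.sum_right)
  have "(n * norm (average E b \<xi>))\<^sup>2 = (norm (\<Sum>h\<in>E. perm h (l2_fun \<omega> h)))\<^sup>2"
    unfolding av[symmetric] using n by simp
  also have "\<dots> \<le> n * (\<Sum>h\<in>E. (norm (perm h (l2_fun \<omega> h)))\<^sup>2)"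
    unfolding n_def by (rule norm_sum_square_le) simp
  also have "\<dots> \<le> n * (\<Sum>h\<in>E. (norm (l2_fun \<omega> h))\<^sup>2)"
    using E n by (intro mult_left_mono sum_mono power_mono)
      (auto simp: norm_perm_apply norm_restr_apply_le subset_iff)
  also have "\<dots> \<le> n * (norm \<omega>)\<^sup>2"
    using n E by (intro mult_left_mono sum_le_norm_l2) auto
  also have "\<dots> \<le> n * (norm (block_op E b) * norm \<eta>)\<^sup>2"
    unfolding \<omega>_def using n by (intro mult_left_mono power_mono norm_blinfun) auto
  also have "\<dots> = n * (norm (block_op E b))\<^sup>2 * (norm \<eta>)\<^sup>2" by (simp add: power_mult_distrib)
  also have "\<dots> \<le> n * (norm (block_op E b))\<^sup>2 * (n * (norm \<xi>)\<^sup>2)"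
    using n\<eta> n by (intro mult_left_mono) auto
  also have "\<dots> = (n * (norm (block_op E b) * norm \<xi>))\<^sup>2" by (simp add: power2_eq_square mult_ac)
  finally have "n * norm (average E b \<xi>) \<le> n * (norm (block_op E b) * norm \<xi>)"
    by (rule power2_le_imp_le) (use n in simp)
  then show "norm (average E b \<xi>) \<le> norm (block_op E b) * norm \<xi>" using n by simp
qed simp

text \<open>The outer permutation operators undo the conjugation in the entry at
  \<open>(h, k)\<close>, leaving the summand of \<open>h \<otimes> inv k\<close>. A fixed
  \<open>g\<close> arises from exactly as many pairs as \<open>E\<close> and its translate by
  \<open>g\<close> have common points.\<close>

lemma average_covariant_block:
  assumes F: "finite F" "F \<subseteq> carrier G" "\<forall>g\<in>F. t g \<in> \<D>0" and E: "finite E" "E \<subseteq> carrier G"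
  shows "average E (covariant_block F t)
    = (\<Sum>g\<in>F. (card (E \<inter> (\<lambda>k. g \<otimes> k) ` E) / card E) *\<^sub>R (t g o\<^sub>L perm g))"
proof -
  have EG: "h \<in> carrier G" if "h \<in> E" for h using E that by blast
  have FG: "h \<in> carrier G" if "h \<in> F" for h using F that by blast
  have term_eq: "perm h o\<^sub>L covariant_block F t h k o\<^sub>L perm (inv k)
      = (\<Sum>g\<in>F. if g \<otimes> k = h then t g o\<^sub>L perm g else 0)" if hk: "h \<in> E" "k \<in> E" for h k
  proof -
    have hG: "h \<in> carrier G" "k \<in> carrier G" "h \<otimes> inv k \<in> carrier G" using EG hk by auto
    have "(\<Sum>g\<in>F. if g \<otimes> k = h then t g o\<^sub>L perm g else 0)
        = (\<Sum>g\<in>F. if g = h \<otimes> inv k then t g o\<^sub>L perm g else 0)"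
      using mult_eq_iff[OF FG hG(1,2)] by (intro sum.cong) auto
    also have "\<dots> = (if h \<otimes> inv k \<in> F then t (h \<otimes> inv k) o\<^sub>L perm (h \<otimes> inv k) else 0)"
      using F(1) by simp
    also have "\<dots> = perm h o\<^sub>L covariant_block F t h k o\<^sub>L perm (inv k)"
    proof (cases "h \<otimes> inv k \<in> F")
      case True
      then have "t (h \<otimes> inv k) \<in> l2_ops X" using F(3) \<D>0_\<D> \<D>_l2 by blast
      then have r: "restr X (t (h \<otimes> inv k) \<xi>) = t (h \<otimes> inv k) \<xi>" for \<xi>
        unfolding l2_ops_iff by (metis blinfun_apply_blinfun_compose)
      show ?thesis using True hG by (intro blinfun_eqI) (simp add: covariant_block_def r perm_perm perm_one group.r_inv[OF group_G])
    qed (simp add: covariant_block_def blinfun_comp_simps)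
    finally show ?thesis by simp
  qed
  have count: "(\<Sum>h\<in>E. \<Sum>k\<in>E. if g \<otimes> k = h then t g o\<^sub>L perm g else 0)
      = real (card (E \<inter> (\<lambda>k. g \<otimes> k) ` E)) *\<^sub>R (t g o\<^sub>L perm g)" if g: "g \<in> F" for g
  proof -
    have inj: "inj_on (\<lambda>k. g \<otimes> k) E"
    proof (rule inj_onI)
      fix k k' assume "k \<in> E" "k' \<in> E" "g \<otimes> k = g \<otimes> k'"
      then show "k = k'" using FG[OF g] EG by (metis group.is_monoid[OF group_G] group.Units_eq[OF group_G] monoid.Units_l_cancel)
    qed
    have "(\<Sum>h\<in>E. \<Sum>k\<in>E. if g \<otimes> k = h then t g o\<^sub>L perm g else 0)
        = (\<Sum>h\<in>E. \<Sum>h'\<in>(\<lambda>k. g \<otimes> k) ` E. if h' = h then t g o\<^sub>L perm g else 0)"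
      by (simp add: sum.reindex[OF inj])
    also have "\<dots> = (\<Sum>h\<in>E. if h \<in> (\<lambda>k. g \<otimes> k) ` E then t g o\<^sub>L perm g else 0)"
      using E(1) by simp
    also have "\<dots> = (\<Sum>h\<in>E \<inter> (\<lambda>k. g \<otimes> k) ` E. t g o\<^sub>L perm g)"
      using E(1) by (rule sum.inter_restrict[symmetric])
    finally show ?thesis by (simp add: sum_constant_scaleR)
  qed
  have "average E (covariant_block F t)
      = (1 / card E) *\<^sub>R (\<Sum>h\<in>E. \<Sum>k\<in>E. \<Sum>g\<in>F. if g \<otimes> k = h then t g o\<^sub>L perm g else 0)"
    unfolding average_def using term_eq by (intro arg_cong[of _ _ "\<lambda>x. _ *\<^sub>R x"] sum.cong) auto
  also have "(\<Sum>h\<in>E. \<Sum>k\<in>E. \<Sum>g\<in>F. if g \<otimes> k = h then t g o\<^sub>L perm g else 0)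
      = (\<Sum>h\<in>E. \<Sum>g\<in>F. \<Sum>k\<in>E. if g \<otimes> k = h then t g o\<^sub>L perm g else 0)"
    by (intro sum.cong refl sum.swap)
  also have "\<dots> = (\<Sum>g\<in>F. \<Sum>h\<in>E. \<Sum>k\<in>E. if g \<otimes> k = h then t g o\<^sub>L perm g else 0)"
    by (rule sum.swap)
  also have "\<dots> = (\<Sum>g\<in>F. real (card (E \<inter> (\<lambda>k. g \<otimes> k) ` E)) *\<^sub>R (t g o\<^sub>L perm g))"
    by (intro sum.cong refl count)
  finally show ?thesis by (simp add: scaleR_sum_right)
qed

text \<open>Correct the block matrix by compact entries so that its norm drops to about that of its
  image, then average: the matrix returns nearly \<open>a\<close>, and the correction becomes the
  required compact operator.\<close>

lemma graph_compact_approximation: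
  assumes amen: "amenable G" and ab: "(a, b) \<in> graph" and e: "e > 0"
  shows "\<exists>k\<in>\<K>. norm (a - k) \<le> norm b + e"
proof -
  obtain F t where F: "finite F" "F \<subseteq> carrier G" "\<forall>g\<in>F. t g \<in> \<D>0"
    "a = (\<Sum>g\<in>F. t g o\<^sub>L perm g)" "b = (\<Sum>g\<in>F. rho (t g) o\<^sub>L tr.perm g)"
    by (rule graphE[OF ab])
  define M where "M = (\<Sum>g\<in>F. norm (t g))"
  have M: "M \<ge> 0" by (simp add: M_def sum_nonneg)
  \<comment> \<open>Makes the total loss from coefficients within \<open>\<epsilon>\<close> of one
    at most \<open>e / 2\<close>; the added one avoids division by zero.\<close>
  define \<epsilon> where "\<epsilon> = e / 2 / (M + 1)"
  have \<epsilon>: "\<epsilon> > 0" "\<epsilon> * M \<le> e / 2"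
    using e M by (auto simp: \<epsilon>_def field_simps)
  obtain E where E: "finite E" "E \<noteq> {}" "E \<subseteq> carrier G"
    and inv: "\<forall>g\<in>F. (1 - \<epsilon>) * card E \<le> card (E \<inter> (\<lambda>h. g \<otimes> h) ` E)"
    using group.almost_invariant_finite_set[OF group_G amen F(1,2) \<epsilon>(1)] by blast
  let ?a = "covariant_block F t"
  have aD: "?a h k \<in> \<D>" if "h \<in> E" "k \<in> E" for h k
    using F(3) E that by (intro \<D>0_\<D> covariant_block_finite_propagation) auto
  have "norm (block_op E (\<lambda>h k. \<theta> (?a h k))) \<le> norm b"
  proof -
    have "block_op E (\<lambda>h k. \<theta> (?a h k)) = restr E o\<^sub>L b o\<^sub>L restr E"
      unfolding F(5) by (rule compression_covariant[OF F(1-3) E(1,3), symmetric])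
    also have "norm \<dots> \<le> norm (restr E o\<^sub>L b) * norm (restr E :: ('g, 'k) l2 \<Rightarrow>\<^sub>L _)"
      by (rule norm_blinfun_compose)
    also have "\<dots> \<le> (norm (restr E :: ('g, 'k) l2 \<Rightarrow>\<^sub>L _) * norm b) * 1"
      by (intro mult_mono norm_blinfun_compose norm_restr_le) auto
    also have "\<dots> \<le> (1 * norm b) * 1" by (intro mult_right_mono norm_restr_le) auto
    finally show ?thesis by simp
  qed
  \<comment> \<open>The lifting lemma needs a strict bound, which uses up the other half of
    \<open>e\<close>.\<close>
  then have "norm (block_op E (\<lambda>h k. \<theta> (?a h k))) < norm b + e / 2" using e by simp
  from roe.block_kernel_approximation[OF E(1) aD this]
  obtain n where n: "\<forall>h\<in>E. \<forall>k\<in>E. n h k \<in> \<D> \<and> \<theta> (n h k) = 0"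
    "norm (block_op E (\<lambda>h k. ?a h k - n h k)) \<le> norm b + e / 2" by blast
  have nK: "n h k \<in> \<K>" if "h \<in> E" "k \<in> E" for h k
    using n(1) quotient_facts(2) that by blast
  have "average E n \<in> \<K>"
  proof -
    have K_sum: "(\<Sum>i\<in>I. f i) \<in> \<K>" if "\<And>i. i \<in> I \<Longrightarrow> f i \<in> \<K>"
      for I :: "'g set" and f
      using that by (induction I rule: infinite_finite_induct) (auto intro: compact_ops_ideal)
    have "perm h o\<^sub>L n h k o\<^sub>L perm (inv k) \<in> \<K>" if "h \<in> E" "k \<in> E" for h k
      using that E
      by (intro compact_ops_ideal(4)[OF compact_ops_ideal(5)] nK perm_in_l2_ops inv_closed) auto
    then have "(\<Sum>h\<in>E. \<Sum>k\<in>E. perm h o\<^sub>L n h k o\<^sub>L perm (inv k)) \<in> \<K>" by (intro K_sum)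
    then show ?thesis unfolding average_def scale_op_of_real[symmetric] by (rule compact_ops_ideal(3))
  qed
  moreover have "norm (a - average E n) \<le> norm b + e"
  proof -
    have cE: "real (card E) > 0" using E by (simp add: card_gt_0_iff)
    let ?c = "\<lambda>g. card (E \<inter> (\<lambda>k. g \<otimes> k) ` E) / card E"
    have c: "0 \<le> 1 - ?c g" "1 - ?c g \<le> \<epsilon>" if "g \<in> F" for g
    proof -
      have "card (E \<inter> (\<lambda>k. g \<otimes> k) ` E) \<le> card E" using E by (intro card_mono) auto
      then show "0 \<le> 1 - ?c g" using cE by simp
      show "1 - ?c g \<le> \<epsilon>" using inv that cE by (simp add: field_simps)
    qed
    have tp: "norm (t g o\<^sub>L perm g) \<le> norm (t g)" if "g \<in> F" for g
    proof -
      have "norm (t g o\<^sub>L perm g) \<le> norm (t g) * norm (perm g :: ('x, 'h) l2 \<Rightarrow>\<^sub>L _)"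
        by (rule norm_blinfun_compose)
      also have "\<dots> \<le> norm (t g) * 1" using F that by (intro mult_left_mono norm_perm_le) auto
      finally show ?thesis by simp
    qed
    have "a - average E ?a = (\<Sum>g\<in>F. (1 - ?c g) *\<^sub>R (t g o\<^sub>L perm g))"
      unfolding average_covariant_block[OF F(1-3) E(1,3)] F(4)
      by (simp add: scaleR_diff_left sum_subtractf)
    also have "norm \<dots> \<le> (\<Sum>g\<in>F. \<epsilon> * norm (t g))"
    proof (rule order_trans[OF norm_sum], rule sum_mono)
      fix g assume g: "g \<in> F"
      have "norm ((1 - ?c g) *\<^sub>R (t g o\<^sub>L perm g)) = (1 - ?c g) * norm (t g o\<^sub>L perm g)"
        using c(1)[OF g] by simp
      also have "\<dots> \<le> \<epsilon> * norm (t g)" using c[OF g] tp[OF g] \<epsilon> by (intro mult_mono) auto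
      finally show "norm ((1 - ?c g) *\<^sub>R (t g o\<^sub>L perm g)) \<le> \<epsilon> * norm (t g)" .
    qed
    also have "\<dots> \<le> e / 2" using \<epsilon>(2) by (simp add: M_def sum_distrib_left)
    finally have 1: "norm (a - average E ?a) \<le> e / 2" .
    have "norm (average E ?a - average E n) \<le> norm (block_op E (\<lambda>h k. ?a h k - n h k))"
      unfolding average_diff[symmetric] by (rule norm_average_le[OF E(1,3,2)])
    then have 2: "norm (average E ?a - average E n) \<le> norm b + e / 2" using n(2) by simp
    have "a - average E n = (a - average E ?a) + (average E ?a - average E n)" by simp
    also have "norm \<dots> \<le> norm (a - average E ?a) + norm (average E ?a - average E n)"
      by (rule norm_triangle_ineq)
    finally show ?thesis using 1 2 by linarith
  qed
  ultimately show ?thesis by blast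
qed

lemma exact_sequence:
  assumes A: "property_A TYPE('s) X d" and amen: "amenable G"
  shows "\<exists>q. short_exact (op_algebra \<K>) (op_algebra (roe_ops X dG))
    (reduced_crossed_product (roe_mod_compacts X d) G (conj_action X d \<phi>) \<pi>) id q"
  unfolding reduced_crossed_product_eq roe_ops_def[of X dG] fst_graph[symmetric]
  by (rule closed_range_extension)
    (fact graph_clinear graph_add graph_scale graph_mult graph_adj graph_contractive[OF A]
      graph_compact_approximation[OF amen] closed_compact_ops_space graph_compact)+

end

theorem corollary5p9:
  fixes X :: "'x set" and d d\<^sub>G :: "'x \<Rightarrow> 'x \<Rightarrow> real"
    and G :: "('g, 'm) monoid_scheme" and \<phi> :: "'g \<Rightarrow> 'x \<Rightarrow> 'x"
    and \<pi> :: "(('x, 'h::complex_hilbert) l2 \<Rightarrow>\<^sub>L ('x, 'h) l2) set \<Rightarrow> ('k::complex_hilbert \<Rightarrow>\<^sub>L 'k)"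
  assumes "separable_space (euclidean :: 'h topology)"
    and "\<not> (\<exists>B :: 'h set. finite B \<and> span B = UNIV)"
    and "discrete_bounded_geometry_space X d"
    and "property_A TYPE('s) X d"
    and "group G" and "countable (carrier G)" and "amenable G"
    and "acts_by_coarse_equivalences G X d \<phi>"
    and "coarsely_discontinuous G X d \<phi>"
    and "discrete_bounded_geometry_space X d\<^sub>G"
    and "metric_lss X d\<^sub>G = action_lss G X d \<phi>"
    and "faithful_rep (roe_mod_compacts X d) \<pi>"
  shows "\<exists>q :: (('x, 'h) l2 \<Rightarrow>\<^sub>L ('x, 'h) l2) \<Rightarrow> (('g, 'k) l2 \<Rightarrow>\<^sub>L ('g, 'k) l2). short_exact
    (op_algebra (compact_ops X))
    (op_algebra (roe_ops X d\<^sub>G))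
    (reduced_crossed_product (roe_mod_compacts X d) G (conj_action X d \<phi>) \<pi>)
    id q"
proof -
  have "coarse_action X d G \<phi> d\<^sub>G"
    unfolding coarse_action_def coarse_action_axioms_def bg_space_def bg_space_axioms_def
    using assms(3,8-11)
    by (auto simp: discrete_bounded_geometry_space_def acts_by_coarse_equivalences_def)
  then have "coarse_crossed_product X d G \<phi> d\<^sub>G \<pi>"
    using assms(12) by (simp add: coarse_crossed_product_def coarse_crossed_product_axioms_def)
  from coarse_crossed_product.exact_sequence[OF this assms(4,7)] show ?thesis .
qed

end
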